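(* Let $(M^4,g)$ and $(\overline M^4,\overline g)$ be two oriented and time-oriented spacetimes, let $S^2$ be an oriented closed spacelike surface in $M$, and let $N$ be a future-directed timelike vector field on $S$ (a section of $TM|_S$, not necessarily tangent or orthogonal to $S$). Let $\varphi$ be a 4D isometric matching reference. Let $N^\perp$ be the orthogonal projection of $N$ into the normal bundle $T_S^\perp M$, let $N^\top=N-N^\perp$, and let $X$ be the unit vector field on $S$ with $X\in T_S^\perp M$, $X\perp N$, such that $(N^\perp, X)$ followed by the orientation of $S$ gives the orientation of $M$. Put $\overline S=\varphi(S)$, $\overline X=\varphi_*X$, $\overline N^\perp=\varphi_*N^\perp$, $\overline N^\top=\varphi_*N^\top$, and let $H$ and $\overline H$ be the mean curvature vectors of $S$ in $M$ and of $\overline S$ in $\overline M$. Then \[ \begin{split} E(S,N,\varphi)=&\frac{1}{8\pi}\int_{\overline S}\left(-\|\overline N^\perp\|\langle\overline H,\overline X\rangle+\frac{1}{\|\overline N^\perp\|}\langle\overline\nabla_{\overline N^\top}\overline X,\overline N^\perp\rangle\right)dV_{\overline S}\\ &-\frac{1}{8\pi}\int_S\left(-\|N^\perp\|\langle H,X\rangle+\frac{1}{\|N^\perp\|}\langle\nabla_{N^\top}X,N^\perp\rangle\right)dV_S . \end{split} \] In particular, if $N$ is orthogonal to $S$, then \[ E(S,N,\varphi)=\frac{1}{8\pi}\int_{S}\|N\|\left(-\langle\overline H,\overline X\rangle+\langle H,X\rangle\right)dV_S , \] where $\langle\overline H,\overline X\rangle$ is evaluated at $\varphi(p)$, $p\in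 S$.
   Context: Lorentzian metrics have signature $(-,+,+,+)$; everything is smooth; $\|W\|=\sqrt{-\langle W,W\rangle}$ for a timelike vector $W$. $\nabla,\overline\nabla$ are the Levi-Civita connections of $g,\overline g$. The mean curvature vector of a spacelike surface is the trace of its second fundamental form: $H=(\nabla_{e_2}e_2+\nabla_{e_3}e_3)^\perp$ for a local orthonormal frame $e_2,e_3$ of the surface. A reference is a smooth embedding $\varphi:U\to\overline M$ of an open neighborhood $U$ of $S$ in $M$ that preserves orientation and time orientation. It is a 4D isometric matching reference if $\varphi^*\overline g=g$ at every point of $S$ (as bilinear forms on $T_pM$, $p\in S$). Let $\omega^a{}_b$ and $\overline\omega^a{}_b$ be the connection forms, with respect to a common local frame $(e_a)$ near $S$, of the Levi-Civita connections of $g$ and $\varphi^*\overline g$ ($\nabla e_b=\omega^a{}_b\otimes e_a$), let $\iota:S\to M$ be the inclusion, and let \[\eta_a{}^b=\tfrac12\sqrt{-\det g}\,g^{b\beta}\epsilon_{a\beta\mu\nu}\,dx^\mu\wedge dx^\nu\] in positively oriented coordinates (indices $0,\dots,3$, $\epsilon_{0123}=1$; analogously in a positively oriented orthonormal frame). For a 4D isometric matching reference, the Chen-Nester-Tung (CNT) quasi-local energy is \[E(S,N,\varphi)=\frac{1}{16\pi}\int_S\iota^*\left[(\omega^a{}_b-\overline\omega^a{}_b)\wedge i_N\eta_a{}^b\right],\] with summation over $a,b$ (the integrand is frame independent). This is the general CNT energy $\frac{1}{2\kappa}\int_S\iota^*[(\omega^a{}_b-\overline\omega^a{}_b)\wedge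 i_N\eta_a{}^b+\overline D_bN^a(\eta_a{}^b-\overline\eta_a{}^b)]$ with $\kappa=8\pi$, the second term vanishing because $\eta_a{}^b$ depends only on the metric, and the two metrics agree on $S$. *)

theory Defs
  imports "HOL-Analysis.Analysis"
begin

section \<open>Smooth maps between Euclidean spaces\<close>

text \<open>These notions are meant for open \<open>S\<close>.\<close>

primrec Ck_on :: "nat \<Rightarrow> ('a::real_normed_vector \<Rightarrow> 'b::real_normed_vector) \<Rightarrow> 'a set \<Rightarrow> bool" where
  "Ck_on 0 f S \<longleftrightarrow> continuous_on S f"
| "Ck_on (Suc k) f S \<longleftrightarrow>
     (\<forall>x\<in>S. f differentiable (at x)) \<and> (\<forall>v. Ck_on k (\<lambda>x. frechet_derivative f (at x) v) S)"

definition smooth_on :: "('a::real_normed_vector \<Rightarrow> 'b::real_normed_vector) \<Rightarrow> 'a set \<Rightarrow> bool" where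
  "smooth_on f S \<longleftrightarrow> (\<forall>k. Ck_on k f S)"

section \<open>Oriented manifolds and tangent spaces\<close>

text \<open>
  A chart is a pair \<open>(U, x)\<close> of its domain and its coordinate map.  An oriented smooth manifold is
  a set \<open>M\<close> of points of a (Hausdorff, second countable) space, with the subspace topology,
  together with an atlas whose transition maps are smooth with positive Jacobian determinant.
  The charts of the atlas are the positively oriented ones; coordinates are indexed
  \<open>0, \<dots>, n - 1\<close> and are ordered in this way (in the numeral type \<open>4\<close> the index \<open>4\<close> is \<open>0\<close>).
\<close>

type_synonym ('a, 'n) chart = "'a set \<times> ('a \<Rightarrow> real^'n)"

definition inv_chart :: "('a, 'n::finite) chart \<Rightarrow> real^'n \<Rightarrow> 'a" where
  "inv_chart c = inv_into (fst c) (snd c)"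

text \<open>The differential at \<open>p\<close> of \<open>f\<close>, written in the coordinates \<open>c\<close> (source) and \<open>d\<close> (target).\<close>

definition chart_deriv ::
    "('a, 'm::finite) chart \<Rightarrow> ('b, 'n::finite) chart \<Rightarrow> ('a \<Rightarrow> 'b) \<Rightarrow> 'a \<Rightarrow> real^'m \<Rightarrow> real^'n" where
  "chart_deriv c d f p = frechet_derivative (snd d \<circ> f \<circ> inv_chart c) (at (snd c p))"

definition oriented_atlas :: "'a::topological_space set \<Rightarrow> ('a, 'n::finite) chart set \<Rightarrow> bool" where
  "oriented_atlas M A \<longleftrightarrow>
     \<Union> (fst ` A) = M \<and>
     (\<forall>(U, x)\<in>A. openin (top_of_set M) U \<and> open (x ` U) \<and>
        homeomorphism U (x ` U) x (inv_into U x)) \<and>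
     (\<forall>(U, x)\<in>A. \<forall>(V, y)\<in>A.
        smooth_on (y \<circ> inv_into U x) (x ` (U \<inter> V)) \<and>
        (\<forall>p\<in>U \<inter> V. det (matrix (chart_deriv (U, x) (V, y) (\<lambda>q. q) p)) > 0))"

text \<open>
  The tangent space at \<open>p\<close> is \<open>real^'n\<close>, a vector being identified with its components in one fixed
  chart \<open>chart_at A p\<close> around \<open>p\<close>.  A vector field is thus a function \<open>'a \<Rightarrow> real^'n\<close>; because the
  preferred chart varies with the point, a field is differentiated only after its values have been
  converted by \<open>components\<close> to the components in a single chart.
\<close>

definition chart_at :: "('a, 'n::finite) chart set \<Rightarrow> 'a \<Rightarrow> ('a, 'n) chart" where
  "chart_at A p = (SOME c. c \<in> A \<and> p \<in> fst c)"

definition components :: "('a, 'n::finite) chart set \<Rightarrow> ('a, 'n) chart \<Rightarrow> 'a \<Rightarrow> real^'n \<Rightarrow> real^'n" where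
  "components A c q = chart_deriv (chart_at A q) c (\<lambda>r. r) q"

text \<open>The coordinate vector field \<open>\<partial>/\<partial>x\<^sup>i\<close> of the chart \<open>c\<close>.\<close>

definition coord_field :: "('a, 'n::finite) chart set \<Rightarrow> ('a, 'n) chart \<Rightarrow> 'n \<Rightarrow> 'a \<Rightarrow> real^'n" where
  "coord_field A c i q = chart_deriv c (chart_at A q) (\<lambda>r. r) q (axis i 1)"

definition tangent_map ::
    "('a, 'm::finite) chart set \<Rightarrow> ('b, 'n::finite) chart set \<Rightarrow> ('a \<Rightarrow> 'b) \<Rightarrow> 'a \<Rightarrow> real^'m \<Rightarrow> real^'n" where
  "tangent_map A B f p = chart_deriv (chart_at A p) (chart_at B (f p)) f p"

text \<open>The derivative \<open>v(f)\<close> of a function \<open>f\<close> along a tangent vector \<open>v\<close> at \<open>p\<close>.\<close>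

definition dirderiv ::
    "('a, 'n::finite) chart set \<Rightarrow> ('a \<Rightarrow> 'b::real_normed_vector) \<Rightarrow> 'a \<Rightarrow> real^'n \<Rightarrow> 'b" where
  "dirderiv A f p = frechet_derivative (f \<circ> inv_chart (chart_at A p)) (at (snd (chart_at A p) p))"

definition smooth_map ::
    "('a::topological_space, 'm::finite) chart set \<Rightarrow> ('b::topological_space, 'n::finite) chart set \<Rightarrow>
     'a set \<Rightarrow> ('a \<Rightarrow> 'b) \<Rightarrow> bool" where
  "smooth_map A B U f \<longleftrightarrow>
     continuous_on U f \<and> f ` U \<subseteq> \<Union> (fst ` B) \<and>
     (\<forall>(V, x)\<in>A. \<forall>(W, y)\<in>B. smooth_on (y \<circ> f \<circ> inv_into V x) (x ` {p \<in> V \<inter> U. f p \<in> W}))"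

definition smooth_embedding ::
    "('a::topological_space, 'm::finite) chart set \<Rightarrow> ('b::topological_space, 'n::finite) chart set \<Rightarrow>
     'a set \<Rightarrow> ('a \<Rightarrow> 'b) \<Rightarrow> bool" where
  "smooth_embedding A B U f \<longleftrightarrow>
     smooth_map A B U f \<and> (\<forall>p\<in>U. inj (tangent_map A B f p)) \<and>
     homeomorphism U (f ` U) f (inv_into U f)"

definition smooth_function :: "('a, 'n::finite) chart set \<Rightarrow> 'a set \<Rightarrow> ('a \<Rightarrow> real) \<Rightarrow> bool" where
  "smooth_function A W f \<longleftrightarrow> (\<forall>(U, x)\<in>A. smooth_on (f \<circ> inv_into U x) (x ` (U \<inter> W)))"

text \<open>
  Smoothness on \<open>W\<close> of a vector field of the manifold with atlas \<open>A\<close> that is defined along a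
  submanifold with atlas \<open>P\<close>.  For \<open>P = A\<close> this is smoothness of an ordinary vector field.
\<close>

definition smooth_field ::
    "('a, 'm::finite) chart set \<Rightarrow> ('a, 'n::finite) chart set \<Rightarrow> 'a set \<Rightarrow> ('a \<Rightarrow> real^'n) \<Rightarrow> bool" where
  "smooth_field P A W X \<longleftrightarrow>
     (\<forall>(V, s)\<in>P. \<forall>c\<in>A.
        smooth_on ((\<lambda>q. components A c q (X q)) \<circ> inv_into V s) (s ` (V \<inter> fst c \<inter> W)))"

section \<open>Spacetimes\<close>

definition lorentz_metric ::
    "('a, 4) chart set \<Rightarrow> 'a set \<Rightarrow> ('a \<Rightarrow> real^4 \<Rightarrow> real^4 \<Rightarrow> real) \<Rightarrow> bool" where
  "lorentz_metric A M g \<longleftrightarrow>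
     (\<forall>p\<in>M. bilinear (g p) \<and> (\<forall>u v. g p u v = g p v u) \<and>
        (\<exists>e :: 4 \<Rightarrow> real^4. \<forall>a b. g p (e a) (e b) = (if a \<noteq> b then 0 else if a = 0 then -1 else 1))) \<and>
     (\<forall>c\<in>A. \<forall>i j. smooth_function A (fst c \<inter> M) (\<lambda>q. g q (coord_field A c i q) (coord_field A c j q)))"

text \<open>The time orientation is the one determined by a global smooth timelike vector field \<open>T\<close>.\<close>

definition spacetime ::
    "'a::{t2_space, second_countable_topology} set \<Rightarrow> ('a, 4) chart set \<Rightarrow>
     ('a \<Rightarrow> real^4 \<Rightarrow> real^4 \<Rightarrow> real) \<Rightarrow> ('a \<Rightarrow> real^4) \<Rightarrow> bool" where
  "spacetime M A g T \<longleftrightarrow>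
     oriented_atlas M A \<and> lorentz_metric A M g \<and> smooth_field A A M T \<and> (\<forall>p\<in>M. g p (T p) (T p) < 0)"

definition future_timelike ::
    "('a \<Rightarrow> real^4 \<Rightarrow> real^4 \<Rightarrow> real) \<Rightarrow> ('a \<Rightarrow> real^4) \<Rightarrow> 'a \<Rightarrow> real^4 \<Rightarrow> bool" where
  "future_timelike g T p v \<longleftrightarrow> g p v v < 0 \<and> g p v (T p) < 0"

definition timelike_norm :: "('a \<Rightarrow> real^4 \<Rightarrow> real^4 \<Rightarrow> real) \<Rightarrow> 'a \<Rightarrow> real^4 \<Rightarrow> real" where
  "timelike_norm g p v = sqrt (- g p v v)"

definition lie_bracket ::
    "('a, 'n::finite) chart set \<Rightarrow> ('a \<Rightarrow> real^'n) \<Rightarrow> ('a \<Rightarrow> real^'n) \<Rightarrow> 'a \<Rightarrow> real^'n" where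
  "lie_bracket A V W p =
     dirderiv A (\<lambda>q. components A (chart_at A p) q (W q)) p (V p) -
     dirderiv A (\<lambda>q. components A (chart_at A p) q (V q)) p (W p)"

definition field_near ::
    "('a::topological_space, 'n::finite) chart set \<Rightarrow> 'a set \<Rightarrow> 'a \<Rightarrow> ('a \<Rightarrow> real^'n) \<Rightarrow> bool" where
  "field_near A U p X \<longleftrightarrow> (\<exists>W. openin (top_of_set U) W \<and> p \<in> W \<and> smooth_field A A W X)"

definition function_near ::
    "('a::topological_space, 'n::finite) chart set \<Rightarrow> 'a set \<Rightarrow> 'a \<Rightarrow> ('a \<Rightarrow> real) \<Rightarrow> bool" where
  "function_near A U p f \<longleftrightarrow> (\<exists>W. openin (top_of_set U) W \<and> p \<in> W \<and> smooth_function A W f)"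

text \<open>
  \<open>nab v X p\<close> stands for \<open>\<nabla>\<^sub>v X\<close> at \<open>p\<close>, where \<open>v\<close> is a tangent vector at \<open>p\<close> and \<open>X\<close> is a vector field
  that is smooth near \<open>p\<close>.  The metric \<open>g\<close> and the connection live on the open set \<open>U\<close>.
  Locality in \<open>X\<close> follows from the Leibniz rule, applied to functions such as the
  indicator function of a neighbourhood of \<open>p\<close>, which is smooth near \<open>p\<close>.
\<close>

definition affine_connection ::
    "('a::topological_space, 4) chart set \<Rightarrow> 'a set \<Rightarrow>
     (real^4 \<Rightarrow> ('a \<Rightarrow> real^4) \<Rightarrow> 'a \<Rightarrow> real^4) \<Rightarrow> bool" where
  "affine_connection A U nab \<longleftrightarrow>
     (\<forall>p\<in>U. \<forall>X. field_near A U p X \<longrightarrow> linear (\<lambda>v. nab v X p)) \<and>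
     (\<forall>p\<in>U. \<forall>X Y v. field_near A U p X \<and> field_near A U p Y \<longrightarrow>
        nab v (\<lambda>q. X q + Y q) p = nab v X p + nab v Y p) \<and>
     (\<forall>p\<in>U. \<forall>f X v. function_near A U p f \<and> field_near A U p X \<longrightarrow>
        nab v (\<lambda>q. f q *\<^sub>R X q) p = dirderiv A f p v *\<^sub>R X p + f p *\<^sub>R nab v X p) \<and>
     (\<forall>W V X. openin (top_of_set U) W \<and> smooth_field A A W V \<and> smooth_field A A W X \<longrightarrow>
        smooth_field A A W (\<lambda>q. nab (V q) X q))"

definition levi_civita ::
    "('a::topological_space, 4) chart set \<Rightarrow> 'a set \<Rightarrow> ('a \<Rightarrow> real^4 \<Rightarrow> real^4 \<Rightarrow> real) \<Rightarrow>
     (real^4 \<Rightarrow> ('a \<Rightarrow> real^4) \<Rightarrow> 'a \<Rightarrow> real^4) \<Rightarrow> bool" where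
  "levi_civita A U g nab \<longleftrightarrow>
     affine_connection A U nab \<and>
     (\<forall>p\<in>U. \<forall>X Y. field_near A U p X \<and> field_near A U p Y \<longrightarrow>
        nab (X p) Y p - nab (Y p) X p = lie_bracket A X Y p) \<and>
     (\<forall>p\<in>U. \<forall>X Y v. field_near A U p X \<and> field_near A U p Y \<longrightarrow>
        dirderiv A (\<lambda>q. g q (X q) (Y q)) p v = g p (nab v X p) (Y p) + g p (X p) (nab v Y p))"

section \<open>Spacelike surfaces\<close>

text \<open>
  \<open>A\<close> is the atlas of the ambient spacetime, \<open>P\<close> the oriented atlas of the surface.
  \<open>incl_deriv P A p\<close> is the differential of the inclusion.
\<close>

abbreviation incl_deriv ::
    "('a, 2) chart set \<Rightarrow> ('a, 4) chart set \<Rightarrow> 'a \<Rightarrow> real^2 \<Rightarrow> real^4" where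
  "incl_deriv P A p \<equiv> tangent_map P A (\<lambda>q. q) p"

definition closed_spacelike_surface ::
    "('a::topological_space, 4) chart set \<Rightarrow> ('a \<Rightarrow> real^4 \<Rightarrow> real^4 \<Rightarrow> real) \<Rightarrow>
     'a set \<Rightarrow> ('a, 2) chart set \<Rightarrow> bool" where
  "closed_spacelike_surface A g S P \<longleftrightarrow>
     compact S \<and> oriented_atlas S P \<and> smooth_embedding P A S (\<lambda>q. q) \<and>
     (\<forall>p\<in>S. \<forall>w. w \<noteq> 0 \<longrightarrow> g p (incl_deriv P A p w) (incl_deriv P A p w) > 0)"

definition surface_tangent_space :: "('a, 2) chart set \<Rightarrow> ('a, 4) chart set \<Rightarrow> 'a \<Rightarrow> (real^4) set" where
  "surface_tangent_space P A p = range (incl_deriv P A p)"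

definition surface_normal_space ::
    "('a, 2) chart set \<Rightarrow> ('a, 4) chart set \<Rightarrow> ('a \<Rightarrow> real^4 \<Rightarrow> real^4 \<Rightarrow> real) \<Rightarrow> 'a \<Rightarrow> (real^4) set" where
  "surface_normal_space P A g p = {v. \<forall>w\<in>surface_tangent_space P A p. g p v w = 0}"

definition normal_part ::
    "('a, 2) chart set \<Rightarrow> ('a, 4) chart set \<Rightarrow> ('a \<Rightarrow> real^4 \<Rightarrow> real^4 \<Rightarrow> real) \<Rightarrow>
     'a \<Rightarrow> real^4 \<Rightarrow> real^4" where
  "normal_part P A g p v = (THE n. n \<in> surface_normal_space P A g p \<and> v - n \<in> surface_tangent_space P A p)"

text \<open>
  The covariant derivative \<open>\<nabla>\<^sub>v Y\<close> at \<open>p\<close> of a field \<open>Y = Y\<^sup>i \<partial>\<^sub>i\<close> of spacetime vectors that is defined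
  only along the surface, for \<open>v\<close> tangent to the surface: \<open>v(Y\<^sup>i) \<partial>\<^sub>i + Y\<^sup>i \<nabla>\<^sub>v \<partial>\<^sub>i\<close>.  The coordinates
  are those of \<open>chart_at A p\<close>, in which the vectors at \<open>p\<close> are equal to their components.
\<close>

definition cov_along ::
    "('a, 2) chart set \<Rightarrow> ('a, 4) chart set \<Rightarrow> (real^4 \<Rightarrow> ('a \<Rightarrow> real^4) \<Rightarrow> 'a \<Rightarrow> real^4) \<Rightarrow>
     real^4 \<Rightarrow> ('a \<Rightarrow> real^4) \<Rightarrow> 'a \<Rightarrow> real^4" where
  "cov_along P A nab v Y p =
     dirderiv P (\<lambda>q. components A (chart_at A p) q (Y q)) p (inv (incl_deriv P A p) v) +
     (\<Sum>i\<in>UNIV. (Y p $ i) *\<^sub>R nab v (coord_field A (chart_at A p) i) p)"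

definition tangent_orthonormal_frame ::
    "'a::topological_space set \<Rightarrow> ('a, 2) chart set \<Rightarrow> ('a, 4) chart set \<Rightarrow>
     ('a \<Rightarrow> real^4 \<Rightarrow> real^4 \<Rightarrow> real) \<Rightarrow> 'a \<Rightarrow> ('a \<Rightarrow> real^4) \<times> ('a \<Rightarrow> real^4) \<Rightarrow> bool" where
  "tangent_orthonormal_frame S P A g p = (\<lambda>(e2, e3).
     \<exists>W. openin (top_of_set S) W \<and> p \<in> W \<and> smooth_field P A W e2 \<and> smooth_field P A W e3 \<and>
       (\<forall>q\<in>W. e2 q \<in> surface_tangent_space P A q \<and> e3 q \<in> surface_tangent_space P A q \<and>
          g q (e2 q) (e2 q) = 1 \<and> g q (e3 q) (e3 q) = 1 \<and> g q (e2 q) (e3 q) = 0))"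

definition mean_curvature ::
    "'a::topological_space set \<Rightarrow> ('a, 2) chart set \<Rightarrow> ('a, 4) chart set \<Rightarrow>
     ('a \<Rightarrow> real^4 \<Rightarrow> real^4 \<Rightarrow> real) \<Rightarrow> (real^4 \<Rightarrow> ('a \<Rightarrow> real^4) \<Rightarrow> 'a \<Rightarrow> real^4) \<Rightarrow>
     'a \<Rightarrow> real^4" where
  "mean_curvature S P A g nab p =
     (let (e2, e3) = (SOME e. tangent_orthonormal_frame S P A g p e)
      in normal_part P A g p (cov_along P A nab (e2 p) e2 p + cov_along P A nab (e3 p) e3 p))"

section \<open>Integration over a compact oriented surface\<close>

text \<open>
  A 2-form on the surface assigns to every point a form on the tangent space \<open>real^2\<close> there.  It is
  integrated by means of a finite partition of unity subordinate to the atlas.  As the partition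
  functions are never differentiated, they are only required to be continuous.
\<close>

definition partition_of_unity ::
    "'a::topological_space set \<Rightarrow> ('a, 2) chart set \<Rightarrow>
     ('a, 2) chart set \<times> (('a, 2) chart \<Rightarrow> 'a \<Rightarrow> real) \<Rightarrow> bool" where
  "partition_of_unity S P = (\<lambda>(C, \<rho>).
     finite C \<and> C \<subseteq> P \<and>
     (\<forall>c\<in>C. continuous_on S (\<rho> c) \<and> (\<forall>p\<in>S. \<rho> c p \<ge> 0) \<and> S \<inter> closure {p\<in>S. \<rho> c p \<noteq> 0} \<subseteq> fst c) \<and>
     (\<forall>p\<in>S. (\<Sum>c\<in>C. \<rho> c p) = 1))"

definition form_integral ::
    "'a::topological_space set \<Rightarrow> ('a, 2) chart set \<Rightarrow> ('a \<Rightarrow> real^2 \<Rightarrow> real^2 \<Rightarrow> real) \<Rightarrow> real" where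
  "form_integral S P \<alpha> =
     (let (C, \<rho>) = (SOME c. partition_of_unity S P c)
      in \<Sum>c\<in>C. integral (snd c ` fst c)
           (\<lambda>y. let q = inv_chart c y in \<rho> c q * \<alpha> q (coord_field P c 0 q) (coord_field P c 1 q)))"

text \<open>The area form: \<open>sqrt (det h) dy\<^sup>0 \<and> dy\<^sup>1\<close>, with \<open>h\<close> the induced metric.\<close>

definition area_form ::
    "('a, 2) chart set \<Rightarrow> ('a, 4) chart set \<Rightarrow> ('a \<Rightarrow> real^4 \<Rightarrow> real^4 \<Rightarrow> real) \<Rightarrow>
     'a \<Rightarrow> real^2 \<Rightarrow> real^2 \<Rightarrow> real" where
  "area_form P A g p u v =
     sqrt (det (\<chi> i j. g p (incl_deriv P A p (axis i 1)) (incl_deriv P A p (axis j 1)) :: real^2^2)) *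
     (u $ 0 * v $ 1 - u $ 1 * v $ 0)"

definition surface_integral ::
    "'a::topological_space set \<Rightarrow> ('a, 2) chart set \<Rightarrow> ('a, 4) chart set \<Rightarrow>
     ('a \<Rightarrow> real^4 \<Rightarrow> real^4 \<Rightarrow> real) \<Rightarrow> ('a \<Rightarrow> real) \<Rightarrow> real" where
  "surface_integral S P A g f = form_integral S P (\<lambda>p u v. f p * area_form P A g p u v)"

section \<open>Reference embeddings\<close>

definition push_field ::
    "('a, 4) chart set \<Rightarrow> ('b, 4) chart set \<Rightarrow> ('a \<Rightarrow> 'b) \<Rightarrow> 'a set \<Rightarrow> ('a \<Rightarrow> real^4) \<Rightarrow> 'b \<Rightarrow> real^4" where
  "push_field A B \<phi> S X q = tangent_map A B \<phi> (inv_into S \<phi> q) (X (inv_into S \<phi> q))"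

definition push_atlas :: "('a \<Rightarrow> 'b) \<Rightarrow> ('a, 2) chart set \<Rightarrow> ('b, 2) chart set" where
  "push_atlas \<phi> P = (\<lambda>(V, s). (\<phi> ` V, s \<circ> inv_into V \<phi>)) ` P"

definition pullback_metric ::
    "('a, 4) chart set \<Rightarrow> ('b, 4) chart set \<Rightarrow> ('a \<Rightarrow> 'b) \<Rightarrow> ('b \<Rightarrow> real^4 \<Rightarrow> real^4 \<Rightarrow> real) \<Rightarrow>
     'a \<Rightarrow> real^4 \<Rightarrow> real^4 \<Rightarrow> real" where
  "pullback_metric A B \<phi> g p u v = g (\<phi> p) (tangent_map A B \<phi> p u) (tangent_map A B \<phi> p v)"

text \<open>
  Off \<open>S\<close> the metrics \<open>g\<close> and \<open>\<phi>\<^sup>*g'\<close> may have different timelike vectors, so preservation of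
  the time orientation is demanded at the points of \<open>S\<close>, where the light cones agree.
\<close>

definition matching_reference ::
    "'a::topological_space set \<Rightarrow> ('a, 4) chart set \<Rightarrow> ('a \<Rightarrow> real^4 \<Rightarrow> real^4 \<Rightarrow> real) \<Rightarrow> ('a \<Rightarrow> real^4) \<Rightarrow>
     ('b::topological_space, 4) chart set \<Rightarrow> ('b \<Rightarrow> real^4 \<Rightarrow> real^4 \<Rightarrow> real) \<Rightarrow> ('b \<Rightarrow> real^4) \<Rightarrow>
     'a set \<Rightarrow> 'a set \<Rightarrow> ('a \<Rightarrow> 'b) \<Rightarrow> bool" where
  "matching_reference M A g T A' g' T' S U \<phi> \<longleftrightarrow>
     openin (top_of_set M) U \<and> S \<subseteq> U \<and> smooth_embedding A A' U \<phi> \<and>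
     (\<forall>p\<in>U. det (matrix (tangent_map A A' \<phi> p)) > 0) \<and>
     (\<forall>p\<in>S. \<forall>v. future_timelike g T p v \<longrightarrow> future_timelike g' T' (\<phi> p) (tangent_map A A' \<phi> p v)) \<and>
     (\<forall>p\<in>S. \<forall>u v. pullback_metric A A' \<phi> g' p u v = g p u v)"

section \<open>The Chen--Nester--Tung energy\<close>

definition list4 :: "'b \<Rightarrow> 'b \<Rightarrow> 'b \<Rightarrow> 'b \<Rightarrow> 4 \<Rightarrow> 'b" where
  "list4 a b c d i = (if i = 0 then a else if i = 1 then b else if i = 2 then c else d)"

definition positive_basis :: "(4 \<Rightarrow> real^4) \<Rightarrow> bool" where
  "positive_basis e \<longleftrightarrow> det (\<chi> i a. e a $ i :: real^4^4) > 0"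

definition local_frame ::
    "('a::topological_space, 4) chart set \<Rightarrow> 'a set \<Rightarrow> 'a \<Rightarrow> (4 \<Rightarrow> 'a \<Rightarrow> real^4) \<Rightarrow> bool" where
  "local_frame A U p e \<longleftrightarrow>
     (\<exists>W. openin (top_of_set U) W \<and> p \<in> W \<and> (\<forall>a. smooth_field A A W (e a)) \<and>
       (\<forall>q\<in>W. positive_basis (\<lambda>a. e a q)))"

definition levi_civita_symbol :: "4 \<Rightarrow> 4 \<Rightarrow> 4 \<Rightarrow> 4 \<Rightarrow> real" where
  "levi_civita_symbol a b c d =
     (if inj (list4 a b c d) then of_int (sign (list4 a b c d)) else 0)"

text \<open>The dual basis: \<open>u = (\<Sum>a. coframe e a u *\<^sub>R e a)\<close>.\<close>

definition coframe :: "(4 \<Rightarrow> real^4) \<Rightarrow> 4 \<Rightarrow> real^4 \<Rightarrow> real" where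
  "coframe e a u = (matrix_inv (\<chi> i b. e b $ i :: real^4^4) *v u) $ a"

definition eta_form :: "(real^4 \<Rightarrow> real^4 \<Rightarrow> real) \<Rightarrow> (4 \<Rightarrow> real^4) \<Rightarrow> 4 \<Rightarrow> 4 \<Rightarrow> real^4 \<Rightarrow> real^4 \<Rightarrow> real" where
  "eta_form h e a b u v =
     (let G = (\<chi> c d. h (e c) (e d)) :: real^4^4
      in 1/2 * sqrt (- det G) *
         (\<Sum>\<beta>\<in>UNIV. \<Sum>\<mu>\<in>UNIV. \<Sum>\<nu>\<in>UNIV. matrix_inv G $ b $ \<beta> * levi_civita_symbol a \<beta> \<mu> \<nu> *
            (coframe e \<mu> u * coframe e \<nu> v - coframe e \<mu> v * coframe e \<nu> u)))"

definition connection_form ::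
    "(real^4 \<Rightarrow> ('a \<Rightarrow> real^4) \<Rightarrow> 'a \<Rightarrow> real^4) \<Rightarrow> (4 \<Rightarrow> 'a \<Rightarrow> real^4) \<Rightarrow> 'a \<Rightarrow> 4 \<Rightarrow> 4 \<Rightarrow> real^4 \<Rightarrow> real" where
  "connection_form nab e p a b u = coframe (\<lambda>c. e c p) a (nab u (e b) p)"

text \<open>
  \<open>cnt_form\<close> is the pulled-back 2-form
  \<open>\<iota>\<^sup>*[(\<omega>\<^sup>a\<^sub>b - \<omega>'\<^sup>a\<^sub>b) \<and> i\<^sub>N \<eta>\<^sub>a\<^sup>b]\<close>, where \<open>nab\<close> and \<open>nab'\<close> are the Levi-Civita connections of \<open>g\<close>
  and of the pulled-back reference metric.  At each point it is computed in some positively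
  oriented local frame; the form does not depend on this choice.
\<close>

definition cnt_form ::
    "('a::topological_space, 2) chart set \<Rightarrow> ('a, 4) chart set \<Rightarrow> 'a set \<Rightarrow>
     ('a \<Rightarrow> real^4 \<Rightarrow> real^4 \<Rightarrow> real) \<Rightarrow>
     (real^4 \<Rightarrow> ('a \<Rightarrow> real^4) \<Rightarrow> 'a \<Rightarrow> real^4) \<Rightarrow> (real^4 \<Rightarrow> ('a \<Rightarrow> real^4) \<Rightarrow> 'a \<Rightarrow> real^4) \<Rightarrow>
     ('a \<Rightarrow> real^4) \<Rightarrow> 'a \<Rightarrow> real^2 \<Rightarrow> real^2 \<Rightarrow> real" where
  "cnt_form P A U g nab nab' N p u v =
     (let e = (SOME e. local_frame A U p e);
          \<Delta> = (\<lambda>a b w. connection_form nab e p a b (incl_deriv P A p w) -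
                        connection_form nab' e p a b (incl_deriv P A p w));
          \<eta>\<^sub>N = (\<lambda>a b w. eta_form (g p) (\<lambda>c. e c p) a b (N p) (incl_deriv P A p w))
      in \<Sum>a\<in>UNIV. \<Sum>b\<in>UNIV. \<Delta> a b u * \<eta>\<^sub>N a b v - \<Delta> a b v * \<eta>\<^sub>N a b u)"

definition cnt_energy ::
    "'a::topological_space set \<Rightarrow> ('a, 2) chart set \<Rightarrow> ('a, 4) chart set \<Rightarrow> 'a set \<Rightarrow>
     ('a \<Rightarrow> real^4 \<Rightarrow> real^4 \<Rightarrow> real) \<Rightarrow>
     (real^4 \<Rightarrow> ('a \<Rightarrow> real^4) \<Rightarrow> 'a \<Rightarrow> real^4) \<Rightarrow> (real^4 \<Rightarrow> ('a \<Rightarrow> real^4) \<Rightarrow> 'a \<Rightarrow> real^4) \<Rightarrow>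
     ('a \<Rightarrow> real^4) \<Rightarrow> real" where
  "cnt_energy S P A U g nab nab' N = 1 / (16 * pi) * form_integral S P (cnt_form P A U g nab nab' N)"

end

theory Submission
  imports Defs
begin

text \<open>
  Let \<open>D = \<nabla> - \<nabla>'\<close> be the difference of the connections of \<open>g\<close> and of the pulled-back reference metric.
  The connection forms enter the integrand only through \<open>D\<close>, and the contraction with \<open>\<eta>\<close> is the trace with
  respect to \<open>g\<close> of \<open>(x, y) \<mapsto> vol (D x, y, N, \<cdot>)\<close>, hence does not depend on the frame.  The two metrics agree
  along \<open>S\<close>, so \<open>D\<^sub>u\<close> is skew for \<open>u\<close> tangent to \<open>S\<close>.  In the orthonormal frame \<open>N\<^sup>\<bottom> / \<parallel>N\<^sup>\<bottom>\<parallel>, X, e\<^sub>2, e\<^sub>3\<close> the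
  integrand is therefore \<open>2 (\<parallel>N\<^sup>\<bottom>\<parallel> (\<langle>X, D\<^sub>2 e\<^sub>2\<rangle> + \<langle>X, D\<^sub>3 e\<^sub>3\<rangle>) - \<langle>D X, N\<^sup>\<bottom>\<rangle> / \<parallel>N\<^sup>\<bottom>\<parallel>)\<close> times the area form,
  the last \<open>D\<close> being taken in the direction \<open>N\<^sup>\<top>\<close>.
  As \<open>X\<close> is normal, \<open>\<langle>H, X\<rangle> = - \<Sum>\<^sub>i \<langle>e\<^sub>i, \<nabla>\<^sub>i X\<rangle>\<close>, and likewise on the image surface; the Koszul formula and the symmetry of second
  derivatives show that \<open>\<phi>\<close> carries \<open>\<nabla>'\<close> to the connection of the reference spacetime.  The integrals can then be
  compared because they do not depend on the partition of unity.
\<close>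

section \<open>Calculus of smooth maps\<close>

text \<open>Two features of the definitions shape the proof. Tangent vectors are component vectors
  in a preferred chart, and this chart jumps from point to point. Derivatives are therefore
  rewritten in a fixed chart, where the Hessian of the transition map has to cancel between the
  derivative of the components and the Christoffel symbols; the same cancellation, with the Hessian
  of \<open>\<phi>\<close>, gives the naturality of covariant derivatives. Moreover local frames,
  tangent frames and partitions of unity are selected by \<open>SOME\<close>, so every quantity
  built from them has to be shown independent of the selection. For the mean curvature this is
  achieved by moving the derivative from the frame to \<open>X\<close>: the trace of the derivative
  of \<open>X\<close> needs an orthonormal pair at one point only, and it makes sense for any
  connection along \<open>S\<close>, in particular for the pulled-back one. Finally, the integrals
  are gauge integrals over chart images, so linearity and independence of the partition rest on
  continuity of the two energy densities, which is proved in an explicit frame; the integrand of the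
  energy is then a difference of these densities.\<close>

abbreviation fd :: "('a::real_normed_vector \<Rightarrow> 'b::real_normed_vector) \<Rightarrow> 'a \<Rightarrow> 'a \<Rightarrow> 'b" where
  "fd f x \<equiv> frechet_derivative f (at x)"

lemma fd_eq: "(f has_derivative f') (at x) \<Longrightarrow> fd f x = f'"
  by (metis frechet_derivative_at)

lemma fd_works: "f differentiable (at x) \<Longrightarrow> (f has_derivative fd f x) (at x)"
  using frechet_derivative_works by blast

lemma linear_fd: "f differentiable (at x) \<Longrightarrow> linear (fd f x)"
  by (rule has_derivative_linear[OF fd_works])

text \<open>\<open>frechet_derivative\<close> is a choice among the admissible derivatives, and
  functions that agree near \<open>x\<close> admit the same ones; hence the equality holds even
  where no derivative exists.\<close>

lemma fd_cong:
  assumes "eventually (\<lambda>y. f y = g y) (nhds x)"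
  shows "fd f x = fd g x"
    and "f differentiable (at x) \<longleftrightarrow> g differentiable (at x)"
proof -
  from assms obtain X where X: "open X" "x \<in> X" "\<And>y. y \<in> X \<Longrightarrow> f y = g y"
    unfolding eventually_nhds by blast
  have 1: "(f has_derivative f') (at x) \<longleftrightarrow> (g has_derivative f') (at x)" for f'
    using X by (metis has_derivative_transform_within_open)
  show "fd f x = fd g x"
    unfolding frechet_derivative_def using 1 by simp
  show "f differentiable (at x) \<longleftrightarrow> g differentiable (at x)"
    unfolding differentiable_def using 1 by simp
qed

section \<open>Closure properties of finitely differentiable maps\<close>

lemma Ck_on_subset: "Ck_on k f S \<Longrightarrow> T \<subseteq> S \<Longrightarrow> Ck_on k f T"
proof (induction k arbitrary: f)
  case 0 then show ?case by (auto intro: continuous_on_subset)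
next
  case (Suc k) then show ?case by (auto)
qed

text \<open>Derivatives are taken in full neighbourhoods; openness of \<open>S\<close> turns
  agreement on \<open>S\<close> into agreement near each of its points.\<close>

lemma Ck_on_cong:
  assumes "Ck_on k f S" "open S" "\<And>x. x \<in> S \<Longrightarrow> f x = g x"
  shows "Ck_on k g S"
  using assms(1,3)
proof (induction k arbitrary: f g)
  case 0 then show ?case using continuous_on_cong[of S S f g] by simp
next
  case (Suc k)
  have ev: "eventually (\<lambda>y. f y = g y) (nhds x)" if "x \<in> S" for x
    using \<open>open S\<close> that Suc.prems(2) unfolding eventually_nhds by blast
  have "\<forall>x\<in>S. g differentiable (at x)"
    using Suc.prems(1) fd_cong(2)[OF ev] by simp
  moreover have "Ck_on k (\<lambda>x. fd g x v) S" for v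
    by (rule Suc.IH[of "\<lambda>x. fd f x v"]) (use Suc.prems(1) fd_cong(1)[OF ev] in auto)
  ultimately show ?case by simp
qed

lemma Ck_on_lower: "Ck_on (Suc k) f S \<Longrightarrow> Ck_on k f S"
proof (induction k arbitrary: f)
  case 0 then show ?case
    by (auto intro!: differentiable_imp_continuous_on differentiable_at_imp_differentiable_on)
next
  case (Suc k) then show ?case by simp
qed

lemma Ck_on_differentiable: "Ck_on k f S \<Longrightarrow> 0 < k \<Longrightarrow> x \<in> S \<Longrightarrow> f differentiable (at x)"
  by (cases k) auto

text \<open>Derivatives are local, so the induction passes to them; at order 0, continuity within
  \<open>S\<close> is unaffected by intersecting with a neighbourhood of the point.\<close>

lemma Ck_on_local:
  assumes "\<And>x. x \<in> S \<Longrightarrow> \<exists>T. open T \<and> x \<in> T \<and> Ck_on k f (S \<inter> T)"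
  shows "Ck_on k f S"
  using assms
proof (induction k arbitrary: f)
  case 0
  show ?case
    unfolding Ck_on.simps continuous_on_eq_continuous_within
  proof
    fix x assume x: "x \<in> S"
    then obtain T where T: "open T" "x \<in> T" "continuous_on (S \<inter> T) f" using 0 by force
    then have "(f \<longlongrightarrow> f x) (at x within S \<inter> T)"
      using x by (simp add: continuous_on_def)
    moreover have "at x within S \<inter> T = at x within S"
      by (rule at_within_nhd[of x T]) (use T in auto)
    ultimately show "continuous (at x within S) f"
      by (simp add: continuous_within)
  qed
next
  case (Suc k)
  have "f differentiable at x" if x: "x \<in> S" for x
    using Suc.prems[OF x] x by auto
  moreover have "Ck_on k (\<lambda>x. fd f x v) S" for v
    by (rule Suc.IH) (use Suc.prems in fastforce)
  ultimately show ?case by simp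
qed

lemma Ck_on_const [simp]: "Ck_on k (\<lambda>_. c) S"
proof (induction k arbitrary: c)
  case (Suc k)
  have "fd (\<lambda>_. c) x = (\<lambda>_. 0)" for x by (rule fd_eq) simp
  with Suc show ?case by simp
qed simp

lemma Ck_on_add:
  assumes "Ck_on k f S" "Ck_on k g S" "open S"
  shows "Ck_on k (\<lambda>x. f x + g x) S"
  using assms(1,2)
proof (induction k arbitrary: f g)
  case 0 then show ?case by (simp add: continuous_on_add)
next
  case (Suc k)
  have "fd (\<lambda>x. f x + g x) x = (\<lambda>v. fd f x v + fd g x v)" if "x \<in> S" for x
    by (rule fd_eq) (use Suc.prems that in \<open>auto intro!: has_derivative_add fd_works\<close>)
  note eq = this
  have "Ck_on k (\<lambda>x. fd f x v + fd g x v) S" for v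
    by (rule Suc.IH) (use Suc.prems in simp_all)
  then have "Ck_on k (\<lambda>x. fd (\<lambda>x. f x + g x) x v) S" for v
    by (rule Ck_on_cong[OF _ \<open>open S\<close>]) (simp add: eq)
  moreover have "(\<lambda>x. f x + g x) differentiable at x" if "x \<in> S" for x
    using Suc.prems that by (simp add: differentiable_add)
  ultimately show ?case by simp
qed

text \<open>The product rule gives two terms of the same shape with one factor differentiated, so
  the induction runs over all pairs of factors, and the undifferentiated factor is brought down by
  one order.\<close>

lemma Ck_on_bilinear:
  assumes "bounded_bilinear B" "Ck_on k f S" "Ck_on k g S" "open S"
  shows "Ck_on k (\<lambda>x. B (f x) (g x)) S"
  using assms(2,3)
proof (induction k arbitrary: f g)
  case 0 then show ?case using assms(1) by (simp add: bounded_bilinear.continuous_on)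
next
  case (Suc k)
  have der: "((\<lambda>x. B (f x) (g x)) has_derivative (\<lambda>v. B (f x) (fd g x v) + B (fd f x v) (g x))) (at x)"
    if "x \<in> S" for x
    by (rule bounded_bilinear.FDERIV[OF assms(1)]) (use Suc.prems that in \<open>auto intro!: fd_works\<close>)
  have "Ck_on k (\<lambda>x. B (f x) (fd g x v) + B (fd f x v) (g x)) S" for v
    by (intro Ck_on_add Suc.IH \<open>open S\<close>) (use Suc.prems Ck_on_lower in auto)
  then have "Ck_on k (\<lambda>x. fd (\<lambda>x. B (f x) (g x)) x v) S" for v
    by (rule Ck_on_cong) (use \<open>open S\<close> fd_eq[OF der] in auto)
  moreover have "(\<lambda>x. B (f x) (g x)) differentiable at x" if "x \<in> S" for x
    using der[OF that] by (rule differentiableI)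
  ultimately show ?case by simp
qed

lemma Ck_on_scaleR:
  "Ck_on k f S \<Longrightarrow> Ck_on k g S \<Longrightarrow> open S \<Longrightarrow> Ck_on k (\<lambda>x. f x *\<^sub>R g x) S"
  by (rule Ck_on_bilinear[OF bounded_bilinear_scaleR])

text \<open>A linear map is the bilinear map \<open>a *\<^sub>R h b\<close> with the constant 1 as
  its first argument.\<close>

lemma Ck_on_linear_compose:
  assumes "bounded_linear h" "Ck_on k f S" "open S"
  shows "Ck_on k (\<lambda>x. h (f x)) S"
proof -
  have "bounded_bilinear (\<lambda>(a::real) b. a *\<^sub>R h b)"
    using bounded_bilinear.comp[OF bounded_bilinear_scaleR bounded_linear_ident assms(1)] .
  from Ck_on_bilinear[OF this Ck_on_const[of k 1] assms(2,3)] show ?thesis by simp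
qed

lemma Ck_on_sum:
  assumes "\<And>i. i \<in> I \<Longrightarrow> Ck_on k (f i) S" "open S"
  shows "Ck_on k (\<lambda>x. \<Sum>i\<in>I. f i x) S"
  using assms
proof (induction I rule: infinite_finite_induct)
  case (insert i I) then show ?case by (auto intro: Ck_on_add)
qed auto

text \<open>\<open>Ck_on\<close> controls derivatives in fixed directions only. A direction that
  moves with the point is resolved in the basis, which reduces it to finitely many fixed
  ones.\<close>

lemma fd_euclidean_expand:
  fixes f :: "'a::euclidean_space \<Rightarrow> 'b::real_normed_vector"
  assumes "f differentiable (at x)"
  shows "fd f x w = (\<Sum>b\<in>Basis. (w \<bullet> b) *\<^sub>R fd f x b)"
proof -
  have "linear (fd f x)" using assms linear_frechet_derivative by blast
  then have "fd f x (\<Sum>b\<in>Basis. (w \<bullet> b) *\<^sub>R b) = (\<Sum>b\<in>Basis. (w \<bullet> b) *\<^sub>R fd f x b)"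
    by (simp add: linear_sum linear_cmul)
  then show ?thesis by (simp add: euclidean_representation)
qed

text \<open>In the chain rule the outer derivative is applied to the moving direction
  \<open>fd g x v\<close>, which is expanded in a basis; this is why the intermediate space is
  Euclidean.\<close>

lemma Ck_on_compose:
  fixes g :: "'a::real_normed_vector \<Rightarrow> 'b::euclidean_space"
  assumes "Ck_on k f T" "Ck_on k g S" "g ` S \<subseteq> T" "open S"
  shows "Ck_on k (\<lambda>x. f (g x)) S"
  using assms(1-3)
proof (induction k arbitrary: f g)
  case 0 then show ?case by (auto intro: continuous_on_compose2)
next
  case (Suc k)
  have der: "((\<lambda>x. f (g x)) has_derivative (\<lambda>v. fd f (g x) (fd g x v))) (at x)" if "x \<in> S" for x
  proof -
    have "(g has_derivative fd g x) (at x)" "(f has_derivative fd f (g x)) (at (g x))"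
      using Suc.prems that by (auto intro!: fd_works)
    from diff_chain_at[OF this] show ?thesis by (simp add: o_def)
  qed
  have dg: "Ck_on k (\<lambda>x. fd f (g x) b) S" for b
    by (rule Suc.IH[of "\<lambda>y. fd f y b"]) (use Suc.prems Ck_on_lower[OF Suc.prems(2)] in simp_all)
  have "Ck_on k (\<lambda>x. \<Sum>b\<in>Basis. (fd g x v \<bullet> b) *\<^sub>R fd f (g x) b) S" for v
    by (intro Ck_on_sum Ck_on_scaleR dg \<open>open S\<close> Ck_on_linear_compose[OF bounded_linear_inner_left])
      (use Suc.prems in auto)
  then have "Ck_on k (\<lambda>x. fd (\<lambda>x. f (g x)) x v) S" for v
  proof (rule Ck_on_cong[OF _ \<open>open S\<close>])
    fix x assume x: "x \<in> S"
    have "f differentiable at (g x)" using Suc.prems x by auto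
    from fd_euclidean_expand[OF this, of "fd g x v"]
    show "(\<Sum>b\<in>Basis. (fd g x v \<bullet> b) *\<^sub>R fd f (g x) b) = fd (\<lambda>x. f (g x)) x v"
      unfolding fd_eq[OF der[OF x]] by (rule sym)
  qed
  moreover have "(\<lambda>x. f (g x)) differentiable at x" if "x \<in> S" for x
    using der[OF that] by (rule differentiableI)
  ultimately show ?case by simp
qed

text \<open>The derivative of the inverse is a multiple of its own square, which closes the
  induction.\<close>

lemma Ck_on_inverse: "0 \<notin> S \<Longrightarrow> open S \<Longrightarrow> Ck_on k (inverse :: real \<Rightarrow> real) S"
proof (induction k)
  case 0 then show ?case by (auto intro!: continuous_intros)
next
  case (Suc k)
  have der: "(inverse has_derivative (\<lambda>h. - (inverse x * h * inverse x))) (at x)" if "x \<in> S" for x :: real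
    by (rule has_derivative_inverse') (use that Suc.prems in auto)
  have "Ck_on k (\<lambda>x::real. (- h) *\<^sub>R (inverse x *\<^sub>R inverse x)) S" for h
    by (intro Ck_on_scaleR Ck_on_const Suc.IH Suc.prems)
  then have "Ck_on k (\<lambda>x::real. fd inverse x h) S" for h
    by (rule Ck_on_cong) (use Suc.prems fd_eq[OF der] in auto)
  then show ?case using der by (auto intro: differentiableI)
qed

text \<open>The derivative is a multiple of the inverse of \<open>sqrt\<close>, which has the order
  of \<open>sqrt\<close> provided by the induction hypothesis.\<close>

lemma Ck_on_sqrt: "S \<subseteq> {0<..} \<Longrightarrow> open S \<Longrightarrow> Ck_on k sqrt S"
proof (induction k)
  case 0 then show ?case by (auto intro!: continuous_intros)
next
  case (Suc k)
  have der: "(sqrt has_derivative (\<lambda>h. (h / 2) * inverse (sqrt x))) (at x)" if "x \<in> S" for x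
  proof -
    have "x > 0" using that Suc.prems by auto
    then have "(sqrt has_derivative (*) (inverse (sqrt x) / 2)) (at x)"
      using DERIV_real_sqrt[of x] by (simp add: has_field_derivative_def)
    moreover have "(*) (inverse (sqrt x) / 2) = (\<lambda>h. (h / 2) * inverse (sqrt x))" by auto
    ultimately show ?thesis by simp
  qed
  have "Ck_on k (\<lambda>x. inverse (sqrt x)) S"
    by (rule Ck_on_compose[of k inverse "{0<..}"]) (use Suc in \<open>auto intro!: Ck_on_inverse\<close>)
  then have "Ck_on k (\<lambda>x. (h / 2) *\<^sub>R inverse (sqrt x)) S" for h
    using Suc.prems by (intro Ck_on_scaleR) auto
  then have "Ck_on k (\<lambda>x. fd sqrt x h) S" for h
    by (rule Ck_on_cong) (use Suc.prems fd_eq[OF der] in auto)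
  then show ?case using der by (auto intro: differentiableI)
qed

section \<open>Closure properties of smooth maps\<close>

lemma smooth_onD: "smooth_on f S \<Longrightarrow> Ck_on k f S"
  by (simp add: smooth_on_def)

lemma smooth_on_subset: "smooth_on f S \<Longrightarrow> T \<subseteq> S \<Longrightarrow> smooth_on f T"
  by (auto simp: smooth_on_def intro: Ck_on_subset)

lemma smooth_on_cong:
  "smooth_on f S \<Longrightarrow> open S \<Longrightarrow> (\<And>x. x \<in> S \<Longrightarrow> f x = g x) \<Longrightarrow> smooth_on g S"
  by (auto simp: smooth_on_def intro: Ck_on_cong)

lemma smooth_on_local:
  assumes "\<And>x. x \<in> S \<Longrightarrow> \<exists>T. open T \<and> x \<in> T \<and> smooth_on f (S \<inter> T)"
  shows "smooth_on f S"
  unfolding smooth_on_def by (intro allI Ck_on_local) (use assms smooth_onD in metis)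

lemma smooth_on_differentiable: "smooth_on f S \<Longrightarrow> x \<in> S \<Longrightarrow> f differentiable (at x)"
  by (metis smooth_on_def Ck_on_differentiable zero_less_Suc)

lemma smooth_on_continuous: "smooth_on f S \<Longrightarrow> continuous_on S f"
  by (metis smooth_on_def Ck_on.simps(1))

lemma smooth_on_fd: "smooth_on f S \<Longrightarrow> smooth_on (\<lambda>x. fd f x v) S"
  unfolding smooth_on_def by (metis Ck_on.simps(2))

lemma smooth_on_const [simp]: "smooth_on (\<lambda>_. c) S"
  by (simp add: smooth_on_def)

lemma smooth_on_add:
  "smooth_on f S \<Longrightarrow> smooth_on g S \<Longrightarrow> open S \<Longrightarrow> smooth_on (\<lambda>x. f x + g x) S"
  by (simp add: smooth_on_def Ck_on_add)

lemma smooth_on_scaleR: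
  "smooth_on f S \<Longrightarrow> smooth_on g S \<Longrightarrow> open S \<Longrightarrow> smooth_on (\<lambda>x. f x *\<^sub>R g x) S"
  by (simp add: smooth_on_def Ck_on_scaleR)

lemma smooth_on_mult:
  fixes f g :: "_ \<Rightarrow> real"
  shows "smooth_on f S \<Longrightarrow> smooth_on g S \<Longrightarrow> open S \<Longrightarrow> smooth_on (\<lambda>x. f x * g x) S"
  using smooth_on_scaleR[of f S g] by simp

lemma smooth_on_linear_compose:
  "bounded_linear h \<Longrightarrow> smooth_on f S \<Longrightarrow> open S \<Longrightarrow> smooth_on (\<lambda>x. h (f x)) S"
  by (simp add: smooth_on_def Ck_on_linear_compose)

lemma smooth_on_uminus:
  "smooth_on f S \<Longrightarrow> open S \<Longrightarrow> smooth_on (\<lambda>x. - f x) S"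
  by (rule smooth_on_linear_compose[OF bounded_linear_minus[OF bounded_linear_ident]])

lemma smooth_on_diff:
  "smooth_on f S \<Longrightarrow> smooth_on g S \<Longrightarrow> open S \<Longrightarrow> smooth_on (\<lambda>x. f x - g x) S"
  using smooth_on_add[of f S "\<lambda>x. - g x"] smooth_on_uminus[of g S] by simp

lemma smooth_on_component:
  fixes f :: "_ \<Rightarrow> real^'n"
  shows "smooth_on f S \<Longrightarrow> open S \<Longrightarrow> smooth_on (\<lambda>x. f x $ i) S"
  by (rule smooth_on_linear_compose[OF bounded_linear_vec_nth])

lemma smooth_on_sum:
  "(\<And>i. i \<in> I \<Longrightarrow> smooth_on (f i) S) \<Longrightarrow> open S \<Longrightarrow> smooth_on (\<lambda>x. \<Sum>i\<in>I. f i x) S"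
  by (simp add: smooth_on_def Ck_on_sum)

lemma smooth_on_compose:
  fixes g :: "'a::real_normed_vector \<Rightarrow> 'b::euclidean_space"
  shows "smooth_on f T \<Longrightarrow> smooth_on g S \<Longrightarrow> g ` S \<subseteq> T \<Longrightarrow> open S \<Longrightarrow> smooth_on (\<lambda>x. f (g x)) S"
  unfolding smooth_on_def by (auto intro: Ck_on_compose)

lemma smooth_on_inverse:
  fixes f :: "_ \<Rightarrow> real"
  assumes "smooth_on f S" "open S" "\<And>x. x \<in> S \<Longrightarrow> f x \<noteq> 0"
  shows "smooth_on (\<lambda>x. inverse (f x)) S"
  by (rule smooth_on_compose[of inverse "-{0}"])
    (use assms in \<open>auto simp: smooth_on_def intro!: Ck_on_inverse\<close>)

lemma smooth_on_sqrt:
  assumes "smooth_on f S" "open S" "\<And>x. x \<in> S \<Longrightarrow> f x > 0"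
  shows "smooth_on (\<lambda>x. sqrt (f x)) S"
  by (rule smooth_on_compose[of sqrt "{0<..}"])
    (use assms in \<open>auto simp: smooth_on_def intro!: Ck_on_sqrt\<close>)

text \<open>This is the form in which changes of components occur: a Jacobian at a moving point,
  applied to a moving component vector.\<close>

lemma smooth_on_fd_apply:
  fixes F :: "'a::euclidean_space \<Rightarrow> 'b::real_normed_vector"
    and h :: "'c::real_normed_vector \<Rightarrow> 'a"
  assumes "smooth_on F T" "smooth_on h S" "h ` S \<subseteq> T" "smooth_on w S" "open S"
  shows "smooth_on (\<lambda>x. fd F (h x) (w x)) S"
proof (rule smooth_on_cong[OF _ \<open>open S\<close>])
  show "smooth_on (\<lambda>x. \<Sum>b\<in>Basis. (w x \<bullet> b) *\<^sub>R fd F (h x) b) S"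
    by (intro smooth_on_sum smooth_on_scaleR smooth_on_linear_compose[OF bounded_linear_inner_left]
        smooth_on_compose[OF smooth_on_fd[OF assms(1)] assms(2,3)] assms)
  show "(\<Sum>b\<in>Basis. (w x \<bullet> b) *\<^sub>R fd F (h x) b) = fd F (h x) (w x)" if "x \<in> S" for x
    using assms that by (subst fd_euclidean_expand[of F]) (auto intro: smooth_on_differentiable)
qed

text \<open>Schwarz's theorem by second differences. The alternating sum of \<open>f\<close> over
  the corners of a parallelogram does not depend on the order of the sides, while two applications
  of the mean value theorem express it through either mixed derivative at some point nearby.
  Continuity of the mixed derivatives then forces them to agree at \<open>x\<close>.\<close>

lemma fd_second_symmetric_real:
  fixes f :: "'a::real_normed_vector \<Rightarrow> real"
  assumes f: "Ck_on 2 f S" and S: "open S" "x \<in> S"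
  shows "fd (\<lambda>y. fd f y u) x v = fd (\<lambda>y. fd f y v) x u"
proof -
  have df: "(f has_derivative fd f y) (at y)" if "y \<in> S" for y
    using f that by (auto simp: numeral_2_eq_2 intro!: fd_works)
  have d2: "((\<lambda>y. fd f y a) has_derivative fd (\<lambda>y. fd f y a) y) (at y)" if "y \<in> S" for y a
    using f that by (auto simp: numeral_2_eq_2 intro!: fd_works)
  have c2: "continuous_on S (\<lambda>y. fd (\<lambda>y. fd f y a) y b)" for a b
    using f by (auto simp: numeral_2_eq_2)
  obtain r where r: "r > 0" "ball x r \<subseteq> S" using S open_contains_ball by blast
  \<comment> \<open>Multiples of \<open>u\<close> and \<open>v\<close> by factors below this bound
    stay in the ball, in either order; the summand 1 keeps the denominator positive.\<close>
  define R where "R = r / (norm u + norm v + 1)"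
  have R: "R > 0" using r by (simp add: R_def add_nonneg_pos)
  have inS: "x + s *\<^sub>R a + t *\<^sub>R b \<in> ball x r"
    if "\<bar>s\<bar> < R" "\<bar>t\<bar> < R" "norm a + norm b \<le> norm u + norm v" for s t a b
  proof -
    have "norm (s *\<^sub>R a + t *\<^sub>R b) \<le> \<bar>s\<bar> * norm a + \<bar>t\<bar> * norm b"
      by (metis norm_scaleR norm_triangle_ineq)
    also have "\<dots> \<le> R * norm a + R * norm b"
      using that by (intro add_mono mult_right_mono) auto
    also have "\<dots> \<le> R * (norm u + norm v)" using that R by (metis distrib_left less_imp_le mult_left_mono)
    also have "\<dots> < R * (norm u + norm v + 1)" using R by simp
    also have "\<dots> = r" by (simp add: R_def add_nonneg_pos) (smt (verit) norm_ge_zero)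
    finally have "norm (s *\<^sub>R a + t *\<^sub>R b) < r" .
    moreover have "x - (x + s *\<^sub>R a + t *\<^sub>R b) = - (s *\<^sub>R a + t *\<^sub>R b)" by simp
    ultimately show ?thesis by (simp only: mem_ball dist_norm norm_minus_cancel)
  qed
  have key: "\<exists>s t. 0 < s \<and> s < h \<and> 0 < t \<and> t < h \<and>
      f (x + h *\<^sub>R a + h *\<^sub>R b) - f (x + h *\<^sub>R a) - f (x + h *\<^sub>R b) + f x
        = h * (h * fd (\<lambda>y. fd f y a) (x + s *\<^sub>R a + t *\<^sub>R b) b)"
    if h: "0 < h" "h < R" and ab: "norm a + norm b \<le> norm u + norm v" for h a b
  proof -
    \<comment> \<open>\<open>p\<close> compares opposite sides of the parallelogram, so its
      increment from 0 to \<open>h\<close> is the second difference.\<close>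
    define p where "p s = f (x + s *\<^sub>R a + h *\<^sub>R b) - f (x + s *\<^sub>R a + 0 *\<^sub>R b)" for s
    have dp: "(p has_real_derivative
        fd f (x + s *\<^sub>R a + h *\<^sub>R b) a - fd f (x + s *\<^sub>R a + 0 *\<^sub>R b) a) (at s)"
      if s: "0 \<le> s" "s \<le> h" for s
    proof -
      have 1: "((\<lambda>s. f (x + s *\<^sub>R a + t *\<^sub>R b)) has_real_derivative fd f (x + s *\<^sub>R a + t *\<^sub>R b) a) (at s)"
        if "\<bar>t\<bar> < R" for t
      proof -
        have in1: "x + s *\<^sub>R a + t *\<^sub>R b \<in> S" using inS[of s t a b] that s h ab r by auto
        have "((\<lambda>s. x + s *\<^sub>R a + t *\<^sub>R b) has_derivative (\<lambda>k. k *\<^sub>R a)) (at s)"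
          by (auto intro!: derivative_eq_intros)
        from diff_chain_at[OF this df[OF in1]]
        have "((\<lambda>s. f (x + s *\<^sub>R a + t *\<^sub>R b)) has_derivative (\<lambda>k. fd f (x + s *\<^sub>R a + t *\<^sub>R b) (k *\<^sub>R a))) (at s)"
          by (simp add: o_def)
        moreover have "fd f (x + s *\<^sub>R a + t *\<^sub>R b) (k *\<^sub>R a) = fd f (x + s *\<^sub>R a + t *\<^sub>R b) a * k" for k
          using has_derivative_linear[OF df[OF in1]] by (simp add: linear_cmul)
        ultimately show ?thesis by (simp add: has_field_derivative_def)
      qed
      show ?thesis unfolding p_def using 1[of h] 1[of 0] h R by (auto intro!: DERIV_diff)
    qed
    from MVT2[OF h(1), of p, OF dp] obtain s where s: "0 < s" "s < h"
      and ps: "p h - p 0 = h * (fd f (x + s *\<^sub>R a + h *\<^sub>R b) a - fd f (x + s *\<^sub>R a + 0 *\<^sub>R b) a)" by auto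
    define q where "q t = fd f (x + s *\<^sub>R a + t *\<^sub>R b) a" for t
    have dq: "(q has_real_derivative fd (\<lambda>y. fd f y a) (x + s *\<^sub>R a + t *\<^sub>R b) b) (at t)"
      if t: "0 \<le> t" "t \<le> h" for t
    proof -
      have in1: "x + s *\<^sub>R a + t *\<^sub>R b \<in> S" using inS[of s t a b] t s h ab r by auto
      have "((\<lambda>t. x + s *\<^sub>R a + t *\<^sub>R b) has_derivative (\<lambda>k. k *\<^sub>R b)) (at t)"
        by (auto intro!: derivative_eq_intros)
      from diff_chain_at[OF this d2[OF in1]]
      have "(q has_derivative (\<lambda>k. fd (\<lambda>y. fd f y a) (x + s *\<^sub>R a + t *\<^sub>R b) (k *\<^sub>R b))) (at t)"
        by (simp add: o_def q_def[abs_def])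
      moreover have "fd (\<lambda>y. fd f y a) (x + s *\<^sub>R a + t *\<^sub>R b) (k *\<^sub>R b)
          = fd (\<lambda>y. fd f y a) (x + s *\<^sub>R a + t *\<^sub>R b) b * k" for k
        using has_derivative_linear[OF d2[OF in1]] by (simp add: linear_cmul)
      ultimately show ?thesis by (simp add: has_field_derivative_def)
    qed
    from MVT2[OF h(1), of q, OF dq] obtain t where t: "0 < t" "t < h"
      and qt: "q h - q 0 = h * fd (\<lambda>y. fd f y a) (x + s *\<^sub>R a + t *\<^sub>R b) b" by auto
    have "p h - p 0 = h * (h * fd (\<lambda>y. fd f y a) (x + s *\<^sub>R a + t *\<^sub>R b) b)"
      using ps qt by (simp add: q_def)
    then show ?thesis using s t
      by (intro exI[of _ s] exI[of _ t]) (simp add: p_def)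
  qed
  let ?A = "fd (\<lambda>y. fd f y u) x v" and ?B = "fd (\<lambda>y. fd f y v) x u"
  have near: "\<exists>d>0. \<forall>y. dist y x < d \<longrightarrow> \<bar>fd (\<lambda>y. fd f y a) y b - fd (\<lambda>y. fd f y a) x b\<bar> < e"
    if "e > 0" for a b e
  proof -
    have "isCont (\<lambda>y. fd (\<lambda>y. fd f y a) y b) x"
      using c2 S continuous_on_eq_continuous_at by blast
    then show ?thesis using that unfolding continuous_at_eps_delta by (auto simp: dist_real_def)
  qed
  show ?thesis
  proof (rule ccontr)
    assume "?A \<noteq> ?B"
    define e where "e = \<bar>?A - ?B\<bar> / 2"
    have e: "e > 0" using \<open>?A \<noteq> ?B\<close> by (simp add: e_def)
    obtain d1 where d1: "d1 > 0" "\<And>y. dist y x < d1 \<Longrightarrow> \<bar>fd (\<lambda>y. fd f y u) y v - ?A\<bar> < e"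
      using near[OF e, of u v] by blast
    obtain d2 where d2: "d2 > 0" "\<And>y. dist y x < d2 \<Longrightarrow> \<bar>fd (\<lambda>y. fd f y v) y u - ?B\<bar> < e"
      using near[OF e, of v u] by blast
    \<comment> \<open>Small enough for the parallelogram to lie in the ball and for its interior
      points to satisfy both continuity estimates.\<close>
    define h where "h = min (R/2) (min d1 d2 / (2 * (norm u + norm v + 1)))"
    have nz: "norm u + norm v + 1 > 0" by (simp add: add_nonneg_pos)
    have h: "0 < h" "h < R" using R d1 d2 nz by (auto simp: h_def)
    have small: "dist (x + s *\<^sub>R a + t *\<^sub>R b) x < min d1 d2"
      if "0 < s" "s < h" "0 < t" "t < h" "norm a + norm b = norm u + norm v" for s t a b
    proof -
      have "dist (x + s *\<^sub>R a + t *\<^sub>R b) x \<le> \<bar>s\<bar> * norm a + \<bar>t\<bar> * norm b"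
        by (simp add: dist_norm add.assoc) (metis norm_scaleR norm_triangle_ineq)
      also have "\<dots> \<le> h * norm a + h * norm b" using that by (intro add_mono mult_right_mono) auto
      also have "\<dots> = h * (norm u + norm v)" using that by (simp flip: distrib_left)
      also have "\<dots> < 2 * h * (norm u + norm v + 1)" 
      proof -
        have "0 \<le> h * norm u" "0 \<le> h * norm v" using h by simp_all
        then show ?thesis using h unfolding distrib_left distrib_right by linarith
      qed
      also have "\<dots> \<le> min d1 d2"
      proof -
        have "h \<le> min d1 d2 / (2 * (norm u + norm v + 1))" by (simp add: h_def)
        then show ?thesis using nz by (simp add: pos_le_divide_eq mult_ac)
      qed
      finally show ?thesis .
    qed
    obtain s t where st: "0 < s" "s < h" "0 < t" "t < h"
      "f (x + h *\<^sub>R u + h *\<^sub>R v) - f (x + h *\<^sub>R u) - f (x + h *\<^sub>R v) + f x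
        = h * (h * fd (\<lambda>y. fd f y u) (x + s *\<^sub>R u + t *\<^sub>R v) v)"
      using key[OF h, of u v] by auto
    obtain s' t' where st': "0 < s'" "s' < h" "0 < t'" "t' < h"
      "f (x + h *\<^sub>R v + h *\<^sub>R u) - f (x + h *\<^sub>R v) - f (x + h *\<^sub>R u) + f x
        = h * (h * fd (\<lambda>y. fd f y v) (x + s' *\<^sub>R v + t' *\<^sub>R u) u)"
      using key[OF h, of v u] by auto
    have "x + h *\<^sub>R v + h *\<^sub>R u = x + h *\<^sub>R u + h *\<^sub>R v" by simp
    then have "h * (h * fd (\<lambda>y. fd f y u) (x + s *\<^sub>R u + t *\<^sub>R v) v)
        = h * (h * fd (\<lambda>y. fd f y v) (x + s' *\<^sub>R v + t' *\<^sub>R u) u)"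
      using st(5) st'(5) by (simp only:)
    then have "fd (\<lambda>y. fd f y u) (x + s *\<^sub>R u + t *\<^sub>R v) v = fd (\<lambda>y. fd f y v) (x + s' *\<^sub>R v + t' *\<^sub>R u) u"
      using h by simp
    moreover have "\<bar>fd (\<lambda>y. fd f y u) (x + s *\<^sub>R u + t *\<^sub>R v) v - ?A\<bar> < e"
      using small[of s t u v] st by (intro d1) auto
    moreover have "\<bar>fd (\<lambda>y. fd f y v) (x + s' *\<^sub>R v + t' *\<^sub>R u) u - ?B\<bar> < e"
      using small[of s' t' v u] st' by (intro d2) auto
    moreover have "\<bar>?A - ?B\<bar> = 2 * e" by (simp add: e_def)
    ultimately show False by argo
  qed
qed

lemma fd_second_symmetric:
  fixes f :: "'a::real_normed_vector \<Rightarrow> 'b::euclidean_space"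
  assumes f: "Ck_on 2 f S" and S: "open S" "x \<in> S"
  shows "fd (\<lambda>y. fd f y u) x v = fd (\<lambda>y. fd f y v) x u"
proof (rule euclidean_eqI)
  fix b :: 'b assume "b \<in> Basis"
  have df: "f differentiable (at y)" if "y \<in> S" for y
    using f that by (auto simp: numeral_2_eq_2)
  have d2: "(\<lambda>y. fd f y a) differentiable (at x)" for a
    using f S by (auto simp: numeral_2_eq_2)
  have fb: "Ck_on 2 (\<lambda>y. f y \<bullet> b) S"
    by (rule Ck_on_linear_compose[OF bounded_linear_inner_left f S(1)])
  have *: "fd (\<lambda>y. f y \<bullet> b) y a = fd f y a \<bullet> b" if "y \<in> S" for y a
    by (subst fd_eq[OF has_derivative_inner_left[OF fd_works[OF df[OF that]]]]) simp
  have **: "fd (\<lambda>y. fd (\<lambda>y. f y \<bullet> b) y a) x c = fd (\<lambda>y. fd f y a) x c \<bullet> b" for a c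
  proof -
    have "fd (\<lambda>y. fd (\<lambda>y. f y \<bullet> b) y a) x = fd (\<lambda>y. fd f y a \<bullet> b) x"
      by (rule fd_cong) (use S * in \<open>auto simp: eventually_nhds\<close>)
    also have "\<dots> = (\<lambda>c. fd (\<lambda>y. fd f y a) x c \<bullet> b)"
      by (rule fd_eq[OF has_derivative_inner_left[OF fd_works[OF d2]]])
    finally show ?thesis by simp
  qed
  show "fd (\<lambda>y. fd f y u) x v \<bullet> b = fd (\<lambda>y. fd f y v) x u \<bullet> b"
    using fd_second_symmetric_real[OF fb S, of u v] by (simp add: **)
qed

section \<open>Charts and components\<close>

text \<open>The eventual condition keeps arbitrary values out of the coordinate expression: near the
  point, \<open>inv_chart c\<close> and the chart \<open>d\<close> are evaluated on their domains
  only. Transition maps, inclusions and maps between spacetimes are all instances, so that one chain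
  rule serves them all.\<close>

definition chart_diff ::
    "('a, 'm::finite) chart \<Rightarrow> ('b, 'n::finite) chart \<Rightarrow> ('a \<Rightarrow> 'b) \<Rightarrow> 'a \<Rightarrow> bool" where
  "chart_diff c d f p \<longleftrightarrow>
     p \<in> fst c \<and> inj_on (snd c) (fst c) \<and> inj_on (snd d) (fst d) \<and>
     eventually (\<lambda>y. y \<in> snd c ` fst c \<and> f (inv_chart c y) \<in> fst d) (nhds (snd c p)) \<and>
     (snd d \<circ> f \<circ> inv_chart c) differentiable (at (snd c p))"

lemma inv_chart_chart: "inj_on (snd c) (fst c) \<Longrightarrow> p \<in> fst c \<Longrightarrow> inv_chart c (snd c p) = p"
  by (simp add: inv_chart_def)

lemma chart_diff_in:
  assumes "chart_diff c d f p" shows "p \<in> fst c" "f p \<in> fst d"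
proof -
  show p: "p \<in> fst c" using assms by (simp add: chart_diff_def)
  from assms have "eventually (\<lambda>y. y \<in> snd c ` fst c \<and> f (inv_chart c y) \<in> fst d) (nhds (snd c p))"
    by (simp add: chart_diff_def)
  from eventually_nhds_x_imp_x[OF this] assms p show "f p \<in> fst d"
    by (simp add: chart_diff_def inv_chart_chart)
qed

lemma chart_deriv_has_derivative:
  assumes "chart_diff c d f p"
  shows "((\<lambda>y. snd d (f (inv_chart c y))) has_derivative chart_deriv c d f p) (at (snd c p))"
  using assms fd_works[of "snd d \<circ> f \<circ> inv_chart c"]
  unfolding chart_diff_def chart_deriv_def by (simp add: o_def)

lemma linear_chart_deriv: "chart_diff c d f p \<Longrightarrow> linear (chart_deriv c d f p)"
  by (rule has_derivative_linear[OF chart_deriv_has_derivative])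

lemma chart_diff_filterlim:
  assumes "chart_diff c d f p"
  shows "filterlim (\<lambda>y. snd d (f (inv_chart c y))) (nhds (snd d (f p))) (nhds (snd c p))"
proof -
  have "isCont (\<lambda>y. snd d (f (inv_chart c y))) (snd c p)"
    using has_derivative_continuous[OF chart_deriv_has_derivative[OF assms]] .
  then have "filterlim (\<lambda>y. snd d (f (inv_chart c y))) (nhds (snd d (f (inv_chart c (snd c p))))) (nhds (snd c p))"
    using tendsto_at_iff_tendsto_nhds[of "\<lambda>y. snd d (f (inv_chart c y))" "snd c p"]
    unfolding isCont_def by (simp only:)
  moreover have "inv_chart c (snd c p) = p" using assms by (simp add: chart_diff_def inv_chart_chart)
  ultimately show ?thesis by (simp only:)
qed

text \<open>The chain rule inserts \<open>snd d\<close> followed by \<open>inv_chart d\<close>. They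
  cancel where \<open>f\<close> lands in the domain of \<open>d\<close>, which is the case in a
  neighbourhood of the point.\<close>

lemma has_derivative_chart_chain:
  assumes f: "chart_diff c d f p"
    and h: "((\<lambda>z. h (inv_chart d z)) has_derivative h') (at (snd d (f p)))"
  shows "((\<lambda>y. h (f (inv_chart c y))) has_derivative (\<lambda>v. h' (chart_deriv c d f p v))) (at (snd c p))"
proof -
  have p: "inv_chart c (snd c p) = p" using f by (simp add: chart_diff_def inv_chart_chart)
  have h': "((\<lambda>z. h (inv_chart d z)) has_derivative h') (at (snd d (f (inv_chart c (snd c p)))))"
    using h p by simp
  have D: "((\<lambda>y. h (inv_chart d (snd d (f (inv_chart c y))))) has_derivative (\<lambda>v. h' (chart_deriv c d f p v)))
      (at (snd c p))"
    using diff_chain_at[OF chart_deriv_has_derivative[OF f] h'] by (simp add: o_def)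
  from f have ev: "eventually (\<lambda>y. f (inv_chart c y) \<in> fst d) (nhds (snd c p))"
    by (auto simp: chart_diff_def elim: eventually_mono)
  then obtain X where X: "open X" "snd c p \<in> X" "\<And>y. y \<in> X \<Longrightarrow> f (inv_chart c y) \<in> fst d"
    unfolding eventually_nhds by blast
  have "h (inv_chart d (snd d (f (inv_chart c y)))) = h (f (inv_chart c y))" if "y \<in> X" for y
    using X(3)[OF that] f by (simp add: inv_chart_chart chart_diff_def)
  with D X(1,2) show ?thesis by (rule has_derivative_transform_within_open)
qed

lemma chart_diff_compose:
  assumes f: "chart_diff c d f p" and g: "chart_diff d e g (f p)"
  shows "chart_diff c e (\<lambda>q. g (f q)) p"
    and "chart_deriv c e (\<lambda>q. g (f q)) p v = chart_deriv d e g (f p) (chart_deriv c d f p v)"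
proof -
  note D = has_derivative_chart_chain[OF f, of "\<lambda>q. snd e (g q)", OF chart_deriv_has_derivative[OF g]]
  have ev: "eventually (\<lambda>y. g (inv_chart d (snd d (f (inv_chart c y)))) \<in> fst e) (nhds (snd c p))"
    by (rule eventually_compose_filterlim[OF _ chart_diff_filterlim[OF f], of "\<lambda>z. g (inv_chart d z) \<in> fst e"])
      (use g in \<open>auto simp: chart_diff_def elim: eventually_mono\<close>)
  show "chart_diff c e (\<lambda>q. g (f q)) p"
    unfolding chart_diff_def
  proof (intro conjI)
    show "(snd e \<circ> (\<lambda>q. g (f q)) \<circ> inv_chart c) differentiable at (snd c p)"
      using differentiableI[OF D] by (simp add: o_def)
    have "eventually (\<lambda>y. y \<in> snd c ` fst c \<and> f (inv_chart c y) \<in> fst d) (nhds (snd c p))"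
      using f by (simp add: chart_diff_def)
    then show "eventually (\<lambda>y. y \<in> snd c ` fst c \<and> g (f (inv_chart c y)) \<in> fst e) (nhds (snd c p))"
      using ev by eventually_elim (use f in \<open>auto simp: chart_diff_def inv_chart_chart\<close>)
  qed (use f g in \<open>auto simp: chart_diff_def\<close>)
  show "chart_deriv c e (\<lambda>q. g (f q)) p v = chart_deriv d e g (f p) (chart_deriv c d f p v)"
    using fd_eq[OF D] by (simp add: chart_deriv_def o_def)
qed

text \<open>For fixed \<open>v\<close> and varying \<open>q\<close> this is the field with constant
  components \<open>v\<close> in the chart \<open>c\<close>; on such fields the conditions on a
  connection take their simplest form.\<close>

definition from_components ::
    "('a, 'n::finite) chart set \<Rightarrow> ('a, 'n) chart \<Rightarrow> 'a \<Rightarrow> real^'n \<Rightarrow> real^'n" where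
  "from_components A c q = chart_deriv c (chart_at A q) (\<lambda>r. r) q"

locale oriented_manifold =
  fixes M :: "'a::topological_space set" and A :: "('a, 'n::finite) chart set"
  assumes atlas: "oriented_atlas M A"
begin

lemma chart_facts:
  assumes "c \<in> A"
  shows "openin (top_of_set M) (fst c)" "open (snd c ` fst c)"
    "homeomorphism (fst c) (snd c ` fst c) (snd c) (inv_into (fst c) (snd c))"
proof -
  have "\<forall>(U, x)\<in>A. openin (top_of_set M) U \<and> open (x ` U) \<and> homeomorphism U (x ` U) x (inv_into U x)"
    using atlas unfolding oriented_atlas_def by blast
  from bspec[OF this assms, unfolded case_prod_beta]
  show "openin (top_of_set M) (fst c)" "open (snd c ` fst c)"
    "homeomorphism (fst c) (snd c ` fst c) (snd c) (inv_into (fst c) (snd c))" by simp_all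
qed

lemma chart_openin: "c \<in> A \<Longrightarrow> openin (top_of_set M) (fst c)"
  by (rule chart_facts)

lemma chart_subset: "c \<in> A \<Longrightarrow> fst c \<subseteq> M"
  using chart_openin openin_imp_subset by blast

lemma chart_homeomorphism:
  assumes "c \<in> A" shows "homeomorphism (fst c) (snd c ` fst c) (snd c) (inv_chart c)"
  using chart_facts[OF assms] by (simp add: inv_chart_def)

lemma inj_chart: "c \<in> A \<Longrightarrow> inj_on (snd c) (fst c)"
  by (rule inj_on_inverseI[of _ "inv_chart c"]) (simp add: homeomorphism_apply1[OF chart_homeomorphism])

lemma inv_chart_left [simp]: "c \<in> A \<Longrightarrow> p \<in> fst c \<Longrightarrow> inv_chart c (snd c p) = p"
  by (rule inv_chart_chart[OF inj_chart])

lemma open_chart_image: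
  assumes "c \<in> A" "openin (top_of_set M) W" shows "open (snd c ` (fst c \<inter> W))"
proof -
  have "openin (top_of_set (fst c)) (fst c \<inter> W)"
    using assms chart_subset[of c] by (auto simp: openin_open)
  then have "openin (top_of_set (snd c ` fst c)) (snd c ` (fst c \<inter> W))"
    by (rule homeomorphism_imp_open_map[OF chart_homeomorphism[OF assms(1)]])
  moreover have "open (snd c ` fst c)" by (rule chart_facts) fact
  ultimately show ?thesis using openin_open_trans by blast
qed

lemma open_chart_range: "c \<in> A \<Longrightarrow> open (snd c ` fst c)"
  using open_chart_image[of c M] chart_subset[of c] by (simp add: Int_absorb2)

lemma chart_at_mem: "p \<in> M \<Longrightarrow> chart_at A p \<in> A" "p \<in> M \<Longrightarrow> p \<in> fst (chart_at A p)"
proof -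
  assume "p \<in> M"
  moreover have "\<Union> (fst ` A) = M" using atlas by (auto simp: oriented_atlas_def)
  ultimately have "\<exists>c. c \<in> A \<and> p \<in> fst c" by blast
  from someI_ex[OF this] show "chart_at A p \<in> A" "p \<in> fst (chart_at A p)"
    by (auto simp: chart_at_def)
qed

lemma transition_smooth:
  assumes "c \<in> A" "d \<in> A"
  shows "smooth_on (\<lambda>y. snd d (inv_chart c y)) (snd c ` (fst c \<inter> fst d))"
proof -
  have "\<forall>(U, x)\<in>A. \<forall>(V, y)\<in>A. smooth_on (y \<circ> inv_into U x) (x ` (U \<inter> V))"
    using atlas unfolding oriented_atlas_def by blast
  from bspec[OF bspec[OF this assms(1), unfolded case_prod_beta] assms(2), unfolded case_prod_beta]
  show ?thesis by (simp add: inv_chart_def o_def)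
qed

lemma transition_det:
  assumes "c \<in> A" "d \<in> A" "p \<in> fst c" "p \<in> fst d"
  shows "0 < det (matrix (chart_deriv c d (\<lambda>q. q) p))"
proof -
  have "\<forall>(U, x)\<in>A. \<forall>(V, y)\<in>A. \<forall>p\<in>U \<inter> V. 0 < det (matrix (chart_deriv (U, x) (V, y) (\<lambda>q. q) p))"
    using atlas unfolding oriented_atlas_def by blast
  from bspec[OF bspec[OF this assms(1), unfolded case_prod_beta] assms(2), unfolded case_prod_beta]
  show ?thesis using assms by simp
qed

lemma eventually_in_chart:
  assumes "c \<in> A" "p \<in> fst c" "openin (top_of_set M) W" "p \<in> W"
  shows "eventually (\<lambda>y. y \<in> snd c ` (fst c \<inter> W)) (nhds (snd c p))"
  using open_chart_image[OF assms(1,3)] assms eventually_nhds_in_open by blast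

lemma chart_diff_id:
  assumes "c \<in> A" "d \<in> A" "p \<in> fst c" "p \<in> fst d"
  shows "chart_diff c d (\<lambda>q. q) p"
  unfolding chart_diff_def
proof (intro conjI assms inj_chart)
  have "eventually (\<lambda>y. y \<in> snd c ` (fst c \<inter> fst d)) (nhds (snd c p))"
    by (rule eventually_in_chart) (use assms chart_openin in auto)
  then show "eventually (\<lambda>y. y \<in> snd c ` fst c \<and> inv_chart c y \<in> fst d) (nhds (snd c p))"
    by eventually_elim (use assms in auto)
  have "(\<lambda>y. snd d (inv_chart c y)) differentiable at (snd c p)"
    using transition_smooth[OF assms(1,2)] by (rule smooth_on_differentiable) (use assms in auto)
  then show "(snd d \<circ> (\<lambda>q. q) \<circ> inv_chart c) differentiable at (snd c p)" by (simp add: o_def)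
qed

lemma chart_deriv_same:
  assumes "c \<in> A" "p \<in> fst c" shows "chart_deriv c c (\<lambda>q. q) p v = v"
proof -
  have "eventually (\<lambda>y. y \<in> snd c ` fst c) (nhds (snd c p))"
    using open_chart_range[OF assms(1)] assms eventually_nhds_in_open by blast
  then have "eventually (\<lambda>y. snd c (inv_chart c y) = y) (nhds (snd c p))"
    by eventually_elim (use assms in auto)
  from fd_cong(1)[OF this] have "fd (\<lambda>y. snd c (inv_chart c y)) (snd c p) = fd (\<lambda>y. y) (snd c p)" .
  also have "\<dots> = (\<lambda>v. v)" by (rule fd_eq) (rule has_derivative_ident)
  finally show ?thesis by (simp add: chart_deriv_def o_def)
qed

lemma chart_deriv_trans:
  assumes "c \<in> A" "d \<in> A" "e \<in> A" "p \<in> fst c" "p \<in> fst d" "p \<in> fst e"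
  shows "chart_deriv d e (\<lambda>q. q) p (chart_deriv c d (\<lambda>q. q) p v) = chart_deriv c e (\<lambda>q. q) p v"
  using chart_diff_compose(2)[OF chart_diff_id[of c d] chart_diff_id[of d e], of p v] assms by simp

lemma components_from_components [simp]:
  assumes "c \<in> A" "p \<in> fst c"
  shows "components A c p (from_components A c p v) = v"
    and "from_components A c p (components A c p v) = v"
proof -
  have "p \<in> M" using assms chart_subset by blast
  note m = chart_at_mem[OF this]
  show "components A c p (from_components A c p v) = v"
    and "from_components A c p (components A c p v) = v"
    unfolding components_def from_components_def
    by (subst chart_deriv_trans; use m assms in \<open>simp add: chart_deriv_same\<close>)+
qed

lemma components_transition:
  assumes "c \<in> A" "d \<in> A" "p \<in> fst c" "p \<in> fst d"
  shows "components A d p v = chart_deriv c d (\<lambda>q. q) p (components A c p v)"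
proof -
  have "p \<in> M" using assms chart_subset by blast
  note m = chart_at_mem[OF this]
  show ?thesis unfolding components_def by (subst chart_deriv_trans; use m assms in simp)
qed

lemma components_chart_at [simp]: "p \<in> M \<Longrightarrow> components A (chart_at A p) p v = v"
  by (simp add: components_def chart_at_mem chart_deriv_same)

lemma from_components_chart_at [simp]: "p \<in> M \<Longrightarrow> from_components A (chart_at A p) p v = v"
  by (simp add: from_components_def chart_at_mem chart_deriv_same)

lemma linear_components: "c \<in> A \<Longrightarrow> p \<in> fst c \<Longrightarrow> linear (components A c p)"
  unfolding components_def
  using chart_at_mem[of p] chart_subset[of c] by (intro linear_chart_deriv chart_diff_id) auto

lemma linear_from_components: "c \<in> A \<Longrightarrow> p \<in> fst c \<Longrightarrow> linear (from_components A c p)"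
  unfolding from_components_def
  using chart_at_mem[of p] chart_subset[of c] by (intro linear_chart_deriv chart_diff_id) auto

lemma coord_field_eq: "coord_field A c i q = from_components A c q (axis i 1)"
  by (simp add: coord_field_def from_components_def)

lemma from_components_expand:
  assumes "c \<in> A" "p \<in> fst c"
  shows "from_components A c p v = (\<Sum>i\<in>UNIV. v $ i *\<^sub>R coord_field A c i p)"
proof -
  have "from_components A c p (\<Sum>i\<in>UNIV. v $ i *\<^sub>R axis i 1) = (\<Sum>i\<in>UNIV. v $ i *\<^sub>R coord_field A c i p)"
    using linear_from_components[OF assms] by (simp add: linear_sum linear_cmul coord_field_eq)
  then show ?thesis using basis_expansion[of v] by (simp add: scalar_mult_eq_scaleR)
qed

lemma field_expand:
  assumes "c \<in> A" "p \<in> fst c"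
  shows "v = (\<Sum>i\<in>UNIV. components A c p v $ i *\<^sub>R coord_field A c i p)"
  using from_components_expand[OF assms, of "components A c p v"] assms by simp

end

text \<open>The case \<open>S = M\<close>, \<open>P = A\<close> is included
  (\<open>smooth_inclusion_self\<close>), so that fields on a spacetime and fields along a surface
  share one set of lemmas.\<close>

locale smooth_inclusion = sub: oriented_manifold S P + amb: oriented_manifold M A
  for S :: "'a::topological_space set" and P :: "('a, 'm::finite) chart set"
    and M and A :: "('a, 'n::finite) chart set" +
  assumes smooth_incl: "smooth_map P A S (\<lambda>q. q)"
begin

lemma sub_subset: "S \<subseteq> M"
  using smooth_incl amb.atlas by (auto simp: smooth_map_def oriented_atlas_def)

lemma openin_chart_inter:
  assumes "c \<in> A" shows "openin (top_of_set S) (S \<inter> fst c)"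
proof -
  obtain T where T: "open T" "fst c = M \<inter> T"
    using amb.chart_openin[OF assms] unfolding openin_open by (elim exE conjE)
  then have "S \<inter> fst c = S \<inter> T" using sub_subset by auto
  then show ?thesis using T(1) openin_open_Int by simp
qed

lemma inclusion_smooth:
  assumes "s \<in> P" "c \<in> A"
  shows "smooth_on (\<lambda>y. snd c (inv_chart s y)) (snd s ` (fst s \<inter> fst c))"
proof -
  have "\<forall>(V, x)\<in>P. \<forall>(W, y)\<in>A. smooth_on (y \<circ> (\<lambda>q. q) \<circ> inv_into V x) (x ` {p \<in> V \<inter> S. p \<in> W})"
    using smooth_incl unfolding smooth_map_def by blast
  from bspec[OF bspec[OF this assms(1), unfolded case_prod_beta] assms(2), unfolded case_prod_beta]
  have "smooth_on (\<lambda>y. snd c (inv_chart s y)) (snd s ` {p \<in> fst s \<inter> S. p \<in> fst c})"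
    by (simp add: inv_chart_def o_def)
  moreover have "{p \<in> fst s \<inter> S. p \<in> fst c} = fst s \<inter> fst c"
    using sub.chart_subset[OF assms(1)] by auto
  ultimately show ?thesis by simp
qed

lemma open_inter_image:
  assumes "s \<in> P" "c \<in> A" "openin (top_of_set S) W"
  shows "open (snd s ` (fst s \<inter> fst c \<inter> W))"
proof -
  have "openin (top_of_set S) ((S \<inter> fst c) \<inter> W)"
    by (rule openin_Int[OF openin_chart_inter[OF assms(2)] assms(3)])
  from sub.open_chart_image[OF assms(1) this] show ?thesis
    using sub.chart_subset[OF assms(1)] by (simp add: Int_assoc Int_absorb2 flip: Int_assoc)
qed

lemma chart_diff_incl:
  assumes "s \<in> P" "c \<in> A" "p \<in> fst s" "p \<in> fst c"
  shows "chart_diff s c (\<lambda>q. q) p"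
  unfolding chart_diff_def
proof (intro conjI assms sub.inj_chart amb.inj_chart)
  have "eventually (\<lambda>y. y \<in> snd s ` (fst s \<inter> (S \<inter> fst c))) (nhds (snd s p))"
    using assms sub.chart_subset[of s] openin_chart_inter[of c] by (intro sub.eventually_in_chart) auto
  then show "eventually (\<lambda>y. y \<in> snd s ` fst s \<and> inv_chart s y \<in> fst c) (nhds (snd s p))"
    by eventually_elim (use assms in auto)
  have "(\<lambda>y. snd c (inv_chart s y)) differentiable at (snd s p)"
    using inclusion_smooth[OF assms(1,2)] by (rule smooth_on_differentiable) (use assms in auto)
  then show "(snd c \<circ> (\<lambda>q. q) \<circ> inv_chart s) differentiable at (snd s p)" by (simp add: o_def)
qed

lemma incl_transition:
  assumes "s \<in> P" "c \<in> A" "d \<in> A" "p \<in> fst s" "p \<in> fst c" "p \<in> fst d"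
  shows "chart_deriv c d (\<lambda>q. q) p (chart_deriv s c (\<lambda>q. q) p v) = chart_deriv s d (\<lambda>q. q) p v"
  using chart_diff_compose(2)[OF chart_diff_incl[of s c] amb.chart_diff_id[of c d], of p v] assms by simp

lemma incl_transition':
  assumes "s \<in> P" "s' \<in> P" "d \<in> A" "p \<in> fst s" "p \<in> fst s'" "p \<in> fst d"
  shows "chart_deriv s' d (\<lambda>q. q) p (chart_deriv s s' (\<lambda>q. q) p v) = chart_deriv s d (\<lambda>q. q) p v"
  using chart_diff_compose(2)[OF sub.chart_diff_id[of s s'] chart_diff_incl[of s' d], of p v] assms by simp

lemma components_incl:
  assumes "s \<in> P" "c \<in> A" "p \<in> fst s" "p \<in> fst c"
  shows "components A c p (tangent_map P A (\<lambda>q. q) p (from_components P s p w))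
    = chart_deriv s c (\<lambda>q. q) p w"
proof -
  have p: "p \<in> S" "p \<in> M" using assms sub.chart_subset amb.chart_subset by blast+
  note m = sub.chart_at_mem[OF p(1)] amb.chart_at_mem[OF p(2)]
  show ?thesis
    unfolding components_def tangent_map_def from_components_def
    by (subst incl_transition; use m assms in \<open>simp add: incl_transition'\<close>)
qed

section \<open>Smooth fields along a submanifold\<close>

lemma smooth_fieldD:
  assumes "smooth_field P A W X" "s \<in> P" "c \<in> A"
  shows "smooth_on (\<lambda>y. components A c (inv_chart s y) (X (inv_chart s y))) (snd s ` (fst s \<inter> fst c \<inter> W))"
proof -
  from assms(1) have "\<forall>(V, s)\<in>P. \<forall>c\<in>A.
        smooth_on ((\<lambda>q. components A c q (X q)) \<circ> inv_into V s) (s ` (V \<inter> fst c \<inter> W))"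
    unfolding smooth_field_def .
  from bspec[OF bspec[OF this assms(2), unfolded case_prod_beta] assms(3)]
  show ?thesis by (simp add: inv_chart_def o_def)
qed

lemma smooth_field_differentiable:
  assumes "smooth_field P A W X" "s \<in> P" "c \<in> A" "p \<in> fst s" "p \<in> fst c" "p \<in> W"
  shows "(\<lambda>y. components A c (inv_chart s y) (X (inv_chart s y))) differentiable (at (snd s p))"
  using smooth_fieldD[OF assms(1-3)] by (rule smooth_on_differentiable) (use assms in auto)

lemma smooth_field_iff:
  "smooth_field P A W X \<longleftrightarrow> (\<forall>s\<in>P. \<forall>c\<in>A.
     smooth_on (\<lambda>y. components A c (inv_chart s y) (X (inv_chart s y))) (snd s ` (fst s \<inter> fst c \<inter> W)))"
  unfolding smooth_field_def by (simp add: inv_chart_def o_def case_prod_beta)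

lemma smooth_function_iff:
  "smooth_function P W f \<longleftrightarrow> (\<forall>s\<in>P. smooth_on (\<lambda>y. f (inv_chart s y)) (snd s ` (fst s \<inter> W)))"
  unfolding smooth_function_def by (simp add: inv_chart_def o_def case_prod_beta)

lemma smooth_field_subset:
  assumes "smooth_field P A W X" "V \<subseteq> W" shows "smooth_field P A V X"
  unfolding smooth_field_iff
proof (intro ballI)
  fix s c assume "s \<in> P" "c \<in> A"
  from smooth_fieldD[OF assms(1) this]
  show "smooth_on (\<lambda>y. components A c (inv_chart s y) (X (inv_chart s y))) (snd s ` (fst s \<inter> fst c \<inter> V))"
    by (rule smooth_on_subset) (use assms(2) in auto)
qed

lemma smooth_function_subset:
  assumes "smooth_function P W f" "V \<subseteq> W" shows "smooth_function P V f"
  unfolding smooth_function_iff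
proof (intro ballI)
  fix s assume "s \<in> P"
  with assms(1) have "smooth_on (\<lambda>y. f (inv_chart s y)) (snd s ` (fst s \<inter> W))"
    unfolding smooth_function_iff by (rule bspec)
  then show "smooth_on (\<lambda>y. f (inv_chart s y)) (snd s ` (fst s \<inter> V))"
    by (rule smooth_on_subset) (use assms(2) in auto)
qed

lemma smooth_field_add:
  assumes "smooth_field P A W X" "smooth_field P A W Y" "openin (top_of_set S) W"
  shows "smooth_field P A W (\<lambda>q. X q + Y q)"
  unfolding smooth_field_iff
proof (intro ballI)
  fix s c assume s: "s \<in> P" and c: "c \<in> A"
  note op = open_inter_image[OF s c assms(3)]
  note sm = smooth_on_add[OF smooth_fieldD[OF assms(1) s c] smooth_fieldD[OF assms(2) s c] op]
  show "smooth_on (\<lambda>y. components A c (inv_chart s y) (X (inv_chart s y) + Y (inv_chart s y)))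
     (snd s ` (fst s \<inter> fst c \<inter> W))"
    by (rule smooth_on_cong[OF sm op]) (use s c in \<open>auto simp: linear_add[OF amb.linear_components]\<close>)
qed

lemma smooth_field_scale:
  assumes "smooth_function P W f" "smooth_field P A W Y" "openin (top_of_set S) W"
  shows "smooth_field P A W (\<lambda>q. f q *\<^sub>R Y q)"
  unfolding smooth_field_iff
proof (intro ballI)
  fix s c assume s: "s \<in> P" and c: "c \<in> A"
  note op = open_inter_image[OF s c assms(3)]
  have f: "smooth_on (\<lambda>y. f (inv_chart s y)) (snd s ` (fst s \<inter> fst c \<inter> W))"
    by (rule smooth_on_subset[of _ "snd s ` (fst s \<inter> W)"]) (use assms(1) s in \<open>auto simp: smooth_function_iff\<close>)
  note sm = smooth_on_scaleR[OF f smooth_fieldD[OF assms(2) s c] op]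
  show "smooth_on (\<lambda>y. components A c (inv_chart s y) (f (inv_chart s y) *\<^sub>R Y (inv_chart s y)))
     (snd s ` (fst s \<inter> fst c \<inter> W))"
    by (rule smooth_on_cong[OF sm op]) (use s c in \<open>auto simp: linear_cmul[OF amb.linear_components]\<close>)
qed

lemma smooth_function_component:
  assumes "smooth_field P A W X" "openin (top_of_set S) W" "c \<in> A" "W \<subseteq> fst c"
  shows "smooth_function P W (\<lambda>q. components A c q (X q) $ i)"
  unfolding smooth_function_iff
proof
  fix s assume s: "s \<in> P"
  have "fst s \<inter> fst c \<inter> W = fst s \<inter> W" using assms by auto
  then show "smooth_on (\<lambda>y. components A c (inv_chart s y) (X (inv_chart s y)) $ i) (snd s ` (fst s \<inter> W))"
    using smooth_on_component[OF smooth_fieldD[OF assms(1) s assms(3)] open_inter_image[OF s assms(3,2)]] by simp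
qed

text \<open>A smooth field must have smooth components in all pairs of charts, but one pair near
  each point is enough: the components in another chart arise by applying the differential of the
  transition map to those in the given one.\<close>

lemma smooth_fieldI:
  assumes W: "openin (top_of_set S) W"
    and loc: "\<And>p. p \<in> W \<Longrightarrow> \<exists>s\<in>P. \<exists>c\<in>A. \<exists>V. openin (top_of_set S) V \<and> p \<in> V \<and> p \<in> fst s \<and> p \<in> fst c \<and>
       smooth_on (\<lambda>y. components A c (inv_chart s y) (X (inv_chart s y))) (snd s ` (fst s \<inter> fst c \<inter> V))"
  shows "smooth_field P A W X"
  unfolding smooth_field_def
proof (clarify)
  fix V0 x0 U0 y0
  assume P: "(V0, x0) \<in> P" and A: "(U0, y0) \<in> A"
  define s' where "s' = (V0, x0)"
  define c' where "c' = (U0, y0)"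
  have s': "s' \<in> P" and c': "c' \<in> A" using P A by (auto simp: s'_def c'_def)
  let ?X = "\<lambda>c s y. components A c (inv_chart s y) (X (inv_chart s y))"
  have "smooth_on (?X c' s') (snd s' ` (fst s' \<inter> fst c' \<inter> W))"
  proof (rule smooth_on_local)
    fix y assume "y \<in> snd s' ` (fst s' \<inter> fst c' \<inter> W)"
    then obtain p where p: "p \<in> fst s'" "p \<in> fst c'" "p \<in> W" "y = snd s' p" by auto
    from loc[OF p(3)] obtain s c V where s: "s \<in> P" "c \<in> A" "openin (top_of_set S) V" "p \<in> V" "p \<in> fst s"
      "p \<in> fst c" and sm: "smooth_on (?X c s) (snd s ` (fst s \<inter> fst c \<inter> V))" by blast
    define V' where "V' = fst s \<inter> (S \<inter> fst c) \<inter> V \<inter> (S \<inter> fst c') \<inter> W"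
    have V': "openin (top_of_set S) V'"
      unfolding V'_def using openin_chart_inter[OF s(2)] openin_chart_inter[OF c'] sub.chart_openin[OF s(1)] s(3) W
      by (simp add: openin_Int)
    define T where "T = snd s' ` (fst s' \<inter> V')"
    have T: "open T" using sub.open_chart_image[OF s' V'] by (simp add: T_def)
    have inT: "inv_chart s' z \<in> V' \<and> inv_chart s' z \<in> fst s'" if "z \<in> T" for z
      using that s' by (auto simp: T_def)
    have 1: "smooth_on (\<lambda>z. snd s (inv_chart s' z)) T"
      by (rule smooth_on_subset[OF sub.transition_smooth[OF s' s(1)]]) (auto simp: T_def V'_def)
    have 2: "smooth_on (\<lambda>z. snd c (inv_chart s' z)) T"
      by (rule smooth_on_subset[OF inclusion_smooth[OF s' s(2)]]) (auto simp: T_def V'_def)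
    have 3: "smooth_on (\<lambda>z. ?X c s (snd s (inv_chart s' z))) T"
      by (rule smooth_on_compose[OF sm 1 _ T]) (use inT in \<open>auto simp: V'_def\<close>)
    have 4: "smooth_on (\<lambda>z. fd (\<lambda>y. snd c' (inv_chart c y)) (snd c (inv_chart s' z))
        (?X c s (snd s (inv_chart s' z)))) T"
      by (rule smooth_on_fd_apply[OF amb.transition_smooth[OF s(2) c'] 2 _ 3 T])
        (use inT in \<open>auto simp: V'_def\<close>)
    have "smooth_on (?X c' s') T"
    proof (rule smooth_on_cong[OF 4 T])
      fix z assume z: "z \<in> T"
      define q where "q = inv_chart s' z"
      have q: "q \<in> fst s" "q \<in> fst c" "q \<in> fst c'" using inT[OF z] by (auto simp: q_def V'_def)
      have "components A c' q (X q) = chart_deriv c c' (\<lambda>q. q) q (components A c q (X q))"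
        using q s c' by (intro amb.components_transition) auto
      then show "fd (\<lambda>y. snd c' (inv_chart c y)) (snd c (inv_chart s' z)) (?X c s (snd s (inv_chart s' z)))
          = ?X c' s' z"
        using q s by (simp add: chart_deriv_def o_def flip: q_def)
    qed
    moreover have "y \<in> T" using p s sub_subset sub.chart_subset[OF s']  by (auto simp: T_def V'_def)
    ultimately show "\<exists>T. open T \<and> y \<in> T \<and> smooth_on (?X c' s') (snd s' ` (fst s' \<inter> fst c' \<inter> W) \<inter> T)"
      by (intro exI[of _ T] conjI T) (auto elim!: smooth_on_subset)
  qed
  then show "smooth_on ((\<lambda>q. components A (U0, y0) q (X q)) \<circ> inv_into V0 x0) (x0 ` (V0 \<inter> fst (U0, y0) \<inter> W))"
    by (simp add: s'_def c'_def inv_chart_def o_def)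
qed

end

lemma (in oriented_manifold) smooth_inclusion_self: "smooth_inclusion M A M A"
proof (unfold_locales)
  show "smooth_map A A M (\<lambda>q. q)"
    unfolding smooth_map_def
  proof (intro conjI)
    show "(\<lambda>q. q) ` M \<subseteq> \<Union> (fst ` A)" using atlas by (auto simp: oriented_atlas_def)
    show "\<forall>(V, x)\<in>A. \<forall>(W, y)\<in>A. smooth_on (y \<circ> (\<lambda>q. q) \<circ> inv_into V x) (x ` {p \<in> V \<inter> M. p \<in> W})"
    proof (clarify)
      fix V x W y assume c: "(V, x) \<in> A" "(W, y) \<in> A"
      have "{p \<in> V \<inter> M. p \<in> W} = V \<inter> W" using chart_subset[OF c(1)] by auto
      then show "smooth_on (y \<circ> (\<lambda>q. q) \<circ> inv_into V x) (x ` {p \<in> V \<inter> M. p \<in> W})"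
        using transition_smooth[OF c] by (simp add: inv_chart_def o_def)
    qed
  qed simp
qed

lemma (in oriented_manifold) dirderiv_chart:
  assumes "c \<in> A" "p \<in> fst c" "(\<lambda>x. h (inv_chart c x)) differentiable (at (snd c p))"
  shows "dirderiv A h p v = fd (\<lambda>x. h (inv_chart c x)) (snd c p) (components A c p v)"
proof -
  have p: "p \<in> M" using assms chart_subset by blast
  note m = chart_at_mem[OF p]
  have "chart_diff (chart_at A p) c (\<lambda>q. q) p" by (rule chart_diff_id) (use m assms in auto)
  from fd_eq[OF has_derivative_chart_chain[OF this fd_works[OF assms(3)]]]
  show ?thesis by (simp add: dirderiv_def o_def components_def)
qed

text \<open>One chart near each point suffices, and in \<open>c\<close> itself the components are
  constant.\<close>

lemma (in oriented_manifold) smooth_from_components: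
  assumes "c \<in> A" shows "smooth_field A A (fst c) (\<lambda>q. from_components A c q v)"
proof -
  interpret self: smooth_inclusion M A M A by (rule smooth_inclusion_self)
  show ?thesis
  proof (rule self.smooth_fieldI[OF chart_openin[OF assms]])
    fix p assume p: "p \<in> fst c"
    have "smooth_on (\<lambda>y. components A c (inv_chart c y) (from_components A c (inv_chart c y) v))
        (snd c ` (fst c \<inter> fst c \<inter> fst c))"
      by (rule smooth_on_cong[OF smooth_on_const[of v]]) (use assms open_chart_range in auto)
    then show "\<exists>s\<in>A. \<exists>ca\<in>A. \<exists>V. openin (top_of_set M) V \<and> p \<in> V \<and> p \<in> fst s \<and> p \<in> fst ca \<and>
       smooth_on (\<lambda>y. components A ca (inv_chart s y) (from_components A c (inv_chart s y) v))
        (snd s ` (fst s \<inter> fst ca \<inter> V))"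
      using p by (intro bexI[OF _ assms] exI[of _ "fst c"] conjI chart_openin[OF assms])
  qed
qed

section \<open>Connections in charts\<close>

text \<open>Product rule for a differential evaluated at a moving point on a moving vector. The
  first term is the Hessian of \<open>F\<close>; it is the inhomogeneous term in the transformation
  of Christoffel symbols.\<close>

lemma has_derivative_fd_apply:
  fixes F :: "'a::euclidean_space \<Rightarrow> 'b::real_normed_vector" and \<kappa> :: "'c::real_normed_vector \<Rightarrow> 'a"
  assumes F: "Ck_on 2 F O'" "open O'" and k: "(\<kappa> has_derivative \<kappa>') (at y0)" "\<kappa> y0 \<in> O'"
    and w: "(w has_derivative w') (at y0)"
  shows "((\<lambda>y. fd F (\<kappa> y) (w y)) has_derivative
    (\<lambda>h. fd (\<lambda>x. fd F x (w y0)) (\<kappa> y0) (\<kappa>' h) + fd F (\<kappa> y0) (w' h))) (at y0)"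
proof -
  have dF: "F differentiable (at x)" if "x \<in> O'" for x
    using F that by (auto simp: numeral_2_eq_2)
  have dFv: "((\<lambda>x. fd F x b) has_derivative fd (\<lambda>x. fd F x b) (\<kappa> y0)) (at (\<kappa> y0))" for b
    using F k by (intro fd_works) (auto simp: numeral_2_eq_2)
  have chain: "((\<lambda>y. fd F (\<kappa> y) b) has_derivative (\<lambda>h. fd (\<lambda>x. fd F x b) (\<kappa> y0) (\<kappa>' h))) (at y0)" for b
    using diff_chain_at[OF k(1) dFv] by (simp add: o_def)
  have sum: "((\<lambda>y. \<Sum>b\<in>Basis. (w y \<bullet> b) *\<^sub>R fd F (\<kappa> y) b) has_derivative
      (\<lambda>h. \<Sum>b\<in>Basis. (w y0 \<bullet> b) *\<^sub>R fd (\<lambda>x. fd F x b) (\<kappa> y0) (\<kappa>' h) + (w' h \<bullet> b) *\<^sub>R fd F (\<kappa> y0) b)) (at y0)"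
    by (intro has_derivative_sum has_derivative_scaleR has_derivative_inner_left w chain)
  have "((\<lambda>x. \<Sum>b\<in>Basis. (w y0 \<bullet> b) *\<^sub>R fd F x b) has_derivative
      (\<lambda>k. \<Sum>b\<in>Basis. (w y0 \<bullet> b) *\<^sub>R fd (\<lambda>x. fd F x b) (\<kappa> y0) k)) (at (\<kappa> y0))"
    by (intro has_derivative_sum has_derivative_scaleR_right dFv)
  then have "((\<lambda>x. fd F x (w y0)) has_derivative
      (\<lambda>k. \<Sum>b\<in>Basis. (w y0 \<bullet> b) *\<^sub>R fd (\<lambda>x. fd F x b) (\<kappa> y0) k)) (at (\<kappa> y0))"
    by (rule has_derivative_transform_within_open[OF _ F(2) k(2)]) (rule fd_euclidean_expand[OF dF, symmetric])
  \<comment> \<open>The derivative of \<open>fd F x (w y0)\<close> in \<open>x\<close> has the same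
    basis expansion as the first half of the sum, which can therefore be folded back into
    it.\<close>
  note e1 = fd_eq[OF this]
  have "isCont \<kappa> y0" using k(1) has_derivative_continuous by auto
  then obtain T where T: "open T" "y0 \<in> T" "\<kappa> ` T \<subseteq> O'"
    using F(2) k(2) by (metis continuous_at_open image_subsetI)
  have "((\<lambda>y. fd F (\<kappa> y) (w y)) has_derivative
      (\<lambda>h. \<Sum>b\<in>Basis. (w y0 \<bullet> b) *\<^sub>R fd (\<lambda>x. fd F x b) (\<kappa> y0) (\<kappa>' h) + (w' h \<bullet> b) *\<^sub>R fd F (\<kappa> y0) b)) (at y0)"
    by (rule has_derivative_transform_within_open[OF sum T(1,2)])
      (use T(3) in \<open>auto intro!: fd_euclidean_expand[OF dF, symmetric]\<close>)
  moreover have "(\<Sum>b\<in>Basis. (w y0 \<bullet> b) *\<^sub>R fd (\<lambda>x. fd F x b) (\<kappa> y0) (\<kappa>' h) + (w' h \<bullet> b) *\<^sub>R fd F (\<kappa> y0) b)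
      = fd (\<lambda>x. fd F x (w y0)) (\<kappa> y0) (\<kappa>' h) + fd F (\<kappa> y0) (w' h)" for h
    unfolding e1 by (subst fd_euclidean_expand[OF dF[OF k(2)], of "w' h"]) (simp add: sum.distrib)
  ultimately show ?thesis by simp
qed

lemma bilinear_sum_components:
  fixes m :: "real^'n \<Rightarrow> real^'n \<Rightarrow> real"
  assumes "bilinear m"
  shows "m v w = (\<Sum>a\<in>UNIV. \<Sum>b\<in>UNIV. v $ a * w $ b * m (axis a 1) (axis b 1))"
proof -
  have v: "v = (\<Sum>a\<in>UNIV. v $ a *\<^sub>R axis a 1)" for v :: "real^'n"
    using basis_expansion[of v] by (simp add: scalar_mult_eq_scaleR)
  have l: "linear (\<lambda>v. m v w)" "linear (m v)" for v w
    using assms by (auto simp: bilinear_def)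
  have "m v w = (\<Sum>a\<in>UNIV. v $ a * m (axis a 1) w)"
    by (subst (1) v) (simp add: linear_sum[OF l(1)] linear_cmul[OF l(1)])
  also have "\<dots> = (\<Sum>a\<in>UNIV. v $ a * (\<Sum>b\<in>UNIV. w $ b * m (axis a 1) (axis b 1)))"
  proof -
    have "m (axis a 1) w = (\<Sum>b\<in>UNIV. w $ b * m (axis a 1) (axis b 1))" for a
      by (subst (1) v[of w]) (simp add: linear_sum[OF l(2)] linear_cmul[OF l(2)])
    then show ?thesis by simp
  qed
  finally show ?thesis by (simp add: sum_distrib_left mult.assoc)
qed

lemma bilinear_vec_sum_components:
  fixes m :: "real^'n \<Rightarrow> real^'n \<Rightarrow> real^'k"
  assumes "bilinear m"
  shows "m v w $ k = (\<Sum>a\<in>UNIV. \<Sum>b\<in>UNIV. v $ a * w $ b * m (axis a 1) (axis b 1) $ k)"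
proof -
  have "bilinear (\<lambda>v w. m v w $ k)"
    unfolding bilinear_def
    by (auto intro!: linearI simp: bilinear_ladd[OF assms] bilinear_radd[OF assms] bilinear_lmul[OF assms] bilinear_rmul[OF assms])
  from bilinear_sum_components[OF this, of v w] show ?thesis .
qed

text \<open>Product rule for a bilinear form whose coefficients vary with the point. Bilinearity is
  asked near the point only, since off the image of a chart the coordinate expression of a metric
  has arbitrary values.\<close>

lemma has_derivative_bilinear_field:
  fixes m :: "'a::real_normed_vector \<Rightarrow> real^'n \<Rightarrow> real^'n \<Rightarrow> real"
  assumes ev: "eventually (\<lambda>x. bilinear (m x)) (nhds (\<kappa> y0))"
    and d: "\<And>v w. (\<lambda>x. m x v w) differentiable (at (\<kappa> y0))"
    and k: "(\<kappa> has_derivative \<kappa>') (at y0)"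
    and Y: "(Y has_derivative Y') (at y0)" and Z: "(Z has_derivative Z') (at y0)"
  shows "((\<lambda>y. m (\<kappa> y) (Y y) (Z y)) has_derivative
    (\<lambda>h. m (\<kappa> y0) (Y' h) (Z y0) + m (\<kappa> y0) (Y y0) (Z' h) + fd (\<lambda>x. m x (Y y0) (Z y0)) (\<kappa> y0) (\<kappa>' h))) (at y0)"
proof -
  let ?e = "\<lambda>a. axis a 1 :: real^'n"
  from ev obtain X where X: "open X" "\<kappa> y0 \<in> X" "\<And>x. x \<in> X \<Longrightarrow> bilinear (m x)"
    unfolding eventually_nhds by blast
  note dm = fd_works[OF d]
  have nth: "((\<lambda>y. f y $ a) has_derivative (\<lambda>h. f' h $ a)) (at y0)"
    if "(f has_derivative f') (at y0)" for f f' and a :: 'n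
    using bounded_linear.has_derivative[OF bounded_linear_vec_nth that] .
  have chain: "((\<lambda>y. m (\<kappa> y) (?e a) (?e b)) has_derivative
      (\<lambda>h. fd (\<lambda>x. m x (?e a) (?e b)) (\<kappa> y0) (\<kappa>' h))) (at y0)" for a b
    using diff_chain_at[OF k dm] by (simp add: o_def)
  have "((\<lambda>y. \<Sum>a\<in>UNIV. \<Sum>b\<in>UNIV. Y y $ a * Z y $ b * m (\<kappa> y) (?e a) (?e b)) has_derivative
      (\<lambda>h. \<Sum>a\<in>UNIV. \<Sum>b\<in>UNIV. Y y0 $ a * Z y0 $ b * fd (\<lambda>x. m x (?e a) (?e b)) (\<kappa> y0) (\<kappa>' h)
        + (Y y0 $ a * Z' h $ b + Y' h $ a * Z y0 $ b) * m (\<kappa> y0) (?e a) (?e b))) (at y0)"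
    by (intro has_derivative_sum has_derivative_mult nth Y Z chain)
  moreover have "((\<lambda>x. \<Sum>a\<in>UNIV. \<Sum>b\<in>UNIV. Y y0 $ a * Z y0 $ b * m x (?e a) (?e b)) has_derivative
      (\<lambda>h. \<Sum>a\<in>UNIV. \<Sum>b\<in>UNIV. Y y0 $ a * Z y0 $ b * fd (\<lambda>x. m x (?e a) (?e b)) (\<kappa> y0) h)) (at (\<kappa> y0))"
    by (intro has_derivative_sum has_derivative_mult_right dm)
  then have "((\<lambda>x. m x (Y y0) (Z y0)) has_derivative
      (\<lambda>h. \<Sum>a\<in>UNIV. \<Sum>b\<in>UNIV. Y y0 $ a * Z y0 $ b * fd (\<lambda>x. m x (?e a) (?e b)) (\<kappa> y0) h)) (at (\<kappa> y0))"
    by (rule has_derivative_transform_within_open[OF _ X(1,2)]) (rule bilinear_sum_components[OF X(3), symmetric])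
  note e1 = fd_eq[OF this]
  have "isCont \<kappa> y0" using k(1) has_derivative_continuous by auto
  then obtain T where T: "open T" "y0 \<in> T" "\<kappa> ` T \<subseteq> X"
    using X(1,2) by (metis continuous_at_open image_subsetI)
  have b0: "bilinear (m (\<kappa> y0))" using X by blast
  ultimately have "((\<lambda>y. m (\<kappa> y) (Y y) (Z y)) has_derivative
      (\<lambda>h. \<Sum>a\<in>UNIV. \<Sum>b\<in>UNIV. Y y0 $ a * Z y0 $ b * fd (\<lambda>x. m x (?e a) (?e b)) (\<kappa> y0) (\<kappa>' h)
        + (Y y0 $ a * Z' h $ b + Y' h $ a * Z y0 $ b) * m (\<kappa> y0) (?e a) (?e b))) (at y0)"
    by (elim has_derivative_transform_within_open[OF _ T(1,2)])
      (use T(3) X(3) in \<open>auto intro!: bilinear_sum_components[symmetric]\<close>)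
  moreover have "(\<Sum>a\<in>UNIV. \<Sum>b\<in>UNIV. Y y0 $ a * Z y0 $ b * fd (\<lambda>x. m x (?e a) (?e b)) (\<kappa> y0) (\<kappa>' h)
        + (Y y0 $ a * Z' h $ b + Y' h $ a * Z y0 $ b) * m (\<kappa> y0) (?e a) (?e b))
     = m (\<kappa> y0) (Y' h) (Z y0) + m (\<kappa> y0) (Y y0) (Z' h) + fd (\<lambda>x. m x (Y y0) (Z y0)) (\<kappa> y0) (\<kappa>' h)" for h
    unfolding e1 bilinear_sum_components[OF b0, of "Y' h"] bilinear_sum_components[OF b0, of "Y y0"]
    by (simp add: distrib_right sum.distrib)
  ultimately show ?thesis by simp
qed

text \<open>The Christoffel symbols as a bilinear map on component vectors. The sum over coordinate
  fields makes linearity in \<open>v\<close> immediate; \<open>christoffel_field\<close> identifies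
  the value with the derivative of the field with constant components \<open>v\<close>.\<close>

definition christoffel ::
    "('a, 4) chart set \<Rightarrow> (real^4 \<Rightarrow> ('a \<Rightarrow> real^4) \<Rightarrow> 'a \<Rightarrow> real^4) \<Rightarrow>
     ('a, 4) chart \<Rightarrow> 'a \<Rightarrow> real^4 \<Rightarrow> real^4 \<Rightarrow> real^4" where
  "christoffel A nab c p u v =
     components A c p (\<Sum>i\<in>UNIV. v $ i *\<^sub>R nab (from_components A c p u) (coord_field A c i) p)"

locale connection = oriented_manifold M A for M and A :: "('a::topological_space, 4) chart set" +
  fixes U nab
  assumes U: "openin (top_of_set M) U" and conn: "affine_connection A U nab"
begin

sublocale self: smooth_inclusion M A M A by (rule smooth_inclusion_self)

lemma openin_U: "openin (top_of_set U) W \<Longrightarrow> openin (top_of_set M) W"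
  by (rule openin_trans[OF _ U])

lemma U_subset: "U \<subseteq> M" by (rule openin_imp_subset[OF U])

lemma openin_U_iff: "openin (top_of_set M) W \<Longrightarrow> W \<subseteq> U \<Longrightarrow> openin (top_of_set U) W"
  by (rule openin_subset_trans[OF _ _ U_subset])

lemma field_nearI:
  assumes "openin (top_of_set M) W" "smooth_field A A W X" "p \<in> W" "p \<in> U"
  shows "field_near A U p X"
proof -
  have "smooth_field A A (W \<inter> U) X" by (rule self.smooth_field_subset[OF assms(2)]) simp
  moreover have "openin (top_of_set U) (W \<inter> U)" by (rule openin_U_iff[OF openin_Int[OF assms(1) U]]) simp
  ultimately show ?thesis unfolding field_near_def using assms by (intro exI[of _ "W \<inter> U"]) simp
qed

lemma function_nearI:
  assumes "openin (top_of_set M) W" "smooth_function A W f" "p \<in> W" "p \<in> U"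
  shows "function_near A U p f"
proof -
  have "smooth_function A (W \<inter> U) f"
    by (rule self.smooth_function_subset[OF assms(2)]) simp
  moreover have "openin (top_of_set U) (W \<inter> U)" by (rule openin_U_iff[OF openin_Int[OF assms(1) U]]) simp
  ultimately show ?thesis unfolding function_near_def using assms by (intro exI[of _ "W \<inter> U"]) simp
qed

lemma nab_linear: "p \<in> U \<Longrightarrow> field_near A U p X \<Longrightarrow> linear (\<lambda>v. nab v X p)"
  by (rule conn[unfolded affine_connection_def, THEN conjunct1, rule_format])

lemma nab_add: "p \<in> U \<Longrightarrow> field_near A U p X \<Longrightarrow> field_near A U p Y \<Longrightarrow>
    nab v (\<lambda>q. X q + Y q) p = nab v X p + nab v Y p"
  by (rule conn[unfolded affine_connection_def, THEN conjunct2, THEN conjunct1, rule_format, OF _ conjI])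

lemma nab_leibniz: "p \<in> U \<Longrightarrow> function_near A U p f \<Longrightarrow> field_near A U p X \<Longrightarrow>
    nab v (\<lambda>q. f q *\<^sub>R X q) p = dirderiv A f p v *\<^sub>R X p + f p *\<^sub>R nab v X p"
  by (rule conn[unfolded affine_connection_def, THEN conjunct2, THEN conjunct2, THEN conjunct1, rule_format, OF _ conjI])

lemma nab_smooth: "openin (top_of_set M) W \<Longrightarrow> W \<subseteq> U \<Longrightarrow> smooth_field A A W V \<Longrightarrow> smooth_field A A W X \<Longrightarrow>
    smooth_field A A W (\<lambda>q. nab (V q) X q)"
  by (rule conn[unfolded affine_connection_def, THEN conjunct2, THEN conjunct2, THEN conjunct2, rule_format,
        OF conjI[OF openin_U_iff conjI]])

text \<open>Multiplied by the indicator of \<open>W\<close> the two fields become equal everywhere,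
  and the Leibniz rule does not see this factor, whose value at \<open>p\<close> is 1 and whose
  derivative there is 0.\<close>

lemma nab_local:
  assumes p: "p \<in> U" and X: "field_near A U p X" and Y: "field_near A U p Y"
    and W: "openin (top_of_set M) W" "p \<in> W" and eq: "\<And>q. q \<in> W \<Longrightarrow> X q = Y q"
  shows "nab v X p = nab v Y p"
proof -
  define f where "f q = (if q \<in> W then 1 else 0 :: real)" for q
  have f1: "f (inv_chart c y) = 1" if "c \<in> A" "y \<in> snd c ` (fst c \<inter> W)" for c y
    using that by (auto simp: f_def)
  have "smooth_function A W f"
    unfolding self.smooth_function_iff
    by (intro ballI smooth_on_cong[OF smooth_on_const[of "1::real"]]) (auto simp: f1 open_chart_image W)
  then have f: "function_near A U p f" by (rule function_nearI[OF W(1)]) (use W p in auto)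
  have pM: "p \<in> M" using p U_subset by blast
  define c where "c = chart_at A p"
  have c: "c \<in> A" "p \<in> fst c" using chart_at_mem[OF pM] by (auto simp: c_def)
  have "eventually (\<lambda>y. (f \<circ> inv_chart c) y = 1) (nhds (snd c p))"
    using eventually_in_chart[OF c W] by eventually_elim (use f1[OF c(1)] in simp)
  from fd_cong(1)[OF this] have "dirderiv A f p v = fd (\<lambda>_. 1::real) (snd c p) v"
    by (simp add: dirderiv_def o_def flip: c_def)
  also have "\<dots> = 0" by (simp add: fd_eq[OF has_derivative_const])
  finally have d: "dirderiv A f p v = 0" .
  have "nab v (\<lambda>q. f q *\<^sub>R X q) p = nab v X p" "nab v (\<lambda>q. f q *\<^sub>R Y q) p = nab v Y p"
    using nab_leibniz[OF p f X, of v] nab_leibniz[OF p f Y, of v] d W(2) by (simp_all add: f_def)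
  moreover have "(\<lambda>q. f q *\<^sub>R X q) = (\<lambda>q. f q *\<^sub>R Y q)" by (auto simp: f_def eq)
  ultimately show ?thesis by simp
qed

text \<open>Additivity is available for smooth summands, so smoothness of the partial sums is
  carried through the induction.\<close>

lemma nab_sum:
  assumes "finite I" "p \<in> U" "openin (top_of_set M) W" "p \<in> W" "\<And>i. i \<in> I \<Longrightarrow> smooth_field A A W (Z i)"
  shows "nab v (\<lambda>q. \<Sum>i\<in>I. Z i q) p = (\<Sum>i\<in>I. nab v (Z i) p) \<and> smooth_field A A W (\<lambda>q. \<Sum>i\<in>I. Z i q)"
  using assms(1,5)
proof (induction I rule: finite_induct)
  case empty
  have z: "smooth_field A A W (\<lambda>_. 0)"
    unfolding self.smooth_field_iff
  proof (intro ballI smooth_on_cong[OF smooth_on_const[of 0]])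
    fix s c y assume *: "s \<in> A" "c \<in> A" "y \<in> snd s ` (fst s \<inter> fst c \<inter> W)"
    then have "inv_chart s y \<in> fst c" by auto
    from linear_0[OF linear_components[OF *(2) this]]
    show "0 = components A c (inv_chart s y) 0" by simp
  qed (simp add: self.open_inter_image assms(3))
  \<comment> \<open>The Leibniz rule with the factor 0 gives the derivative of the zero
    field.\<close>
  have "smooth_function A W (\<lambda>_. 0)" by (simp add: self.smooth_function_iff)
  from nab_leibniz[OF assms(2) function_nearI[OF assms(3) this assms(4,2)] field_nearI[OF assms(3) z assms(4,2)], of v]
  show ?case using z by (simp add: dirderiv_def o_def fd_eq[OF has_derivative_const])
next
  case (insert i I)
  then have IH: "nab v (\<lambda>q. \<Sum>i\<in>I. Z i q) p = (\<Sum>i\<in>I. nab v (Z i) p)" "smooth_field A A W (\<lambda>q. \<Sum>i\<in>I. Z i q)"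
    by auto
  have Zi: "smooth_field A A W (Z i)" using insert by auto
  have "nab v (\<lambda>q. Z i q + (\<Sum>i\<in>I. Z i q)) p = nab v (Z i) p + nab v (\<lambda>q. \<Sum>i\<in>I. Z i q) p"
    using assms IH(2) Zi field_nearI by (intro nab_add) auto
  then show ?case
    using insert.hyps IH self.smooth_field_add[OF Zi IH(2) assms(3)] by simp
qed

text \<open>The field is expanded in the coordinate fields near \<open>p\<close>. The Leibniz rule
  differentiates the coefficients, and the derivatives of the coordinate fields make up the
  Christoffel part.\<close>

lemma components_nab:
  assumes p: "p \<in> U" and c: "c \<in> A" "p \<in> fst c"
    and W: "openin (top_of_set M) W" "p \<in> W" and Y: "smooth_field A A W Y"
  shows "components A c p (nab v Y p) =
     fd (\<lambda>x. components A c (inv_chart c x) (Y (inv_chart c x))) (snd c p) (components A c p v)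
     + christoffel A nab c p (components A c p v) (components A c p (Y p))"
proof -
  define W' where "W' = W \<inter> fst c \<inter> U"
  have W': "openin (top_of_set M) W'" "p \<in> W'" "W' \<subseteq> fst c" "W' \<subseteq> U"
    using W(2) p c openin_Int[OF openin_Int[OF W(1) chart_openin[OF c(1)]] U] by (simp_all add: W'_def le_infI1)
  have Y': "smooth_field A A W' Y" by (rule self.smooth_field_subset[OF Y]) (auto simp: W'_def)
  define f where "f i q = components A c q (Y q) $ i" for i q
  have cf: "smooth_field A A W' (coord_field A c i)" for i
    using self.smooth_field_subset[OF smooth_from_components[OF c(1), of "axis i 1"] W'(3)]
    by (simp add: coord_field_eq[abs_def])
  have f: "smooth_function A W' (f i)" for i
    unfolding f_def by (rule self.smooth_function_component[OF Y' W'(1) c(1) W'(3)])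
  have Z: "smooth_field A A W' (\<lambda>q. f i q *\<^sub>R coord_field A c i q)" for i
    by (rule self.smooth_field_scale[OF f cf W'(1)])
  note S = nab_sum[OF finite_class.finite_UNIV p W'(1,2), of "\<lambda>i q. f i q *\<^sub>R coord_field A c i q", OF Z]
  have "nab v Y p = nab v (\<lambda>q. \<Sum>i\<in>UNIV. f i q *\<^sub>R coord_field A c i q) p"
  proof (rule nab_local[OF p _ _ W'(1,2)])
    show "Y q = (\<Sum>i\<in>UNIV. f i q *\<^sub>R coord_field A c i q)" if "q \<in> W'" for q
      unfolding f_def using that W'(3) c by (intro field_expand) auto
  qed (use field_nearI[OF W'(1)] Y' S W' p in auto)
  also have "\<dots> = (\<Sum>i\<in>UNIV. nab v (\<lambda>q. f i q *\<^sub>R coord_field A c i q) p)" using S by blast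
  also have "\<dots> = (\<Sum>i\<in>UNIV. dirderiv A (f i) p v *\<^sub>R coord_field A c i p + f i p *\<^sub>R nab v (coord_field A c i) p)"
    by (intro sum.cong refl nab_leibniz function_nearI[OF W'(1) f] field_nearI[OF W'(1) cf] p W')
  finally have n: "nab v Y p = \<dots>" .
  let ?Y = "\<lambda>x. components A c (inv_chart c x) (Y (inv_chart c x))"
  have dY: "?Y differentiable (at (snd c p))"
    by (rule self.smooth_field_differentiable[OF Y' c(1) c(1) c(2) c(2) W'(2)])
  have df: "((\<lambda>x. f i (inv_chart c x)) has_derivative (\<lambda>h. fd ?Y (snd c p) h $ i)) (at (snd c p))" for i
    unfolding f_def by (rule bounded_linear.has_derivative[OF bounded_linear_vec_nth fd_works[OF dY]])
  have d: "dirderiv A (f i) p v = fd ?Y (snd c p) (components A c p v) $ i" for i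
    by (subst dirderiv_chart[OF c differentiableI[OF df]]) (simp add: fd_eq[OF df])
  note L = linear_components[OF c]
  show ?thesis
    unfolding n sum.distrib linear_add[OF L] christoffel_def
    using c by (simp add: d f_def flip: from_components_expand)
qed

lemma christoffel_field:
  assumes p: "p \<in> U" and c: "c \<in> A" "p \<in> fst c"
  shows "christoffel A nab c p u v = components A c p (nab (from_components A c p u) (\<lambda>q. from_components A c q v) p)"
proof -
  have "eventually (\<lambda>x. components A c (inv_chart c x) (from_components A c (inv_chart c x) v) = v) (nhds (snd c p))"
    using eventually_in_chart[OF c chart_openin[OF c(1)] c(2)] by eventually_elim (use c in auto)
  from fd_cong(1)[OF this]
  have "fd (\<lambda>x. components A c (inv_chart c x) (from_components A c (inv_chart c x) v)) (snd c p) = (\<lambda>_. 0)"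
    by (simp add: fd_eq[OF has_derivative_const])
  with components_nab[OF p c chart_openin[OF c(1)] c(2) smooth_from_components[OF c(1)]] show ?thesis
    using c by simp
qed

lemma bilinear_christoffel:
  assumes p: "p \<in> U" and c: "c \<in> A" "p \<in> fst c"
  shows "bilinear (christoffel A nab c p)"
proof -
  note L = linear_components[OF c]
  have cf: "field_near A U p (coord_field A c i)" for i
    using field_nearI[OF chart_openin[OF c(1)] smooth_from_components[OF c(1), of "axis i 1"] c(2) p]
    by (simp add: coord_field_eq[abs_def])
  note N = nab_linear[OF p cf]
  have "linear (\<lambda>u. components A c p (\<Sum>i\<in>UNIV. v $ i *\<^sub>R nab (from_components A c p u) (coord_field A c i) p))" for v
    using linear_from_components[OF c]
    by (intro linear_compose[OF _ L, unfolded o_def] linear_compose_sum ballI linear_compose_scale_right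
        linear_compose[OF _ N, unfolded o_def]) 
  moreover have "linear (\<lambda>v. components A c p (\<Sum>i\<in>UNIV. v $ i *\<^sub>R nab (from_components A c p u) (coord_field A c i) p))" for u
    by (intro linear_compose[OF _ L, unfolded o_def] linear_compose_sum ballI)
      (auto intro!: linearI simp: scaleR_add_left)
  ultimately show ?thesis by (simp add: bilinear_def christoffel_def)
qed

text \<open>The field with constant components \<open>v\<close> in \<open>c\<close> is
  differentiated in both charts. Its components in \<open>d\<close> are the Jacobian of the
  transition map applied to \<open>v\<close>, and their derivative is the Hessian term.\<close>

lemma christoffel_transition:
  assumes p: "p \<in> U" and c: "c \<in> A" "p \<in> fst c" and d: "d \<in> A" "p \<in> fst d"
  defines "F \<equiv> \<lambda>x. snd d (inv_chart c x)"
  shows "fd F (snd c p) (christoffel A nab c p u v) =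
    fd (\<lambda>x. fd F x v) (snd c p) u + christoffel A nab d p (fd F (snd c p) u) (fd F (snd c p) v)"
proof -
  have J: "chart_deriv c d (\<lambda>q. q) q v = fd F (snd c q) v" for q v
    by (simp add: chart_deriv_def F_def o_def)
  have comp: "components A d q w = fd F (snd c q) (components A c q w)" if "q \<in> fst c" "q \<in> fst d" for q w
    using components_transition[OF c(1) d(1) that] J by simp
  let ?Y = "\<lambda>q. from_components A c q v" and ?w = "from_components A c p u"
  let ?h = "\<lambda>q. components A d q (?Y q)"
  note sm = smooth_from_components[OF c(1), of v]
  have dh: "(\<lambda>x. ?h (inv_chart d x)) differentiable (at (snd d p))"
    by (rule self.smooth_field_differentiable[OF sm d(1) d(1) d(2) d(2) c(2)])
  have "fd F (snd c p) (christoffel A nab c p u v) = components A d p (nab ?w ?Y p)"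
    using c d by (simp add: christoffel_field[OF p c] comp)
  also have "\<dots> = fd (\<lambda>x. ?h (inv_chart d x)) (snd d p) (components A d p ?w)
     + christoffel A nab d p (components A d p ?w) (?h p)"
    by (rule components_nab[OF p d chart_openin[OF c(1)] c(2) sm])
  also have "fd (\<lambda>x. ?h (inv_chart d x)) (snd d p) (components A d p ?w) = fd (\<lambda>x. ?h (inv_chart c x)) (snd c p) u"
    unfolding fd_eq[OF has_derivative_chart_chain[OF chart_diff_id[OF c(1) d(1) c(2) d(2)] fd_works[OF dh]]] J
    using c d by (simp add: comp)
  also have "fd (\<lambda>x. ?h (inv_chart c x)) (snd c p) = fd (\<lambda>x. fd F x v) (snd c p)"
  proof (rule fd_cong(1))
    show "\<forall>\<^sub>F x in nhds (snd c p). ?h (inv_chart c x) = fd F x v"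
      using eventually_in_chart[OF c chart_openin[OF d(1)] d(2)]
      by eventually_elim (use c in \<open>auto simp: comp\<close>)
  qed
  finally show ?thesis using c d by (simp add: comp)
qed

end

section \<open>Metric connections and their naturality\<close>

locale smooth_map_between = src: oriented_manifold M A + dst: oriented_manifold M' A'
  for M :: "'a::topological_space set" and A :: "('a, 'm::finite) chart set"
    and M' :: "'b::topological_space set" and A' :: "('b, 'n::finite) chart set" +
  fixes U \<phi>
  assumes U: "openin (top_of_set M) U" and smooth: "smooth_map A A' U \<phi>"
begin

lemma U_subset: "U \<subseteq> M" by (rule openin_imp_subset[OF U])

lemma map_into: "q \<in> U \<Longrightarrow> \<phi> q \<in> M'"
  using smooth dst.atlas by (auto simp: smooth_map_def oriented_atlas_def)

lemma openin_preimage: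
  assumes "openin (top_of_set M') V" shows "openin (top_of_set M) {q \<in> U. \<phi> q \<in> V}"
proof -
  have "continuous_on U \<phi>" using smooth by (simp add: smooth_map_def)
  then have "openin (top_of_set U) (U \<inter> \<phi> -` V)"
    by (rule continuous_openin_preimage[OF _ _ assms]) (use map_into in auto)
  moreover have "U \<inter> \<phi> -` V = {q \<in> U. \<phi> q \<in> V}" by auto
  ultimately show ?thesis using openin_trans[OF _ U] by simp
qed

lemma map_smooth:
  assumes "c \<in> A" "d \<in> A'"
  shows "smooth_on (\<lambda>x. snd d (\<phi> (inv_chart c x))) (snd c ` (fst c \<inter> {q \<in> U. \<phi> q \<in> fst d}))"
proof -
  have "\<forall>(V, x)\<in>A. \<forall>(W, y)\<in>A'. smooth_on (y \<circ> \<phi> \<circ> inv_into V x) (x ` {p \<in> V \<inter> U. \<phi> p \<in> W})"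
    using smooth unfolding smooth_map_def by (elim conjE)
  from bspec[OF bspec[OF this assms(1), unfolded case_prod_beta] assms(2), unfolded case_prod_beta]
  have "smooth_on (\<lambda>x. snd d (\<phi> (inv_chart c x))) (snd c ` {p \<in> fst c \<inter> U. \<phi> p \<in> fst d})"
    by (simp add: inv_chart_def o_def)
  moreover have "{p \<in> fst c \<inter> U. \<phi> p \<in> fst d} = fst c \<inter> {q \<in> U. \<phi> q \<in> fst d}" by auto
  ultimately show ?thesis by simp
qed

lemma map_open_image:
  "c \<in> A \<Longrightarrow> d \<in> A' \<Longrightarrow> open (snd c ` (fst c \<inter> {q \<in> U. \<phi> q \<in> fst d}))"
  by (intro src.open_chart_image openin_preimage dst.chart_openin)

lemma chart_diff_map:
  assumes "c \<in> A" "d \<in> A'" "p \<in> fst c" "p \<in> U" "\<phi> p \<in> fst d"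
  shows "chart_diff c d \<phi> p"
  unfolding chart_diff_def
proof (intro conjI assms src.inj_chart dst.inj_chart)
  have "eventually (\<lambda>y. y \<in> snd c ` (fst c \<inter> {q \<in> U. \<phi> q \<in> fst d})) (nhds (snd c p))"
    by (rule src.eventually_in_chart) (use assms openin_preimage[OF dst.chart_openin] in auto)
  then show "eventually (\<lambda>y. y \<in> snd c ` fst c \<and> \<phi> (inv_chart c y) \<in> fst d) (nhds (snd c p))"
    by eventually_elim (use assms in auto)
  have "(\<lambda>y. snd d (\<phi> (inv_chart c y))) differentiable at (snd c p)"
    using map_smooth[OF assms(1,2)] by (rule smooth_on_differentiable) (use assms in auto)
  then show "(snd d \<circ> \<phi> \<circ> inv_chart c) differentiable at (snd c p)" by (simp add: o_def)
qed

lemma components_tangent_map: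
  assumes "c \<in> A" "d \<in> A'" "p \<in> fst c" "p \<in> U" "\<phi> p \<in> fst d"
  shows "components A' d (\<phi> p) (tangent_map A A' \<phi> p v) = chart_deriv c d \<phi> p (components A c p v)"
proof -
  have p: "p \<in> M" "\<phi> p \<in> M'" using assms map_into U_subset by auto
  note m = src.chart_at_mem[OF p(1)] dst.chart_at_mem[OF p(2)]
  let ?c = "chart_at A p" and ?d = "chart_at A' (\<phi> p)"
  have D: "chart_diff ?c ?d \<phi> p" "chart_diff ?d d (\<lambda>q. q) (\<phi> p)" "chart_diff ?c c (\<lambda>q. q) p" "chart_diff c d \<phi> p"
    using m assms by (auto intro!: chart_diff_map src.chart_diff_id dst.chart_diff_id)
  show ?thesis unfolding components_def tangent_map_def
    using chart_diff_compose(2)[OF D(1,2), of v] chart_diff_compose(2)[OF D(3) , of d \<phi> v] D(4) by simp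
qed

lemma linear_tangent_map: "p \<in> U \<Longrightarrow> linear (tangent_map A A' \<phi> p)"
  unfolding tangent_map_def
  using src.chart_at_mem[of p] dst.chart_at_mem[of "\<phi> p"] map_into[of p] U_subset
  by (intro linear_chart_deriv chart_diff_map) auto

end

section \<open>Metrics in coordinates and the Koszul formula\<close>

definition chart_metric ::
    "('a, 'n::finite) chart set \<Rightarrow> ('a \<Rightarrow> real^'n \<Rightarrow> real^'n \<Rightarrow> real) \<Rightarrow> ('a, 'n) chart \<Rightarrow>
     real^'n \<Rightarrow> real^'n \<Rightarrow> real^'n \<Rightarrow> real" where
  "chart_metric A g c x v w =
     g (inv_chart c x) (from_components A c (inv_chart c x) v) (from_components A c (inv_chart c x) w)"

lemma (in oriented_manifold) metric_chart:
  assumes "c \<in> A" "q \<in> fst c"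
  shows "g q v w = chart_metric A g c (snd c q) (components A c q v) (components A c q w)"
  using assms by (simp add: chart_metric_def)

lemma (in oriented_manifold) bilinear_chart_metric:
  assumes "c \<in> A" "q \<in> fst c" "bilinear (g q)"
  shows "bilinear (chart_metric A g c (snd c q))"
proof -
  have "linear (g q u)" "linear (\<lambda>v. g q v u)" for u using assms(3) by (auto simp: bilinear_def)
  note l = linear_compose[OF linear_from_components[OF assms(1,2)] this(1), unfolded o_def]
    linear_compose[OF linear_from_components[OF assms(1,2)] this(2), unfolded o_def]
  show ?thesis using assms l by (simp add: bilinear_def chart_metric_def)
qed

lemma (in smooth_map_between) chart_metric_map:
  assumes c: "c \<in> A" "q \<in> fst c" and d: "d \<in> A'" "\<phi> q \<in> fst d" and q: "q \<in> U"
    and isometric: "\<And>u v. g q u v = g' (\<phi> q) (tangent_map A A' \<phi> q u) (tangent_map A A' \<phi> q v)"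
  defines "F \<equiv> \<lambda>x. snd d (\<phi> (inv_chart c x))"
  shows "chart_metric A g c (snd c q) v w = chart_metric A' g' d (F (snd c q)) (fd F (snd c q) v) (fd F (snd c q) w)"
proof -
  have J: "chart_deriv c d \<phi> q v = fd F (snd c q) v" for v by (simp add: chart_deriv_def F_def o_def)
  have "chart_metric A g c (snd c q) v w =
      g' (\<phi> q) (tangent_map A A' \<phi> q (from_components A c q v)) (tangent_map A A' \<phi> q (from_components A c q w))"
    using c isometric by (simp add: chart_metric_def)
  also have "\<dots> = chart_metric A' g' d (F (snd c q)) (fd F (snd c q) v) (fd F (snd c q) w)"
    by (subst dst.metric_chart[OF d]) (use c in \<open>simp add: components_tangent_map[OF c(1) d(1) c(2) q d(2)] J F_def\<close>)
  finally show ?thesis .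
qed

text \<open>The requirements are met by a Lorentz metric and equally by the pullback of the
  reference metric to \<open>U\<close>. Nondegeneracy is asked of the target metric in
  \<open>isometric_map\<close>.\<close>

locale metric_connection = connection M A U nab
  for M and A :: "('a::topological_space, 4) chart set" and U nab +
  fixes g
  assumes bil: "p \<in> U \<Longrightarrow> bilinear (g p)" and sym: "p \<in> U \<Longrightarrow> g p u v = g p v u"
    and metric_diff: "c \<in> A \<Longrightarrow> p \<in> fst c \<Longrightarrow> p \<in> U \<Longrightarrow>
      (\<lambda>x. chart_metric A g c x v w) differentiable (at (snd c p))"
    and torsion_free: "p \<in> U \<Longrightarrow> field_near A U p X \<Longrightarrow> field_near A U p Y \<Longrightarrow>
      nab (X p) Y p - nab (Y p) X p = lie_bracket A X Y p"
    and compatible: "p \<in> U \<Longrightarrow> field_near A U p X \<Longrightarrow> field_near A U p Y \<Longrightarrow>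
      dirderiv A (\<lambda>q. g q (X q) (Y q)) p v = g p (nab v X p) (Y p) + g p (X p) (nab v Y p)"
begin

lemma eventually_bilinear:
  assumes "c \<in> A" "p \<in> fst c" "p \<in> U"
  shows "eventually (\<lambda>x. bilinear (chart_metric A g c x)) (nhds (snd c p))"
  using eventually_in_chart[OF assms(1,2) U assms(3)]
proof eventually_elim
  case (elim x)
  then obtain q where "q \<in> fst c" "q \<in> U" "x = snd c q" by auto
  then show ?case using bilinear_chart_metric[OF assms(1)] bil by simp
qed

lemma field_near_from_components:
  "p \<in> U \<Longrightarrow> c \<in> A \<Longrightarrow> p \<in> fst c \<Longrightarrow> field_near A U p (\<lambda>q. from_components A c q v)"
  by (rule field_nearI[OF chart_openin smooth_from_components])

text \<open>Compatibility, applied to two fields with constant components in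
  \<open>c\<close>.\<close>

lemma fd_chart_metric:
  assumes p: "p \<in> U" and c: "c \<in> A" "p \<in> fst c"
  shows "fd (\<lambda>x. chart_metric A g c x v w) (snd c p) u =
    chart_metric A g c (snd c p) (christoffel A nab c p u v) w + chart_metric A g c (snd c p) v (christoffel A nab c p u w)"
proof -
  let ?V = "\<lambda>q. from_components A c q v" and ?W = "\<lambda>q. from_components A c q w" and ?u = "from_components A c p u"
  note n = field_near_from_components[OF p c]
  have "(\<lambda>x. g (inv_chart c x) (?V (inv_chart c x)) (?W (inv_chart c x))) differentiable (at (snd c p))"
    using metric_diff[OF c p] by (simp add: chart_metric_def)
  from dirderiv_chart[OF c this, of ?u]
  have "fd (\<lambda>x. chart_metric A g c x v w) (snd c p) u = dirderiv A (\<lambda>q. g q (?V q) (?W q)) p ?u"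
    using c by (simp add: chart_metric_def[abs_def])
  also have "\<dots> = g p (nab ?u ?V p) (?W p) + g p (?V p) (nab ?u ?W p)"
    by (rule compatible[OF p n n])
  finally show ?thesis
    using c by (simp add: christoffel_field[OF p c] chart_metric_def)
qed

text \<open>Fields with constant components in one chart commute, so torsion freeness makes their
  mutual derivatives agree. The preferred chart at \<open>p\<close> is the one in which
  \<open>lie_bracket\<close> is computed.\<close>

lemma christoffel_sym:
  assumes p: "p \<in> U"
  shows "christoffel A nab (chart_at A p) p u v = christoffel A nab (chart_at A p) p v u"
proof -
  have pM: "p \<in> M" using p U_subset by blast
  let ?c = "chart_at A p"
  note c = chart_at_mem[OF pM]
  let ?V = "\<lambda>v q. from_components A ?c q v"
  have "dirderiv A (\<lambda>q. components A ?c q (?V v q)) p w = 0" for v w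
  proof -
    have "eventually (\<lambda>x. components A ?c (inv_chart ?c x) (?V v (inv_chart ?c x)) = v) (nhds (snd ?c p))"
      using eventually_in_chart[OF c chart_openin[OF c(1)] c(2)] by eventually_elim (use c in auto)
    from fd_cong(1)[OF this] show ?thesis
      by (simp add: dirderiv_def o_def fd_eq[OF has_derivative_const])
  qed
  then have "nab (?V u p) (?V v) p - nab (?V v p) (?V u) p = 0"
    by (subst torsion_free) (auto simp: lie_bracket_def p intro!: field_near_from_components c)
  then show ?thesis by (simp add: christoffel_field[OF p c])
qed

text \<open>Each derivative of the metric splits by compatibility into two Christoffel terms; by
  symmetry of the metric and of the symbols, four of the six cancel and two coincide.\<close>

lemma koszul:
  fixes p and u v w defines "c \<equiv> chart_at A p"
  assumes p: "p \<in> U"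
  shows "2 * chart_metric A g c (snd c p) (christoffel A nab c p u v) w =
    fd (\<lambda>x. chart_metric A g c x v w) (snd c p) u + fd (\<lambda>x. chart_metric A g c x u w) (snd c p) v
    - fd (\<lambda>x. chart_metric A g c x u v) (snd c p) w"
proof -
  have pM: "p \<in> M" using p U_subset by blast
  note c = chart_at_mem[OF pM, folded c_def]
  have s: "chart_metric A g c (snd c p) a b = chart_metric A g c (snd c p) b a" for a b
    using sym[OF p] c by (simp add: chart_metric_def)
  note cs = christoffel_sym[OF p, folded c_def]
  show ?thesis
    unfolding fd_chart_metric[OF p c]
    using cs[of u v] cs[of u w] cs[of v w] s[of u "christoffel A nab c p v w"] s[of v "christoffel A nab c p u w"]
      s[of u "christoffel A nab c p w v"] s[of v "christoffel A nab c p w u"] by simp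
qed

end

section \<open>Isometries carry one Levi-Civita connection to the other\<close>

locale isometric_map = src: metric_connection M A U nab g + dst: metric_connection M' A' U' nab' g'
  + smooth_map_between M A M' A' U \<phi>
  for M and A :: "('a::topological_space, 4) chart set" and U nab g
    and M' and A' :: "('b::topological_space, 4) chart set" and U' nab' g' \<phi> +
  assumes map_U: "q \<in> U \<Longrightarrow> \<phi> q \<in> U'"
    and isometric: "q \<in> U \<Longrightarrow> g q u v = g' (\<phi> q) (tangent_map A A' \<phi> q u) (tangent_map A A' \<phi> q v)"
    and inj: "q \<in> U \<Longrightarrow> inj (tangent_map A A' \<phi> q)"
    and nondegenerate: "p \<in> U' \<Longrightarrow> (\<And>w. g' p v w = 0) \<Longrightarrow> v = 0"
begin

text \<open>The source metric is the pullback by \<open>F\<close> of the target metric, so its first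
  derivatives contain the Hessian \<open>B\<close> of \<open>F\<close>. The Koszul formula then
  shows that the defect of the claim is orthogonal to the range of the differential
  \<open>L\<close>. This range is the whole space, and nondegeneracy makes the defect
  vanish.\<close>

lemma christoffel_map:
  fixes u v
  assumes p: "p \<in> U"
  defines "c \<equiv> chart_at A p" and "d \<equiv> chart_at A' (\<phi> p)"
  defines "F \<equiv> \<lambda>x. snd d (\<phi> (inv_chart c x))"
  shows "fd F (snd c p) (christoffel A nab c p u v) =
    fd (\<lambda>x. fd F x v) (snd c p) u + christoffel A' nab' d (\<phi> p) (fd F (snd c p) u) (fd F (snd c p) v)"
proof -
  have pM: "p \<in> M" "\<phi> p \<in> M'" "\<phi> p \<in> U'" using p U_subset map_into map_U by auto
  note c = src.chart_at_mem[OF pM(1), folded c_def] and d = dst.chart_at_mem[OF pM(2), folded d_def]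
  define x0 where "x0 = snd c p"
  define T where "T = snd c ` (fst c \<inter> {q \<in> U. \<phi> q \<in> fst d})"
  have T: "open T" "x0 \<in> T" using map_open_image[OF c(1) d(1)] c d p by (auto simp: T_def x0_def)
  have smF: "smooth_on F T" unfolding F_def T_def by (rule map_smooth[OF c(1) d(1)])
  have Fp: "F x0 = snd d (\<phi> p)" using c by (simp add: F_def x0_def)
  define L where "L = fd F x0"
  define B where "B u v = fd (\<lambda>x. fd F x v) x0 u" for u v
  have Bsym: "B u v = B v u" for u v
    unfolding B_def by (rule fd_second_symmetric[OF smooth_onD[OF smF] T])
  have dF: "(F has_derivative L) (at x0)"
    unfolding L_def by (rule fd_works[OF smooth_on_differentiable[OF smF T(2)]])
  have dL: "((\<lambda>x. fd F x v) has_derivative (\<lambda>u. B u v)) (at x0)" for v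
    unfolding B_def by (rule fd_works[OF smooth_on_differentiable[OF smooth_on_fd[OF smF] T(2)]])
  let ?m = "chart_metric A g c" and ?m' = "chart_metric A' g' d"
  have ev: "eventually (\<lambda>x. bilinear (?m' x)) (nhds (F x0))"
    unfolding Fp by (rule dst.eventually_bilinear[OF d pM(3)])
  have md: "(\<lambda>x. ?m' x v w) differentiable (at (F x0))" for v w
    unfolding Fp by (rule dst.metric_diff[OF d pM(3)])
  have mF: "?m x v w = ?m' (F x) (fd F x v) (fd F x w)" if x: "x \<in> T" for x v w
  proof -
    obtain q where q: "q \<in> fst c" "q \<in> U" "\<phi> q \<in> fst d" "x = snd c q" using x by (auto simp: T_def)
    show ?thesis using chart_metric_map[where g = g and g' = g', OF c(1) q(1) d(1) q(3,2) isometric[OF q(2)]] by (simp add: q(4) F_def)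
  qed
  have dm: "fd (\<lambda>x. ?m x v w) x0 u =
      ?m' (F x0) (B u v) (L w) + ?m' (F x0) (L v) (B u w) + fd (\<lambda>z. ?m' z (L v) (L w)) (F x0) (L u)" for u v w
  proof -
    note D = has_derivative_bilinear_field[OF ev md dF dL dL, of v w, folded L_def]
    have "((\<lambda>x. ?m x v w) has_derivative (\<lambda>u. ?m' (F x0) (B u v) (L w) + ?m' (F x0) (L v) (B u w)
        + fd (\<lambda>z. ?m' z (L v) (L w)) (F x0) (L u))) (at x0)"
      by (rule has_derivative_transform_within_open[OF D T]) (rule mF[symmetric])
    from fd_eq[OF this] show ?thesis by simp
  qed
  let ?G = "christoffel A nab c p" and ?G' = "christoffel A' nab' d (\<phi> p)"
  have b: "bilinear (?m' (F x0))" using ev eventually_nhds_x_imp_x by blast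
  have s: "?m' (F x0) a b = ?m' (F x0) b a" for a b
    using dst.sym[OF pM(3)] d by (simp add: chart_metric_def Fp)
  have "?m' (F x0) (L (?G u v) - B u v - ?G' (L u) (L v)) (L w) = 0" for w
  proof -
    have "2 * ?m' (F x0) (L (?G u v)) (L w) = 2 * ?m x0 (?G u v) w"
      using mF[OF T(2)] by (simp add: L_def)
    also have "\<dots> = fd (\<lambda>x. ?m x v w) x0 u + fd (\<lambda>x. ?m x u w) x0 v - fd (\<lambda>x. ?m x u v) x0 w"
      unfolding x0_def c_def by (rule src.koszul[OF p])
    \<comment> \<open>Of the six Hessian terms the two with \<open>B u v\<close> add up; the other
      four cancel by symmetry of \<open>B\<close> and of the metric. What is left is the Koszul
      combination of the target.\<close>
    also have "\<dots> = 2 * ?m' (F x0) (B u v) (L w) + (fd (\<lambda>z. ?m' z (L v) (L w)) (F x0) (L u)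
        + fd (\<lambda>z. ?m' z (L u) (L w)) (F x0) (L v) - fd (\<lambda>z. ?m' z (L u) (L v)) (F x0) (L w))"
      unfolding dm using Bsym[of u v] Bsym[of u w] Bsym[of v w] s[of "L v" "B u w"] s[of "L u" "B v w"]
      by simp
    also have "(fd (\<lambda>z. ?m' z (L v) (L w)) (F x0) (L u)
        + fd (\<lambda>z. ?m' z (L u) (L w)) (F x0) (L v) - fd (\<lambda>z. ?m' z (L u) (L v)) (F x0) (L w))
        = 2 * ?m' (F x0) (?G' (L u) (L v)) (L w)"
      unfolding Fp d_def by (rule dst.koszul[OF pM(3), symmetric])
    finally show ?thesis by (simp add: bilinear_lsub[OF b])
  qed
  moreover have "surj L"
  proof -
    have "L = tangent_map A A' \<phi> p"
      unfolding L_def x0_def F_def tangent_map_def chart_deriv_def c_def d_def by (simp add: o_def)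
    then show ?thesis using inj[OF p] linear_tangent_map[OF p] linear_injective_imp_surjective by metis
  qed
  ultimately have z: "?m' (F x0) (L (?G u v) - B u v - ?G' (L u) (L v)) w = 0" for w
    by (metis surjD)
  have "L (?G u v) - B u v - ?G' (L u) (L v) = 0"
  proof (rule nondegenerate[OF pM(3)])
    fix w show "g' (\<phi> p) (L (?G u v) - B u v - ?G' (L u) (L v)) w = 0"
      using z[of w] d pM(2) unfolding Fp by (simp add: chart_metric_def d_def)
  qed
  then show ?thesis by (simp add: L_def B_def x0_def algebra_simps)
qed

end

section \<open>Covariant derivatives along a surface\<close>

text \<open>The spacetime vector of the surface vector with components \<open>w\<close> in the chart
  \<open>s\<close>; for fixed \<open>w\<close> it is a field along the surface with constant
  components in \<open>s\<close>.\<close>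

definition surf_vec ::
    "('a, 2) chart set \<Rightarrow> ('a, 4) chart set \<Rightarrow> ('a, 2) chart \<Rightarrow> 'a \<Rightarrow> real^2 \<Rightarrow> real^4" where
  "surf_vec P A s p w = incl_deriv P A p (from_components P s p w)"

lemma components_surf_vec:
  assumes "smooth_inclusion S P M A" "s \<in> P" "c \<in> A" "p \<in> fst s" "p \<in> fst c"
  shows "components A c p (surf_vec P A s p w) = chart_deriv s c (\<lambda>q. q) p w"
  unfolding surf_vec_def by (rule smooth_inclusion.components_incl) fact+

locale surface_map = smooth_map_between M A M' A' U \<phi>
  + src: smooth_inclusion S P M A + dst: smooth_inclusion S' P' M' A'
  for M and A :: "('a::topological_space, 4) chart set" and M' and A' :: "('b::topological_space, 4) chart set"
    and U \<phi> S and P :: "('a, 2) chart set" and S' and P' :: "('b, 2) chart set" +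
  assumes S_subset: "S \<subseteq> U"
begin

text \<open>Both sides are the differential of one map from the surface to the second spacetime,
  factored through the first spacetime or through the second surface.\<close>

lemma surf_vec_map:
  assumes s: "s \<in> P" "p \<in> fst s" and s': "s' \<in> P'" and d: "chart_diff s s' \<phi> p"
  shows "tangent_map A A' \<phi> p (surf_vec P A s p w) = surf_vec P' A' s' (\<phi> p) (chart_deriv s s' \<phi> p w)"
proof -
  have p: "p \<in> M" "p \<in> U" "\<phi> p \<in> M'" "\<phi> p \<in> fst s'"
    using s src.sub.chart_subset S_subset U_subset map_into chart_diff_in[OF d] by blast+
  let ?c = "chart_at A p" and ?d = "chart_at A' (\<phi> p)"
  note c = src.chart_at_mem[OF p(1)] and d' = dst.chart_at_mem[OF p(3)]
  have 1: "chart_diff s ?c (\<lambda>q. q) p" "chart_diff ?c ?d \<phi> p" "chart_diff s' ?d (\<lambda>q. q) (\<phi> p)"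
    using s s' c d' p by (auto intro!: src.chart_diff_incl chart_diff_map dst.chart_diff_incl)
  have "components A' ?d (\<phi> p) (tangent_map A A' \<phi> p (surf_vec P A s p w)) =
      chart_deriv ?c ?d \<phi> p (chart_deriv s ?c (\<lambda>q. q) p w)"
    using components_tangent_map[OF c(1) d'(1) c(2) p(2) d'(2)]
      components_surf_vec[OF src.smooth_inclusion_axioms s(1) c(1) s(2) c(2)] by simp
  also have "\<dots> = chart_deriv s ?d (\<lambda>q. \<phi> q) p w" by (rule chart_diff_compose(2)[OF 1(1,2), symmetric])
  also have "\<dots> = chart_deriv s' ?d (\<lambda>q. q) (\<phi> p) (chart_deriv s s' \<phi> p w)"
    by (rule chart_diff_compose(2)[OF d 1(3)])
  also have "\<dots> = components A' ?d (\<phi> p) (surf_vec P' A' s' (\<phi> p) (chart_deriv s s' \<phi> p w))"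
    by (rule components_surf_vec[OF dst.smooth_inclusion_axioms s' d'(1) p(4) d'(2), symmetric])
  finally show ?thesis using p by simp
qed

end

locale surface_connection = connection M A U nab + smooth_inclusion S P M A
  for M and A :: "('a::topological_space, 4) chart set" and U nab S and P :: "('a, 2) chart set" +
  assumes S_subset: "S \<subseteq> U" and inj_incl: "p \<in> S \<Longrightarrow> inj (incl_deriv P A p)"
begin

text \<open>In the preferred chart at \<open>p\<close> vectors at \<open>p\<close> equal their
  components, so the conversions disappear; the inverse of the inclusion differential is resolved by
  its injectivity.\<close>

lemma cov_along_preferred:
  assumes s: "s \<in> P" "p \<in> fst s" and Y: "smooth_field P A W Y" "p \<in> W"
  defines "c \<equiv> chart_at A p"
  shows "cov_along P A nab (surf_vec P A s p w) Y p =
     fd (\<lambda>y. components A c (inv_chart s y) (Y (inv_chart s y))) (snd s p) w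
     + christoffel A nab c p (chart_deriv s c (\<lambda>q. q) p w) (Y p)"
proof -
  have p: "p \<in> S" "p \<in> M" using s sub.chart_subset sub_subset by blast+
  note c = chart_at_mem[OF p(2), folded c_def]
  have "inv (incl_deriv P A p) (surf_vec P A s p w) = from_components P s p w"
    unfolding surf_vec_def by (rule inv_f_f[OF inj_incl[OF p(1)]])
  moreover have "dirderiv P (\<lambda>q. components A c q (Y q)) p (from_components P s p w) =
      fd (\<lambda>y. components A c (inv_chart s y) (Y (inv_chart s y))) (snd s p) w"
    by (subst sub.dirderiv_chart[OF s smooth_field_differentiable[OF Y(1) s(1) c(1) s(2) c(2) Y(2)]])
      (use s in simp)
  moreover have "from_components A c p (chart_deriv s c (\<lambda>q. q) p w) = surf_vec P A s p w"
    using components_surf_vec[OF smooth_inclusion_axioms s(1) c(1) s(2) c(2), of w] p by (simp add: c_def)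
  ultimately show ?thesis
    unfolding cov_along_def christoffel_def using p by (simp add: c_def)
qed

text \<open>\<open>cov_along\<close> is computed in the preferred chart at \<open>p\<close>, which
  need not vary continuously with \<open>p\<close>, so continuity of covariant derivatives needs a
  formula in a fixed chart. The Hessian of the transition map enters through the derivative of the
  components and through the Christoffel symbols, and cancels.\<close>

lemma cov_along_chart:
  assumes s: "s \<in> P" "p \<in> fst s" and Y: "smooth_field P A W Y" "p \<in> W" and c: "c \<in> A" "p \<in> fst c"
    and W: "openin (top_of_set S) W"
  shows "components A c p (cov_along P A nab (surf_vec P A s p w) Y p) =
     fd (\<lambda>y. components A c (inv_chart s y) (Y (inv_chart s y))) (snd s p) w
     + christoffel A nab c p (chart_deriv s c (\<lambda>q. q) p w) (components A c p (Y p))"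
proof -
  have p: "p \<in> S" "p \<in> M" "p \<in> U" using s sub.chart_subset sub_subset S_subset by blast+
  define c0 where "c0 = chart_at A p"
  note c0 = chart_at_mem[OF p(2), folded c0_def]
  define F where "F = (\<lambda>x. snd c (inv_chart c0 x))"
  have J: "chart_deriv c0 c (\<lambda>q. q) q v = fd F (snd c0 q) v" for q v
    by (simp add: chart_deriv_def F_def o_def)
  let ?T = "snd c0 ` (fst c0 \<inter> fst c)"
  have T: "open ?T" "snd c0 p \<in> ?T" using open_chart_image[OF c0(1) chart_openin[OF c(1)]] c c0 by auto
  have smF: "smooth_on F ?T" unfolding F_def by (rule transition_smooth[OF c0(1) c(1)])
  let ?k = "\<lambda>y. snd c0 (inv_chart s y)" and ?Y = "\<lambda>c y. components A c (inv_chart s y) (Y (inv_chart s y))"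
  have k0: "?k (snd s p) = snd c0 p" "inv_chart s (snd s p) = p" using s by auto
  note dY = fd_works[OF smooth_field_differentiable[OF Y(1) s(1) c0(1) s(2) c0(2) Y(2)]]
  have "((\<lambda>y. fd F (?k y) (?Y c0 y)) has_derivative
    (\<lambda>h. fd (\<lambda>x. fd F x (?Y c0 (snd s p))) (?k (snd s p)) (chart_deriv s c0 (\<lambda>q. q) p h)
       + fd F (?k (snd s p)) (fd (?Y c0) (snd s p) h))) (at (snd s p))"
    by (rule has_derivative_fd_apply[OF smooth_onD[OF smF] T(1)
          chart_deriv_has_derivative[OF chart_diff_incl[OF s(1) c0(1) s(2) c0(2)]] _ dY])
      (use T(2) k0 in simp)
  note D = this[unfolded k0]
  have "eventually (\<lambda>y. fd F (?k y) (?Y c0 y) = ?Y c y) (nhds (snd s p))"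
  proof -
    have "eventually (\<lambda>y. y \<in> snd s ` (fst s \<inter> ((S \<inter> fst c0) \<inter> (S \<inter> fst c)))) (nhds (snd s p))"
      by (rule sub.eventually_in_chart[OF s openin_Int[OF openin_chart_inter[OF c0(1)] openin_chart_inter[OF c(1)]]])
        (use c c0 p in auto)
    then show ?thesis
      by eventually_elim (use s c c0 in \<open>auto simp: components_transition[of c0 c] J\<close>)
  qed
  from fd_cong(1)[OF this] fd_eq[OF D]
  have e: "fd (?Y c) (snd s p) w = fd (\<lambda>x. fd F x (Y p)) (snd c0 p) (chart_deriv s c0 (\<lambda>q. q) p w)
       + fd F (snd c0 p) (fd (?Y c0) (snd s p) w)"
    using p by (simp add: c0_def)
  have lF: "linear (fd F (snd c0 p))"
    using smooth_on_differentiable[OF smF T(2)] linear_frechet_derivative by blast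
  have t: "fd F (snd c0 p) (christoffel A nab c0 p u v) =
    fd (\<lambda>x. fd F x v) (snd c0 p) u + christoffel A nab c p (fd F (snd c0 p) u) (fd F (snd c0 p) v)" for u v
    unfolding F_def by (rule christoffel_transition[OF p(3) c0 c])
  have i: "fd F (snd c0 p) (chart_deriv s c0 (\<lambda>q. q) p w) = chart_deriv s c (\<lambda>q. q) p w"
    using incl_transition[OF s(1) c0(1) c(1) s(2) c0(2) c(2), of w] J by simp
  have cc: "components A c p v = fd F (snd c0 p) v" for v
    using components_transition[OF c0(1) c(1) c0(2) c(2), of v] J p by (simp add: c0_def)
  show ?thesis
    unfolding cc cov_along_preferred[OF s Y, folded c0_def] linear_add[OF lF] t i
    using e by simp
qed

end

locale metric_surface = metric_connection M A U nab g + surface_connection M A U nab S P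
  for M and A :: "('a::topological_space, 4) chart set" and U nab g S P
begin

text \<open>No extension of \<open>Y\<close> and \<open>Z\<close> off the surface is chosen: the
  product rule is applied in coordinates, and the derivative of the metric coefficients supplies the
  two Christoffel terms.\<close>

lemma compatible_along:
  assumes s: "s \<in> P" "p \<in> fst s" and W: "openin (top_of_set S) W" "p \<in> W"
    and Y: "smooth_field P A W Y" and Z: "smooth_field P A W Z"
  shows "fd (\<lambda>y. g (inv_chart s y) (Y (inv_chart s y)) (Z (inv_chart s y))) (snd s p) w =
    g p (cov_along P A nab (surf_vec P A s p w) Y p) (Z p) + g p (Y p) (cov_along P A nab (surf_vec P A s p w) Z p)"
proof -
  have p: "p \<in> S" "p \<in> M" "p \<in> U" using s sub.chart_subset sub_subset S_subset by blast+
  define c where "c = chart_at A p"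
  note c = chart_at_mem[OF p(2), folded c_def]
  let ?k = "\<lambda>y. snd c (inv_chart s y)" and ?C = "\<lambda>Y y. components A c (inv_chart s y) (Y (inv_chart s y))"
  let ?m = "chart_metric A g c"
  have k0: "inv_chart s (snd s p) = p" using s by simp
  have cp: "components A c p v = v" for v using p by (simp add: c_def)
  have C0: "?C Y (snd s p) = Y p" for Y using s by (simp add: cp)
  have ev: "eventually (\<lambda>x. bilinear (?m x)) (nhds (?k (snd s p)))"
    unfolding k0 by (rule eventually_bilinear[OF c p(3)])
  have md: "(\<lambda>x. ?m x v w) differentiable (at (?k (snd s p)))" for v w
    unfolding k0 by (rule metric_diff[OF c p(3)])
  have dC: "(?C X has_derivative fd (?C X) (snd s p)) (at (snd s p))" if "smooth_field P A W X" for X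
    by (rule fd_works[OF smooth_field_differentiable[OF that s(1) c(1) s(2) c(2) W(2)]])
  let ?i = "chart_deriv s c (\<lambda>q. q) p"
  note D = has_derivative_bilinear_field[OF ev md chart_deriv_has_derivative[OF chart_diff_incl[OF s(1) c(1) s(2) c(2)]]
      dC[OF Y] dC[OF Z], unfolded C0 k0]
  have "eventually (\<lambda>y. g (inv_chart s y) (Y (inv_chart s y)) (Z (inv_chart s y)) = ?m (?k y) (?C Y y) (?C Z y)) (nhds (snd s p))"
  proof -
    have "eventually (\<lambda>y. y \<in> snd s ` (fst s \<inter> (S \<inter> fst c))) (nhds (snd s p))"
      using s c p openin_chart_inter[OF c(1)] by (intro sub.eventually_in_chart) auto
    then show ?thesis
      by eventually_elim (use s c in \<open>auto simp flip: metric_chart\<close>)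
  qed
  from fd_cong(1)[OF this] fd_eq[OF D]
  have "fd (\<lambda>y. g (inv_chart s y) (Y (inv_chart s y)) (Z (inv_chart s y))) (snd s p) w =
     ?m (snd c p) (fd (?C Y) (snd s p) w) (Z p) + ?m (snd c p) (Y p) (fd (?C Z) (snd s p) w)
     + fd (\<lambda>x. ?m x (Y p) (Z p)) (snd c p) (?i w)" by (simp add: cp)
  also have "\<dots> = ?m (snd c p) (fd (?C Y) (snd s p) w + christoffel A nab c p (?i w) (Y p)) (Z p)
     + ?m (snd c p) (Y p) (fd (?C Z) (snd s p) w + christoffel A nab c p (?i w) (Z p))"
    using bilinear_ladd[OF eventually_nhds_x_imp_x[OF ev]] bilinear_radd[OF eventually_nhds_x_imp_x[OF ev]]
    unfolding k0 fd_chart_metric[OF p(3) c] by simp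
  also have "\<dots> = g p (cov_along P A nab (surf_vec P A s p w) Y p) (Z p) + g p (Y p) (cov_along P A nab (surf_vec P A s p w) Z p)"
    unfolding cov_along_preferred[OF s Y W(2), folded c_def] cov_along_preferred[OF s Z W(2), folded c_def]
    using c p by (simp add: chart_metric_def) (simp add: c_def)
  finally show ?thesis .
qed

end

locale isometric_surfaces = isometric_map M A U nab g M' A' U' nab' g' \<phi>
  + src: metric_surface M A U nab g S P + dst: metric_surface M' A' U' nab' g' S' P'
  for M and A :: "('a::topological_space, 4) chart set" and U nab g
    and M' and A' :: "('b::topological_space, 4) chart set" and U' nab' g' \<phi>
    and S P S' P'
begin

text \<open>The same cancellation as for a change of chart, now with the Hessian of the coordinate
  expression of \<open>\<phi>\<close>. The field \<open>Y'\<close> is related to \<open>Y\<close>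
  only at the points \<open>\<phi> q\<close>, that is, along the image surface.\<close>

lemma cov_along_map:
  assumes s: "s \<in> P" "p \<in> fst s" and s': "s' \<in> P'" and d: "chart_diff s s' \<phi> p"
    and W: "openin (top_of_set S) W" "p \<in> W" and Y: "smooth_field P A W Y"
    and W': "\<phi> p \<in> W'" and Y': "smooth_field P' A' W' Y'"
    and eq: "\<And>q. q \<in> W \<Longrightarrow> Y' (\<phi> q) = tangent_map A A' \<phi> q (Y q)"
  shows "cov_along P' A' nab' (tangent_map A A' \<phi> p (surf_vec P A s p w)) Y' (\<phi> p) =
    tangent_map A A' \<phi> p (cov_along P A nab (surf_vec P A s p w) Y p)"
proof -
  interpret sm: surface_map M A M' A' U \<phi> S P S' P' by unfold_locales (rule src.S_subset)
  have p: "p \<in> M" "p \<in> U" "\<phi> p \<in> M'" "\<phi> p \<in> fst s'" "p \<in> S"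
    using s src.sub.chart_subset src.S_subset U_subset map_into chart_diff_in[OF d] by blast+
  define c where "c = chart_at A p"
  define e where "e = chart_at A' (\<phi> p)"
  note c = src.chart_at_mem[OF p(1), folded c_def] and e = dst.chart_at_mem[OF p(3), folded e_def]
  define F where "F = (\<lambda>x. snd e (\<phi> (inv_chart c x)))"
  have J: "chart_deriv c e \<phi> q v = fd F (snd c q) v" for q v
    by (simp add: chart_deriv_def F_def o_def)
  have TF: "tangent_map A A' \<phi> p = fd F (snd c p)"
    unfolding tangent_map_def using J by (auto simp: c_def e_def)
  let ?T = "snd c ` (fst c \<inter> {q \<in> U. \<phi> q \<in> fst e})"
  have T: "open ?T" "snd c p \<in> ?T" using map_open_image[OF c(1) e(1)] c e p by auto
  have smF: "smooth_on F ?T" unfolding F_def by (rule map_smooth[OF c(1) e(1)])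
  let ?k = "\<lambda>y. snd c (inv_chart s y)" and ?Y = "\<lambda>y. components A c (inv_chart s y) (Y (inv_chart s y))"
  let ?h = "\<lambda>q. components A' e q (Y' q)"
  have k0: "inv_chart s (snd s p) = p" using s by auto
  have cp: "components A c p v = v" for v using p by (simp add: c_def)
  have Y0: "?Y (snd s p) = Y p" using s by (simp add: cp)
  note dY = fd_works[OF src.smooth_field_differentiable[OF Y s(1) c(1) s(2) c(2) W(2)]]
  have "((\<lambda>y. fd F (?k y) (?Y y)) has_derivative
    (\<lambda>h. fd (\<lambda>x. fd F x (?Y (snd s p))) (?k (snd s p)) (chart_deriv s c (\<lambda>q. q) p h)
       + fd F (?k (snd s p)) (fd ?Y (snd s p) h))) (at (snd s p))"
    by (rule has_derivative_fd_apply[OF smooth_onD[OF smF] T(1)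
          chart_deriv_has_derivative[OF src.chart_diff_incl[OF s(1) c(1) s(2) c(2)]] _ dY])
      (use T(2) k0 in simp)
  note D = this[unfolded Y0 k0]
  have ev: "eventually (\<lambda>y. ?h (\<phi> (inv_chart s y)) = fd F (?k y) (?Y y)) (nhds (snd s p))"
  proof -
    have o: "openin (top_of_set S) (S \<inter> {q \<in> U. \<phi> q \<in> fst e})"
    proof -
      obtain V where V: "open V" "{q \<in> U. \<phi> q \<in> fst e} = M \<inter> V"
        using openin_preimage[OF dst.chart_openin[OF e(1)]] unfolding openin_open by (elim exE conjE)
      then have "S \<inter> {q \<in> U. \<phi> q \<in> fst e} = S \<inter> V" using src.sub_subset by auto
      then show ?thesis using V(1) openin_open_Int by simp
    qed
    have "eventually (\<lambda>y. y \<in> snd s ` (fst s \<inter> ((S \<inter> fst c) \<inter> (S \<inter> {q \<in> U. \<phi> q \<in> fst e}) \<inter> W))) (nhds (snd s p))"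
      by (rule src.sub.eventually_in_chart[OF s openin_Int[OF openin_Int[OF src.openin_chart_inter[OF c(1)] o] W(1)]])
        (use c e p W in auto)
    then show ?thesis
      by eventually_elim (use s c e in \<open>auto simp: components_tangent_map[of c e] J eq\<close>)
  qed
  have dh: "(\<lambda>z. ?h (inv_chart s' z)) differentiable (at (snd s' (\<phi> p)))"
    by (rule dst.smooth_field_differentiable[OF Y' s' e(1) p(4) e(2) W'])
  let ?w = "chart_deriv s s' \<phi> p w"
  have "fd (\<lambda>z. ?h (inv_chart s' z)) (snd s' (\<phi> p)) ?w = fd (\<lambda>y. ?h (\<phi> (inv_chart s y))) (snd s p) w"
    by (simp add: fd_eq[OF has_derivative_chart_chain[OF d fd_works[OF dh]]])
  also have "\<dots> = fd (\<lambda>x. fd F x (Y p)) (snd c p) (chart_deriv s c (\<lambda>q. q) p w)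
       + fd F (snd c p) (fd ?Y (snd s p) w)"
    unfolding fd_cong(1)[OF ev] fd_eq[OF D] by (simp add: cp)
  finally have 1: "fd (\<lambda>z. ?h (inv_chart s' z)) (snd s' (\<phi> p)) ?w = \<dots>" .
  have cd: "chart_diff s c (\<lambda>q. q) p" "chart_diff c e \<phi> p" "chart_diff s' e (\<lambda>q. q) (\<phi> p)"
    using s s' c e p by (auto intro!: src.chart_diff_incl chart_diff_map dst.chart_diff_incl)
  have 2: "chart_deriv s' e (\<lambda>q. q) (\<phi> p) ?w = fd F (snd c p) (chart_deriv s c (\<lambda>q. q) p w)"
    using chart_diff_compose(2)[OF cd(1,2), of w] chart_diff_compose(2)[OF d cd(3), of w] by (simp add: J)
  have lF: "linear (fd F (snd c p))"
    using smooth_on_differentiable[OF smF T(2)] linear_frechet_derivative by blast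
  have t: "fd F (snd c p) (christoffel A nab c p u v) =
    fd (\<lambda>x. fd F x v) (snd c p) u + christoffel A' nab' e (\<phi> p) (fd F (snd c p) u) (fd F (snd c p) v)" for u v
    unfolding F_def c_def e_def by (rule christoffel_map[OF p(2)])
  have eqp: "Y' (\<phi> p) = fd F (snd c p) (Y p)" using eq[OF W(2)] TF by simp
  show ?thesis
    unfolding sm.surf_vec_map[OF s s' d] dst.cov_along_preferred[OF s' p(4) Y' W', folded e_def] 1 2 eqp
      src.cov_along_preferred[OF s Y W(2), folded c_def]
    unfolding TF linear_add[OF lF] t by simp
qed

end

section \<open>Integration of two-forms\<close>

text \<open>In the numeral types \<open>2\<close> and \<open>4\<close> the greatest numeral is \<open>0\<close>, and charts are indexed from \<open>0\<close>.\<close>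

lemma det_2_eq: "det (A :: real^2^2) = A$0$0 * A$1$1 - A$1$0 * A$0$1"
proof -
  have z: "(2::2) = 0" by simp
  show ?thesis unfolding det_2 z by (simp add: mult.commute)
qed

lemma absolutely_integrable_compact_support:
  fixes f :: "'a::euclidean_space \<Rightarrow> real"
  assumes "continuous_on O' f" "compact K" "K \<subseteq> O'" "\<And>x. x \<in> O' - K \<Longrightarrow> f x = 0"
  shows "f absolutely_integrable_on O'"
proof -
  have i: "integrable lborel (\<lambda>x. indicator K x *\<^sub>R f x)"
    by (rule borel_integrable_compact[OF assms(2) continuous_on_subset[OF assms(1,3)]])
  then have "integrable lebesgue (\<lambda>x. indicator K x *\<^sub>R f x)"
    by (subst integrable_completion) (auto simp: borel_measurable_integrable)
  moreover have "(\<lambda>x. indicator K x *\<^sub>R f x) = (\<lambda>x. indicator O' x *\<^sub>R f x)"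
    using assms(3,4) by (intro ext) (auto simp: indicator_def)
  ultimately show ?thesis unfolding set_integrable_def by (simp only:)
qed

text \<open>The scalar function is read as one with values in \<open>real^1\<close>, to which the
  change of variables theorem for vector-valued functions applies.\<close>

lemma integral_change_of_variables_real:
  fixes f :: "real^'n::{finite,wellorder} \<Rightarrow> real" and g :: "real^'n::_ \<Rightarrow> real^'n::_"
  assumes "S \<in> sets lebesgue" "\<And>x. x \<in> S \<Longrightarrow> (g has_derivative g' x) (at x within S)" "inj_on g S"
    and "f absolutely_integrable_on (g ` S)"
  shows "integral (g ` S) f = integral S (\<lambda>x. \<bar>det (matrix (g' x))\<bar> * f (g x))"
proof -
  let ?f = "\<lambda>x. vec (f x) :: real^1"
  have "?f absolutely_integrable_on (g ` S)"
    using assms(4) by (simp add: absolutely_integrable_on_1_iff)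
  with has_absolute_integral_change_of_variables[OF assms(1-3), of ?f "integral (g ` S) ?f"]
  have "integral S (\<lambda>x. \<bar>det (matrix (g' x))\<bar> *\<^sub>R ?f (g x)) = integral (g ` S) ?f" by simp
  then have "vec (integral S (\<lambda>x. \<bar>det (matrix (g' x))\<bar> * f (g x))) = (vec (integral (g ` S) f) :: real^1)"
    unfolding integral_on_1_eq by simp
  then show ?thesis by (simp add: vec_eq_iff)
qed

lemma integral_vanishing_outside:
  fixes f :: "'n::euclidean_space \<Rightarrow> real"
  assumes "T \<subseteq> O'" "\<And>x. x \<in> O' - T \<Longrightarrow> f x = 0"
  shows "integral O' f = integral T f"
proof -
  have "(\<lambda>x. if x \<in> O' then f x else 0) = (\<lambda>x. if x \<in> T then f x else 0)"
    by (intro ext) (use assms in auto)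
  then show ?thesis
    using Henstock_Kurzweil_Integration.integral_restrict_UNIV[of O' f]
      Henstock_Kurzweil_Integration.integral_restrict_UNIV[of T f] by simp
qed

text \<open>Truncated cones in chart coordinates, extended by 0, serve as bump functions around the
  points of \<open>S\<close>. By compactness finitely many of them have a positive sum on all of
  \<open>S\<close>, and division by this sum normalises them.\<close>

lemma partition_of_unity_exists:
  fixes S :: "'a::t2_space set"
  assumes "oriented_atlas S P" and comp: "compact S"
  shows "\<exists>c. partition_of_unity S P c"
proof -
  interpret oriented_manifold S P by unfold_locales (rule assms)
  define ch where "ch = chart_at P"
  have ch: "ch p \<in> P" "p \<in> fst (ch p)" if "p \<in> S" for p
    using chart_at_mem[OF that] by (auto simp: ch_def)
  have "\<exists>r>0. cball (snd (ch p) p) r \<subseteq> snd (ch p) ` fst (ch p)" if "p \<in> S" for p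
    using open_chart_range[OF ch(1)[OF that]] ch(2)[OF that] that unfolding open_contains_cball by blast
  then obtain r where r: "\<And>p. p \<in> S \<Longrightarrow> r p > 0"
    "\<And>p. p \<in> S \<Longrightarrow> cball (snd (ch p) p) (r p) \<subseteq> snd (ch p) ` fst (ch p)" by metis
  define b where "b p q = (if q \<in> fst (ch p) then max 0 (r p - dist (snd (ch p) q) (snd (ch p) p)) else 0)" for p q
  define K where "K p = inv_chart (ch p) ` cball (snd (ch p) p) (r p)" for p
  have K: "compact (K p)" "K p \<subseteq> fst (ch p)" if "p \<in> S" for p
  proof -
    have "continuous_on (snd (ch p) ` fst (ch p)) (inv_chart (ch p))"
      using chart_homeomorphism[OF ch(1)[OF that]] by (simp add: homeomorphism_def)
    then show "compact (K p)" unfolding K_def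
      by (intro compact_continuous_image continuous_on_subset[OF _ r(2)[OF that]]) auto
    show "K p \<subseteq> fst (ch p)" unfolding K_def using r(2)[OF that] ch(1)[OF that] by auto
  qed
  have bK: "q \<in> K p" if "p \<in> S" "b p q \<noteq> 0" for p q
  proof -
    have q: "q \<in> fst (ch p)" "dist (snd (ch p) q) (snd (ch p) p) \<le> r p"
      using that by (auto simp: b_def split: if_splits)
    then have "snd (ch p) q \<in> cball (snd (ch p) p) (r p)" by (simp add: dist_commute)
    then show ?thesis unfolding K_def using q ch(1)[OF that(1)] by (metis image_eqI inv_chart_left)
  qed
  have b0: "b p q \<ge> 0" for p q by (simp add: b_def)
  have bp: "b p p > 0" if "p \<in> S" for p using r(1) ch that by (simp add: b_def)
  \<comment> \<open>Continuity is glued from two open pieces: the chart, and the complement of the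
    compact set \<open>K p\<close>, on which the function is 0. The complement is open by the
    Hausdorff property.\<close>
  have bc: "continuous_on S (b p)" if p: "p \<in> S" for p
  proof -
    have S: "S = fst (ch p) \<union> (S - K p)" using chart_subset[OF ch(1)[OF p]] K(2)[OF p] by auto
    have "continuous_on (fst (ch p)) (snd (ch p))"
      using chart_homeomorphism[OF ch(1)[OF p]] by (simp add: homeomorphism_def)
    then have c1: "continuous_on (fst (ch p)) (b p)"
      by (subst continuous_on_cong[OF refl, of _ _ "\<lambda>q. max 0 (r p - dist (snd (ch p) q) (snd (ch p) p))"])
        (auto simp: b_def intro!: continuous_intros)
    have c2: "continuous_on (S - K p) (b p)"
      by (subst continuous_on_cong[OF refl, of _ _ "\<lambda>q. 0"]) (use bK[OF p] in auto)
    have "openin (top_of_set S) (S - K p)"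
      using compact_imp_closed[OF K(1)[OF p]] by (simp add: Diff_eq open_Compl openin_open_Int)
    with continuous_on_Un_local_open[of "fst (ch p)" "S - K p" "b p"] c1 c2 chart_openin[OF ch(1)[OF p]]
    show ?thesis using S by simp
  qed
  define V where "V p = {q \<in> S. b p q > 0}" for p
  have "openin (top_of_set S) (V p)" if "p \<in> S" for p
    unfolding V_def using continuous_openin_preimage_gen[OF bc[OF that], of "{0<..}"]
    by (simp add: vimage_def Int_def)
  moreover have "S \<subseteq> \<Union> (V ` S)" using bp by (auto simp: V_def)
  ultimately obtain D where D: "D \<subseteq> V ` S" "finite D" "S \<subseteq> \<Union>D"
    using comp[unfolded compact_eq_openin_cover, rule_format, of "V ` S"] by auto
  then obtain F where F: "F \<subseteq> S" "finite F" "D = V ` F" using finite_subset_image by metis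
  define B where "B q = (\<Sum>p\<in>F. b p q)" for q
  have Bpos: "B q > 0" if q: "q \<in> S" for q
  proof -
    obtain p where "p \<in> F" "b p q > 0" using D(3) F(3) q by (auto simp: V_def)
    then show ?thesis unfolding B_def using b0 F(2) by (intro sum_pos2[of F p]) auto
  qed
  \<comment> \<open>The partition is indexed by charts, and several points may have the same
    preferred chart; their bumps are added up.\<close>
  define \<rho> where "\<rho> c q = (\<Sum>p\<in>{p\<in>F. ch p = c}. b p q) / B q" for c q
  have "partition_of_unity S P (ch ` F, \<rho>)"
    unfolding partition_of_unity_def
  proof (clarsimp, intro conjI ballI)
    show "finite (ch ` F)" using F by simp
    show "ch ` F \<subseteq> P" using ch F by auto
    fix p assume p: "p \<in> F"
    show "continuous_on S (\<rho> (ch p))"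
      unfolding \<rho>_def B_def using F bc Bpos unfolding B_def
      by (intro continuous_on_divide continuous_on_sum) (auto simp: less_le)
    show "0 \<le> \<rho> (ch p) q" if "q \<in> S" for q
      unfolding \<rho>_def using b0 Bpos[OF that] by (intro divide_nonneg_pos sum_nonneg) auto
    let ?K = "\<Union>p'\<in>{p'\<in>F. ch p' = ch p}. K p'"
    have "{q \<in> S. \<rho> (ch p) q \<noteq> 0} \<subseteq> ?K"
    proof
      fix q assume "q \<in> {q \<in> S. \<rho> (ch p) q \<noteq> 0}"
      then have "(\<Sum>p\<in>{p'\<in>F. ch p' = ch p}. b p q) \<noteq> 0" by (auto simp: \<rho>_def)
      then obtain p' where "p' \<in> F" "ch p' = ch p" "b p' q \<noteq> 0" by (auto elim: sum.not_neutral_contains_not_neutral)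
      then show "q \<in> ?K" using bK F by auto
    qed
    moreover have "closed ?K" using F K(1) by (intro closed_UN) (auto intro: compact_imp_closed)
    ultimately have "closure {q \<in> S. \<rho> (ch p) q \<noteq> 0} \<subseteq> ?K" by (rule closure_minimal)
    moreover have "?K \<subseteq> fst (ch p)"
    proof (rule UN_least)
      fix p' assume "p' \<in> {p' \<in> F. ch p' = ch p}"
      then show "K p' \<subseteq> fst (ch p)" using K(2)[of p'] F(1) by auto
    qed
    ultimately show "S \<inter> closure {q \<in> S. \<rho> (ch p) q \<noteq> 0} \<subseteq> fst (ch p)" by auto
  next
    fix q assume q: "q \<in> S"
    have "(\<Sum>c\<in>ch ` F. \<rho> c q) = (\<Sum>c\<in>ch ` F. \<Sum>p\<in>{p\<in>F. ch p = c}. b p q) / B q"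
      by (simp add: \<rho>_def sum_divide_distrib)
    also have "\<dots> = 1"
      using sum.group[OF F(2), of "ch ` F" ch "\<lambda>p. b p q"] F(2) Bpos[OF q] by (simp add: B_def)
    finally show "(\<Sum>c\<in>ch ` F. \<rho> c q) = 1" .
  qed
  then show ?thesis by blast
qed

section \<open>Independence of the integral from the partition of unity\<close>

definition form_density :: "('a, 2) chart set \<Rightarrow> ('a \<Rightarrow> real^2 \<Rightarrow> real^2 \<Rightarrow> real) \<Rightarrow> ('a, 2) chart \<Rightarrow> 'a \<Rightarrow> real" where
  "form_density P \<alpha> c q = \<alpha> q (coord_field P c 0 q) (coord_field P c 1 q)"

text \<open>Forms are plain functions of two vectors, so the first clause is what makes them
  bilinear and alternating: at each point they are a multiple of the determinant.\<close>

definition continuous_two_form :: "'a set \<Rightarrow> ('a, 2) chart set \<Rightarrow> ('a \<Rightarrow> real^2 \<Rightarrow> real^2 \<Rightarrow> real) \<Rightarrow> bool" where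
  "continuous_two_form S P \<alpha> \<longleftrightarrow>
     (\<forall>p\<in>S. \<exists>k. \<forall>u v. \<alpha> p u v = k * (u $ 0 * v $ 1 - u $ 1 * v $ 0)) \<and>
     (\<forall>c\<in>P. continuous_on (snd c ` fst c) (\<lambda>y. form_density P \<alpha> c (inv_chart c y)))"

definition partition_integral ::
    "('a, 2) chart set \<Rightarrow> ('a, 2) chart set \<Rightarrow> (('a, 2) chart \<Rightarrow> 'a \<Rightarrow> real) \<Rightarrow> ('a \<Rightarrow> real^2 \<Rightarrow> real^2 \<Rightarrow> real) \<Rightarrow> real" where
  "partition_integral P C \<rho> \<alpha> = (\<Sum>c\<in>C. integral (snd c ` fst c)
     (\<lambda>y. \<rho> c (inv_chart c y) * form_density P \<alpha> c (inv_chart c y)))"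

locale compact_surface = oriented_manifold S P
  for S :: "'a::t2_space set" and P :: "('a, 2) chart set" +
  assumes compact: "compact S"
begin

text \<open>Each density is the same multiple of the Jacobian determinant from its chart into the
  preferred one, and these determinants are related by the chain rule.\<close>

lemma density_transform:
  assumes \<alpha>: "continuous_two_form S P \<alpha>" and s: "s \<in> P" "s' \<in> P" "p \<in> fst s" "p \<in> fst s'"
  shows "form_density P \<alpha> s p = det (matrix (chart_deriv s s' (\<lambda>q. q) p)) * form_density P \<alpha> s' p"
proof -
  have p: "p \<in> S" using s chart_subset by blast
  then obtain k where k: "\<And>u v. \<alpha> p u v = k * (u $ 0 * v $ 1 - u $ 1 * v $ 0)"
    using \<alpha> unfolding continuous_two_form_def by metis
  note m = chart_at_mem[OF p]
  let ?c = "chart_at P p"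
  have d: "form_density P \<alpha> t p = k * det (matrix (chart_deriv t ?c (\<lambda>q. q) p))" for t
    by (simp add: form_density_def k coord_field_def det_2_eq matrix_def)
  have l: "linear (chart_deriv s s' (\<lambda>q. q) p)" "linear (chart_deriv s' ?c (\<lambda>q. q) p)"
    using s m by (auto intro!: linear_chart_deriv chart_diff_id)
  have "chart_deriv s ?c (\<lambda>q. q) p = chart_deriv s' ?c (\<lambda>q. q) p \<circ> chart_deriv s s' (\<lambda>q. q) p"
    using chart_deriv_trans[OF s(1,2) m(1) s(3,4) m(2)] by auto
  then show ?thesis unfolding d by (simp add: matrix_compose[OF l] det_mul)
qed

lemma partition_support:
  assumes "partition_of_unity S P (C, \<rho>)" "c \<in> C"
  shows "\<exists>K. compact K \<and> K \<subseteq> fst c \<and> (\<forall>q\<in>S - K. \<rho> c q = 0)"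
proof (intro exI conjI ballI)
  let ?K = "S \<inter> closure {p \<in> S. \<rho> c p \<noteq> 0}"
  show "compact ?K" by (rule compact_Int_closed[OF compact closed_closure])
  show "?K \<subseteq> fst c" using assms by (auto simp: partition_of_unity_def)
  show "\<rho> c q = 0" if "q \<in> S - ?K" for q using that closure_subset[of "{p \<in> S. \<rho> c p \<noteq> 0}"] by auto
qed

lemma partition_mem: "partition_of_unity S P (C, \<rho>) \<Longrightarrow> c \<in> C \<Longrightarrow> c \<in> P"
  by (auto simp: partition_of_unity_def)

text \<open>The density may be unbounded near the boundary of the chart image, but the partition
  function confines the integrand to a compact subset, where it is continuous. The factor
  \<open>f\<close> will be 1 or a function of a second partition.\<close>

lemma integrable_chart:
  assumes part: "partition_of_unity S P (C, \<rho>)" and c: "c \<in> C" and \<alpha>: "continuous_two_form S P \<alpha>"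
    and f: "continuous_on S f"
  shows "(\<lambda>y. \<rho> c (inv_chart c y) * f (inv_chart c y) * form_density P \<alpha> c (inv_chart c y))
    absolutely_integrable_on (snd c ` fst c)"
proof -
  note cP = partition_mem[OF part c]
  obtain K where K0: "compact K \<and> K \<subseteq> fst c \<and> (\<forall>q\<in>S - K. \<rho> c q = 0)"
    using partition_support[OF part c] by (rule exE)
  then have K: "compact K" "K \<subseteq> fst c" "\<And>q. q \<in> S - K \<Longrightarrow> \<rho> c q = 0" by simp_all
  have hom: "continuous_on (fst c) (snd c)" "continuous_on (snd c ` fst c) (inv_chart c)"
    using chart_homeomorphism[OF cP] by (auto simp: homeomorphism_def)
  have sub: "inv_chart c ` snd c ` fst c \<subseteq> S" using chart_subset[OF cP] cP by auto
  show ?thesis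
  proof (rule absolutely_integrable_compact_support)
    have "continuous_on S (\<rho> c)" using part c by (auto simp: partition_of_unity_def)
    then have 1: "continuous_on (snd c ` fst c) (\<lambda>y. \<rho> c (inv_chart c y))"
      by (rule continuous_on_compose2[OF _ hom(2) sub])
    have 2: "continuous_on (snd c ` fst c) (\<lambda>y. f (inv_chart c y))"
      by (rule continuous_on_compose2[OF f hom(2) sub])
    have 3: "continuous_on (snd c ` fst c) (\<lambda>y. form_density P \<alpha> c (inv_chart c y))"
      using \<alpha> cP by (simp add: continuous_two_form_def)
    show "continuous_on (snd c ` fst c)
        (\<lambda>y. \<rho> c (inv_chart c y) * f (inv_chart c y) * form_density P \<alpha> c (inv_chart c y))"
      by (intro continuous_on_mult 1 2 3)
    show "compact (snd c ` K)" by (rule compact_continuous_image[OF continuous_on_subset[OF hom(1) K(2)] K(1)])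
    show "snd c ` K \<subseteq> snd c ` fst c" using K(2) by auto
    show "\<rho> c (inv_chart c y) * f (inv_chart c y) * form_density P \<alpha> c (inv_chart c y) = 0"
      if y: "y \<in> snd c ` fst c - snd c ` K" for y
    proof -
      obtain q where q: "q \<in> fst c" "y = snd c q" using y by blast
      moreover have "q \<notin> K" using y q by blast
      ultimately show ?thesis using K(3) chart_subset[OF cP] cP by auto
    qed
  qed
qed

text \<open>Both integrands vanish off the overlap of the two charts. There the densities differ by
  the Jacobian determinant of the transition map, and its positivity removes the absolute value in
  the change of variables.\<close>

lemma integral_overlap:
  assumes part: "partition_of_unity S P (C, \<rho>)" "partition_of_unity S P (D, \<sigma>)"
    and c: "c \<in> C" and d: "d \<in> D" and \<alpha>: "continuous_two_form S P \<alpha>"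
  shows "integral (snd c ` fst c) (\<lambda>y. \<rho> c (inv_chart c y) * \<sigma> d (inv_chart c y) * form_density P \<alpha> c (inv_chart c y))
    = integral (snd d ` fst d) (\<lambda>y. \<sigma> d (inv_chart d y) * \<rho> c (inv_chart d y) * form_density P \<alpha> d (inv_chart d y))"
proof -
  note cP = partition_mem[OF part(1) c] and dP = partition_mem[OF part(2) d]
  have sub: "fst c \<subseteq> S" "fst d \<subseteq> S" using chart_subset cP dP by auto
  have \<rho>0: "\<rho> c (inv_chart d y) = 0" if y: "y \<in> snd d ` fst d - snd d ` (fst c \<inter> fst d)" for y
  proof -
    obtain q where q: "q \<in> fst d" "y = snd d q" using y by blast
    moreover have "q \<notin> fst c" using y q by blast
    moreover obtain K where "compact K \<and> K \<subseteq> fst c \<and> (\<forall>q\<in>S - K. \<rho> c q = 0)"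
      using partition_support[OF part(1) c] by (rule exE)
    ultimately show ?thesis using sub dP by auto
  qed
  have \<sigma>0: "\<sigma> d (inv_chart c y) = 0" if y: "y \<in> snd c ` fst c - snd c ` (fst c \<inter> fst d)" for y
  proof -
    obtain q where q: "q \<in> fst c" "y = snd c q" using y by blast
    moreover have "q \<notin> fst d" using y q by blast
    moreover obtain K where "compact K \<and> K \<subseteq> fst d \<and> (\<forall>q\<in>S - K. \<sigma> d q = 0)"
      using partition_support[OF part(2) d] by (rule exE)
    ultimately show ?thesis using sub cP by auto
  qed
  have cont: "continuous_on S (\<rho> c)" using part c by (auto simp: partition_of_unity_def)
  let ?O = "fst c \<inter> fst d"
  let ?T = "snd c ` ?O" and ?T' = "snd d ` ?O"
  let ?f = "\<lambda>y. \<sigma> d (inv_chart d y) * \<rho> c (inv_chart d y) * form_density P \<alpha> d (inv_chart d y)"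
  let ?g = "\<lambda>y. snd d (inv_chart c y)"
  have gT: "?g ` ?T = ?T'" using cP by (force simp: image_iff)
  have oT: "open ?T" using open_chart_image[OF cP chart_openin[OF dP]] .
  have oT': "open ?T'" using open_chart_image[OF dP chart_openin[OF cP]] by (simp add: Int_commute)
  have "integral (snd d ` fst d) ?f = integral ?T' ?f"
    by (rule integral_vanishing_outside) (use \<rho>0 in auto)
  also have "\<dots> = integral (?g ` ?T) ?f" by (simp only: gT)
  also have "\<dots> = integral ?T (\<lambda>y. \<bar>det (matrix (chart_deriv c d (\<lambda>q. q) (inv_chart c y)))\<bar> * ?f (?g y))"
  proof (rule integral_change_of_variables_real)
    show "?T \<in> sets lebesgue" by (rule sets_completionI_sets) (simp add: oT)
    show "inj_on ?g ?T" using cP dP inj_onD[OF inj_chart[OF dP]] by (auto simp: inj_on_def)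
    show "?f absolutely_integrable_on ?g ` ?T"
      unfolding gT by (rule set_integrable_subset[OF integrable_chart[OF part(2) d \<alpha> cont]]) (use oT' in auto)
    show "(?g has_derivative chart_deriv c d (\<lambda>q. q) (inv_chart c y)) (at y within ?T)" if y: "y \<in> ?T" for y
    proof -
      obtain q where q: "q \<in> fst c" "q \<in> fst d" "y = snd c q" using y by auto
      show ?thesis
        using chart_deriv_has_derivative[OF chart_diff_id[OF cP dP q(1,2)]] q cP
        by (simp add: has_derivative_at_withinI)
    qed
  qed
  also have "\<dots> = integral ?T (\<lambda>y. \<rho> c (inv_chart c y) * \<sigma> d (inv_chart c y) * form_density P \<alpha> c (inv_chart c y))"
  proof (rule integral_cong)
    fix y assume "y \<in> ?T"
    then obtain q where q: "q \<in> fst c" "q \<in> fst d" "y = snd c q" by auto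
    show "\<bar>det (matrix (chart_deriv c d (\<lambda>q. q) (inv_chart c y)))\<bar> * ?f (?g y) =
        \<rho> c (inv_chart c y) * \<sigma> d (inv_chart c y) * form_density P \<alpha> c (inv_chart c y)"
      using q cP dP transition_det[OF cP dP q(1,2)] density_transform[OF \<alpha> cP dP q(1,2)] by simp
  qed
  also have "\<dots> = integral (snd c ` fst c) (\<lambda>y. \<rho> c (inv_chart c y) * \<sigma> d (inv_chart c y) * form_density P \<alpha> c (inv_chart c y))"
    by (rule integral_vanishing_outside[symmetric]) (use \<sigma>0 in auto)
  finally show ?thesis by simp
qed

text \<open>The second partition is inserted as a factor that sums to 1; integrability of the pieces
  lets the sum leave the integral.\<close>

lemma partition_integral_refine:
  assumes part: "partition_of_unity S P (C, \<rho>)" "partition_of_unity S P (D, \<sigma>)"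
    and \<alpha>: "continuous_two_form S P \<alpha>"
  shows "partition_integral P C \<rho> \<alpha> = (\<Sum>c\<in>C. \<Sum>d\<in>D. integral (snd c ` fst c)
     (\<lambda>y. \<rho> c (inv_chart c y) * \<sigma> d (inv_chart c y) * form_density P \<alpha> c (inv_chart c y)))"
  unfolding partition_integral_def
proof (rule sum.cong[OF refl])
  fix c assume c: "c \<in> C"
  note cP = partition_mem[OF part(1) c]
  have fin: "finite D" using part(2) by (auto simp: partition_of_unity_def)
  have "(\<Sum>d\<in>D. integral (snd c ` fst c)
       (\<lambda>y. \<rho> c (inv_chart c y) * \<sigma> d (inv_chart c y) * form_density P \<alpha> c (inv_chart c y)))
    = integral (snd c ` fst c) (\<lambda>y. \<Sum>d\<in>D. \<rho> c (inv_chart c y) * \<sigma> d (inv_chart c y) * form_density P \<alpha> c (inv_chart c y))"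
  proof (rule integral_sum[symmetric, OF fin])
    fix d assume d: "d \<in> D"
    have "continuous_on S (\<sigma> d)" using part d by (auto simp: partition_of_unity_def)
    from integrable_chart[OF part(1) c \<alpha> this]
    show "(\<lambda>y. \<rho> c (inv_chart c y) * \<sigma> d (inv_chart c y) * form_density P \<alpha> c (inv_chart c y)) integrable_on (snd c ` fst c)"
      by (rule set_lebesgue_integral_eq_integral(1))
  qed
  also have "\<dots> = integral (snd c ` fst c) (\<lambda>y. \<rho> c (inv_chart c y) * form_density P \<alpha> c (inv_chart c y))"
  proof (rule integral_cong)
    fix y assume "y \<in> snd c ` fst c"
    then have "inv_chart c y \<in> S" using chart_subset[OF cP] cP by auto
    then have "(\<Sum>d\<in>D. \<sigma> d (inv_chart c y)) = 1" using part(2) by (auto simp: partition_of_unity_def)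
    then show "(\<Sum>d\<in>D. \<rho> c (inv_chart c y) * \<sigma> d (inv_chart c y) * form_density P \<alpha> c (inv_chart c y))
        = \<rho> c (inv_chart c y) * form_density P \<alpha> c (inv_chart c y)"
      by (simp flip: sum_distrib_left sum_distrib_right)
  qed
  finally show "integral (snd c ` fst c) (\<lambda>y. \<rho> c (inv_chart c y) * form_density P \<alpha> c (inv_chart c y)) =
    (\<Sum>d\<in>D. integral (snd c ` fst c)
       (\<lambda>y. \<rho> c (inv_chart c y) * \<sigma> d (inv_chart c y) * form_density P \<alpha> c (inv_chart c y)))" by simp
qed

text \<open>Both integrals refine to the same double sum over pairs of charts.\<close>

lemma partition_integral_unique:
  assumes part: "partition_of_unity S P (C, \<rho>)" "partition_of_unity S P (D, \<sigma>)"
    and \<alpha>: "continuous_two_form S P \<alpha>"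
  shows "partition_integral P C \<rho> \<alpha> = partition_integral P D \<sigma> \<alpha>"
  unfolding partition_integral_refine[OF part \<alpha>] partition_integral_refine[OF part(2,1) \<alpha>]
  by (subst (2) sum.swap) (intro sum.cong refl integral_overlap[OF part _ _ \<alpha>])

text \<open>The partition is selected without reference to the form, so one selection serves all
  forms at once; congruence and linearity can be checked with it fixed.\<close>

lemma form_integral_chosen:
  obtains C \<rho> where "partition_of_unity S P (C, \<rho>)" "\<And>\<alpha>. form_integral S P \<alpha> = partition_integral P C \<rho> \<alpha>"
proof -
  obtain C \<rho> where e: "(SOME c. partition_of_unity S P c) = (C, \<rho>)" by (metis surj_pair)
  show thesis
  proof
    show "partition_of_unity S P (C, \<rho>)"
      using someI_ex[OF partition_of_unity_exists[OF atlas compact]] e by simp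
    show "form_integral S P \<alpha> = partition_integral P C \<rho> \<alpha>" for \<alpha>
      by (simp add: form_integral_def e partition_integral_def form_density_def Let_def)
  qed
qed

lemma form_integral_eq:
  assumes "partition_of_unity S P (C, \<rho>)" "continuous_two_form S P \<alpha>"
  shows "form_integral S P \<alpha> = partition_integral P C \<rho> \<alpha>"
  using form_integral_chosen partition_integral_unique[OF assms(1) _ assms(2)] by metis

lemma form_integral_cong:
  assumes "\<And>p u v. p \<in> S \<Longrightarrow> \<alpha> p u v = \<beta> p u v"
  shows "form_integral S P \<alpha> = form_integral S P \<beta>"
proof -
  obtain C \<rho> where part: "partition_of_unity S P (C, \<rho>)" and e: "\<And>\<alpha>. form_integral S P \<alpha> = partition_integral P C \<rho> \<alpha>"
    using form_integral_chosen by blast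
  show ?thesis unfolding e partition_integral_def
  proof (intro sum.cong refl integral_cong)
    fix c y assume c: "c \<in> C" and y: "y \<in> snd c ` fst c"
    have "inv_chart c y \<in> S" using y partition_mem[OF part c] chart_subset[of c] by auto
    then show "\<rho> c (inv_chart c y) * form_density P \<alpha> c (inv_chart c y) = \<rho> c (inv_chart c y) * form_density P \<beta> c (inv_chart c y)"
      using assms by (simp add: form_density_def)
  qed
qed

lemma form_integral_linear:
  assumes \<alpha>: "continuous_two_form S P \<alpha>" and \<beta>: "continuous_two_form S P \<beta>"
  shows "form_integral S P (\<lambda>p u v. k * (\<alpha> p u v - \<beta> p u v)) = k * (form_integral S P \<alpha> - form_integral S P \<beta>)"
proof -
  obtain C \<rho> where part: "partition_of_unity S P (C, \<rho>)" and e: "\<And>\<alpha>. form_integral S P \<alpha> = partition_integral P C \<rho> \<alpha>"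
    using form_integral_chosen by blast
  have "integral (snd c ` fst c) (\<lambda>y. \<rho> c (inv_chart c y) * form_density P (\<lambda>p u v. k * (\<alpha> p u v - \<beta> p u v)) c (inv_chart c y))
    = k * (integral (snd c ` fst c) (\<lambda>y. \<rho> c (inv_chart c y) * form_density P \<alpha> c (inv_chart c y))
       - integral (snd c ` fst c) (\<lambda>y. \<rho> c (inv_chart c y) * form_density P \<beta> c (inv_chart c y)))" if c: "c \<in> C" for c
  proof -
    have i: "(\<lambda>y. \<rho> c (inv_chart c y) * form_density P \<gamma> c (inv_chart c y)) integrable_on (snd c ` fst c)"
      if "continuous_two_form S P \<gamma>" for \<gamma>
      using set_lebesgue_integral_eq_integral(1)[OF integrable_chart[OF part c that continuous_on_const[of S 1]]] by simp
    have "integral (snd c ` fst c) (\<lambda>y. \<rho> c (inv_chart c y) * form_density P (\<lambda>p u v. k * (\<alpha> p u v - \<beta> p u v)) c (inv_chart c y))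
      = integral (snd c ` fst c) (\<lambda>y. k * (\<rho> c (inv_chart c y) * form_density P \<alpha> c (inv_chart c y)
         - \<rho> c (inv_chart c y) * form_density P \<beta> c (inv_chart c y)))"
      by (rule integral_cong) (simp add: form_density_def algebra_simps)
    then show ?thesis by (simp add: integral_diff[OF i[OF \<alpha>] i[OF \<beta>]])
  qed
  then show ?thesis unfolding e partition_integral_def by (simp add: sum_subtractf flip: sum_distrib_left)
qed

end

section \<open>Transport of a surface along a homeomorphism\<close>

definition push_chart :: "('a \<Rightarrow> 'b) \<Rightarrow> ('a, 'n) chart \<Rightarrow> ('b, 'n) chart" where
  "push_chart \<phi> s = (\<phi> ` fst s, snd s \<circ> inv_into (fst s) \<phi>)"

lemma push_atlas_eq: "push_atlas \<phi> P = push_chart \<phi> ` P"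
  by (simp add: push_atlas_def push_chart_def case_prod_beta)

locale pushed_surface = oriented_manifold S P
  for S :: "'a::topological_space set" and P :: "('a, 2) chart set" +
  fixes \<phi> :: "'a \<Rightarrow> 'b::topological_space" and S' and P'
  assumes hom: "homeomorphism S (\<phi> ` S) \<phi> (inv_into S \<phi>)"
    and S': "S' = \<phi> ` S" and P': "P' = push_atlas \<phi> P"
begin

lemma inj_\<phi>: "inj_on \<phi> S"
  by (rule inj_on_inverseI[of _ "inv_into S \<phi>"]) (simp add: homeomorphism_apply1[OF hom])

lemma fst_push: "fst (push_chart \<phi> s) = \<phi> ` fst s" by (simp add: push_chart_def)

lemma snd_push: "s \<in> P \<Longrightarrow> p \<in> fst s \<Longrightarrow> snd (push_chart \<phi> s) (\<phi> p) = snd s p"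
  using inj_on_subset[OF inj_\<phi> chart_subset] by (simp add: push_chart_def)

lemma push_range: "s \<in> P \<Longrightarrow> snd (push_chart \<phi> s) ` fst (push_chart \<phi> s) = snd s ` fst s"
  by (simp add: fst_push image_image snd_push cong: image_cong_simp)

lemma inj_push: "s \<in> P \<Longrightarrow> inj_on (snd (push_chart \<phi> s)) (fst (push_chart \<phi> s))"
  using inj_chart[of s] by (auto simp: fst_push snd_push inj_on_def)

lemma inv_push: 
  assumes "s \<in> P" "y \<in> snd s ` fst s"
  shows "inv_chart (push_chart \<phi> s) y = \<phi> (inv_chart s y)"
proof -
  obtain p where p: "p \<in> fst s" "y = snd s p" using assms by auto
  have "inv_chart (push_chart \<phi> s) (snd (push_chart \<phi> s) (\<phi> p)) = \<phi> p"
    by (rule inv_chart_chart[OF inj_push[OF assms(1)]]) (use p in \<open>simp add: fst_push\<close>)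
  then show ?thesis using p assms by (simp add: snd_push)
qed

lemma push_mem: "s \<in> P \<Longrightarrow> push_chart \<phi> s \<in> P'"
  by (simp add: P' push_atlas_eq)

lemma push_transition:
  assumes "s \<in> P" "t \<in> P"
  shows "\<phi> ` fst s \<inter> \<phi> ` fst t = \<phi> ` (fst s \<inter> fst t)"
    and "snd (push_chart \<phi> s) ` (\<phi> ` (fst s \<inter> fst t)) = snd s ` (fst s \<inter> fst t)"
    and "y \<in> snd s ` (fst s \<inter> fst t) \<Longrightarrow> snd (push_chart \<phi> t) (inv_chart (push_chart \<phi> s) y) = snd t (inv_chart s y)"
proof -
  show "\<phi> ` fst s \<inter> \<phi> ` fst t = \<phi> ` (fst s \<inter> fst t)"
    using inj_on_image_Int[OF inj_\<phi> chart_subset chart_subset] assms by simp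
  show "snd (push_chart \<phi> s) ` (\<phi> ` (fst s \<inter> fst t)) = snd s ` (fst s \<inter> fst t)"
    using assms by (auto simp: image_image snd_push intro!: image_cong)
  show "snd (push_chart \<phi> t) (inv_chart (push_chart \<phi> s) y) = snd t (inv_chart s y)"
    if "y \<in> snd s ` (fst s \<inter> fst t)"
    using that assms by (auto simp: inv_push snd_push)
qed

lemma push_chart_deriv:
  assumes "s \<in> P" "t \<in> P" "p \<in> fst s" "p \<in> fst t"
  shows "chart_deriv (push_chart \<phi> s) (push_chart \<phi> t) (\<lambda>q. q) (\<phi> p) = chart_deriv s t (\<lambda>q. q) p"
proof -
  have "eventually (\<lambda>y. y \<in> snd s ` (fst s \<inter> fst t)) (nhds (snd s p))"
    by (rule eventually_in_chart[OF assms(1,3) chart_openin[OF assms(2)] assms(4)])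
  then have "eventually (\<lambda>y. snd (push_chart \<phi> t) (inv_chart (push_chart \<phi> s) y) = snd t (inv_chart s y)) (nhds (snd s p))"
    by eventually_elim (rule push_transition(3)[OF assms(1,2)])
  from fd_cong(1)[OF this] show ?thesis
    using assms by (simp add: chart_deriv_def o_def snd_push)
qed

text \<open>The transition maps between pushed charts are those between the original charts, so
  smoothness and orientation are inherited.\<close>

lemma oriented_atlas_push: "oriented_atlas S' P'"
proof -
  have 1: "openin (top_of_set S') (\<phi> ` fst s)" if "s \<in> P" for s
    unfolding S' by (rule homeomorphism_imp_open_map[OF hom chart_openin[OF that]])
  have 2: "homeomorphism (\<phi> ` fst s) (snd s ` fst s) (snd (push_chart \<phi> s)) (inv_chart (push_chart \<phi> s))"
    if s: "s \<in> P" for s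
  proof -
    have "homeomorphism (\<phi> ` fst s) (fst s) (inv_into S \<phi>) \<phi>"
      using homeomorphism_symD[OF homeomorphism_of_subsets[OF hom chart_subset[OF s] _ refl, of "\<phi> ` fst s"]] chart_subset[OF s]
      by auto
    from homeomorphism_compose[OF this chart_homeomorphism[OF s]]
    show ?thesis
    proof (rule homeomorphism_cong)
      fix x assume "x \<in> \<phi> ` fst s"
      then show "snd (push_chart \<phi> s) x = (snd s \<circ> inv_into S \<phi>) x"
        using s chart_subset[OF s] homeomorphism_apply1[OF hom] by (auto simp: snd_push)
    qed (use inv_push[OF s] in auto)
  qed
  show ?thesis
    unfolding oriented_atlas_def
  proof (intro conjI)
    have "\<Union> (fst ` P) = S" using atlas by (simp add: oriented_atlas_def)
    then show "\<Union> (fst ` P') = S'" by (auto simp: P' push_atlas_eq S' fst_push image_iff) 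
    show "\<forall>(U, x)\<in>P'. openin (top_of_set S') U \<and> open (x ` U) \<and> homeomorphism U (x ` U) x (inv_into U x)"
    proof (clarify)
      fix U x assume "(U, x) \<in> P'"
      then obtain s where s: "s \<in> P" "(U, x) = push_chart \<phi> s" by (auto simp: P' push_atlas_eq)
      have Ux: "U = \<phi> ` fst s" "x = snd (push_chart \<phi> s)" "inv_into U x = inv_chart (push_chart \<phi> s)"
        using fst_conv[of U x] snd_conv[of U x] unfolding inv_chart_def s(2) fst_push by simp_all
      have "x ` U = snd s ` fst s" using push_range[OF s(1)] by (simp add: Ux fst_push)
      then show "openin (top_of_set S') U \<and> open (x ` U) \<and> homeomorphism U (x ` U) x (inv_into U x)"
        using 1[OF s(1)] 2[OF s(1)] open_chart_range[OF s(1)] Ux by simp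
    qed
    show "\<forall>(U, x)\<in>P'. \<forall>(V, y)\<in>P'. smooth_on (y \<circ> inv_into U x) (x ` (U \<inter> V)) \<and>
        (\<forall>p\<in>U \<inter> V. 0 < det (matrix (chart_deriv (U, x) (V, y) (\<lambda>q. q) p)))"
    proof (clarify)
      fix U x V y assume "(U, x) \<in> P'" "(V, y) \<in> P'"
      then obtain s t where s: "s \<in> P" "(U, x) = push_chart \<phi> s" and t: "t \<in> P" "(V, y) = push_chart \<phi> t"
        by (auto simp: P' push_atlas_eq)
      have Ux: "U = \<phi> ` fst s" "x = snd (push_chart \<phi> s)" "inv_into U x = inv_chart (push_chart \<phi> s)"
        using fst_conv[of U x] snd_conv[of U x] unfolding inv_chart_def s(2) fst_push by simp_all
      have Vy: "V = \<phi> ` fst t" "y = snd (push_chart \<phi> t)"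
        using fst_conv[of V y] snd_conv[of V y] unfolding t(2) fst_push by simp_all
      note Ux = Ux Vy
      have o: "open (snd s ` (fst s \<inter> fst t))" by (rule open_chart_image[OF s(1) chart_openin[OF t(1)]])
      have "smooth_on (\<lambda>z. snd (push_chart \<phi> t) (inv_chart (push_chart \<phi> s) z)) (snd s ` (fst s \<inter> fst t))"
        by (rule smooth_on_cong[OF transition_smooth[OF s(1) t(1)] o]) (rule push_transition(3)[OF s(1) t(1), symmetric])
      then have "smooth_on (y \<circ> inv_into U x) (x ` (U \<inter> V))"
        using push_transition(1,2)[OF s(1) t(1)] Ux by (simp add: o_def)
      moreover have "0 < det (matrix (chart_deriv (U, x) (V, y) (\<lambda>q. q) p))" if p: "p \<in> U \<inter> V" for p
      proof -
        obtain q where q: "q \<in> fst s" "q \<in> fst t" "p = \<phi> q" using p Ux push_transition(1)[OF s(1) t(1)] by auto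
        show ?thesis
          unfolding s(2) t(2) q(3) push_chart_deriv[OF s(1) t(1) q(1,2)] by (rule transition_det[OF s(1) t(1) q(1,2)])
      qed
      ultimately show "smooth_on (y \<circ> inv_into U x) (x ` (U \<inter> V)) \<and>
        (\<forall>p\<in>U \<inter> V. 0 < det (matrix (chart_deriv (U, x) (V, y) (\<lambda>q. q) p)))" by blast
    qed
  qed
qed

text \<open>In the charts \<open>s\<close> and \<open>push_chart \<phi> s\<close> the map
  \<open>\<phi>\<close> is the identity.\<close>

lemma push_chart_diff:
  assumes "s \<in> P" "p \<in> fst s"
  shows "chart_diff s (push_chart \<phi> s) \<phi> p" and "chart_deriv s (push_chart \<phi> s) \<phi> p v = v"
proof -
  have ev: "eventually (\<lambda>y. y \<in> snd s ` fst s) (nhds (snd s p))"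
    using open_chart_range[OF assms(1)] assms(2) by (intro eventually_nhds_in_open) auto
  then have ev': "eventually (\<lambda>y. (snd (push_chart \<phi> s) \<circ> \<phi> \<circ> inv_chart s) y = y) (nhds (snd s p))"
    by eventually_elim (use assms in \<open>auto simp: snd_push\<close>)
  show "chart_diff s (push_chart \<phi> s) \<phi> p"
    unfolding chart_diff_def
  proof (intro conjI assms(2) inj_chart[OF assms(1)] inj_push[OF assms(1)])
    show "\<forall>\<^sub>F y in nhds (snd s p). y \<in> snd s ` fst s \<and> \<phi> (inv_chart s y) \<in> fst (push_chart \<phi> s)"
      using ev by eventually_elim (use assms in \<open>auto simp: fst_push\<close>)
    show "(snd (push_chart \<phi> s) \<circ> \<phi> \<circ> inv_chart s) differentiable at (snd s p)"
      unfolding fd_cong(2)[OF ev'] by (rule differentiable_ident)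
  qed
  show "chart_deriv s (push_chart \<phi> s) \<phi> p v = v"
    unfolding chart_deriv_def fd_cong(1)[OF ev'] by (simp add: fd_eq[OF has_derivative_ident])
qed

end

text \<open>
  Charts that differ off their domains can have the same image under \<open>push_chart\<close>, so a chart of \<open>S\<close> has to be
  chosen for every chart in the partition of unity of the image.
\<close>

lemma form_integral_push:
  fixes S :: "'a::t2_space set" and \<phi> :: "'a \<Rightarrow> 'b::t2_space"
  assumes "pushed_surface S P \<phi> S' P'" and comp: "compact S"
    and \<alpha>: "continuous_two_form S P \<alpha>"
    and eq: "\<And>s p. s \<in> P \<Longrightarrow> p \<in> fst s \<Longrightarrow> form_density P' \<alpha>' (push_chart \<phi> s) (\<phi> p) = form_density P \<alpha> s p"
  shows "form_integral S' P' \<alpha>' = form_integral S P \<alpha>"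
proof -
  interpret pushed_surface S P \<phi> S' P' by fact
  interpret cs: compact_surface S P by unfold_locales (rule comp)
  have contS: "continuous_on S \<phi>" using hom by (simp add: homeomorphism_def)
  interpret cs': compact_surface S' P'
  proof unfold_locales
    show "oriented_atlas S' P'" by (rule oriented_atlas_push)
    show "compact S'" unfolding S' by (rule compact_continuous_image[OF contS comp])
  qed
  obtain C' \<rho>' where part: "partition_of_unity S' P' (C', \<rho>')"
    and e: "\<And>\<alpha>. form_integral S' P' \<alpha> = partition_integral P' C' \<rho>' \<alpha>"
    using cs'.form_integral_chosen by blast
  have "\<exists>s. s \<in> P \<and> push_chart \<phi> s = c" if "c \<in> C'" for c
  proof -
    have "C' \<subseteq> push_chart \<phi> ` P"
      using part unfolding partition_of_unity_def P' push_atlas_eq by simp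
    with that have "c \<in> push_chart \<phi> ` P" by (rule rev_subsetD)
    then obtain s where "s \<in> P" "c = push_chart \<phi> s" by (rule imageE)
    then show ?thesis by (intro exI[of _ s]) simp
  qed
  then obtain t where t: "\<And>c. c \<in> C' \<Longrightarrow> t c \<in> P" "\<And>c. c \<in> C' \<Longrightarrow> push_chart \<phi> (t c) = c" by metis
  have inj_t: "inj_on t C'" using t(2) by (metis inj_onI)
  define C where "C = t ` C'"
  define \<rho> where "\<rho> c q = \<rho>' (push_chart \<phi> c) (\<phi> q)" for c q
  have fin: "finite C'" using part by (auto simp: partition_of_unity_def)
  have "partition_of_unity S P (C, \<rho>)"
    unfolding partition_of_unity_def prod.case
  proof (intro conjI ballI)
    show "finite C" using fin by (simp add: C_def)
    show "C \<subseteq> P" using t by (auto simp: C_def)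
    fix c assume "c \<in> C"
    then obtain c' where c': "c' \<in> C'" "c = t c'" by (auto simp: C_def)
    have cont': "continuous_on S' (\<rho>' c')" and pos: "\<And>p. p \<in> S' \<Longrightarrow> 0 \<le> \<rho>' c' p"
      and cl: "S' \<inter> closure {p \<in> S'. \<rho>' c' p \<noteq> 0} \<subseteq> fst c'"
      using part c' by (auto simp: partition_of_unity_def)
    have \<rho>c: "\<rho> c = (\<lambda>q. \<rho>' c' (\<phi> q))" using t(2)[OF c'(1)] c'(2) by (intro ext) (simp add: \<rho>_def)
    show "continuous_on S (\<rho> c)" unfolding \<rho>c
      by (rule continuous_on_compose2[OF cont' contS]) (simp add: S')
    show "0 \<le> \<rho> c p" if "p \<in> S" for p unfolding \<rho>c using pos that by (simp add: S')
    show "S \<inter> closure {p \<in> S. \<rho> c p \<noteq> 0} \<subseteq> fst c"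
    proof
      fix p assume p: "p \<in> S \<inter> closure {p \<in> S. \<rho> c p \<noteq> 0}"
      \<comment> \<open>Compactness of \<open>S\<close> keeps the closure of the support inside
        \<open>S\<close>, where \<open>\<phi>\<close> is continuous and carries it into the closure
        of the support on the image.\<close>
      have sub: "closure {p \<in> S. \<rho> c p \<noteq> 0} \<subseteq> S"
        by (rule closure_minimal) (auto intro: compact_imp_closed comp)
      have "\<phi> ` closure {p \<in> S. \<rho> c p \<noteq> 0} \<subseteq> closure {p \<in> S'. \<rho>' c' p \<noteq> 0}"
        by (rule image_closure_subset[OF continuous_on_subset[OF contS sub] closed_closure])
          (use closure_subset in \<open>force simp: \<rho>c S'\<close>)
      then have "\<phi> p \<in> fst c'" using cl p by (auto simp: S')
      then have "\<phi> p \<in> \<phi> ` fst c" using t c' fst_push by metis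
      then show "p \<in> fst c" using p inj_\<phi> chart_subset[OF t(1)[OF c'(1)]] c' by (auto simp: inj_on_def)
    qed
  next
    fix p assume p: "p \<in> S"
    have "(\<Sum>c\<in>C. \<rho> c p) = (\<Sum>c'\<in>C'. \<rho>' c' (\<phi> p))"
      unfolding C_def by (subst sum.reindex[OF inj_t]) (simp add: \<rho>_def t)
    also have "\<dots> = 1" using part p by (auto simp: partition_of_unity_def S')
    finally show "(\<Sum>c\<in>C. \<rho> c p) = 1" .
  qed
  \<comment> \<open>Independence of the partition enters here: the partition selected for
    \<open>S\<close> need not correspond to the one selected for the image.\<close>
  from cs.form_integral_eq[OF this \<alpha>]
  have "form_integral S P \<alpha> = (\<Sum>c'\<in>C'. integral (snd (t c') ` fst (t c'))
     (\<lambda>y. \<rho> (t c') (inv_chart (t c') y) * form_density P \<alpha> (t c') (inv_chart (t c') y)))"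
    unfolding partition_integral_def C_def by (simp add: sum.reindex[OF inj_t])
  also have "\<dots> = partition_integral P' C' \<rho>' \<alpha>'"
    unfolding partition_integral_def
  proof (rule sum.cong[OF refl])
    fix c' assume c': "c' \<in> C'"
    note tc = t[OF c']
    have r: "snd c' ` fst c' = snd (t c') ` fst (t c')" using push_range[OF tc(1)] tc(2) by simp
    show "integral (snd (t c') ` fst (t c')) (\<lambda>y. \<rho> (t c') (inv_chart (t c') y) * form_density P \<alpha> (t c') (inv_chart (t c') y))
      = integral (snd c' ` fst c') (\<lambda>y. \<rho>' c' (inv_chart c' y) * form_density P' \<alpha>' c' (inv_chart c' y))"
      unfolding r
    proof (rule integral_cong)
      fix y assume y: "y \<in> snd (t c') ` fst (t c')"
      have i: "inv_chart c' y = \<phi> (inv_chart (t c') y)" using inv_push[OF tc(1) y] tc(2) by simp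
      have "inv_chart (t c') y \<in> fst (t c')" using y tc by auto
      from eq[OF tc(1) this]
      show "\<rho> (t c') (inv_chart (t c') y) * form_density P \<alpha> (t c') (inv_chart (t c') y) =
        \<rho>' c' (inv_chart c' y) * form_density P' \<alpha>' c' (inv_chart c' y)"
        by (simp add: i \<rho>_def tc)
    qed
  qed
  finally show ?thesis by (simp add: e)
qed

section \<open>The Chen--Nester--Tung form in a frame\<close>

lemma four_eq_zero: "(4::4) = 0" by simp

lemma UNIV_4_zero: "(UNIV :: 4 set) = {0, 1, 2, 3}"
  using UNIV_4 four_eq_zero by auto

lemma sum_4_zero: "sum f (UNIV :: 4 set) = f 0 + f 1 + f 2 + f 3"
  unfolding UNIV_4_zero by (simp add: add.assoc)

lemma det_4:
  "det (A :: 'a::comm_ring_1^4^4) =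
     A$0$0 * (A$1$1 * (A$2$2 * A$3$3 - A$2$3 * A$3$2) - A$1$2 * (A$2$1 * A$3$3 - A$2$3 * A$3$1) + A$1$3 * (A$2$1 * A$3$2 - A$2$2 * A$3$1))
   - A$0$1 * (A$1$0 * (A$2$2 * A$3$3 - A$2$3 * A$3$2) - A$1$2 * (A$2$0 * A$3$3 - A$2$3 * A$3$0) + A$1$3 * (A$2$0 * A$3$2 - A$2$2 * A$3$0))
   + A$0$2 * (A$1$0 * (A$2$1 * A$3$3 - A$2$3 * A$3$1) - A$1$1 * (A$2$0 * A$3$3 - A$2$3 * A$3$0) + A$1$3 * (A$2$0 * A$3$1 - A$2$1 * A$3$0))
   - A$0$3 * (A$1$0 * (A$2$1 * A$3$2 - A$2$2 * A$3$1) - A$1$1 * (A$2$0 * A$3$2 - A$2$2 * A$3$0) + A$1$2 * (A$2$0 * A$3$1 - A$2$1 * A$3$0))"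
proof -
  have f0123: "finite {1::4, 2, 3}" "0 \<notin> {1::4, 2, 3}" by auto
  have f123: "finite {2::4, 3}" "1 \<notin> {2::4, 3}" by auto
  have f23: "finite {3::4}" "2 \<notin> {3::4}" by auto
  show ?thesis
    unfolding det_def UNIV_4_zero
    unfolding sum_over_permutations_insert[OF f0123]
    unfolding sum_over_permutations_insert[OF f123]
    unfolding sum_over_permutations_insert[OF f23]
    unfolding permutes_sing
    by (simp add: sign_swap_id permutation_swap_id permutation_compose sign_compose sign_id swap_id_eq
        transpose_apply_other Transposition.transpose_def algebra_simps)
qed

text \<open>In the Leibniz expansion only the permutation equal to \<open>f\<close> contributes, and
  there is none if \<open>f\<close> is not injective.\<close>

lemma det_axis_rows:
  fixes f :: "'n::finite \<Rightarrow> 'n"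
  shows "det (\<chi> i. axis (f i) 1 :: real^'n^'n) = (if inj f then of_int (sign f) else 0)"
proof -
  have *: "(\<Prod>i\<in>UNIV. (axis (f i) 1 :: real^'n) $ p i) = (if p = f then 1 else 0)" for p
  proof (cases "p = f")
    case False
    then obtain i where "p i \<noteq> f i" by auto
    then have "(axis (f i) 1 :: real^'n) $ p i = 0" by (simp add: axis_def)
    then have "(\<Prod>i\<in>UNIV. (axis (f i) 1 :: real^'n) $ p i) = 0" by (intro prod_zero) auto
    with False show ?thesis by simp
  qed simp
  have "det (\<chi> i. axis (f i) 1 :: real^'n^'n) =
      (\<Sum>p\<in>{p. p permutes UNIV}. if p = f then of_int (sign p) else 0)"
    unfolding det_def by (intro sum.cong refl) (simp add: *)
  also have "\<dots> = (if f permutes UNIV then of_int (sign f) else 0)"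
    by (simp add: sum.delta' finite_permutations)
  also have "f permutes UNIV \<longleftrightarrow> inj f"
    by (auto simp: permutes_bij bij_def finite_UNIV_inj_surj permutes_inj intro: bij_imp_permutes)
  finally show ?thesis .
qed

definition det4 :: "real^4 \<Rightarrow> real^4 \<Rightarrow> real^4 \<Rightarrow> real^4 \<Rightarrow> real" where
  "det4 x y u v = det (\<chi> i. list4 x y u v i)"

lemma det4_explicit:
  "det4 x y u v =
     x$0 * (y$1 * (u$2 * v$3 - u$3 * v$2) - y$2 * (u$1 * v$3 - u$3 * v$1) + y$3 * (u$1 * v$2 - u$2 * v$1))
   - x$1 * (y$0 * (u$2 * v$3 - u$3 * v$2) - y$2 * (u$0 * v$3 - u$3 * v$0) + y$3 * (u$0 * v$2 - u$2 * v$0))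
   + x$2 * (y$0 * (u$1 * v$3 - u$3 * v$1) - y$1 * (u$0 * v$3 - u$3 * v$0) + y$3 * (u$0 * v$1 - u$1 * v$0))
   - x$3 * (y$0 * (u$1 * v$2 - u$2 * v$1) - y$1 * (u$0 * v$2 - u$2 * v$0) + y$2 * (u$0 * v$1 - u$1 * v$0))"
  by (simp add: det4_def det_4 list4_def)

text \<open>Reading the symbol as a determinant of basis vectors turns the index sums in
  \<open>eta_form\<close> into values of one multilinear form.\<close>

lemma levi_civita_symbol_det: "levi_civita_symbol a b c d = det4 (axis a 1) (axis b 1) (axis c 1) (axis d 1)"
proof -
  have "(\<chi> i. axis (list4 a b c d i) 1 :: real^4^4) = (\<chi> i. list4 (axis a 1) (axis b 1) (axis c 1) (axis d 1) i)"
    by (simp add: list4_def vec_eq_iff)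
  then show ?thesis
    using det_axis_rows[of "list4 a b c d"] by (simp add: levi_civita_symbol_def det4_def)
qed

lemma det4_linear:
  "linear (\<lambda>x. det4 x y u v)" "linear (\<lambda>y. det4 x y u v)" "bilinear (det4 x y)"
  unfolding bilinear_def by (auto intro!: linearI simp: det4_explicit algebra_simps)

lemma det4_swap: "det4 x y v u = - det4 x y u v"
  by (simp add: det4_explicit algebra_simps)

lemma linear_sum_axis:
  fixes f :: "real^'n \<Rightarrow> real"
  assumes "linear f" shows "(\<Sum>a\<in>UNIV. x $ a * f (axis a 1)) = f x"
proof -
  have "f (\<Sum>a\<in>UNIV. x $ a *\<^sub>R axis a 1) = (\<Sum>a\<in>UNIV. x $ a * f (axis a 1))"
    by (simp add: linear_sum[OF assms] linear_cmul[OF assms])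
  then show ?thesis using basis_expansion[of x] by (simp add: scalar_mult_eq_scaleR)
qed

lemma det4_matrix: "det4 (B *v x) (B *v y) (B *v u) (B *v v) = det B * det4 x y u v"
proof -
  have "(\<chi> i. list4 (B *v x) (B *v y) (B *v u) (B *v v) i) = (\<chi> i. list4 x y u v i) ** transpose B"
    by (simp add: vec_eq_iff matrix_matrix_mult_def matrix_vector_mult_def transpose_def list4_def mult.commute)
  then show ?thesis by (simp add: det4_def det_mul)
qed

section \<open>The contraction of an endomorphism with eta and its frame independence\<close>

definition frame_matrix :: "(4 \<Rightarrow> real^4) \<Rightarrow> real^4^4" where
  "frame_matrix e = (\<chi> i b. e b $ i)"

definition gram_matrix :: "(real^4 \<Rightarrow> real^4 \<Rightarrow> real) \<Rightarrow> (4 \<Rightarrow> real^4) \<Rightarrow> real^4^4" where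
  "gram_matrix h e = (\<chi> c d. h (e c) (e d))"

lemma coframe_eq: "coframe e a u = (matrix_inv (frame_matrix e) *v u) $ a"
  by (simp add: coframe_def frame_matrix_def)

text \<open>The sum over \<open>\<mu>\<close> and \<open>\<nu>\<close> alternates in
  \<open>u\<close> and \<open>v\<close> and so counts the determinant twice, which the factor 1/2 in
  \<open>eta_form\<close> compensates.\<close>

lemma eta_form_det4:
  "eta_form h e a b u v = sqrt (- det (gram_matrix h e)) *
     (\<Sum>\<beta>\<in>UNIV. matrix_inv (gram_matrix h e) $ b $ \<beta> *
       det4 (axis a 1) (axis \<beta> 1) (matrix_inv (frame_matrix e) *v u) (matrix_inv (frame_matrix e) *v v))"
proof -
  let ?\<theta> = "\<lambda>u. matrix_inv (frame_matrix e) *v u"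
  let ?G = "gram_matrix h e"
  have "(\<Sum>\<mu>\<in>UNIV. \<Sum>\<nu>\<in>UNIV. levi_civita_symbol a \<beta> \<mu> \<nu> * (coframe e \<mu> u * coframe e \<nu> v - coframe e \<mu> v * coframe e \<nu> u))
      = 2 * det4 (axis a 1) (axis \<beta> 1) (?\<theta> u) (?\<theta> v)" for \<beta>
  proof -
    have *: "det4 (axis a 1) (axis \<beta> 1) (?\<theta> u) (?\<theta> v)
      = (\<Sum>\<mu>\<in>UNIV. \<Sum>\<nu>\<in>UNIV. levi_civita_symbol a \<beta> \<mu> \<nu> * (coframe e \<mu> u * coframe e \<nu> v))" for u v
      by (subst bilinear_sum_components[OF det4_linear(3)]) (simp add: levi_civita_symbol_det coframe_eq mult.commute)
    show ?thesis
      using *[of u v] *[of v u] det4_swap[of "axis a 1" "axis \<beta> 1" "?\<theta> v" "?\<theta> u"]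
      by (simp add: right_diff_distrib sum_subtractf)
  qed
  then have "(\<Sum>\<mu>\<in>UNIV. \<Sum>\<nu>\<in>UNIV. matrix_inv ?G $ b $ \<beta> * levi_civita_symbol a \<beta> \<mu> \<nu> *
        (coframe e \<mu> u * coframe e \<nu> v - coframe e \<mu> v * coframe e \<nu> u))
      = matrix_inv ?G $ b $ \<beta> * (2 * det4 (axis a 1) (axis \<beta> 1) (?\<theta> u) (?\<theta> v))" for \<beta>
    by (simp add: mult.assoc flip: sum_distrib_left)
  then show ?thesis
    unfolding eta_form_def Let_def gram_matrix_def[symmetric]
    by (simp add: sum_distrib_left)
qed

text \<open>The contraction \<open>D\<^sup>a\<^sub>b \<eta>\<^sub>a\<^sup>b\<close> with
  \<open>n\<close> and \<open>v\<close> inserted, for the endomorphism \<open>D\<close> belonging to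
  one direction. The wedge product in \<open>cnt_form\<close> is the alternation of this expression
  in two surface directions.\<close>

definition connection_eta_trace ::
    "(real^4 \<Rightarrow> real^4 \<Rightarrow> real) \<Rightarrow> (4 \<Rightarrow> real^4) \<Rightarrow> (real^4 \<Rightarrow> real^4) \<Rightarrow> real^4 \<Rightarrow> real^4 \<Rightarrow> real" where
  "connection_eta_trace h e D n v = (\<Sum>a\<in>UNIV. \<Sum>b\<in>UNIV. coframe e a (D (e b)) * eta_form h e a b n v)"

text \<open>Summation over \<open>a\<close> moves the endomorphism into the first slot of the
  determinant. The result is the \<open>h\<close>-trace over \<open>x\<close> and \<open>y\<close>
  of the volume form at \<open>D x\<close>, \<open>y\<close>, \<open>n\<close>, \<open>v\<close>, in
  components with respect to \<open>e\<close>.\<close>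

lemma connection_eta_trace_det4:
  "connection_eta_trace h e D n v = sqrt (- det (gram_matrix h e)) *
     (\<Sum>b\<in>UNIV. \<Sum>\<beta>\<in>UNIV. matrix_inv (gram_matrix h e) $ b $ \<beta> *
       det4 (matrix_inv (frame_matrix e) *v D (e b)) (axis \<beta> 1)
         (matrix_inv (frame_matrix e) *v n) (matrix_inv (frame_matrix e) *v v))"
proof -
  let ?\<theta> = "\<lambda>u. matrix_inv (frame_matrix e) *v u"
  let ?G = "gram_matrix h e"
  have "connection_eta_trace h e D n v = (\<Sum>b\<in>UNIV. \<Sum>a\<in>UNIV. ?\<theta> (D (e b)) $ a * (sqrt (- det ?G) *
     (\<Sum>\<beta>\<in>UNIV. matrix_inv ?G $ b $ \<beta> * det4 (axis a 1) (axis \<beta> 1) (?\<theta> n) (?\<theta> v))))"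
    unfolding connection_eta_trace_def eta_form_det4 coframe_eq by (rule sum.swap)
  also have "\<dots> = (\<Sum>b\<in>UNIV. sqrt (- det ?G) *
     (\<Sum>\<beta>\<in>UNIV. matrix_inv ?G $ b $ \<beta> * (\<Sum>a\<in>UNIV. ?\<theta> (D (e b)) $ a * det4 (axis a 1) (axis \<beta> 1) (?\<theta> n) (?\<theta> v))))"
  proof (rule sum.cong[OF refl])
    fix b
    show "(\<Sum>a\<in>UNIV. ?\<theta> (D (e b)) $ a * (sqrt (- det ?G) *
       (\<Sum>\<beta>\<in>UNIV. matrix_inv ?G $ b $ \<beta> * det4 (axis a 1) (axis \<beta> 1) (?\<theta> n) (?\<theta> v)))) = sqrt (- det ?G) *
       (\<Sum>\<beta>\<in>UNIV. matrix_inv ?G $ b $ \<beta> * (\<Sum>a\<in>UNIV. ?\<theta> (D (e b)) $ a * det4 (axis a 1) (axis \<beta> 1) (?\<theta> n) (?\<theta> v)))"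
      unfolding sum_distrib_left by (subst sum.swap) (simp add: mult_ac)
  qed
  finally show ?thesis unfolding linear_sum_axis[OF det4_linear(1)] by (simp add: sum_distrib_left)
qed

lemma gram_matrix_frame:
  assumes "bilinear h"
  shows "gram_matrix h e = transpose (frame_matrix e) ** (gram_matrix h (\<lambda>i. axis i 1) ** frame_matrix e)"
proof -
  have "h (e c) (e d) = (\<Sum>i\<in>UNIV. e c $ i * (\<Sum>j\<in>UNIV. h (axis i 1) (axis j 1) * e d $ j))" for c d
    unfolding bilinear_sum_components[OF assms, of "e c"] by (simp add: sum_distrib_left mult_ac)
  then show ?thesis
    by (simp add: vec_eq_iff gram_matrix_def frame_matrix_def matrix_matrix_mult_def transpose_def)
qed

lemma matrix_inv_right: "invertible A \<Longrightarrow> A ** matrix_inv A = mat 1"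
  and matrix_inv_left: "invertible A \<Longrightarrow> matrix_inv A ** A = mat 1"
  for A :: "'a::semiring_1^'n^'m"
  using someI_ex[of "\<lambda>A'. A ** A' = mat 1 \<and> A' ** A = mat 1"]
  by (auto simp: invertible_def matrix_inv_def)

text \<open>The tensor law of the inverse metric: \<open>E\<close> holds the frame vectors as
  columns and \<open>H\<close> the metric in coordinates.\<close>

lemma matrix_inv_congruence:
  fixes H E :: "real^'n^'n"
  assumes "invertible H" "invertible E"
  shows "E ** (matrix_inv (transpose E ** (H ** E)) ** transpose E) = matrix_inv H"
proof -
  let ?G = "transpose E ** (H ** E)"
  have "invertible ?G" using assms by (simp add: invertible_det_nz det_mul)
  then have G: "matrix_inv ?G ** ?G = mat 1" by (simp add: matrix_inv_left)
  have E: "E ** matrix_inv E = mat 1" by (rule matrix_inv_right[OF assms(2)])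
  have H: "H ** matrix_inv H = mat 1" by (rule matrix_inv_right[OF assms(1)])
  let ?K = "E ** (matrix_inv ?G ** transpose E)"
  have "?K ** H = ?K ** H ** (E ** matrix_inv E)" by (simp add: E)
  also have "\<dots> = E ** (matrix_inv ?G ** ?G) ** matrix_inv E" by (simp add: matrix_mul_assoc)
  also have "\<dots> = mat 1" by (simp add: G E)
  finally have "?K ** H = mat 1" .
  then have "?K ** (H ** matrix_inv H) = matrix_inv H" by (simp add: matrix_mul_assoc)
  then show ?thesis by (simp add: H)
qed

lemma sum_swap_pairs:
  "(\<Sum>b\<in>A. \<Sum>c\<in>B. \<Sum>i\<in>I. \<Sum>j\<in>J. f b c i j) = (\<Sum>i\<in>I. \<Sum>j\<in>J. \<Sum>b\<in>A. \<Sum>c\<in>B. f b c i j)"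
proof -
  have "(\<Sum>b\<in>A. \<Sum>c\<in>B. \<Sum>i\<in>I. \<Sum>j\<in>J. f b c i j) = (\<Sum>b\<in>A. \<Sum>i\<in>I. \<Sum>j\<in>J. \<Sum>c\<in>B. f b c i j)"
    by (rule sum.cong[OF refl], subst sum.swap, rule sum.cong[OF refl], rule sum.swap)
  also have "\<dots> = (\<Sum>i\<in>I. \<Sum>j\<in>J. \<Sum>b\<in>A. \<Sum>c\<in>B. f b c i j)"
    by (subst sum.swap, rule sum.cong[OF refl], rule sum.swap)
  finally show ?thesis .
qed

lemma if_zero_mult:
  fixes x y :: real
  shows "(if b then x else 0) * y = (if b then x * y else 0)" "y * (if b then x else 0) = (if b then y * x else 0)"
  by simp_all

text \<open>Passing to frame components divides the determinant by \<open>det E\<close> and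
  multiplies the root of the Gram determinant by \<open>\<bar>det E\<bar>\<close>; for a positive
  basis the product is unchanged. With the tensor law of the inverse metric, the value is expressed
  through the standard basis alone.\<close>

lemma connection_eta_trace_invariant:
  assumes h: "bilinear h" "det (gram_matrix h (\<lambda>i. axis i 1)) \<noteq> 0" and e: "positive_basis e" and D: "linear D"
  shows "connection_eta_trace h e D n v = sqrt (- det (gram_matrix h (\<lambda>i. axis i 1))) *
     (\<Sum>i\<in>UNIV. \<Sum>j\<in>UNIV. matrix_inv (gram_matrix h (\<lambda>i. axis i 1)) $ i $ j * det4 (D (axis i 1)) (axis j 1) n v)"
proof -
  define E where "E = frame_matrix e"
  define H where "H = gram_matrix h (\<lambda>i. axis i 1)"
  define G where "G = gram_matrix h e"
  have detE: "det E > 0" using e by (simp add: E_def frame_matrix_def positive_basis_def)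
  have invE: "invertible E" using detE by (simp add: invertible_det_nz)
  have invH: "invertible H" using h by (simp add: invertible_det_nz H_def)
  have G: "G = transpose E ** (H ** E)" unfolding G_def E_def H_def by (rule gram_matrix_frame[OF h(1)])
  have EE: "matrix_inv E ** E = mat 1" by (rule matrix_inv_left[OF invE])
  have detEi: "det (matrix_inv E) * det E = 1" using arg_cong[OF EE, of det] by (simp add: det_mul)
  have ax: "matrix_inv E *v e \<beta> = axis \<beta> 1" for \<beta>
  proof -
    have "e \<beta> = E *v axis \<beta> 1" by (simp add: E_def frame_matrix_def vec_eq_iff matrix_vector_mult_basis column_def)
    then show ?thesis by (simp add: matrix_vector_mul_assoc EE)
  qed
  have m: "bilinear (\<lambda>x y. det4 (D x) y n v)"
    unfolding bilinear_def using linear_compose[OF D det4_linear(1)] det4_linear(2) by (simp add: o_def)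
  have "(\<Sum>b\<in>UNIV. \<Sum>\<beta>\<in>UNIV. matrix_inv G $ b $ \<beta> * det4 (D (e b)) (e \<beta>) n v)
     = (\<Sum>i\<in>UNIV. \<Sum>j\<in>UNIV. (E ** (matrix_inv G ** transpose E)) $ i $ j * det4 (D (axis i 1)) (axis j 1) n v)"
  proof -
    have "(\<Sum>b\<in>UNIV. \<Sum>\<beta>\<in>UNIV. matrix_inv G $ b $ \<beta> * det4 (D (e b)) (e \<beta>) n v)
      = (\<Sum>b\<in>UNIV. \<Sum>\<beta>\<in>UNIV. \<Sum>i\<in>UNIV. \<Sum>j\<in>UNIV. E $ i $ b * (matrix_inv G $ b $ \<beta> * E $ j $ \<beta>) * det4 (D (axis i 1)) (axis j 1) n v)"
      unfolding bilinear_sum_components[OF m, of "e _"] sum_distrib_left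
      by (simp add: E_def frame_matrix_def mult_ac)
    also have "\<dots> = (\<Sum>i\<in>UNIV. \<Sum>j\<in>UNIV. \<Sum>b\<in>UNIV. \<Sum>\<beta>\<in>UNIV. E $ i $ b * (matrix_inv G $ b $ \<beta> * E $ j $ \<beta>) * det4 (D (axis i 1)) (axis j 1) n v)"
      by (rule sum_swap_pairs)
    also have "\<dots> = (\<Sum>i\<in>UNIV. \<Sum>j\<in>UNIV. (E ** (matrix_inv G ** transpose E)) $ i $ j * det4 (D (axis i 1)) (axis j 1) n v)"
      by (simp add: matrix_matrix_mult_def transpose_def sum_distrib_left sum_distrib_right)
    finally show ?thesis .
  qed
  also have "E ** (matrix_inv G ** transpose E) = matrix_inv H"
    unfolding G by (rule matrix_inv_congruence[OF invH invE])
  finally have S: "(\<Sum>b\<in>UNIV. \<Sum>\<beta>\<in>UNIV. matrix_inv G $ b $ \<beta> * det4 (D (e b)) (e \<beta>) n v)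
     = (\<Sum>i\<in>UNIV. \<Sum>j\<in>UNIV. matrix_inv H $ i $ j * det4 (D (axis i 1)) (axis j 1) n v)" .
  have "connection_eta_trace h e D n v = sqrt (- det G) *
     (\<Sum>b\<in>UNIV. \<Sum>\<beta>\<in>UNIV. matrix_inv G $ b $ \<beta> *
       det4 (matrix_inv E *v D (e b)) (matrix_inv E *v e \<beta>) (matrix_inv E *v n) (matrix_inv E *v v))"
    unfolding connection_eta_trace_det4 ax E_def[symmetric] G_def[symmetric] ..
  also have "\<dots> = sqrt (- det G) * det (matrix_inv E) *
     (\<Sum>b\<in>UNIV. \<Sum>\<beta>\<in>UNIV. matrix_inv G $ b $ \<beta> * det4 (D (e b)) (e \<beta>) n v)"
    unfolding det4_matrix by (simp add: sum_distrib_left mult_ac)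
  also have "sqrt (- det G) * det (matrix_inv E) = sqrt (- det H)"
  proof -
    have "- det G = (det E)\<^sup>2 * - det H" unfolding G by (simp add: det_mul power2_eq_square)
    then have "sqrt (- det G) = sqrt ((det E)\<^sup>2) * sqrt (- det H)" by (simp only: real_sqrt_mult)
    then have "sqrt (- det G) = det E * sqrt (- det H)" using detE by simp
    then show ?thesis using detEi by (simp add: mult_ac)
  qed
  finally show ?thesis unfolding S H_def .
qed

section \<open>Evaluation in an orthonormal frame\<close>

definition lorentz_sign :: "4 \<Rightarrow> real" where "lorentz_sign a = (if a = 0 then -1 else 1)"

locale lorentz_frame =
  fixes h :: "real^4 \<Rightarrow> real^4 \<Rightarrow> real" and f :: "4 \<Rightarrow> real^4"
  assumes h: "bilinear h" "h x y = h y x"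
    and ortho: "h (f a) (f b) = (if a = b then lorentz_sign a else 0)"
begin

lemma gram_f: "gram_matrix h f = (\<chi> a b. if a = b then lorentz_sign a else 0)"
  by (simp add: gram_matrix_def ortho)

lemma det_gram_f: "det (gram_matrix h f) = -1"
proof -
  have "det (gram_matrix h f) = (\<Prod>i\<in>UNIV. gram_matrix h f $ i $ i)"
    by (rule det_diagonal) (simp add: gram_f)
  also have "\<dots> = -1" unfolding gram_f UNIV_4_zero by (simp add: lorentz_sign_def)
  finally show ?thesis .
qed

lemma det_gram_axis: "det (gram_matrix h (\<lambda>i. axis i 1)) \<noteq> 0"
  using det_gram_f unfolding gram_matrix_frame[OF h(1), of f] by (auto simp: det_mul)

lemma invertible_f: "invertible (frame_matrix f)"
  using det_gram_f unfolding gram_matrix_frame[OF h(1), of f] by (auto simp: det_mul invertible_det_nz)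

text \<open>A diagonal matrix of signs is its own inverse.\<close>

lemma gram_f_inv: "matrix_inv (gram_matrix h f) = gram_matrix h f"
proof -
  let ?G = "gram_matrix h f"
  have GG: "?G ** ?G = mat 1"
    unfolding gram_f by (simp add: vec_eq_iff forall_4 sum_4_zero matrix_matrix_mult_def mat_def lorentz_sign_def)
  have inv: "invertible ?G" using GG invertible_def by blast
  have "matrix_inv ?G ** (?G ** ?G) = ?G" using matrix_inv_left[OF inv] by (simp add: matrix_mul_assoc)
  then show ?thesis by (simp add: GG)
qed

lemma expand: "x = (\<Sum>b\<in>UNIV. (lorentz_sign b * h (f b) x) *\<^sub>R f b)"
  and coframe_f: "matrix_inv (frame_matrix f) *v x = (\<chi> b. lorentz_sign b * h (f b) x)"
proof -
  let ?c = "matrix_inv (frame_matrix f) *v x"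
  have "(\<Sum>b\<in>UNIV. c $ b *\<^sub>R f b) = frame_matrix f *v c" for c
    by (simp add: vec_eq_iff matrix_vector_mult_def frame_matrix_def mult.commute)
  then have x: "(\<Sum>b\<in>UNIV. ?c $ b *\<^sub>R f b) = x"
    by (simp add: matrix_vector_mul_assoc matrix_inv_right[OF invertible_f])
  have l: "linear (h y)" for y using h by (simp add: bilinear_def)
  have "h (f a) x = lorentz_sign a * ?c $ a" for a
  proof -
    have "h (f a) (\<Sum>b\<in>UNIV. ?c $ b *\<^sub>R f b) = lorentz_sign a * ?c $ a"
    proof -
      have "h (f a) (\<Sum>b\<in>UNIV. ?c $ b *\<^sub>R f b) = (\<Sum>b\<in>UNIV. ?c $ b * h (f a) (f b))"
        by (simp only: linear_sum[OF l] linear_cmul[OF l] real_scaleR_def)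
      also have "\<dots> = (\<Sum>b\<in>UNIV. if a = b then ?c $ b * lorentz_sign a else 0)"
        by (simp only: ortho if_zero_mult)
      also have "\<dots> = lorentz_sign a * ?c $ a" by simp
      finally show ?thesis .
    qed
    then show ?thesis unfolding x .
  qed
  moreover have "lorentz_sign a * lorentz_sign a = 1" for a by (simp add: lorentz_sign_def)
  ultimately have "?c $ a = lorentz_sign a * h (f a) x" for a by (simp add: mult.assoc[symmetric])
  then show c: "?c = (\<chi> b. lorentz_sign b * h (f b) x)" by (simp add: vec_eq_iff)
  show "x = (\<Sum>b\<in>UNIV. (lorentz_sign b * h (f b) x) *\<^sub>R f b)" using x[symmetric] unfolding c vec_lambda_beta .
qed

lemma nondegenerate: "(\<And>y. h x y = 0) \<Longrightarrow> x = 0"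
  by (subst expand[of x]) (simp add: h(2)[of _ x])

lemma connection_eta_trace_frame:
  "connection_eta_trace h f D n v = (\<Sum>b\<in>UNIV. lorentz_sign b *
       det4 (\<chi> a. lorentz_sign a * h (f a) (D (f b))) (axis b 1)
         (\<chi> a. lorentz_sign a * h (f a) n) (\<chi> a. lorentz_sign a * h (f a) v))"
  unfolding connection_eta_trace_det4 det_gram_f gram_f_inv coframe_f
  by (simp add: gram_f if_zero_mult)

text \<open>With \<open>f 0\<close> and one tangent vector in the last slots of the determinant, or
  with both tangent vectors there, two frame vectors survive in the trace, and skewness makes their
  contributions equal; this is the factor 2. The part of \<open>N\<close> along \<open>f 0\<close>
  pairs derivatives of \<open>f 1\<close> with tangent vectors. The tangential part leaves the
  derivative of \<open>f 1\<close> in its own direction, paired with \<open>f 0\<close>, since a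
  repeated vector kills the other terms.\<close>

lemma connection_eta_alternation:
  assumes e: "positive_basis e" and f: "positive_basis f"
    and D: "linear D2" "linear D3"
    and anti: "\<And>x y. h (D2 x) y + h x (D2 y) = 0" "\<And>x y. h (D3 x) y + h x (D3 y) = 0"
    and N: "N = r *\<^sub>R f 0 + s *\<^sub>R f 2 + t *\<^sub>R f 3"
  shows "connection_eta_trace h e D2 N (f 3) - connection_eta_trace h e D3 N (f 2)
    = -2 * (r * (h (D2 (f 1)) (f 2) + h (D3 (f 1)) (f 3)) + (s * h (D2 (f 1)) (f 0) + t * h (D3 (f 1)) (f 0)))"
proof -
  have l: "linear (h y)" for y using h by (simp add: bilinear_def)
  have sgn: "lorentz_sign 0 = -1" "lorentz_sign 1 = 1" "lorentz_sign 2 = 1" "lorentz_sign 3 = 1"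
    by (simp_all add: lorentz_sign_def)
  have hN: "h (f a) N = r * h (f a) (f 0) + s * h (f a) (f 2) + t * h (f a) (f 3)" for a
    unfolding N by (simp add: linear_add[OF l] linear_cmul[OF l])
  have 2: "h (f a) (D2 (f b)) = - h (f b) (D2 (f a))" and 3: "h (f a) (D3 (f b)) = - h (f b) (D3 (f a))" for a b
    using anti[of "f a" "f b"] h(2)[of "D2 (f a)"] h(2)[of "D3 (f a)"] by simp_all
  \<comment> \<open>Frame independence replaces the given basis by the orthonormal one.\<close>
  have "connection_eta_trace h e D N v = connection_eta_trace h f D N v" if "linear D" for D v
    unfolding connection_eta_trace_invariant[OF h(1) det_gram_axis e that]
      connection_eta_trace_invariant[OF h(1) det_gram_axis f that] ..
  then have "connection_eta_trace h e D2 N (f 3) - connection_eta_trace h e D3 N (f 2)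
      = connection_eta_trace h f D2 N (f 3) - connection_eta_trace h f D3 N (f 2)" using D by simp
  also have "\<dots> = 2 * (r * (h (f 1) (D2 (f 2)) + h (f 1) (D3 (f 3))) - (s * h (f 0) (D2 (f 1)) + t * h (f 0) (D3 (f 1))))"
    unfolding connection_eta_trace_frame sum_4_zero det4_explicit
    by (simp add: hN ortho sgn axis_def 2[of 2 1] 2[of 1 0] 3[of 3 1] 3[of 1 0] 3[of 2 1] 2[of 3 1] 2[of 2 0] 2[of 3 0] 3[of 2 0] 3[of 3 0] 2[of 3 2] 3[of 3 2] algebra_simps)
  finally show ?thesis
    using 2[of 1 2] 3[of 1 3] by (simp add: h(2)[of "D2 _"] h(2)[of "D3 _"] algebra_simps)
qed

end

section \<open>Spacelike surfaces\<close>

context oriented_manifold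
begin

lemma smooth_function_mult:
  assumes "smooth_function A W f" "smooth_function A W h" "openin (top_of_set M) W"
  shows "smooth_function A W (\<lambda>q. f q * h q)"
proof -
  interpret self: smooth_inclusion M A M A by (rule smooth_inclusion_self)
  show ?thesis using assms unfolding self.smooth_function_iff
    by (intro ballI smooth_on_mult) (simp_all add: open_chart_image)
qed

lemma smooth_function_diff:
  assumes "smooth_function A W f" "smooth_function A W h" "openin (top_of_set M) W"
  shows "smooth_function A W (\<lambda>q. f q - h q)"
proof -
  interpret self: smooth_inclusion M A M A by (rule smooth_inclusion_self)
  show ?thesis using assms unfolding self.smooth_function_iff
    by (intro ballI smooth_on_diff) (simp_all add: open_chart_image)
qed

lemma smooth_function_inverse_sqrt:
  assumes "smooth_function A W f" "\<And>q. q \<in> W \<Longrightarrow> 0 < f q" "openin (top_of_set M) W"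
  shows "smooth_function A W (\<lambda>q. inverse (sqrt (f q)))"
proof -
  interpret self: smooth_inclusion M A M A by (rule smooth_inclusion_self)
  show ?thesis unfolding self.smooth_function_iff
  proof (intro ballI smooth_on_inverse smooth_on_sqrt)
    fix c assume c: "c \<in> A"
    show "smooth_on (\<lambda>y. f (inv_chart c y)) (snd c ` (fst c \<inter> W))"
      using assms(1) c by (simp add: self.smooth_function_iff)
    show "open (snd c ` (fst c \<inter> W))" by (rule open_chart_image[OF c assms(3)])
    then show "open (snd c ` (fst c \<inter> W))" .
    fix x assume "x \<in> snd c ` (fst c \<inter> W)"
    then show "0 < f (inv_chart c x)" using assms(2) c by auto
    then show "sqrt (f (inv_chart c x)) \<noteq> 0" by simp
  qed
qed

lemma smooth_function_continuous:
  assumes "smooth_function A W f" "s \<in> A" "fst s \<subseteq> W"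
  shows "continuous_on (snd s ` fst s) (\<lambda>y. f (inv_chart s y))"
proof -
  interpret self: smooth_inclusion M A M A by (rule smooth_inclusion_self)
  have "smooth_on (\<lambda>y. f (inv_chart s y)) (snd s ` (fst s \<inter> W))"
    using assms by (simp add: self.smooth_function_iff)
  then show ?thesis using assms(3) by (auto simp: Int_absorb2 dest: smooth_on_continuous)
qed

end

lemma forall_2_zero: "(\<forall>i::2. Q i) \<longleftrightarrow> Q 0 \<and> Q 1"
proof -
  have z: "(2::2) = 0" by simp
  show ?thesis unfolding forall_2 z by (rule conj_commute)
qed

text \<open>The determinant of the induced metric in the chart \<open>s\<close>, that is, the square
  of the area density.\<close>

definition induced_gram ::
    "('a, 2) chart set \<Rightarrow> ('a, 4) chart set \<Rightarrow> ('a \<Rightarrow> real^4 \<Rightarrow> real^4 \<Rightarrow> real) \<Rightarrow> ('a, 2) chart \<Rightarrow> 'a \<Rightarrow> real" where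
  "induced_gram P A g s p =
     g p (surf_vec P A s p (axis 0 1)) (surf_vec P A s p (axis 0 1)) *
     g p (surf_vec P A s p (axis 1 1)) (surf_vec P A s p (axis 1 1)) -
     (g p (surf_vec P A s p (axis 0 1)) (surf_vec P A s p (axis 1 1)))\<^sup>2"

locale spacelike_inclusion = smooth_inclusion S P M A
  for S :: "'a::topological_space set" and P :: "('a, 2) chart set" and M and A :: "('a, 4) chart set" +
  fixes g
  assumes lorentz: "lorentz_metric A M g"
    and positive: "p \<in> S \<Longrightarrow> w \<noteq> 0 \<Longrightarrow> 0 < g p (incl_deriv P A p w) (incl_deriv P A p w)"
begin

lemma bil: "p \<in> M \<Longrightarrow> bilinear (g p)"
  and sym: "p \<in> M \<Longrightarrow> g p u v = g p v u"
  using lorentz unfolding lorentz_metric_def by simp_all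

lemma bilS: "p \<in> S \<Longrightarrow> bilinear (g p)" and symS: "p \<in> S \<Longrightarrow> g p u v = g p v u"
  using bil sym sub_subset by auto

lemma linear_incl: "p \<in> S \<Longrightarrow> linear (incl_deriv P A p)"
  unfolding tangent_map_def
  using sub.chart_at_mem[of p] amb.chart_at_mem[of p] sub_subset by (intro linear_chart_deriv chart_diff_incl) auto

text \<open>A vector in the kernel would have length 0 in the induced metric, which is positive
  definite.\<close>

lemma inj_incl: "p \<in> S \<Longrightarrow> inj (incl_deriv P A p)"
  unfolding linear_injective_0[OF linear_incl]
  using positive[of p] bilinear_lzero[OF bilS[of p]] by (metis less_irrefl)

lemma linear_surf_vec:
  assumes "s \<in> P" "p \<in> fst s" shows "linear (surf_vec P A s p)"
proof -
  have p: "p \<in> S" using assms sub.chart_subset by blast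
  show ?thesis unfolding surf_vec_def[abs_def]
    using linear_compose[OF sub.linear_from_components[OF assms] linear_incl[OF p]] by (simp add: o_def)
qed

lemma surf_vec_nonzero:
  assumes "s \<in> P" "p \<in> fst s" "w \<noteq> 0" shows "0 < g p (surf_vec P A s p w) (surf_vec P A s p w)"
  unfolding surf_vec_def
proof (rule positive)
  show "p \<in> S" using assms sub.chart_subset by blast
  show "from_components P s p w \<noteq> 0"
  proof
    assume "from_components P s p w = 0"
    then have "components P s p 0 = w" using sub.components_from_components(1)[OF assms(1,2), of w] by simp
    then show False using linear_0[OF sub.linear_components[OF assms(1,2)]] assms(3) by simp
  qed
qed

lemma surf_vec_chart_at: "p \<in> S \<Longrightarrow> surf_vec P A (chart_at P p) p w = incl_deriv P A p w"
  by (simp add: surf_vec_def)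

lemma surf_vec_tangent: "surf_vec P A s p w \<in> surface_tangent_space P A p"
  by (simp add: surf_vec_def surface_tangent_space_def)

lemma smooth_chart_metric:
  assumes c: "c \<in> A" shows "smooth_on (\<lambda>x. chart_metric A g c x v w) (snd c ` fst c)"
proof -
  interpret self: smooth_inclusion M A M A by (rule amb.smooth_inclusion_self)
  note o = amb.open_chart_range[OF c]
  have sm: "smooth_on (\<lambda>x. chart_metric A g c x (axis i 1) (axis j 1)) (snd c ` fst c)" for i j
  proof -
    have "\<forall>c\<in>A. \<forall>i j. smooth_function A (fst c \<inter> M) (\<lambda>q. g q (coord_field A c i q) (coord_field A c j q))"
      using lorentz unfolding lorentz_metric_def by (elim conjE)
    then have "smooth_function A (fst c \<inter> M) (\<lambda>q. g q (coord_field A c i q) (coord_field A c j q))"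
      using c by simp
    then have "smooth_on (\<lambda>x. g (inv_chart c x) (coord_field A c i (inv_chart c x)) (coord_field A c j (inv_chart c x)))
      (snd c ` (fst c \<inter> (fst c \<inter> M)))" unfolding self.smooth_function_iff using c by (rule bspec)
    then show ?thesis
      using amb.chart_subset[OF c] by (simp add: chart_metric_def amb.coord_field_eq Int_absorb2)
  qed
  have "smooth_on (\<lambda>x. \<Sum>a\<in>UNIV. \<Sum>b\<in>UNIV. v $ a * w $ b * chart_metric A g c x (axis a 1) (axis b 1)) (snd c ` fst c)"
    by (intro smooth_on_sum smooth_on_mult smooth_on_const sm o)
  then show ?thesis
  proof (rule smooth_on_cong[OF _ o])
    fix x assume "x \<in> snd c ` fst c"
    then obtain q where q: "q \<in> fst c" "x = snd c q" by auto
    then have "q \<in> M" using amb.chart_subset[OF c] by auto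
    then have "bilinear (chart_metric A g c x)"
      unfolding q(2) by (intro amb.bilinear_chart_metric c q bil)
    then show "(\<Sum>a\<in>UNIV. \<Sum>b\<in>UNIV. v $ a * w $ b * chart_metric A g c x (axis a 1) (axis b 1)) = chart_metric A g c x v w"
      by (rule bilinear_sum_components[symmetric])
  qed
qed

lemma smooth_metric_apply:
  assumes Y: "smooth_field P A W Y" and Z: "smooth_field P A W Z" and W: "openin (top_of_set S) W"
  shows "smooth_function P W (\<lambda>q. g q (Y q) (Z q))"
  unfolding smooth_function_iff
proof
  fix s assume s: "s \<in> P"
  show "smooth_on (\<lambda>y. g (inv_chart s y) (Y (inv_chart s y)) (Z (inv_chart s y))) (snd s ` (fst s \<inter> W))"
  proof (rule smooth_on_local)
    fix y0 assume "y0 \<in> snd s ` (fst s \<inter> W)"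
    then obtain p where p: "p \<in> fst s" "p \<in> W" "y0 = snd s p" by auto
    have pM: "p \<in> M" using p s sub.chart_subset sub_subset by blast
    define c where "c = chart_at A p"
    note c = amb.chart_at_mem[OF pM, folded c_def]
    let ?T = "snd s ` (fst s \<inter> fst c \<inter> W)"
    have T: "open ?T" by (rule open_inter_image[OF s c(1) W])
    let ?k = "\<lambda>y. snd c (inv_chart s y)" and ?C = "\<lambda>Y y. components A c (inv_chart s y) (Y (inv_chart s y))"
    let ?m = "chart_metric A g c"
    have k: "smooth_on ?k ?T" by (rule smooth_on_subset[OF inclusion_smooth[OF s c(1)]]) auto
    have m: "smooth_on (\<lambda>y. ?m (?k y) v w) ?T" for v w
      by (rule smooth_on_compose[OF smooth_chart_metric[OF c(1)] k _ T]) (use s in auto)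
    have "smooth_on (\<lambda>y. \<Sum>a\<in>UNIV. \<Sum>b\<in>UNIV. ?C Y y $ a * ?C Z y $ b * ?m (?k y) (axis a 1) (axis b 1)) ?T"
      by (intro smooth_on_sum smooth_on_mult smooth_on_component smooth_fieldD[OF Y s c(1)] smooth_fieldD[OF Z s c(1)] m T)
    then have "smooth_on (\<lambda>y. g (inv_chart s y) (Y (inv_chart s y)) (Z (inv_chart s y))) ?T"
    proof (rule smooth_on_cong[OF _ T])
      fix y assume "y \<in> ?T"
      then obtain q where q: "q \<in> fst s" "q \<in> fst c" "y = snd s q" by auto
      then have "q \<in> M" using c amb.chart_subset by blast
      then have b: "bilinear (?m (snd c q))" by (intro amb.bilinear_chart_metric c q bil)
      show "(\<Sum>a\<in>UNIV. \<Sum>b\<in>UNIV. ?C Y y $ a * ?C Z y $ b * ?m (?k y) (axis a 1) (axis b 1)) =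
          g (inv_chart s y) (Y (inv_chart s y)) (Z (inv_chart s y))"
        using q s unfolding q(3) by (simp add: amb.metric_chart[OF c(1) q(2)] flip: bilinear_sum_components[OF b])
    qed
    then show "\<exists>T. open T \<and> y0 \<in> T \<and> smooth_on (\<lambda>y. g (inv_chart s y) (Y (inv_chart s y)) (Z (inv_chart s y)))
        (snd s ` (fst s \<inter> W) \<inter> T)"
      using T p c by (intro exI[of _ ?T] conjI) (auto elim!: smooth_on_subset)
  qed
qed

text \<open>In spacetime coordinates this field is a directional derivative of the inclusion, and
  derivatives of smooth maps are smooth.\<close>

lemma smooth_surf_vec:
  assumes s: "s \<in> P" shows "smooth_field P A (fst s) (\<lambda>q. surf_vec P A s q w)"
proof (rule smooth_fieldI[OF sub.chart_openin[OF s]])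
  fix p assume p: "p \<in> fst s"
  have pM: "p \<in> M" using p s sub.chart_subset sub_subset by blast
  define c where "c = chart_at A p"
  note c = amb.chart_at_mem[OF pM, folded c_def]
  have o: "open (snd s ` (fst s \<inter> fst c \<inter> fst s))" by (rule open_inter_image[OF s c(1) sub.chart_openin[OF s]])
  have "smooth_on (\<lambda>y. fd (\<lambda>y. snd c (inv_chart s y)) y w) (snd s ` (fst s \<inter> fst c \<inter> fst s))"
    by (rule smooth_on_fd, rule smooth_on_subset[OF inclusion_smooth[OF s c(1)]]) auto
  then have "smooth_on (\<lambda>y. components A c (inv_chart s y) (surf_vec P A s (inv_chart s y) w)) (snd s ` (fst s \<inter> fst c \<inter> fst s))"
  proof (rule smooth_on_cong[OF _ o])
    fix y assume "y \<in> snd s ` (fst s \<inter> fst c \<inter> fst s)"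
    then obtain q where q: "q \<in> fst s" "q \<in> fst c" "y = snd s q" by auto
    show "fd (\<lambda>y. snd c (inv_chart s y)) y w = components A c (inv_chart s y) (surf_vec P A s (inv_chart s y) w)"
      using q s components_surf_vec[OF smooth_inclusion_axioms s c(1) q(1,2), of w]
      by (simp add: chart_deriv_def o_def)
  qed
  then show "\<exists>sa\<in>P. \<exists>c\<in>A. \<exists>V. openin (top_of_set S) V \<and> p \<in> V \<and> p \<in> fst sa \<and> p \<in> fst c \<and>
     smooth_on (\<lambda>y. components A c (inv_chart sa y) (surf_vec P A s (inv_chart sa y) w)) (snd sa ` (fst sa \<inter> fst c \<inter> V))"
    using p c by (intro bexI[OF _ s] bexI[OF _ c(1)] exI[of _ "fst s"] conjI sub.chart_openin[OF s])
qed

text \<open>Gram-Schmidt on the two coordinate fields of a chart. The frame lives on the whole chart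
  domain; its components \<open>w2\<close>, \<open>w3\<close> are recorded for the continuity
  arguments, and the last two clauses say that it spans unit area and is positively
  oriented.\<close>

lemma orthonormal_frame:
  assumes s: "s \<in> P"
  shows "\<exists>e2 e3 w2 w3. smooth_field P A (fst s) e2 \<and> smooth_field P A (fst s) e3 \<and>
    continuous_on (snd s ` fst s) (\<lambda>y. w2 (inv_chart s y)) \<and> continuous_on (snd s ` fst s) (\<lambda>y. w3 (inv_chart s y)) \<and>
    (\<forall>q\<in>fst s. e2 q = surf_vec P A s q (w2 q) \<and> e3 q = surf_vec P A s q (w3 q) \<and>
      g q (e2 q) (e2 q) = 1 \<and> g q (e3 q) (e3 q) = 1 \<and> g q (e2 q) (e3 q) = 0 \<and>
      sqrt (induced_gram P A g s q) * (w2 q $ 0 * w3 q $ 1 - w2 q $ 1 * w3 q $ 0) = 1 \<and>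
      0 < w2 q $ 0 * w3 q $ 1 - w2 q $ 1 * w3 q $ 0)"
proof -
  note W = sub.chart_openin[OF s]
  define t where "t i q = surf_vec P A s q (axis i 1)" for i :: 2 and q
  define h where "h i j q = g q (t i q) (t j q)" for i j q
  have t: "smooth_field P A (fst s) (t i)" for i unfolding t_def by (rule smooth_surf_vec[OF s])
  have h: "smooth_function P (fst s) (h i j)" for i j unfolding h_def by (rule smooth_metric_apply[OF t t W])
  have b: "bilinear (g q)" and sy: "g q u v = g q v u" if "q \<in> fst s" for q u v
    using that bilS symS sub.chart_subset[OF s] by auto
  define \<Delta> where "\<Delta> q = h 0 0 q * h 1 1 q - h 0 1 q * h 0 1 q" for q
  have \<Delta>: "smooth_function P (fst s) \<Delta>"
    unfolding \<Delta>_def by (intro sub.smooth_function_diff sub.smooth_function_mult h W)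
  have \<Delta>_gram: "induced_gram P A g s q = \<Delta> q" for q
    by (simp add: induced_gram_def \<Delta>_def h_def t_def power2_eq_square)
  have h00: "h 0 0 q > 0" if "q \<in> fst s" for q
    unfolding h_def t_def by (rule surf_vec_nonzero[OF s that]) (simp add: axis_eq_0_iff)
  \<comment> \<open>The part of \<open>t 1\<close> orthogonal to \<open>t 0\<close>, multiplied by
    \<open>h 0 0\<close> to avoid a division; its square length is \<open>h 0 0\<close> times the
    Gram determinant.\<close>
  define e3' where "e3' q = h 0 0 q *\<^sub>R t 1 q - h 0 1 q *\<^sub>R t 0 q" for q
  have e3'_eq: "e3' q = surf_vec P A s q (h 0 0 q *\<^sub>R axis 1 1 - h 0 1 q *\<^sub>R axis 0 1)" if "q \<in> fst s" for q
    using linear_surf_vec[OF s that] by (simp add: e3'_def t_def linear_diff linear_cmul)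
  have hsym: "h 1 0 q = h 0 1 q" if "q \<in> fst s" for q using sy[OF that] by (simp add: h_def)
  have n3: "g q (e3' q) (e3' q) = h 0 0 q * \<Delta> q" and n23: "g q (t 0 q) (e3' q) = 0" if "q \<in> fst s" for q
    unfolding e3'_def \<Delta>_def
    using b[OF that] hsym[OF that]
    by (simp_all add: bilinear_lsub bilinear_rsub bilinear_lmul bilinear_rmul h_def[symmetric] algebra_simps)
  have \<Delta>pos: "h 0 0 q * \<Delta> q > 0" if q: "q \<in> fst s" for q
  proof -
    have "(h 0 0 q *\<^sub>R axis 1 1 - h 0 1 q *\<^sub>R axis 0 1 :: real^2) $ 1 \<noteq> 0"
      using h00[OF q] by (simp add: axis_def)
    then have "h 0 0 q *\<^sub>R axis 1 1 - h 0 1 q *\<^sub>R axis 0 1 \<noteq> (0 :: real^2)" by (metis zero_index)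
    from surf_vec_nonzero[OF s q this] show ?thesis using n3[OF q] by (simp add: e3'_eq[OF q])
  qed
  define r where "r q = inverse (sqrt (h 0 0 q))" for q
  define r' where "r' q = inverse (sqrt (h 0 0 q * \<Delta> q))" for q
  have r: "smooth_function P (fst s) r" unfolding r_def
    by (intro sub.smooth_function_inverse_sqrt h h00 W)
  have r': "smooth_function P (fst s) r'" unfolding r'_def
    by (intro sub.smooth_function_inverse_sqrt sub.smooth_function_mult h \<Delta> \<Delta>pos W)
  have m: "smooth_function P (fst s) (\<lambda>q. - 1)" by (simp add: smooth_function_iff)
  define e2 where "e2 q = r q *\<^sub>R t 0 q" for q
  define e3 where "e3 q = r' q *\<^sub>R e3' q" for q
  define w2 where "w2 q = r q *\<^sub>R (axis 0 1 :: real^2)" for q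
  define w3 where "w3 q = r' q *\<^sub>R (h 0 0 q *\<^sub>R axis 1 1 - h 0 1 q *\<^sub>R (axis 0 1 :: real^2))" for q
  have e2: "smooth_field P A (fst s) e2" unfolding e2_def by (rule smooth_field_scale[OF r t W])
  have "smooth_field P A (fst s) (\<lambda>q. r' q *\<^sub>R (h 0 0 q *\<^sub>R t 1 q + (- 1 * h 0 1 q) *\<^sub>R t 0 q))"
    by (intro smooth_field_scale smooth_field_add r' h t W sub.smooth_function_mult m)
  then have e3: "smooth_field P A (fst s) e3" by (simp add: e3_def[abs_def] e3'_def)
  have ct: "continuous_on (snd s ` fst s) (\<lambda>y. f (inv_chart s y))" if "smooth_function P (fst s) f" for f
    by (rule sub.smooth_function_continuous[OF that s subset_refl])
  have c2: "continuous_on (snd s ` fst s) (\<lambda>y. w2 (inv_chart s y))"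
    unfolding w2_def by (intro continuous_intros ct r)
  have c3: "continuous_on (snd s ` fst s) (\<lambda>y. w3 (inv_chart s y))"
    unfolding w3_def by (intro continuous_intros ct r' h)
  have "e2 q = surf_vec P A s q (w2 q) \<and> e3 q = surf_vec P A s q (w3 q) \<and>
      g q (e2 q) (e2 q) = 1 \<and> g q (e3 q) (e3 q) = 1 \<and> g q (e2 q) (e3 q) = 0 \<and>
      sqrt (induced_gram P A g s q) * (w2 q $ 0 * w3 q $ 1 - w2 q $ 1 * w3 q $ 0) = 1 \<and>
      0 < w2 q $ 0 * w3 q $ 1 - w2 q $ 1 * w3 q $ 0" if q: "q \<in> fst s" for q
  proof (intro conjI)
    note L = linear_surf_vec[OF s q]
    have d: "\<Delta> q > 0" using \<Delta>pos[OF q] h00[OF q] by (simp add: zero_less_mult_iff)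
    show "e2 q = surf_vec P A s q (w2 q)" by (simp add: e2_def w2_def t_def linear_cmul[OF L])
    show "e3 q = surf_vec P A s q (w3 q)" by (simp add: e3_def w3_def e3'_eq[OF q] linear_cmul[OF L])
    have "g q (e2 q) (e2 q) = r q * r q * h 0 0 q"
      using b[OF q] by (simp add: e2_def bilinear_lmul bilinear_rmul h_def)
    also have "\<dots> = 1" using h00[OF q] by (simp add: r_def field_simps)
    finally show "g q (e2 q) (e2 q) = 1" .
    have "g q (e3 q) (e3 q) = r' q * r' q * (h 0 0 q * \<Delta> q)"
      using b[OF q] n3[OF q] by (simp add: e3_def bilinear_lmul bilinear_rmul)
    also have "\<dots> = 1" using \<Delta>pos[OF q] unfolding r'_def
      by (metis inverse_mult_distrib left_inverse less_irrefl less_imp_le real_sqrt_mult_self abs_of_pos)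
    finally show "g q (e3 q) (e3 q) = 1" .
    show "g q (e2 q) (e3 q) = 0"
      using b[OF q] n23[OF q] by (simp add: e2_def e3_def bilinear_lmul bilinear_rmul)
    have cross: "w2 q $ 0 * w3 q $ 1 - w2 q $ 1 * w3 q $ 0 = r q * r' q * h 0 0 q"
      by (simp add: w2_def w3_def axis_def)
    show "0 < w2 q $ 0 * w3 q $ 1 - w2 q $ 1 * w3 q $ 0"
      unfolding cross r_def r'_def using h00[OF q] \<Delta>pos[OF q] by (intro mult_pos_pos) simp_all
    have "sqrt (\<Delta> q) * (r q * r' q * h 0 0 q) = 1"
    proof -
      have "r q * r' q * h 0 0 q = inverse (sqrt (\<Delta> q)) * (inverse (sqrt (h 0 0 q)) * inverse (sqrt (h 0 0 q)) * h 0 0 q)"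
        by (simp add: r_def r'_def real_sqrt_mult)
      also have "inverse (sqrt (h 0 0 q)) * inverse (sqrt (h 0 0 q)) * h 0 0 q = 1"
        using h00[OF q] by (simp add: field_simps)
      finally show ?thesis using d by simp
    qed
    then show "sqrt (induced_gram P A g s q) * (w2 q $ 0 * w3 q $ 1 - w2 q $ 1 * w3 q $ 0) = 1"
      by (simp add: \<Delta>_gram cross)
  qed
  then show ?thesis using e2 e3 c2 c3 by blast
qed

text \<open>Dimension two enters through Cramer's identity for three vectors in the plane. By it the
  part of \<open>x\<close> orthogonal to \<open>e2\<close> and \<open>e3\<close> is a combination of
  these two, hence orthogonal to itself, and positivity makes it 0.\<close>

lemma tangent_expand:
  assumes p: "p \<in> S" and e: "e2 \<in> surface_tangent_space P A p" "e3 \<in> surface_tangent_space P A p"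
    and o: "g p e2 e2 = 1" "g p e3 e3 = 1" "g p e2 e3 = 0" and x: "x \<in> surface_tangent_space P A p"
  shows "x = g p x e2 *\<^sub>R e2 + g p x e3 *\<^sub>R e3"
proof -
  let ?i = "incl_deriv P A p"
  note L = linear_incl[OF p]
  note b = bilS[OF p] and sy = symS[OF p]
  note bs = bilinear_lsub[OF b] bilinear_rsub[OF b] bilinear_ladd[OF b] bilinear_radd[OF b]
    bilinear_lmul[OF b] bilinear_rmul[OF b] bilinear_lzero[OF b] bilinear_rzero[OF b]
  obtain u v y where uv: "e2 = ?i u" "e3 = ?i v" "x = ?i y" using e x unfolding surface_tangent_space_def by blast
  define w where "w = y - g p x e2 *\<^sub>R u - g p x e3 *\<^sub>R v"
  have iw: "?i w = x - g p x e2 *\<^sub>R e2 - g p x e3 *\<^sub>R e3"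
    using L by (simp add: w_def uv linear_diff linear_cmul)
  have ow: "g p (?i w) e2 = 0" "g p (?i w) e3 = 0"
    unfolding iw using o sy[of e3 e2] by (simp_all add: bs)
  have cramer: "(v$0 * w$1 - v$1 * w$0) *\<^sub>R u + (w$0 * u$1 - w$1 * u$0) *\<^sub>R v + (u$0 * v$1 - u$1 * v$0) *\<^sub>R w = 0"
    (is "?a *\<^sub>R u + ?b *\<^sub>R v + ?c *\<^sub>R w = 0")
    by (simp add: vec_eq_iff forall_2_zero algebra_simps)
  have "?i (?a *\<^sub>R u + ?b *\<^sub>R v + ?c *\<^sub>R w) = ?a *\<^sub>R e2 + ?b *\<^sub>R e3 + ?c *\<^sub>R ?i w"
    using L by (simp only: uv linear_add linear_cmul)
  then have z: "?a *\<^sub>R e2 + ?b *\<^sub>R e3 + ?c *\<^sub>R ?i w = 0" unfolding cramer linear_0[OF L] by simp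
  \<comment> \<open>Parallel component vectors would make \<open>e2\<close> and \<open>e3\<close>
    parallel, against orthonormality.\<close>
  have "?c \<noteq> 0"
  proof
    assume c: "?c = 0"
    have "u$k *\<^sub>R v - v$k *\<^sub>R u = 0" for k
    proof -
      have "k = 0 \<or> k = 1" using exhaust_2[of k] by auto
      then show ?thesis using c by (auto simp: vec_eq_iff forall_2_zero algebra_simps)
    qed
    then have "?i (u$k *\<^sub>R v - v$k *\<^sub>R u) = 0" for k using linear_0[OF L] by simp
    then have "u$k *\<^sub>R e3 - v$k *\<^sub>R e2 = 0" for k using L by (simp add: uv linear_diff linear_cmul)
    from arg_cong[OF this, of "\<lambda>x. g p x e3"] have "u$k = 0" for k using o by (simp add: bs)
    then have "u = 0" by (simp add: vec_eq_iff)
    then show False using o(1) linear_0[OF L] by (simp add: uv(1) bs)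
  qed
  moreover from arg_cong[OF z, of "\<lambda>x. g p x (?i w)"] have "?c * g p (?i w) (?i w) = 0"
    using ow sy by (simp add: bs)
  ultimately have "w = 0" using positive[OF p, of w] by auto
  then show ?thesis using iw linear_0[OF L] by (simp add: algebra_simps)
qed

section \<open>Projection to the normal space\<close>

lemma orthonormal_basis_exists:
  assumes p: "p \<in> S"
  shows "\<exists>e2 e3. e2 \<in> surface_tangent_space P A p \<and> e3 \<in> surface_tangent_space P A p \<and>
    g p e2 e2 = 1 \<and> g p e3 e3 = 1 \<and> g p e2 e3 = 0"
proof -
  note s = sub.chart_at_mem[OF p]
  from orthonormal_frame[OF s(1)] s(2) surf_vec_tangent show ?thesis by metis
qed

lemma subspace_tangent: "p \<in> S \<Longrightarrow> subspace (surface_tangent_space P A p)"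
  unfolding surface_tangent_space_def using linear_incl by (simp add: linear_subspace_image subspace_UNIV)

text \<open>Two candidates differ by a vector that is both tangent and normal, and positivity on the
  tangent plane forces it to be 0.\<close>

lemma normal_part_unique:
  assumes p: "p \<in> S" and n: "n \<in> surface_normal_space P A g p" "v - n \<in> surface_tangent_space P A p"
  shows "normal_part P A g p v = n"
  unfolding normal_part_def
proof (rule the_equality)
  show "n \<in> surface_normal_space P A g p \<and> v - n \<in> surface_tangent_space P A p" using n by simp
  fix n' assume n': "n' \<in> surface_normal_space P A g p \<and> v - n' \<in> surface_tangent_space P A p"
  have "(v - n) - (v - n') \<in> surface_tangent_space P A p"
    by (rule subspace_diff[OF subspace_tangent[OF p]]) (use n n' in auto)
  then have t: "n' - n \<in> surface_tangent_space P A p" by simp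
  have "g p (n' - n) (n' - n) = 0"
    using n n' t bilinear_lsub[OF bilS[OF p]] by (simp add: surface_normal_space_def)
  moreover obtain w where "n' - n = incl_deriv P A p w" using t unfolding surface_tangent_space_def by blast
  ultimately have "w = 0" using positive[OF p, of w] by auto
  then show "n' = n" using \<open>n' - n = _\<close> linear_0[OF linear_incl[OF p]] by simp
qed

lemma normal_part_orthonormal:
  assumes p: "p \<in> S" and e: "e2 \<in> surface_tangent_space P A p" "e3 \<in> surface_tangent_space P A p"
    and o: "g p e2 e2 = 1" "g p e3 e3 = 1" "g p e2 e3 = 0"
  shows "normal_part P A g p v = v - g p v e2 *\<^sub>R e2 - g p v e3 *\<^sub>R e3"
proof (rule normal_part_unique[OF p])
  note b = bilS[OF p] and sy = symS[OF p]
  note bs = bilinear_lsub[OF b] bilinear_rsub[OF b] bilinear_ladd[OF b] bilinear_radd[OF b]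
    bilinear_lmul[OF b] bilinear_rmul[OF b]
  show "v - g p v e2 *\<^sub>R e2 - g p v e3 *\<^sub>R e3 \<in> surface_normal_space P A g p"
    unfolding surface_normal_space_def
  proof (clarify)
    fix w assume w: "w \<in> surface_tangent_space P A p"
    show "g p (v - g p v e2 *\<^sub>R e2 - g p v e3 *\<^sub>R e3) w = 0"
      by (subst tangent_expand[OF p e o w]) (use o sy[of e3 e2] in \<open>simp add: bs\<close>)
  qed
  have "g p v e2 *\<^sub>R e2 + g p v e3 *\<^sub>R e3 \<in> surface_tangent_space P A p"
    using subspace_tangent[OF p] e by (simp add: subspace_add subspace_mul)
  then show "v - (v - g p v e2 *\<^sub>R e2 - g p v e3 *\<^sub>R e3) \<in> surface_tangent_space P A p" by simp
qed

lemma normal_part_normal: "p \<in> S \<Longrightarrow> normal_part P A g p v \<in> surface_normal_space P A g p"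
  and normal_part_tangent: "p \<in> S \<Longrightarrow> v - normal_part P A g p v \<in> surface_tangent_space P A p"
proof -
  assume p: "p \<in> S"
  obtain e2 e3 where e: "e2 \<in> surface_tangent_space P A p" "e3 \<in> surface_tangent_space P A p"
    and o: "g p e2 e2 = 1" "g p e3 e3 = 1" "g p e2 e3 = 0" using orthonormal_basis_exists[OF p] by blast
  note b = bilS[OF p] and sy = symS[OF p]
  note bs = bilinear_lsub[OF b] bilinear_rsub[OF b] bilinear_ladd[OF b] bilinear_radd[OF b]
    bilinear_lmul[OF b] bilinear_rmul[OF b]
  show "normal_part P A g p v \<in> surface_normal_space P A g p"
    unfolding surface_normal_space_def normal_part_orthonormal[OF p e o]
  proof (clarify)
    fix w assume w: "w \<in> surface_tangent_space P A p"
    show "g p (v - g p v e2 *\<^sub>R e2 - g p v e3 *\<^sub>R e3) w = 0"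
      by (subst tangent_expand[OF p e o w]) (use o sy[of e3 e2] in \<open>simp add: bs\<close>)
  qed
  have "g p v e2 *\<^sub>R e2 + g p v e3 *\<^sub>R e3 \<in> surface_tangent_space P A p"
    using subspace_tangent[OF p] e by (simp add: subspace_add subspace_mul)
  then show "v - normal_part P A g p v \<in> surface_tangent_space P A p"
    unfolding normal_part_orthonormal[OF p e o] by simp
qed

text \<open>The area form is written in the preferred chart. Passing to \<open>s\<close> multiplies
  the determinant of the metric by the square of the Jacobian, and orientation makes the Jacobian
  the positive root of this square.\<close>

lemma area_form_density:
  assumes s: "s \<in> P" "p \<in> fst s"
  shows "form_density P (area_form P A g) s p = sqrt (induced_gram P A g s p)"
proof -
  have p: "p \<in> S" using s sub.chart_subset by blast
  note m = sub.chart_at_mem[OF p]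
  let ?i = "incl_deriv P A p" and ?L = "chart_deriv s (chart_at P p) (\<lambda>q. q) p"
  define a where "a i j = ?L (axis i 1) $ j" for i j :: 2
  define k where "k i j = g p (?i (axis i 1)) (?i (axis j 1))" for i j :: 2
  have bk: "bilinear (\<lambda>u v. g p (?i u) (?i v))"
    using linear_compose[OF linear_incl[OF p], of "\<lambda>x. g p x (?i _)"] linear_compose[OF linear_incl[OF p], of "g p (?i _)"] bilS[OF p]
    by (simp add: bilinear_def o_def)
  have two: "(2::2) = 0" by simp
  have sv: "surf_vec P A s p (axis i 1) = ?i (?L (axis i 1))" for i
    by (simp add: surf_vec_def from_components_def)
  have gs: "g p (surf_vec P A s p (axis i 1)) (surf_vec P A s p (axis j 1)) =
      a i 0 * a j 0 * k 0 0 + a i 0 * a j 1 * k 0 1 + a i 1 * a j 0 * k 1 0 + a i 1 * a j 1 * k 1 1" for i j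
    unfolding sv bilinear_sum_components[OF bk, of "?L (axis i 1)"] by (simp add: sum_2 two a_def k_def)
  have ks: "k 1 0 = k 0 1" using symS[OF p] by (simp add: k_def)
  have det: "a 0 0 * a 1 1 - a 0 1 * a 1 0 > 0"
  proof -
    have "0 < det (matrix ?L)" by (rule sub.transition_det) (use s m in auto)
    then show ?thesis by (simp add: det_2_eq matrix_def a_def)
  qed
  have "induced_gram P A g s p = (a 0 0 * a 1 1 - a 0 1 * a 1 0)\<^sup>2 * (k 0 0 * k 1 1 - k 0 1 * k 0 1)"
    unfolding induced_gram_def gs ks by (simp add: power2_eq_square algebra_simps)
  then have "sqrt (induced_gram P A g s p) = (a 0 0 * a 1 1 - a 0 1 * a 1 0) * sqrt (k 0 0 * k 1 1 - k 0 1 * k 0 1)"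
    using det by (simp add: real_sqrt_mult)
  moreover have "det (\<chi> i j. k i j :: real^2^2) = k 0 0 * k 1 1 - k 0 1 * k 0 1" by (simp add: det_2_eq ks)
  moreover have "form_density P (area_form P A g) s p = sqrt (det (\<chi> i j. k i j :: real^2^2)) * (a 0 0 * a 1 1 - a 0 1 * a 1 0)"
    by (simp add: form_density_def area_form_def coord_field_def a_def k_def)
  ultimately show ?thesis by simp
qed

end

section \<open>The energy density\<close>

context surface_connection
begin

lemma linear_cov_along:
  assumes X: "smooth_field P A W X" "p \<in> W" and p: "p \<in> S"
  shows "linear (\<lambda>w. cov_along P A nab (incl_deriv P A p w) X p)"
proof -
  note s = sub.chart_at_mem[OF p]
  have pM: "p \<in> M" "p \<in> U" using p sub_subset S_subset by auto
  note c = chart_at_mem[OF pM(1)]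
  have "surf_vec P A (chart_at P p) p w = incl_deriv P A p w" for w using p by (simp add: surf_vec_def)
  note e = cov_along_preferred[OF s X, unfolded this]
  have G: "linear (\<lambda>u. christoffel A nab (chart_at A p) p u (X p))"
    using bilinear_christoffel[OF pM(2) c] by (simp add: bilinear_def)
  show ?thesis unfolding e
    by (intro linear_compose_add linear_fd smooth_field_differentiable[OF X(1) s(1) c(1) s(2) c(2) X(2)]
        linear_compose[OF linear_chart_deriv G, unfolded o_def] chart_diff_incl s c)
qed

text \<open>The regularity of \<open>nab\<close> is expressed by its mapping smooth fields to smooth
  fields; applied to fields with constant components, this makes the symbols smooth.\<close>

lemma smooth_christoffel:
  assumes c: "c \<in> A"
  shows "smooth_on (\<lambda>x. christoffel A nab c (inv_chart c x) u v) (snd c ` (fst c \<inter> U))"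
proof -
  have o: "openin (top_of_set M) (fst c \<inter> U)" by (rule openin_Int[OF chart_openin[OF c] U])
  have f: "smooth_field A A (fst c \<inter> U) (\<lambda>q. from_components A c q v)" for v
    by (rule self.smooth_field_subset[OF smooth_from_components[OF c]]) simp
  have oi: "open (snd c ` (fst c \<inter> U))" by (rule open_chart_image[OF c U])
  have "smooth_field A A (fst c \<inter> U) (\<lambda>q. nab (from_components A c q u) (\<lambda>q. from_components A c q v) q)"
    by (rule nab_smooth[OF o _ f f]) simp
  from self.smooth_fieldD[OF this c c]
  have "smooth_on (\<lambda>x. components A c (inv_chart c x) (nab (from_components A c (inv_chart c x) u)
      (\<lambda>q. from_components A c q v) (inv_chart c x))) (snd c ` (fst c \<inter> U))" by simp
  then show ?thesis
  proof (rule smooth_on_cong[OF _ oi])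
    fix x assume "x \<in> snd c ` (fst c \<inter> U)"
    then obtain q where q: "q \<in> fst c" "q \<in> U" "x = snd c q" by auto
    show "components A c (inv_chart c x) (nab (from_components A c (inv_chart c x) u)
      (\<lambda>q. from_components A c q v) (inv_chart c x)) = christoffel A nab c (inv_chart c x) u v"
      using q c by (simp add: christoffel_field[OF q(2) c q(1)])
  qed
qed

text \<open>In a fixed chart the covariant derivative is a polynomial in the first derivatives of
  \<open>X\<close> and of the inclusion, in the components of \<open>w\<close> and \<open>X\<close>,
  and in the Christoffel symbols, all of which are continuous.\<close>

lemma continuous_cov_along:
  assumes s: "s \<in> P" and c: "c \<in> A" and X: "smooth_field P A S X"
    and w: "continuous_on (snd s ` fst s) (\<lambda>y. w (inv_chart s y))"
  shows "continuous_on (snd s ` (fst s \<inter> fst c))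
    (\<lambda>y. components A c (inv_chart s y) (cov_along P A nab (surf_vec P A s (inv_chart s y) (w (inv_chart s y))) X (inv_chart s y)) $ k)"
proof -
  let ?T = "snd s ` (fst s \<inter> fst c)"
  have SS: "openin (top_of_set S) S" by simp
  have subS: "fst s \<subseteq> S" by (rule sub.chart_subset[OF s])
  have eqT: "fst s \<inter> fst c \<inter> S = fst s \<inter> fst c" using subS by auto
  let ?k = "\<lambda>y. snd c (inv_chart s y)"
  let ?X = "\<lambda>y. components A c (inv_chart s y) (X (inv_chart s y))"
  let ?w = "\<lambda>y. w (inv_chart s y)"
  have T: "open ?T" using open_inter_image[OF s c SS] by (simp add: eqT)
  have sX: "smooth_on ?X ?T" using smooth_fieldD[OF X s c] by (simp add: eqT)
  have sk: "smooth_on ?k ?T" by (rule inclusion_smooth[OF s c])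
  have w': "continuous_on ?T ?w" by (rule continuous_on_subset[OF w]) auto
  have cfd: "continuous_on ?T (\<lambda>y. fd f y (?w y))" if "smooth_on f ?T" for f :: "real^2 \<Rightarrow> real^4"
  proof -
    have "continuous_on ?T (\<lambda>y. \<Sum>b\<in>Basis. (?w y \<bullet> b) *\<^sub>R fd f y b)"
      by (intro continuous_intros w' smooth_on_continuous[OF smooth_on_fd[OF that]])
    then show ?thesis
      by (rule continuous_on_eq) (rule fd_euclidean_expand[OF smooth_on_differentiable[OF that], symmetric])
  qed
  have nth: "continuous_on ?T (\<lambda>y. f y $ i)" if "continuous_on ?T f" for f :: "real^2 \<Rightarrow> real^4" and i
    using that by (intro continuous_intros)
  have G: "continuous_on ?T (\<lambda>y. christoffel A nab c (inv_chart s y) u v $ k)" for u v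
  proof -
    have "smooth_on (\<lambda>y. christoffel A nab c (inv_chart c (?k y)) u v) ?T"
      by (rule smooth_on_compose[OF smooth_christoffel[OF c] sk _ T]) (use s subS S_subset in auto)
    then have "continuous_on ?T (\<lambda>y. christoffel A nab c (inv_chart c (?k y)) u v $ k)"
      by (intro continuous_intros smooth_on_continuous)
    then show ?thesis by (rule continuous_on_eq) (use s c in auto)
  qed
  have "continuous_on ?T (\<lambda>y. fd ?X y (?w y) $ k + (\<Sum>a\<in>UNIV. \<Sum>b\<in>UNIV. fd ?k y (?w y) $ a * ?X y $ b *
      christoffel A nab c (inv_chart s y) (axis a 1) (axis b 1) $ k))"
    by (intro continuous_on_add continuous_on_sum continuous_on_mult nth cfd sX sk G smooth_on_continuous[OF sX])
  then show ?thesis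
  proof (rule continuous_on_eq)
    fix y assume "y \<in> ?T"
    then obtain q where q: "q \<in> fst s" "q \<in> fst c" "y = snd s q" by auto
    have qS: "q \<in> S" "q \<in> U" using q subS S_subset by auto
    note b = bilinear_christoffel[OF qS(2) c q(2)]
    show "fd ?X y (?w y) $ k + (\<Sum>a\<in>UNIV. \<Sum>b\<in>UNIV. fd ?k y (?w y) $ a * ?X y $ b *
        christoffel A nab c (inv_chart s y) (axis a 1) (axis b 1) $ k)
      = components A c (inv_chart s y) (cov_along P A nab (surf_vec P A s (inv_chart s y) (?w y)) X (inv_chart s y)) $ k"
      using q s cov_along_chart[OF s q(1) X qS(1) c q(2) SS, of "w q"]
      by (simp add: bilinear_vec_sum_components[OF b, of "fd ?k (snd s q) (w q)" "components A c q (X q)"]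
          chart_deriv_def o_def)
  qed
qed

end

section \<open>Traces over the tangent plane and the energy density\<close>

definition orthonormal_tangent ::
    "('a, 2) chart set \<Rightarrow> ('a, 4) chart set \<Rightarrow> ('a \<Rightarrow> real^4 \<Rightarrow> real^4 \<Rightarrow> real) \<Rightarrow> 'a \<Rightarrow> real^4 \<Rightarrow> real^4 \<Rightarrow> bool" where
  "orthonormal_tangent P A g p e2 e3 \<longleftrightarrow>
     e2 \<in> surface_tangent_space P A p \<and> e3 \<in> surface_tangent_space P A p \<and>
     g p e2 e2 = 1 \<and> g p e3 e3 = 1 \<and> g p e2 e3 = 0"

text \<open>
  For the connection of \<open>g\<close> this is \<open>- \<langle>H, X\<rangle>\<close>.  The connection is arbitrary because the reference connection is
  metric for a tensor that agrees with \<open>g\<close> on \<open>S\<close> only.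
\<close>

definition normal_trace ::
    "('a, 2) chart set \<Rightarrow> ('a, 4) chart set \<Rightarrow> ('a \<Rightarrow> real^4 \<Rightarrow> real^4 \<Rightarrow> real) \<Rightarrow>
     (real^4 \<Rightarrow> ('a \<Rightarrow> real^4) \<Rightarrow> 'a \<Rightarrow> real^4) \<Rightarrow> ('a \<Rightarrow> real^4) \<Rightarrow> 'a \<Rightarrow> real" where
  "normal_trace P A g nab X p = (let (e2, e3) = (SOME e. orthonormal_tangent P A g p (fst e) (snd e))
     in g p (cov_along P A nab e2 X p) e2 + g p (cov_along P A nab e3 X p) e3)"

text \<open>The integrand of the theorem with \<open>normal_trace\<close> in place of
  \<open>- \<langle>H, X\<rangle>\<close>. As the connection is left free, the same expression
  yields the physical term and the reference term, both as functions on \<open>S\<close>.\<close>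

definition energy_density ::
    "('a, 2) chart set \<Rightarrow> ('a, 4) chart set \<Rightarrow> ('a \<Rightarrow> real^4 \<Rightarrow> real^4 \<Rightarrow> real) \<Rightarrow>
     (real^4 \<Rightarrow> ('a \<Rightarrow> real^4) \<Rightarrow> 'a \<Rightarrow> real^4) \<Rightarrow> ('a \<Rightarrow> real^4) \<Rightarrow> ('a \<Rightarrow> real^4) \<Rightarrow> 'a \<Rightarrow> real" where
  "energy_density P A g nab N X p = (let n = normal_part P A g p (N p) in
     timelike_norm g p n * normal_trace P A g nab X p +
     1 / timelike_norm g p n * g p (cov_along P A nab (N p - n) X p) n)"

locale spacelike_connection = spacelike_inclusion S P M A g + conn: surface_connection M A U nab S P
  for S :: "'a::topological_space set" and P :: "('a, 2) chart set" and M and A :: "('a, 4) chart set" and g U nab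
begin

lemma cov_along_combination:
  assumes X: "smooth_field P A W X" "p \<in> W" and p: "p \<in> S"
    and e: "e2 \<in> surface_tangent_space P A p" "e3 \<in> surface_tangent_space P A p"
  shows "cov_along P A nab (a *\<^sub>R e2 + b *\<^sub>R e3) X p = a *\<^sub>R cov_along P A nab e2 X p + b *\<^sub>R cov_along P A nab e3 X p"
proof -
  obtain u v where uv: "e2 = incl_deriv P A p u" "e3 = incl_deriv P A p v" using e unfolding surface_tangent_space_def by blast
  note L = conn.linear_cov_along[OF X p] and I = linear_incl[OF p]
  have "a *\<^sub>R e2 + b *\<^sub>R e3 = incl_deriv P A p (a *\<^sub>R u + b *\<^sub>R v)"
    by (simp add: uv linear_add[OF I] linear_cmul[OF I])
  then show ?thesis using linear_add[OF L, of "a *\<^sub>R u" "b *\<^sub>R v"] linear_cmul[OF L] by (simp add: uv)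
qed

text \<open>The trace of a bilinear form does not depend on the orthonormal basis. Orthonormality of
  the two pairs says that the rows of the change of basis are orthonormal; the trace needs the same
  for its columns.\<close>

lemma trace_invariant:
  assumes X: "smooth_field P A W X" "p \<in> W" and p: "p \<in> S"
    and e: "orthonormal_tangent P A g p e2 e3" and f: "orthonormal_tangent P A g p f2 f3"
  shows "g p (cov_along P A nab f2 X p) f2 + g p (cov_along P A nab f3 X p) f3
    = g p (cov_along P A nab e2 X p) e2 + g p (cov_along P A nab e3 X p) e3"
proof -
  note b = bilS[OF p] and sy = symS[OF p]
  note bs = bilinear_ladd[OF b] bilinear_radd[OF b] bilinear_lmul[OF b] bilinear_rmul[OF b]
  have et: "e2 \<in> surface_tangent_space P A p" "e3 \<in> surface_tangent_space P A p"
    and eo: "g p e2 e2 = 1" "g p e3 e3 = 1" "g p e2 e3 = 0" "g p e3 e2 = 0" using e sy[of e3 e2] by (auto simp: orthonormal_tangent_def)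
  have ft: "f2 \<in> surface_tangent_space P A p" "f3 \<in> surface_tangent_space P A p"
    and fo: "g p f2 f2 = 1" "g p f3 f3 = 1" "g p f2 f3 = 0" using f by (auto simp: orthonormal_tangent_def)
  define a b c d where "a = g p f2 e2" and "b = g p f2 e3" and "c = g p f3 e2" and "d = g p f3 e3"
  have f2: "f2 = a *\<^sub>R e2 + b *\<^sub>R e3" and f3: "f3 = c *\<^sub>R e2 + d *\<^sub>R e3"
    unfolding a_def b_def c_def d_def by (intro tangent_expand[OF p et eo(1-3)] ft)+
  have 1: "a * a + b * b = 1" "c * c + d * d = 1" "a * c + b * d = 0"
    using fo unfolding f2 f3 by (simp_all add: bs eo mult.commute)
  have det: "(a * d - b * c) * (a * d - b * c) = 1"
  proof -
    have "(a * d - b * c) * (a * d - b * c) = (a * a + b * b) * (c * c + d * d) - (a * c + b * d) * (a * c + b * d)"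
      by (simp add: algebra_simps)
    then show ?thesis using 1 by simp
  qed
  have 2: "a * a + c * c = 1" "b * b + d * d = 1" "a * b + c * d = 0"
  proof -
    \<comment> \<open>As the determinant is 1 or -1, the second row is, up to sign, the first one
      turned by a right angle; the column relations follow from this.\<close>
    define D where "D = a * d - b * c"
    have "D * a = d * (a * a + b * b) - b * (a * c + b * d)" "D * b = a * (a * d - b * c) * 0 - c * (a * a + b * b) + a * (a * c + b * d)"
      by (simp_all add: D_def algebra_simps)
    then have Da: "d = D * a" "c = - (D * b)" using 1 by simp_all
    have DD: "D * D = 1" using det by (simp add: D_def)
    have "c * c = (D * D) * (b * b)" "d * d = (D * D) * (a * a)" "c * d = - ((D * D) * (a * b))"
      unfolding Da(1) by (simp_all add: Da(2))
    then have "c * c = b * b" "d * d = a * a" "c * d = - (a * b)" using DD by simp_all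
    then show "a * a + c * c = 1" "b * b + d * d = 1" "a * b + c * d = 0" using 1(1) by simp_all
  qed
  let ?B = "\<lambda>u v. g p (cov_along P A nab u X p) v"
  have "?B f2 f2 + ?B f3 f3 = (a * a + c * c) * ?B e2 e2 + (b * b + d * d) * ?B e3 e3 + (a * b + c * d) * (?B e2 e3 + ?B e3 e2)"
    unfolding f2 f3 cov_along_combination[OF X p et] by (simp add: bs algebra_simps)
  then show ?thesis by (simp add: 2)
qed

lemma normal_trace_eq:
  assumes X: "smooth_field P A W X" "p \<in> W" and p: "p \<in> S" and e: "orthonormal_tangent P A g p e2 e3"
  shows "normal_trace P A g nab X p = g p (cov_along P A nab e2 X p) e2 + g p (cov_along P A nab e3 X p) e3"
proof -
  obtain f where f: "(SOME e. orthonormal_tangent P A g p (fst e) (snd e)) = f" by blast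
  have "orthonormal_tangent P A g p (fst f) (snd f)"
    unfolding f[symmetric] by (rule someI[of "\<lambda>e. orthonormal_tangent P A g p (fst e) (snd e)" "(e2, e3)"]) (simp add: e)
  from trace_invariant[OF X p e this] show ?thesis by (simp add: normal_trace_def f case_prod_beta)
qed

text \<open>The domain of \<open>s\<close> need not lie in a single spacetime chart, so continuity
  is checked locally, by \<open>Ck_on_local\<close> at order 0.\<close>

lemma continuous_metric_cov_along:
  assumes s: "s \<in> P" and X: "smooth_field P A S X" and Z: "smooth_field P A (fst s) Z"
    and w: "continuous_on (snd s ` fst s) (\<lambda>y. w (inv_chart s y))"
  shows "continuous_on (snd s ` fst s) (\<lambda>y. g (inv_chart s y)
    (cov_along P A nab (surf_vec P A s (inv_chart s y) (w (inv_chart s y))) X (inv_chart s y)) (Z (inv_chart s y)))"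
    (is "continuous_on _ ?f")
proof -
  have "Ck_on 0 ?f (snd s ` fst s)"
  proof (rule Ck_on_local)
    fix y0 assume "y0 \<in> snd s ` fst s"
    then obtain p where p: "p \<in> fst s" "y0 = snd s p" by auto
    have pM: "p \<in> M" using p s sub.chart_subset sub_subset by blast
    define c where "c = chart_at A p"
    note c = amb.chart_at_mem[OF pM, folded c_def]
    let ?T = "snd s ` (fst s \<inter> fst c)"
    have eqT: "fst s \<inter> fst c \<inter> fst s = fst s \<inter> fst c" by auto
    have T: "open ?T" using open_inter_image[OF s c(1) sub.chart_openin[OF s]] by (simp add: eqT)
    let ?k = "\<lambda>y. snd c (inv_chart s y)"
    let ?m = "chart_metric A g c"
    let ?C = "\<lambda>y. components A c (inv_chart s y) (cov_along P A nab (surf_vec P A s (inv_chart s y) (w (inv_chart s y))) X (inv_chart s y))"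
    let ?Z = "\<lambda>y. components A c (inv_chart s y) (Z (inv_chart s y))"
    have m: "smooth_on (\<lambda>y. ?m (?k y) v w) ?T" for v w
      by (rule smooth_on_compose[OF smooth_chart_metric[OF c(1)] inclusion_smooth[OF s c(1)] _ T]) (use s in auto)
    have Z': "continuous_on ?T ?Z" using smooth_on_continuous[OF smooth_fieldD[OF Z s c(1)]] by (simp add: eqT)
    have "continuous_on ?T (\<lambda>y. \<Sum>a\<in>UNIV. \<Sum>b\<in>UNIV. ?C y $ a * ?Z y $ b * ?m (?k y) (axis a 1) (axis b 1))"
      by (intro continuous_on_sum continuous_on_mult conn.continuous_cov_along[OF s c(1) X w] continuous_on_component Z'
          smooth_on_continuous[OF m])
    then have "continuous_on ?T ?f"
    proof (rule continuous_on_eq)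
      fix y assume "y \<in> ?T"
      then obtain q where q: "q \<in> fst s" "q \<in> fst c" "y = snd s q" by auto
      then have "q \<in> M" using c amb.chart_subset by blast
      then have b: "bilinear (?m (snd c q))" by (intro amb.bilinear_chart_metric c q bil)
      show "(\<Sum>a\<in>UNIV. \<Sum>b\<in>UNIV. ?C y $ a * ?Z y $ b * ?m (?k y) (axis a 1) (axis b 1)) = ?f y"
        using q s unfolding q(3) by (simp add: amb.metric_chart[OF c(1) q(2)] flip: bilinear_sum_components[OF b])
    qed
    then show "\<exists>T. open T \<and> y0 \<in> T \<and> Ck_on 0 ?f (snd s ` fst s \<inter> T)"
      using T p c by (intro exI[of _ ?T] conjI) (auto elim!: continuous_on_subset)
  qed
  then show ?thesis by simp
qed

text \<open>Removing the tangential part subtracts two squares, so the normal part of a timelike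
  vector is timelike; in particular its norm can be divided by.\<close>

lemma timelike_normal_part:
  assumes p: "p \<in> S" and N: "g p v v < 0" and e: "orthonormal_tangent P A g p e2 e3"
  defines "n \<equiv> normal_part P A g p v"
  shows "g p n n = g p v v - (g p v e2)\<^sup>2 - (g p v e3)\<^sup>2" "g p n n < 0"
    "v - n = g p v e2 *\<^sub>R e2 + g p v e3 *\<^sub>R e3"
proof -
  note b = bilS[OF p] and sy = symS[OF p]
  note bs = bilinear_lsub[OF b] bilinear_rsub[OF b] bilinear_lmul[OF b] bilinear_rmul[OF b]
  have et: "e2 \<in> surface_tangent_space P A p" "e3 \<in> surface_tangent_space P A p"
    and eo: "g p e2 e2 = 1" "g p e3 e3 = 1" "g p e2 e3 = 0" "g p e3 e2 = 0" using e sy[of e3 e2] by (auto simp: orthonormal_tangent_def)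
  have n: "n = v - g p v e2 *\<^sub>R e2 - g p v e3 *\<^sub>R e3"
    unfolding n_def by (rule normal_part_orthonormal[OF p et eo(1-3)])
  show "v - n = g p v e2 *\<^sub>R e2 + g p v e3 *\<^sub>R e3" by (simp add: n)
  show 1: "g p n n = g p v v - (g p v e2)\<^sup>2 - (g p v e3)\<^sup>2"
    unfolding n using sy[of e2 v] sy[of e3 v] by (simp add: bs eo power2_eq_square)
  then show "g p n n < 0" using N by (smt (verit) zero_le_power2)
qed

text \<open>On a chart domain the density is written through pairings of smooth fields and of
  derivatives of \<open>X\<close> in the frame directions; the only denominator is the norm of the
  normal part of \<open>N\<close>.\<close>

lemma continuous_energy_form:
  assumes N: "smooth_field P A S N" "\<And>p. p \<in> S \<Longrightarrow> g p (N p) (N p) < 0" and X: "smooth_field P A S X"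
  shows "continuous_two_form S P (\<lambda>p u v. energy_density P A g nab N X p * area_form P A g p u v)"
  unfolding continuous_two_form_def
proof (intro conjI ballI)
  fix p assume "p \<in> S"
  show "\<exists>k. \<forall>u v. energy_density P A g nab N X p * area_form P A g p u v = k * (u $ 0 * v $ 1 - u $ 1 * v $ 0)"
    unfolding area_form_def mult.assoc[symmetric] by blast
next
  fix s assume s: "s \<in> P"
  have subS: "fst s \<subseteq> S" by (rule sub.chart_subset[OF s])
  note W = sub.chart_openin[OF s]
  obtain e2 e3 w2 w3 where e2: "smooth_field P A (fst s) e2" and e3: "smooth_field P A (fst s) e3"
    and w2: "continuous_on (snd s ` fst s) (\<lambda>y. w2 (inv_chart s y))"
    and w3: "continuous_on (snd s ` fst s) (\<lambda>y. w3 (inv_chart s y))"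
    and fr: "\<forall>q\<in>fst s. e2 q = surf_vec P A s q (w2 q) \<and> e3 q = surf_vec P A s q (w3 q) \<and>
      g q (e2 q) (e2 q) = 1 \<and> g q (e3 q) (e3 q) = 1 \<and> g q (e2 q) (e3 q) = 0 \<and>
      sqrt (induced_gram P A g s q) * (w2 q $ 0 * w3 q $ 1 - w2 q $ 1 * w3 q $ 0) = 1 \<and>
      0 < w2 q $ 0 * w3 q $ 1 - w2 q $ 1 * w3 q $ 0"
    using orthonormal_frame[OF s] by (elim exE conjE)
  have N': "smooth_field P A (fst s) N" by (rule smooth_field_subset[OF N(1) subS])
  let ?i = "inv_chart s"
  let ?c = "\<lambda>f. continuous_on (snd s ` fst s) (\<lambda>y. f (?i y))"
  have cm: "?c (\<lambda>q. g q (Y q) (Z q))" if "smooth_field P A (fst s) Y" "smooth_field P A (fst s) Z" for Y Z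
    by (rule sub.smooth_function_continuous[OF smooth_metric_apply[OF that W] s subset_refl])
  define a2 where "a2 q = g q (N q) (e2 q)" for q
  define a3 where "a3 q = g q (N q) (e3 q)" for q
  define n where "n q = sqrt (- (g q (N q) (N q) - (a2 q)\<^sup>2 - (a3 q)\<^sup>2))" for q
  define B2 where "B2 Z q = g q (cov_along P A nab (surf_vec P A s q (w2 q)) X q) (Z q)" for Z q
  define B3 where "B3 Z q = g q (cov_along P A nab (surf_vec P A s q (w3 q)) X q) (Z q)" for Z q
  have a: "?c a2" "?c a3" unfolding a2_def a3_def by (intro cm N' e2 e3)+
  have n: "?c n" unfolding n_def by (intro continuous_intros cm N' a)
  have B: "?c (B2 Z)" "?c (B3 Z)" if "smooth_field P A (fst s) Z" for Z
    unfolding B2_def B3_def by (intro continuous_metric_cov_along[OF s X that] w2 w3)+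
  define t where "t i q = surf_vec P A s q (axis i 1)" for i :: 2 and q
  have t: "smooth_field P A (fst s) (t i)" for i unfolding t_def by (rule smooth_surf_vec[OF s])
  have gram: "?c (\<lambda>q. sqrt (induced_gram P A g s q))"
    unfolding induced_gram_def t_def[symmetric] by (intro continuous_intros cm t)
  \<comment> \<open>The normal part is written as \<open>N\<close> minus its tangential components,
    so that derivatives of \<open>X\<close> are paired with the smooth fields \<open>N\<close>,
    \<open>e2\<close> and \<open>e3\<close> only.\<close>
  have npos: "n q > 0" and dens: "energy_density P A g nab N X q =
      n q * (B2 e2 q + B3 e3 q) + inverse (n q) *
       (a2 q * (B2 N q - a2 q * B2 e2 q - a3 q * B2 e3 q) + a3 q * (B3 N q - a2 q * B3 e2 q - a3 q * B3 e3 q))"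
    if q: "q \<in> fst s" for q
  proof -
    have qS: "q \<in> S" using q subS by auto
    note b = bilS[OF qS] and sy = symS[OF qS]
    note bs = bilinear_lsub[OF b] bilinear_rsub[OF b] bilinear_ladd[OF b] bilinear_radd[OF b] bilinear_lmul[OF b] bilinear_rmul[OF b]
    have o: "orthonormal_tangent P A g q (e2 q) (e3 q)"
      unfolding orthonormal_tangent_def using fr q surf_vec_tangent by metis
    have et: "e2 q \<in> surface_tangent_space P A q" "e3 q \<in> surface_tangent_space P A q"
      and eo: "g q (e2 q) (e2 q) = 1" "g q (e3 q) (e3 q) = 1" "g q (e2 q) (e3 q) = 0"
      using o by (auto simp: orthonormal_tangent_def)
    define m where "m = normal_part P A g q (N q)"
    have m: "m = N q - a2 q *\<^sub>R e2 q - a3 q *\<^sub>R e3 q"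
      unfolding m_def a2_def a3_def by (rule normal_part_orthonormal[OF qS et eo])
    note tn = timelike_normal_part[OF qS N(2)[OF qS] o, folded m_def a2_def a3_def]
    have nn: "timelike_norm g q m = n q" by (simp add: timelike_norm_def n_def tn(1))
    show "n q > 0" using tn(1,2) by (simp add: n_def)
    have sv: "surf_vec P A s q (w2 q) = e2 q" "surf_vec P A s q (w3 q) = e3 q" using fr q by auto
    show "energy_density P A g nab N X q =
      n q * (B2 e2 q + B3 e3 q) + inverse (n q) *
       (a2 q * (B2 N q - a2 q * B2 e2 q - a3 q * B2 e3 q) + a3 q * (B3 N q - a2 q * B3 e2 q - a3 q * B3 e3 q))"
      unfolding energy_density_def Let_def m_def[symmetric] nn tn(3) normal_trace_eq[OF X qS qS o]
        cov_along_combination[OF X qS qS et] B2_def B3_def sv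
      by (simp add: m bs inverse_eq_divide) (simp add: algebra_simps)
  qed
  have nz: "\<forall>y\<in>snd s ` fst s. n (?i y) \<noteq> 0"
  proof
    fix y assume "y \<in> snd s ` fst s"
    then have "?i y \<in> fst s" using s by auto
    from npos[OF this] show "n (?i y) \<noteq> 0" by simp
  qed
  have "continuous_on (snd s ` fst s) (\<lambda>y. (n (?i y) * (B2 e2 (?i y) + B3 e3 (?i y)) + inverse (n (?i y)) *
       (a2 (?i y) * (B2 N (?i y) - a2 (?i y) * B2 e2 (?i y) - a3 (?i y) * B2 e3 (?i y))
        + a3 (?i y) * (B3 N (?i y) - a2 (?i y) * B3 e2 (?i y) - a3 (?i y) * B3 e3 (?i y)))) * sqrt (induced_gram P A g s (?i y)))"
    by (intro continuous_on_mult continuous_on_add continuous_on_diff continuous_on_inverse a n B e2 e3 N' gram nz)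
  then show "continuous_on (snd s ` fst s)
      (\<lambda>y. form_density P (\<lambda>p u v. energy_density P A g nab N X p * area_form P A g p u v) s (?i y))"
  proof (rule continuous_on_eq)
    fix y assume "y \<in> snd s ` fst s"
    then have q: "?i y \<in> fst s" using s by auto
    show "(n (?i y) * (B2 e2 (?i y) + B3 e3 (?i y)) + inverse (n (?i y)) *
       (a2 (?i y) * (B2 N (?i y) - a2 (?i y) * B2 e2 (?i y) - a3 (?i y) * B2 e3 (?i y))
        + a3 (?i y) * (B3 N (?i y) - a2 (?i y) * B3 e2 (?i y) - a3 (?i y) * B3 e3 (?i y)))) * sqrt (induced_gram P A g s (?i y))
      = form_density P (\<lambda>p u v. energy_density P A g nab N X p * area_form P A g p u v) s (?i y)"
      unfolding dens[OF q, symmetric] area_form_density[OF s q, symmetric] by (simp add: form_density_def)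
  qed
qed

end

section \<open>The mean curvature vector\<close>

locale spacelike_metric_surface = spacelike_connection S P M A g U nab + met: metric_surface M A U nab g S P
  for S :: "'a::topological_space set" and P :: "('a, 2) chart set" and M and A :: "('a, 4) chart set" and g U nab
begin

text \<open>The function \<open>\<langle>e, X\<rangle>\<close> vanishes along the surface, and so
  does its derivative.\<close>

lemma normal_field_pairing:
  assumes W: "openin (top_of_set S) W" "p \<in> W" and e: "smooth_field P A W e" "\<And>q. q \<in> W \<Longrightarrow> e q \<in> surface_tangent_space P A q"
    and X: "smooth_field P A W X" "\<And>q. q \<in> W \<Longrightarrow> X q \<in> surface_normal_space P A g q"
    and v: "v \<in> surface_tangent_space P A p"
  shows "g p (cov_along P A nab v e p) (X p) = - g p (cov_along P A nab v X p) (e p)"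
proof -
  have p: "p \<in> S" using W openin_imp_subset by blast
  define s where "s = chart_at P p"
  note s = sub.chart_at_mem[OF p, folded s_def]
  obtain w where w: "v = surf_vec P A s p w"
    using v surf_vec_chart_at[OF p] unfolding surface_tangent_space_def s_def by auto
  have "eventually (\<lambda>y. g (inv_chart s y) (e (inv_chart s y)) (X (inv_chart s y)) = 0) (nhds (snd s p))"
    using sub.eventually_in_chart[OF s W]
  proof eventually_elim
    case (elim y)
    then obtain q where q: "q \<in> fst s" "q \<in> W" "y = snd s q" by auto
    have "q \<in> S" using q W openin_imp_subset by blast
    then show ?case using q s e(2)[OF q(2)] X(2)[OF q(2)] symS[of q "e q"] by (simp add: surface_normal_space_def)
  qed
  from fd_cong(1)[OF this] have "fd (\<lambda>y. g (inv_chart s y) (e (inv_chart s y)) (X (inv_chart s y))) (snd s p) w = 0"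
    by (simp add: fd_eq[OF has_derivative_const])
  then have "g p (cov_along P A nab v e p) (X p) + g p (e p) (cov_along P A nab v X p) = 0"
    unfolding w met.compatible_along[OF s W e(1) X(1)] .
  then show ?thesis using symS[OF p, of "e p"] by simp
qed

text \<open>The frame selected in the definition depends on \<open>p\<close> and is differentiated.
  Pairing with the normal field \<open>X\<close> removes the tangential part and moves the
  derivative to \<open>X\<close>; after that only the values of the frame at \<open>p\<close>
  matter.\<close>

lemma mean_curvature_pairing:
  assumes X: "smooth_field P A S X" "\<And>q. q \<in> S \<Longrightarrow> X q \<in> surface_normal_space P A g q" and p: "p \<in> S"
  shows "g p (mean_curvature S P A g nab p) (X p) = - normal_trace P A g nab X p"
proof -
  note s = sub.chart_at_mem[OF p]
  obtain e2 e3 w2 w3 where e: "smooth_field P A (fst (chart_at P p)) e2" "smooth_field P A (fst (chart_at P p)) e3"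
    and fr: "\<forall>q\<in>fst (chart_at P p). e2 q = surf_vec P A (chart_at P p) q (w2 q) \<and> e3 q = surf_vec P A (chart_at P p) q (w3 q) \<and>
      g q (e2 q) (e2 q) = 1 \<and> g q (e3 q) (e3 q) = 1 \<and> g q (e2 q) (e3 q) = 0 \<and>
      sqrt (induced_gram P A g (chart_at P p) q) * (w2 q $ 0 * w3 q $ 1 - w2 q $ 1 * w3 q $ 0) = 1 \<and>
      0 < w2 q $ 0 * w3 q $ 1 - w2 q $ 1 * w3 q $ 0"
    using orthonormal_frame[OF s(1)] by (elim exE conjE)
  have "tangent_orthonormal_frame S P A g p (e2, e3)"
    unfolding tangent_orthonormal_frame_def prod.case
    by (intro exI[of _ "fst (chart_at P p)"] conjI e sub.chart_openin s ballI) (use fr surf_vec_tangent in metis)+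
  then have ex: "\<exists>e. tangent_orthonormal_frame S P A g p e" by blast
  obtain f2 f3 where f: "(SOME e. tangent_orthonormal_frame S P A g p e) = (f2, f3)" by (metis surj_pair)
  have "tangent_orthonormal_frame S P A g p (f2, f3)" using someI_ex[OF ex] unfolding f .
  then obtain W where W: "openin (top_of_set S) W" "p \<in> W" "smooth_field P A W f2" "smooth_field P A W f3"
    and fo: "\<forall>q\<in>W. f2 q \<in> surface_tangent_space P A q \<and> f3 q \<in> surface_tangent_space P A q \<and>
      g q (f2 q) (f2 q) = 1 \<and> g q (f3 q) (f3 q) = 1 \<and> g q (f2 q) (f3 q) = 0"
    unfolding tangent_orthonormal_frame_def prod.case by (elim exE conjE)
  have WS: "W \<subseteq> S" by (rule openin_imp_subset[OF W(1)])
  have XW: "smooth_field P A W X" by (rule smooth_field_subset[OF X(1) WS])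
  have XN: "\<And>q. q \<in> W \<Longrightarrow> X q \<in> surface_normal_space P A g q" using X(2) WS by auto
  have o: "orthonormal_tangent P A g p (f2 p) (f3 p)" using fo W(2) by (auto simp: orthonormal_tangent_def)
  let ?h = "cov_along P A nab (f2 p) f2 p + cov_along P A nab (f3 p) f3 p"
  have H: "mean_curvature S P A g nab p = normal_part P A g p ?h" by (simp add: mean_curvature_def f)
  have "g p (?h - normal_part P A g p ?h) (X p) = 0"
    using normal_part_tangent[OF p, of ?h] X(2)[OF p] symS[OF p, of _ "X p"] by (simp add: surface_normal_space_def)
  then have "g p (mean_curvature S P A g nab p) (X p) = g p ?h (X p)"
    unfolding H by (simp add: bilinear_lsub[OF bilS[OF p]])
  also have "\<dots> = - g p (cov_along P A nab (f2 p) X p) (f2 p) - g p (cov_along P A nab (f3 p) X p) (f3 p)"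
    unfolding bilinear_ladd[OF bilS[OF p]]
    using normal_field_pairing[OF W(1,2,3) _ XW XN, of "f2 p"] normal_field_pairing[OF W(1,2,4) _ XW XN, of "f3 p"] fo W(2)
    by simp
  finally show ?thesis by (simp add: normal_trace_eq[OF X(1) p p o])
qed

end

section \<open>The Chen-Nester-Tung form in terms of the energy densities\<close>

lemma det4_positive_basis: "positive_basis e \<longleftrightarrow> 0 < det4 (e 0) (e 1) (e 2) (e 3)"
proof -
  have "i = 0 \<or> i = 1 \<or> i = 2 \<or> i = 3" for i :: 4
    using UNIV_4_zero by (metis UNIV_I empty_iff insert_iff)
  then have "list4 (e 0) (e 1) (e 2) (e 3) i = e i" for i :: 4 by (auto simp: list4_def)
  then have "(\<chi> i. list4 (e 0) (e 1) (e 2) (e 3) i) = transpose (frame_matrix e)"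
    by (simp add: vec_eq_iff transpose_def frame_matrix_def)
  then show ?thesis by (simp add: det4_def positive_basis_def frame_matrix_def)
qed

lemma connection_eta_trace_linear_vector: "linear (\<lambda>v. connection_eta_trace h e D n v)"
proof -
  have "linear (\<lambda>v. det4 x y n (matrix_inv (frame_matrix e) *v v))" for x y n
    using linear_compose[OF matrix_vector_mul_linear, of "det4 x y n"] det4_linear(3) by (simp add: bilinear_def o_def)
  note l = linear_add[OF this] linear_cmul[OF this]
  show ?thesis unfolding connection_eta_trace_det4
    by (rule linearI) (simp_all add: l distrib_left sum.distrib sum_distrib_left mult_ac)
qed

lemma connection_eta_trace_linear_map:
  assumes "\<And>b. linear (\<lambda>u. D u (e b))"
  shows "linear (\<lambda>u. connection_eta_trace h e (D u) n v)"
  unfolding connection_eta_trace_def coframe_eq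
  by (rule linearI) (simp_all add: linear_add[OF assms] linear_cmul[OF assms] matrix_vector_right_distrib
      distrib_right sum.distrib sum_distrib_left mult.assoc matrix_vector_mult_scaleR)

text \<open>The coordinate fields of a chart serve; they are positively oriented because transition
  maps have positive determinant.\<close>

lemma (in connection) local_frame_exists:
  assumes p: "p \<in> U" shows "\<exists>e. local_frame A U p e"
proof -
  have pM: "p \<in> M" using p U_subset by auto
  define c where "c = chart_at A p"
  note c = chart_at_mem[OF pM, folded c_def]
  have o: "openin (top_of_set M) (fst c \<inter> U)" by (rule openin_Int[OF chart_openin[OF c(1)] U])
  have "local_frame A U p (coord_field A c)"
    unfolding local_frame_def
  proof (intro exI[of _ "fst c \<inter> U"] conjI allI ballI)
    show "openin (top_of_set U) (fst c \<inter> U)" by (rule openin_U_iff[OF o]) simp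
    show "p \<in> fst c \<inter> U" using c p by simp
    show "smooth_field A A (fst c \<inter> U) (coord_field A c a)" for a
      using self.smooth_field_subset[OF smooth_from_components[OF c(1), of "axis a 1"], of "fst c \<inter> U"]
      by (simp add: coord_field_eq[abs_def])
    fix q assume q: "q \<in> fst c \<inter> U"
    then have "q \<in> M" using U_subset by auto
    note d = chart_at_mem[OF this]
    have "0 < det (matrix (chart_deriv c (chart_at A q) (\<lambda>q. q) q))"
      by (rule transition_det) (use c d q in auto)
    then show "positive_basis (\<lambda>a. coord_field A c a q)"
      by (simp add: positive_basis_def coord_field_def matrix_def)
  qed
  then show ?thesis by blast
qed

locale cnt_setting = spacelike_metric_surface S P M A g M nab + ref: metric_surface M A U nab_ref gref S P
  for S :: "'a::topological_space set" and P :: "('a, 2) chart set" and M and A :: "('a, 4) chart set"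
    and g nab U nab_ref gref +
  fixes N X
  assumes gref: "p \<in> S \<Longrightarrow> gref p u v = g p u v"
    and N: "smooth_field P A S N" "p \<in> S \<Longrightarrow> g p (N p) (N p) < 0"
    and X: "smooth_field P A S X" "p \<in> S \<Longrightarrow> X p \<in> surface_normal_space P A g p"
      "p \<in> S \<Longrightarrow> g p (X p) (X p) = 1" "p \<in> S \<Longrightarrow> g p (X p) (N p) = 0"
    and positive_X: "p \<in> S \<Longrightarrow> positive_basis (list4 (normal_part P A g p (N p)) (X p)
           (incl_deriv P A p (axis 0 1)) (incl_deriv P A p (axis 1 1)))"
begin

sublocale ref_conn: spacelike_connection S P M A g U nab_ref by unfold_locales

text \<open>In the preferred chart at \<open>p\<close> vectors at \<open>p\<close> equal their
  components, so this is the difference tensor of the two connections.\<close>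

definition nab_diff :: "'a \<Rightarrow> real^4 \<Rightarrow> real^4 \<Rightarrow> real^4" where
  "nab_diff p u v = christoffel A nab (chart_at A p) p u v - christoffel A nab_ref (chart_at A p) p u v"

lemma bilinear_nab_diff: "p \<in> S \<Longrightarrow> bilinear (nab_diff p)"
proof -
  assume p: "p \<in> S"
  then have pM: "p \<in> M" "p \<in> U" using sub_subset ref.S_subset by auto
  note c = amb.chart_at_mem[OF pM(1)]
  show ?thesis
    using conn.bilinear_christoffel[OF pM(1) c] ref.bilinear_christoffel[OF pM(2) c]
    unfolding bilinear_def nab_diff_def by (auto intro: linear_compose_sub)
qed

text \<open>The derivatives of the components cancel, so the difference depends on the value of
  \<open>Y\<close> at \<open>p\<close> only.\<close>

lemma nab_diff_cov_along:
  assumes Y: "smooth_field P A W Y" "p \<in> W" and p: "p \<in> S" and v: "v \<in> surface_tangent_space P A p"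
  shows "nab_diff p v (Y p) = cov_along P A nab v Y p - cov_along P A nab_ref v Y p"
proof -
  have pM: "p \<in> M" using p sub_subset by auto
  note s = sub.chart_at_mem[OF p] and c = amb.chart_at_mem[OF pM]
  obtain w where w: "v = surf_vec P A (chart_at P p) p w"
    using v surf_vec_chart_at[OF p] unfolding surface_tangent_space_def by auto
  have "chart_deriv (chart_at P p) (chart_at A p) (\<lambda>q. q) p w = v"
    using components_surf_vec[OF smooth_inclusion_axioms s(1) c(1) s(2) c(2), of w] pM by (simp add: w)
  then show ?thesis
    unfolding w conn.cov_along_preferred[OF s Y] ref.cov_along_preferred[OF s Y] nab_diff_def by (simp add: w)
qed

text \<open>Along \<open>S\<close> both connections differentiate the same function \<open>g(Y, Z)\<close>.\<close>

lemma nab_diff_antisymmetric: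
  assumes p: "p \<in> S" and v: "v \<in> surface_tangent_space P A p"
  shows "g p (nab_diff p v x) y + g p x (nab_diff p v y) = 0"
proof -
  have pM: "p \<in> M" using p sub_subset by auto
  define s where "s = chart_at P p"
  define c where "c = chart_at A p"
  note s = sub.chart_at_mem[OF p, folded s_def] and c = amb.chart_at_mem[OF pM, folded c_def]
  obtain w where w: "v = surf_vec P A s p w"
    using v surf_vec_chart_at[OF p] unfolding surface_tangent_space_def s_def by auto
  let ?F = "\<lambda>x q. from_components A c q x"
  let ?W = "S \<inter> fst c"
  note W = openin_chart_inter[OF c(1)]
  have pW: "p \<in> ?W" using p c by simp
  have F: "smooth_field P A ?W (?F x)" for x
  proof (rule smooth_fieldI[OF W])
    fix q assume q: "q \<in> ?W"
    define t where "t = chart_at P q"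
    note t = sub.chart_at_mem[of q, folded t_def]
    have tq: "t \<in> P" "q \<in> fst t" using t q by auto
    have o: "open (snd t ` (fst t \<inter> fst c \<inter> ?W))" by (rule open_inter_image[OF tq(1) c(1) W])
    have "smooth_on (\<lambda>y. components A c (inv_chart t y) (?F x (inv_chart t y))) (snd t ` (fst t \<inter> fst c \<inter> ?W))"
      by (rule smooth_on_cong[OF smooth_on_const[of x] o]) (use tq c in auto)
    then show "\<exists>s\<in>P. \<exists>ca\<in>A. \<exists>V. openin (top_of_set S) V \<and> q \<in> V \<and> q \<in> fst s \<and> q \<in> fst ca \<and>
       smooth_on (\<lambda>y. components A ca (inv_chart s y) (?F x (inv_chart s y))) (snd s ` (fst s \<inter> fst ca \<inter> V))"
      using tq q c by (intro bexI[OF _ tq(1)] bexI[OF _ c(1)] exI[of _ ?W] conjI W) auto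
  qed
  have Fp: "?F x p = x" for x using pM by (simp add: c_def)
  have "eventually (\<lambda>y. g (inv_chart s y) (?F x (inv_chart s y)) (?F y' (inv_chart s y)) =
      gref (inv_chart s y) (?F x (inv_chart s y)) (?F y' (inv_chart s y))) (nhds (snd s p))" for y'
    using sub.eventually_in_chart[OF s openin_subtopology_self p]
    by eventually_elim (use s in \<open>auto simp: gref\<close>)
  from fd_cong(1)[OF this, of y] met.compatible_along[OF s W pW F F, of x y w] ref.compatible_along[OF s W pW F F, of x y w]
  have "g p (cov_along P A nab v (?F x) p) y + g p x (cov_along P A nab v (?F y) p) =
     g p (cov_along P A nab_ref v (?F x) p) y + g p x (cov_along P A nab_ref v (?F y) p)"
    by (simp add: w Fp gref[OF p])
  then show ?thesis
    using nab_diff_cov_along[OF F pW p v, of x] nab_diff_cov_along[OF F pW p v, of y]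
    by (simp add: Fp bilinear_lsub[OF bilS[OF p]] bilinear_rsub[OF bilS[OF p]])
qed

text \<open>The selected frame is differentiated only in the difference of the two connections,
  which is tensorial; what remains of the frame is its value at \<open>p\<close>, a positive
  basis.\<close>

lemma cnt_form_trace:
  assumes p: "p \<in> S"
  shows "\<exists>e. positive_basis e \<and> (\<forall>u v. cnt_form P A U g nab nab_ref N p u v =
      connection_eta_trace (g p) e (nab_diff p (incl_deriv P A p u)) (N p) (incl_deriv P A p v)
      - connection_eta_trace (g p) e (nab_diff p (incl_deriv P A p v)) (N p) (incl_deriv P A p u))"
proof -
  have pM: "p \<in> M" "p \<in> U" using p sub_subset ref.S_subset by auto
  note c = amb.chart_at_mem[OF pM(1)]
  define e where "e = (SOME e. local_frame A U p e)"
  have "local_frame A U p e" unfolding e_def by (rule someI_ex[OF ref.local_frame_exists[OF pM(2)]])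
  then obtain W where W0: "openin (top_of_set U) W" and W: "p \<in> W" and sm: "\<And>a. smooth_field A A W (e a)"
    and pos: "positive_basis (\<lambda>a. e a p)" unfolding local_frame_def by blast
  have WM: "openin (top_of_set M) W" by (rule ref.openin_U[OF W0])
  have d: "nab u (e b) p - nab_ref u (e b) p = nab_diff p u (e b p)" for u b
    using conn.components_nab[OF pM(1) c WM W sm, of u b] ref.components_nab[OF pM(2) c WM W sm, of u b] pM
    by (simp add: nab_diff_def)
  have cf: "connection_form nab e p a b u - connection_form nab_ref e p a b u = coframe (\<lambda>c. e c p) a (nab_diff p u (e b p))" for a b u
    unfolding connection_form_def coframe_eq d[symmetric] by (simp add: matrix_vector_mult_diff_distrib)
  show ?thesis
  proof (intro exI[of _ "\<lambda>a. e a p"] conjI allI)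
    show "positive_basis (\<lambda>a. e a p)" by (rule pos)
    show "cnt_form P A U g nab nab_ref N p u v =
      connection_eta_trace (g p) (\<lambda>a. e a p) (nab_diff p (incl_deriv P A p u)) (N p) (incl_deriv P A p v)
      - connection_eta_trace (g p) (\<lambda>a. e a p) (nab_diff p (incl_deriv P A p v)) (N p) (incl_deriv P A p u)" for u v
      unfolding cnt_form_def Let_def e_def[symmetric] cf connection_eta_trace_def by (simp add: sum_subtractf)
  qed
qed

text \<open>Both sides are alternating forms on a plane, so they are compared on the single pair
  \<open>w2\<close>, \<open>w3\<close>, on which the area form takes the value 1.\<close>

lemma cnt_form_eq:
  assumes p: "p \<in> S"
  shows "cnt_form P A U g nab nab_ref N p u v =
    2 * (energy_density P A g nab_ref N X p - energy_density P A g nab N X p) * area_form P A g p u v"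
proof -
  define s where "s = chart_at P p"
  note s = sub.chart_at_mem[OF p, folded s_def]
  note b = bilS[OF p] and sy = symS[OF p] and L = linear_incl[OF p] and bD = bilinear_nab_diff[OF p]
  note bs = bilinear_lsub[OF b] bilinear_rsub[OF b] bilinear_ladd[OF b] bilinear_radd[OF b] bilinear_lmul[OF b] bilinear_rmul[OF b]
  let ?i = "incl_deriv P A p"
  obtain f2 f3 k2 k3 where "\<forall>q\<in>fst s. f2 q = surf_vec P A s q (k2 q) \<and> f3 q = surf_vec P A s q (k3 q) \<and>
      g q (f2 q) (f2 q) = 1 \<and> g q (f3 q) (f3 q) = 1 \<and> g q (f2 q) (f3 q) = 0 \<and>
      sqrt (induced_gram P A g s q) * (k2 q $ 0 * k3 q $ 1 - k2 q $ 1 * k3 q $ 0) = 1 \<and>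
      0 < k2 q $ 0 * k3 q $ 1 - k2 q $ 1 * k3 q $ 0"
    using orthonormal_frame[OF s(1)] by (elim exE conjE)
  note fr = bspec[OF this s(2)]
  define e2 e3 w2 w3 where ew: "e2 = f2 p" "e3 = f3 p" "w2 = k2 p" "w3 = k3 p"
  note c2 = conjunct2[OF fr[folded ew]]
  note c3 = conjunct2[OF conjunct2[OF c2]]
  have sv: "surf_vec P A s p w = ?i w" for w using surf_vec_chart_at[OF p] by (simp add: s_def)
  have e2: "e2 = ?i w2" and e3: "e3 = ?i w3"
    using conjunct1[OF fr[folded ew]] conjunct1[OF c2] unfolding sv .
  have eo: "g p e2 e2 = 1" "g p e3 e3 = 1" "g p e2 e3 = 0" "g p e3 e2 = 0"
  proof -
    show "g p e2 e2 = 1" by (rule conjunct1[OF conjunct2[OF c2]])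
    show "g p e3 e3 = 1" by (rule conjunct1[OF c3])
    show z: "g p e2 e3 = 0" by (rule conjunct1[OF conjunct2[OF c3]])
    show "g p e3 e2 = 0" using z sy[of e3 e2] by simp
  qed
  have cross: "0 < w2$0 * w3$1 - w2$1 * w3$0" by (rule conjunct2[OF conjunct2[OF conjunct2[OF c3]]])
  have area1: "sqrt (induced_gram P A g s p) * (w2$0 * w3$1 - w2$1 * w3$0) = 1"
    by (rule conjunct1[OF conjunct2[OF conjunct2[OF c3]]])
  have et: "e2 \<in> surface_tangent_space P A p" "e3 \<in> surface_tangent_space P A p"
    by (simp_all add: e2 e3 surface_tangent_space_def)
  have o: "orthonormal_tangent P A g p e2 e3" using et eo by (simp add: orthonormal_tangent_def)
  define n where "n = normal_part P A g p (N p)"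
  note tn = timelike_normal_part[OF p N(2)[OF p] o, folded n_def]
  define r where "r = timelike_norm g p n"
  have r: "r > 0" "r * r = - g p n n" using tn(2) by (simp_all add: r_def timelike_norm_def)
  define f0 where "f0 = (1 / r) *\<^sub>R n"
  have rf0: "n = r *\<^sub>R f0" using r by (simp add: f0_def)
  define a2 a3 where "a2 = g p (N p) e2" and "a3 = g p (N p) e3"
  have Nt: "N p - n = a2 *\<^sub>R e2 + a3 *\<^sub>R e3" using tn(3) by (simp add: a2_def a3_def)
  have nn: "n \<in> surface_normal_space P A g p" unfolding n_def by (rule normal_part_normal[OF p])
  have n0: "g p n e2 = 0" "g p n e3 = 0" using nn et by (auto simp: surface_normal_space_def)
  have X0: "g p (X p) e2 = 0" "g p (X p) e3 = 0" using X(2)[OF p] et by (auto simp: surface_normal_space_def)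
  \<comment> \<open>\<open>X\<close> is orthogonal to \<open>N\<close> and, being normal, to the
    tangential part of \<open>N\<close>; hence it is orthogonal to the normal part.\<close>
  have Xn: "g p (X p) n = 0"
  proof -
    have "g p (X p) (N p - n) = 0" unfolding Nt by (simp add: bs X0)
    then show ?thesis using X(4)[OF p] by (simp add: bs)
  qed
  define f where "f = list4 f0 (X p) e2 e3"
  have f_simps: "f 0 = f0" "f 1 = X p" "f 2 = e2" "f 3 = e3" by (simp_all add: f_def list4_def)
  have f00: "g p f0 f0 = -1"
  proof -
    have "g p n n = - (r * r)" using r(2) by simp
    then show ?thesis using r(1) by (simp add: f0_def bs)
  qed
  have zs: "g p f0 e2 = 0" "g p f0 e3 = 0" "g p f0 (X p) = 0" "g p e2 f0 = 0" "g p e3 f0 = 0" "g p (X p) f0 = 0"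
    "g p e2 (X p) = 0" "g p e3 (X p) = 0"
    using n0 X0 Xn sy[of n "X p"] sy[of e2 n] sy[of e3 n] sy[of e2 "X p"] sy[of e3 "X p"] by (simp_all add: f0_def bs)
  interpret fr: lorentz_frame "g p" f
  proof
    show "bilinear (g p)" by (rule b)
    show "g p x y = g p y x" for x y by (rule sy)
    have *: "i = 0 \<or> i = 1 \<or> i = 2 \<or> i = 3" for i :: 4
      using UNIV_4_zero by (metis UNIV_I empty_iff insert_iff)
    show "g p (f i) (f j) = (if i = j then lorentz_sign i else 0)" for i j
      using *[of i] *[of j] by (elim disjE) (simp_all add: f_simps lorentz_sign_def eo f00 zs X0 X(3)[OF p])
  qed
  \<comment> \<open>The orientation hypothesis concerns \<open>n\<close>, \<open>X\<close> and the
    coordinate vectors of \<open>S\<close>. Replacing the latter by \<open>e2\<close>,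
    \<open>e3\<close> multiplies the determinant by the positive number in \<open>cross\<close>, and
    \<open>n\<close> is scaled by \<open>1 / r\<close>.\<close>
  have pos: "positive_basis f"
  proof -
    let ?x = "?i (axis 0 1)" and ?y = "?i (axis 1 1)"
    let ?B = "det4 n (X p)"
    have "w = w$0 *\<^sub>R axis 0 1 + w$1 *\<^sub>R axis 1 1" for w :: "real^2"
      by (simp add: vec_eq_iff forall_2_zero axis_def)
    then have iw: "?i w = w$0 *\<^sub>R ?x + w$1 *\<^sub>R ?y" for w
      by (metis linear_add[OF L] linear_cmul[OF L])
    note B = bilinear_ladd[OF det4_linear(3)] bilinear_radd[OF det4_linear(3)]
      bilinear_lmul[OF det4_linear(3)] bilinear_rmul[OF det4_linear(3)]
    have z: "?B x x = 0" for x using det4_swap[of n "X p" x x] by simp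
    have "0 < ?B ?x ?y"
      using positive_X[OF p] unfolding det4_positive_basis n_def by (simp add: list4_def)
    moreover have "det4 (f 0) (f 1) (f 2) (f 3) = (1 / r) * ?B e2 e3"
      using linear_cmul[OF det4_linear(1), of "1 / r" n] by (simp add: f_simps f0_def)
    moreover have "?B e2 e3 = (w2$0 * w3$1 - w2$1 * w3$0) * ?B ?x ?y"
      unfolding e2 e3 iw[of w2] iw[of w3] by (simp add: B z det4_swap[of n "X p" ?y ?x] algebra_simps)
    ultimately show ?thesis unfolding det4_positive_basis using r cross by simp
  qed
  obtain e where e_cnt: "positive_basis e \<and> (\<forall>u v. cnt_form P A U g nab nab_ref N p u v =
      connection_eta_trace (g p) e (nab_diff p (?i u)) (N p) (?i v)
      - connection_eta_trace (g p) e (nab_diff p (?i v)) (N p) (?i u))"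
    using cnt_form_trace[OF p] by (rule exE)
  note e = conjunct1[OF e_cnt] and cnt = conjunct2[OF e_cnt, rule_format]
  define \<beta> where "\<beta> u v = connection_eta_trace (g p) e (nab_diff p (?i u)) (N p) (?i v)" for u v
  have lD: "linear (\<lambda>u. nab_diff p u x)" "linear (nab_diff p x)" for x using bD by (auto simp: bilinear_def)
  have b\<beta>: "bilinear \<beta>"
  proof -
    have "linear (\<beta> u)" for u
      unfolding \<beta>_def[abs_def] using linear_compose[OF L connection_eta_trace_linear_vector] by (simp add: o_def)
    moreover have "linear (\<lambda>u. \<beta> u v)" for v
      unfolding \<beta>_def using linear_compose[OF L lD(1)] by (intro connection_eta_trace_linear_map) (simp add: o_def)
    ultimately show ?thesis by (simp add: bilinear_def)
  qed
  define k where "k = \<beta> (axis 0 1) (axis 1 1) - \<beta> (axis 1 1) (axis 0 1)"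
  have two: "(2::2) = 0" by simp
  have cnt_k: "cnt_form P A U g nab nab_ref N p u v = (u$0 * v$1 - u$1 * v$0) * k" for u v
    unfolding cnt \<beta>_def[symmetric] k_def
    by (subst (1 2) bilinear_sum_components[OF b\<beta>]) (simp add: sum_2 two algebra_simps)
  have area: "area_form P A g p u v = sqrt (induced_gram P A g s p) * (u$0 * v$1 - u$1 * v$0)" for u v
    by (simp add: area_form_def det_2_eq induced_gram_def surf_vec_chart_at[OF p] s_def power2_eq_square sy[of "?i (axis 1 1)" "?i (axis 0 1)"])
  have Np: "N p = r *\<^sub>R f 0 + a2 *\<^sub>R f 2 + a3 *\<^sub>R f 3"
    using Nt rf0 by (simp add: f_simps algebra_simps)
  have "cnt_form P A U g nab nab_ref N p w2 w3 = connection_eta_trace (g p) e (nab_diff p e2) (N p) (f 3)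
      - connection_eta_trace (g p) e (nab_diff p e3) (N p) (f 2)"
    unfolding cnt f_simps e2 e3 ..
  also have "\<dots> = -2 * (r * (g p (nab_diff p e2 (f 1)) (f 2) + g p (nab_diff p e3 (f 1)) (f 3))
      + (a2 * g p (nab_diff p e2 (f 1)) (f 0) + a3 * g p (nab_diff p e3 (f 1)) (f 0)))"
    by (rule fr.connection_eta_alternation[OF e pos lD(2) lD(2) nab_diff_antisymmetric[OF p et(1)]
          nab_diff_antisymmetric[OF p et(2)] Np])
  also have "\<dots> = 2 * (energy_density P A g nab_ref N X p - energy_density P A g nab N X p)"
  proof -
    have d: "nab_diff p e2 (X p) = cov_along P A nab e2 X p - cov_along P A nab_ref e2 X p"
      "nab_diff p e3 (X p) = cov_along P A nab e3 X p - cov_along P A nab_ref e3 X p"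
      by (intro nab_diff_cov_along[OF X(1) p p] et)+
    have t: "normal_trace P A g nab X p = g p (cov_along P A nab e2 X p) e2 + g p (cov_along P A nab e3 X p) e3"
      "normal_trace P A g nab_ref X p = g p (cov_along P A nab_ref e2 X p) e2 + g p (cov_along P A nab_ref e3 X p) e3"
      by (rule normal_trace_eq[OF X(1) p p o], rule ref_conn.normal_trace_eq[OF X(1) p p o])
    have rr: "1 / r * g p z n = g p z f0" for z by (simp add: f0_def bs)
    show ?thesis
      unfolding energy_density_def Let_def n_def[symmetric] r_def[symmetric] rr Nt t
        cov_along_combination[OF X(1) p p et] ref_conn.cov_along_combination[OF X(1) p p et] f_simps d
      by (simp add: bs algebra_simps)
  qed
  finally have "cnt_form P A U g nab nab_ref N p w2 w3 =
    2 * (energy_density P A g nab_ref N X p - energy_density P A g nab N X p)" .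
  then have k: "k * (w2$0 * w3$1 - w2$1 * w3$0) = 2 * (energy_density P A g nab_ref N X p - energy_density P A g nab N X p)"
    unfolding cnt_k by (simp add: mult.commute)
  \<comment> \<open>The factor inserted here is 1 by \<open>area1\<close>; its first half turns the
    coordinate determinant into the area form, its second half turns \<open>k\<close> into the value
    on \<open>w2\<close>, \<open>w3\<close>.\<close>
  have "cnt_form P A U g nab nab_ref N p u v = (u$0 * v$1 - u$1 * v$0) * k * (sqrt (induced_gram P A g s p) * (w2$0 * w3$1 - w2$1 * w3$0))"
    unfolding cnt_k area1 by simp
  also have "\<dots> = k * (w2$0 * w3$1 - w2$1 * w3$0) * area_form P A g p u v" unfolding area by (simp add: mult_ac)
  finally show ?thesis unfolding k .
qed

end

section \<open>The image surface\<close>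

lemma range_surf_vec:
  assumes "oriented_manifold S P" "s \<in> P" "p \<in> fst s"
  shows "range (surf_vec P A s p) = surface_tangent_space P A p"
proof -
  interpret oriented_manifold S P by fact
  have "range (from_components P s p) = UNIV"
    using components_from_components(2)[OF assms(2,3)] by (metis surj_def)
  then have "range (incl_deriv P A p \<circ> from_components P s p) = range (incl_deriv P A p)"
    by (metis image_comp)
  then show ?thesis by (simp add: surf_vec_def[abs_def] surface_tangent_space_def o_def)
qed

lemma metric_connectionI:
  assumes "oriented_manifold M A" "openin (top_of_set M) U" and lc: "levi_civita A U g nab"
    and "\<And>p. p \<in> U \<Longrightarrow> bilinear (g p)" "\<And>p u v. p \<in> U \<Longrightarrow> g p u v = g p v u"
    and "\<And>c p v w. c \<in> A \<Longrightarrow> p \<in> fst c \<Longrightarrow> p \<in> U \<Longrightarrow> (\<lambda>x. chart_metric A g c x v w) differentiable (at (snd c p))"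
  shows "metric_connection M A U nab g"
proof -
  interpret oriented_manifold M A by fact
  show ?thesis
  proof unfold_locales
    show "affine_connection A U nab" using lc by (simp add: levi_civita_def)
    show "nab (X p) Y p - nab (Y p) X p = lie_bracket A X Y p"
      if "p \<in> U" "field_near A U p X" "field_near A U p Y" for p X Y
      by (rule lc[unfolded levi_civita_def, THEN conjunct2, THEN conjunct1, rule_format]) (use that in simp_all)
    show "dirderiv A (\<lambda>q. g q (X q) (Y q)) p v = g p (nab v X p) (Y p) + g p (X p) (nab v Y p)"
      if "p \<in> U" "field_near A U p X" "field_near A U p Y" for p X Y v
      by (rule lc[unfolded levi_civita_def, THEN conjunct2, THEN conjunct2, rule_format]) (use that in simp_all)
  qed fact+
qed

text \<open>In coordinates the pulled-back coefficients are those of the target at \<open>F\<close>,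
  evaluated on the differential of \<open>F\<close>; the product rule applies since this
  differential is smooth.\<close>

lemma (in smooth_map_between) chart_metric_map_differentiable:
  assumes c: "c \<in> A" "p \<in> fst c" and p: "p \<in> U"
    and iso: "\<And>q u v. q \<in> U \<Longrightarrow> g q u v = g' (\<phi> q) (tangent_map A A' \<phi> q u) (tangent_map A A' \<phi> q v)"
    and bil: "\<And>q. q \<in> M' \<Longrightarrow> bilinear (g' q)"
    and diff: "\<And>d q v w. d \<in> A' \<Longrightarrow> q \<in> fst d \<Longrightarrow> (\<lambda>x. chart_metric A' g' d x v w) differentiable (at (snd d q))"
  shows "(\<lambda>x. chart_metric A g c x v w) differentiable (at (snd c p))"
proof -
  have pM: "p \<in> M" "\<phi> p \<in> M'" using p U_subset map_into by auto
  define d where "d = chart_at A' (\<phi> p)"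
  note d = dst.chart_at_mem[OF pM(2), folded d_def]
  define F where "F = (\<lambda>x. snd d (\<phi> (inv_chart c x)))"
  define T where "T = snd c ` (fst c \<inter> {q \<in> U. \<phi> q \<in> fst d})"
  have T: "open T" "snd c p \<in> T" using map_open_image[OF c(1) d(1)] c d p by (auto simp: T_def)
  have smF: "smooth_on F T" unfolding F_def T_def by (rule map_smooth[OF c(1) d(1)])
  have Fp: "F (snd c p) = snd d (\<phi> p)" using c by (simp add: F_def)
  have dF: "(F has_derivative fd F (snd c p)) (at (snd c p))"
    by (rule fd_works[OF smooth_on_differentiable[OF smF T(2)]])
  have dL: "((\<lambda>x. fd F x v) has_derivative fd (\<lambda>x. fd F x v) (snd c p)) (at (snd c p))" for v
    by (rule fd_works[OF smooth_on_differentiable[OF smooth_on_fd[OF smF] T(2)]])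
  have ev: "eventually (\<lambda>x. bilinear (chart_metric A' g' d x)) (nhds (F (snd c p)))"
    using dst.eventually_in_chart[OF d dst.chart_openin[OF d(1)] d(2)] unfolding Fp
  proof eventually_elim
    case (elim x)
    then obtain q where q: "q \<in> fst d" "x = snd d q" by auto
    then have "q \<in> M'" using dst.chart_subset[OF d(1)] by auto
    then show ?case unfolding q(2) by (intro dst.bilinear_chart_metric d q bil)
  qed
  have md: "(\<lambda>x. chart_metric A' g' d x v w) differentiable (at (F (snd c p)))" for v w
    unfolding Fp by (rule diff[OF d])
  have mF: "chart_metric A' g' d (F x) (fd F x v) (fd F x w) = chart_metric A g c x v w" if x: "x \<in> T" for x
  proof -
    obtain q where q: "q \<in> fst c" "q \<in> U" "\<phi> q \<in> fst d" "x = snd c q" using x by (auto simp: T_def)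
    show ?thesis
      using chart_metric_map[where g = g and g' = g', OF c(1) q(1) d(1) q(3,2) iso[OF q(2)]] by (simp add: q(4) F_def)
  qed
  show ?thesis
    by (rule differentiableI, rule has_derivative_transform_within_open[OF has_derivative_bilinear_field[OF ev md dF dL dL] T mF])
qed

text \<open>A vector is determined by its pairings with the orthonormal basis that the definition of
  a Lorentz metric provides.\<close>

lemma lorentz_nondegenerate:
  assumes "lorentz_metric A M g" "p \<in> M" "\<And>w. g p v w = 0" shows "v = 0"
proof -
  from assms(1,2) obtain e :: "4 \<Rightarrow> real^4"
    where b: "bilinear (g p)" and sy: "\<forall>u v. g p u v = g p v u"
      and e: "\<forall>a b. g p (e a) (e b) = (if a \<noteq> b then 0 else if a = 0 then -1 else 1)"
    unfolding lorentz_metric_def by blast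
  interpret lorentz_frame "g p" e
    by unfold_locales (use b sy e in \<open>auto simp: lorentz_sign_def\<close>)
  show ?thesis by (rule nondegenerate[OF assms(3)])
qed

section \<open>Transport of fields and tangent spaces to the image\<close>

locale pushed_map = smooth_map_between M A M' A' U \<phi> + src: smooth_inclusion S P M A + pushed_surface S P \<phi> S' P'
  for M and A :: "('a::topological_space, 4) chart set" and M' and A' :: "('b::topological_space, 4) chart set"
    and U \<phi> S and P :: "('a, 2) chart set" and S' and P' +
  assumes S_subset: "S \<subseteq> U"
begin

lemma openin_S_preimage:
  assumes "d \<in> A'" shows "openin (top_of_set S) (S \<inter> {q \<in> U. \<phi> q \<in> fst d})"
proof -
  obtain V where V: "open V" "{q \<in> U. \<phi> q \<in> fst d} = M \<inter> V"
    using openin_preimage[OF dst.chart_openin[OF assms]] unfolding openin_open by (elim exE conjE)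
  then have "S \<inter> {q \<in> U. \<phi> q \<in> fst d} = S \<inter> V" using src.sub_subset by auto
  then show ?thesis using V(1) openin_open_Int by simp
qed

lemma inv_into_\<phi>: "p \<in> S \<Longrightarrow> inv_into S \<phi> (\<phi> p) = p"
  by (rule homeomorphism_apply1[OF hom])

lemma push_field_at: "p \<in> S \<Longrightarrow> push_field A A' \<phi> S Y (\<phi> p) = tangent_map A A' \<phi> p (Y p)"
  by (simp add: push_field_def inv_into_\<phi>)

text \<open>Near each point the map factors through a spacetime chart: the inclusion of the surface,
  followed by the coordinate expression of \<open>\<phi>\<close>.\<close>

lemma smooth_on_surface_map:
  assumes s: "s \<in> P" and d: "d \<in> A'"
  shows "smooth_on (\<lambda>y. snd d (\<phi> (inv_chart s y))) (snd s ` (fst s \<inter> (S \<inter> {q \<in> U. \<phi> q \<in> fst d})))"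
    (is "smooth_on ?f (snd s ` (fst s \<inter> ?O))")
proof (rule smooth_on_local)
  fix y0 assume "y0 \<in> snd s ` (fst s \<inter> ?O)"
  then obtain p where p: "p \<in> fst s" "p \<in> ?O" "y0 = snd s p" by auto
  have pM: "p \<in> M" using p src.sub_subset by auto
  define c where "c = chart_at A p"
  note c = src.chart_at_mem[OF pM, folded c_def]
  let ?T = "snd s ` (fst s \<inter> fst c \<inter> ?O)"
  have T: "open ?T" by (rule src.open_inter_image[OF s c(1) openin_S_preimage[OF d]])
  have k: "smooth_on (\<lambda>y. snd c (inv_chart s y)) ?T"
    by (rule smooth_on_subset[OF src.inclusion_smooth[OF s c(1)]]) auto
  have "smooth_on (\<lambda>y. snd d (\<phi> (inv_chart c (snd c (inv_chart s y))))) ?T"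
    by (rule smooth_on_compose[OF map_smooth[OF c(1) d] k _ T]) (use s in auto)
  then have "smooth_on ?f ?T"
    by (rule smooth_on_cong[OF _ T]) (use s c in auto)
  then show "\<exists>T. open T \<and> y0 \<in> T \<and> smooth_on ?f (snd s ` (fst s \<inter> ?O) \<inter> T)"
    using T p c by (intro exI[of _ ?T] conjI) (auto elim!: smooth_on_subset)
qed

text \<open>With respect to a pushed chart, the inclusion of the image surface has the coordinate
  expression of \<open>\<phi>\<close> on \<open>S\<close>.\<close>

lemma smooth_inclusion_push: "smooth_inclusion S' P' M' A'"
proof unfold_locales
  show "oriented_atlas S' P'" by (rule oriented_atlas_push)
  show "smooth_map P' A' S' (\<lambda>q. q)"
    unfolding smooth_map_def
  proof (intro conjI)
    show "continuous_on S' (\<lambda>q. q)" by (rule continuous_on_id)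
    have "\<Union> (fst ` A') = M'" using dst.atlas by (simp add: oriented_atlas_def)
    then show "(\<lambda>q. q) ` S' \<subseteq> \<Union> (fst ` A')" using map_into S_subset by (auto simp: S')
    have main: "smooth_on (\<lambda>y. snd d (inv_chart (push_chart \<phi> s) y)) (snd (push_chart \<phi> s) ` {p \<in> fst (push_chart \<phi> s) \<inter> S'. p \<in> fst d})"
      if s: "s \<in> P" and d: "d \<in> A'" for s d
    proof -
      let ?O = "S \<inter> {q \<in> U. \<phi> q \<in> fst d}"
      have sub: "fst s \<subseteq> S" by (rule src.sub.chart_subset[OF s])
      have "{p \<in> fst (push_chart \<phi> s) \<inter> S'. p \<in> fst d} = \<phi> ` (fst s \<inter> ?O)"
        using sub S_subset by (auto simp: fst_push S')
      moreover have "snd (push_chart \<phi> s) ` \<phi> ` (fst s \<inter> ?O) = snd s ` (fst s \<inter> ?O)"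
        unfolding image_image by (rule image_cong[OF refl]) (use s in \<open>simp add: snd_push\<close>)
      moreover have "smooth_on (\<lambda>y. snd d (inv_chart (push_chart \<phi> s) y)) (snd s ` (fst s \<inter> ?O))"
        by (rule smooth_on_cong[OF smooth_on_surface_map[OF s d] src.sub.open_chart_image[OF s openin_S_preimage[OF d]]])
          (use inv_push[OF s] in auto)
      ultimately show ?thesis by simp
    qed
    show "\<forall>(V, x)\<in>P'. \<forall>(W, y)\<in>A'. smooth_on (y \<circ> (\<lambda>q. q) \<circ> inv_into V x) (x ` {p \<in> V \<inter> S'. p \<in> W})"
    proof (clarify)
      fix V x W y assume V: "(V, x) \<in> P'" and W: "(W, y) \<in> A'"
      then obtain s where s: "s \<in> P" "(V, x) = push_chart \<phi> s" by (auto simp: P' push_atlas_eq)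
      from main[OF s(1) W] show "smooth_on (y \<circ> (\<lambda>q. q) \<circ> inv_into V x) (x ` {p \<in> V \<inter> S'. p \<in> W})"
        unfolding s(2)[symmetric] by (simp add: inv_chart_def o_def)
    qed
  qed
qed

text \<open>In a pushed chart and a target chart the components of the image field are the
  differential of \<open>\<phi>\<close> applied to the components of \<open>Y\<close>.\<close>

lemma smooth_push_field:
  assumes Y: "smooth_field P A S Y" shows "smooth_field P' A' S' (push_field A A' \<phi> S Y)"
proof -
  interpret img: smooth_inclusion S' P' M' A' by (rule smooth_inclusion_push)
  show ?thesis
  proof (rule img.smooth_fieldI)
    show "openin (top_of_set S') S'" by simp
    fix q assume "q \<in> S'"
    then obtain p where p: "p \<in> S" "q = \<phi> p" by (auto simp: S')
    have pM: "p \<in> M" "p \<in> U" "\<phi> p \<in> M'" using p src.sub_subset S_subset map_into by auto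
    define s where "s = chart_at P p"
    define c where "c = chart_at A p"
    define d where "d = chart_at A' (\<phi> p)"
    note s = src.sub.chart_at_mem[OF p(1), folded s_def] and c = src.chart_at_mem[OF pM(1), folded c_def]
      and d = dst.chart_at_mem[OF pM(3), folded d_def]
    let ?O = "fst s \<inter> (S \<inter> fst c) \<inter> (S \<inter> {q \<in> U. \<phi> q \<in> fst d})"
    have O: "openin (top_of_set S) ?O"
      by (intro openin_Int[OF openin_Int[OF src.sub.chart_openin[OF s(1)] src.openin_chart_inter[OF c(1)]] openin_S_preimage[OF d(1)]])
    let ?T = "snd s ` (fst s \<inter> ?O)"
    have T: "open ?T" by (rule src.sub.open_chart_image[OF s(1) O])
    define F where "F = (\<lambda>x. snd d (\<phi> (inv_chart c x)))"
    let ?s' = "push_chart \<phi> s"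
    let ?Y = "\<lambda>y. components A c (inv_chart s y) (Y (inv_chart s y))"
    have k: "smooth_on (\<lambda>y. snd c (inv_chart s y)) ?T"
      by (rule smooth_on_subset[OF src.inclusion_smooth[OF s(1) c(1)]]) auto
    have sY: "smooth_on ?Y ?T"
      by (rule smooth_on_subset[OF src.smooth_fieldD[OF Y s(1) c(1)]]) auto
    have "smooth_on (\<lambda>y. fd F (snd c (inv_chart s y)) (?Y y)) ?T"
      unfolding F_def by (rule smooth_on_fd_apply[OF map_smooth[OF c(1) d(1)] k _ sY T]) (use s in auto)
    then have sm: "smooth_on (\<lambda>y. components A' d (inv_chart ?s' y) (push_field A A' \<phi> S Y (inv_chart ?s' y))) ?T"
    proof (rule smooth_on_cong[OF _ T])
      fix y assume "y \<in> ?T"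
      then obtain q where q: "q \<in> fst s" "q \<in> fst c" "q \<in> S" "q \<in> U" "\<phi> q \<in> fst d" "y = snd s q" by auto
      have "components A' d (\<phi> q) (tangent_map A A' \<phi> q (Y q)) = chart_deriv c d \<phi> q (components A c q (Y q))"
        by (rule components_tangent_map[OF c(1) d(1) q(2,4,5)])
      then show "fd F (snd c (inv_chart s y)) (?Y y)
          = components A' d (inv_chart ?s' y) (push_field A A' \<phi> S Y (inv_chart ?s' y))"
        using q s by (simp add: inv_push push_field_at chart_deriv_def F_def o_def)
    qed
    have eq: "snd ?s' ` (fst ?s' \<inter> fst d \<inter> \<phi> ` ?O) = ?T"
    proof -
      have "fst ?s' \<inter> fst d \<inter> \<phi> ` ?O = \<phi> ` (fst s \<inter> ?O)" by (auto simp: fst_push)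
      moreover have "snd ?s' ` \<phi> ` (fst s \<inter> ?O) = ?T"
        unfolding image_image by (rule image_cong[OF refl]) (use s in \<open>simp add: snd_push\<close>)
      ultimately show ?thesis by simp
    qed
    have O': "openin (top_of_set S') (\<phi> ` ?O)" unfolding S' by (rule homeomorphism_imp_open_map[OF hom O])
    show "\<exists>s\<in>P'. \<exists>c\<in>A'. \<exists>V. openin (top_of_set S') V \<and> q \<in> V \<and> q \<in> fst s \<and> q \<in> fst c \<and>
       smooth_on (\<lambda>y. components A' c (inv_chart s y) (push_field A A' \<phi> S Y (inv_chart s y))) (snd s ` (fst s \<inter> fst c \<inter> V))"
    proof (intro bexI[OF _ push_mem[OF s(1)]] bexI[OF _ d(1)] exI[of _ "\<phi> ` ?O"] conjI O')
      show "q \<in> \<phi> ` ?O" using p s c d pM by auto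
      show "q \<in> fst ?s'" using p s by (simp add: fst_push)
      show "q \<in> fst d" using p d by simp
      show "smooth_on (\<lambda>y. components A' d (inv_chart ?s' y) (push_field A A' \<phi> S Y (inv_chart ?s' y)))
          (snd ?s' ` (fst ?s' \<inter> fst d \<inter> \<phi> ` ?O))" unfolding eq by (rule sm)
    qed
  qed
qed

lemma surface_map_push: "surface_map M A M' A' U \<phi> S P S' P'"
proof -
  interpret img: smooth_inclusion S' P' M' A' by (rule smooth_inclusion_push)
  show ?thesis by unfold_locales (rule S_subset)
qed

lemma tangent_map_surf_vec:
  assumes "s \<in> P" "p \<in> fst s"
  shows "tangent_map A A' \<phi> p (surf_vec P A s p w) = surf_vec P' A' (push_chart \<phi> s) (\<phi> p) w"
  using surface_map.surf_vec_map[OF surface_map_push assms push_mem[OF assms(1)] push_chart_diff(1)[OF assms], of w]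
  by (simp add: push_chart_diff(2)[OF assms])

lemma tangent_space_push:
  assumes p: "p \<in> S"
  shows "surface_tangent_space P' A' (\<phi> p) = tangent_map A A' \<phi> p ` surface_tangent_space P A p"
proof -
  note s = src.sub.chart_at_mem[OF p]
  have "oriented_manifold S' P'" by unfold_locales (rule oriented_atlas_push)
  from range_surf_vec[OF this push_mem[OF s(1)], of "\<phi> p" A']
  have "surface_tangent_space P' A' (\<phi> p) = range (surf_vec P' A' (push_chart \<phi> (chart_at P p)) (\<phi> p))"
    using s by (simp add: fst_push)
  also have "\<dots> = tangent_map A A' \<phi> p ` range (surf_vec P A (chart_at P p) p)"
    using tangent_map_surf_vec[OF s] by (simp add: image_image)
  also have "range (surf_vec P A (chart_at P p) p) = surface_tangent_space P A p"
    by (rule range_surf_vec[OF src.sub.oriented_manifold_axioms s])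
  finally show ?thesis .
qed

end

theorem theorem1p1:
  fixes M :: "'a::{t2_space, second_countable_topology} set"
    and M' :: "'b::{t2_space, second_countable_topology} set"
    and A :: "('a, 4) chart set" and A' :: "('b, 4) chart set"
    and g :: "'a \<Rightarrow> real^4 \<Rightarrow> real^4 \<Rightarrow> real" and g' :: "'b \<Rightarrow> real^4 \<Rightarrow> real^4 \<Rightarrow> real"
    and T :: "'a \<Rightarrow> real^4" and T' :: "'b \<Rightarrow> real^4"
    and nab nab_ref :: "real^4 \<Rightarrow> ('a \<Rightarrow> real^4) \<Rightarrow> 'a \<Rightarrow> real^4"
    and nab' :: "real^4 \<Rightarrow> ('b \<Rightarrow> real^4) \<Rightarrow> 'b \<Rightarrow> real^4"
    and S U :: "'a set" and P :: "('a, 2) chart set"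
    and N N_perp N_top X :: "'a \<Rightarrow> real^4"
    and \<phi> :: "'a \<Rightarrow> 'b"
    and S' :: "'b set" and P' :: "('b, 2) chart set"
    and N_perp' N_top' X' :: "'b \<Rightarrow> real^4"
    and H :: "'a \<Rightarrow> real^4" and H' :: "'b \<Rightarrow> real^4"
    and E :: real
  assumes M: "spacetime M A g T"
    and M': "spacetime M' A' g' T'"
    and S: "closed_spacelike_surface A g S P"
    and N: "smooth_field P A S N" "\<forall>p\<in>S. future_timelike g T p (N p)"
    and \<phi>: "matching_reference M A g T A' g' T' S U \<phi>"
    and nab: "levi_civita A M g nab"
    and nab': "levi_civita A' M' g' nab'"
    and nab_ref: "levi_civita A U (pullback_metric A A' \<phi> g') nab_ref"
    and N_perp: "N_perp = (\<lambda>p. normal_part P A g p (N p))"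
    and N_top: "N_top = (\<lambda>p. N p - N_perp p)"
    and X: "smooth_field P A S X"
      "\<forall>p\<in>S. X p \<in> surface_normal_space P A g p \<and> g p (X p) (X p) = 1 \<and> g p (X p) (N p) = 0 \<and>
         positive_basis (list4 (N_perp p) (X p)
           (incl_deriv P A p (axis 0 1)) (incl_deriv P A p (axis 1 1)))"
    and S': "S' = \<phi> ` S" "P' = push_atlas \<phi> P"
    and X': "X' = push_field A A' \<phi> S X"
    and N_perp': "N_perp' = push_field A A' \<phi> S N_perp"
    and N_top': "N_top' = push_field A A' \<phi> S N_top"
    and H: "H = mean_curvature S P A g nab"
    and H': "H' = mean_curvature S' P' A' g' nab'"
    and E: "E = cnt_energy S P A U g nab nab_ref N"
  shows "E =
        1 / (8 * pi) * surface_integral S' P' A' g' (\<lambda>q.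
          - timelike_norm g' q (N_perp' q) * g' q (H' q) (X' q)
          + 1 / timelike_norm g' q (N_perp' q)
            * g' q (cov_along P' A' nab' (N_top' q) X' q) (N_perp' q))
      - 1 / (8 * pi) * surface_integral S P A g (\<lambda>p.
          - timelike_norm g p (N_perp p) * g p (H p) (X p)
          + 1 / timelike_norm g p (N_perp p)
            * g p (cov_along P A nab (N_top p) X p) (N_perp p))
    \<and> ((\<forall>p\<in>S. N p \<in> surface_normal_space P A g p) \<longrightarrow>
       E = 1 / (8 * pi) * surface_integral S P A g (\<lambda>p.
          timelike_norm g p (N p) * (- g' (\<phi> p) (H' (\<phi> p)) (X' (\<phi> p)) + g p (H p) (X p))))"
proof -
  have oM: "oriented_atlas M A" "lorentz_metric A M g" using M by (simp_all add: spacetime_def)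
  have oM': "oriented_atlas M' A'" "lorentz_metric A' M' g'" using M' by (simp_all add: spacetime_def)
  have oS: "compact S" "oriented_atlas S P" "smooth_map P A S (\<lambda>q. q)"
    and posS: "\<forall>p\<in>S. \<forall>w. w \<noteq> 0 \<longrightarrow> g p (incl_deriv P A p w) (incl_deriv P A p w) > 0"
    using S by (simp_all add: closed_spacelike_surface_def smooth_embedding_def)
  have U: "openin (top_of_set M) U" "S \<subseteq> U" "smooth_embedding A A' U \<phi>"
    and iso: "\<forall>p\<in>S. \<forall>u v. pullback_metric A A' \<phi> g' p u v = g p u v"
    using \<phi> by (simp_all add: matching_reference_def)
  have sm: "smooth_map A A' U \<phi>" and inj\<phi>: "\<forall>p\<in>U. inj (tangent_map A A' \<phi> p)"
    and homU: "homeomorphism U (\<phi> ` U) \<phi> (inv_into U \<phi>)"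
    using U(3) by (simp_all add: smooth_embedding_def)
  \<comment> \<open>The inverses of \<open>\<phi>\<close> taken on \<open>U\<close> and on
    \<open>S\<close> are different functions that agree on the image of \<open>S\<close>.\<close>
  have homS: "homeomorphism S (\<phi> ` S) \<phi> (inv_into S \<phi>)"
  proof -
    have "homeomorphism S (\<phi> ` S) \<phi> (inv_into U \<phi>)"
      by (rule homeomorphism_of_subsets[OF homU U(2) _ refl]) (use U(2) in auto)
    then show ?thesis
    proof (rule homeomorphism_cong)
      fix y assume "y \<in> \<phi> ` S"
      then obtain p where p: "p \<in> S" "y = \<phi> p" by blast
      have "inj_on \<phi> U"
        by (rule inj_on_inverseI[of _ "inv_into U \<phi>"]) (simp add: homeomorphism_apply1[OF homU])
      then show "inv_into S \<phi> y = inv_into U \<phi> y"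
        using p U(2) by (simp add: inv_into_f_f inj_on_subset subset_eq)
    qed simp_all
  qed
  interpret pm: pushed_map M A M' A' U \<phi> S P S' P'
    by unfold_locales (use oM oM' oS U sm homS S' in simp_all)
  interpret sur: surface_map M A M' A' U \<phi> S P S' P' by (rule pm.surface_map_push)
  interpret sp: spacelike_inclusion S P M A g
    by unfold_locales (use oM posS in simp_all)
  define gr where "gr = pullback_metric A A' \<phi> g'"
  let ?T = "tangent_map A A' \<phi>"
  have gr: "gr p u v = g' (\<phi> p) (?T p u) (?T p v)" for p u v by (simp add: gr_def pullback_metric_def)
  have grS: "g' (\<phi> p) (?T p u) (?T p v) = g p u v" if "p \<in> S" for p u v
    using iso that unfolding pullback_metric_def by simp
  have bil': "bilinear (g' p)" and sym': "g' p u v = g' p v u" if "p \<in> M'" for p u v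
    using oM'(2) that unfolding lorentz_metric_def by simp_all
  \<comment> \<open>Every vector tangent to the image comes from a vector tangent to
    \<open>S\<close>, and \<open>\<phi>\<close> is isometric at the points of \<open>S\<close>;
    hence the image is spacelike.\<close>
  interpret sp': spacelike_inclusion S' P' M' A' g'
  proof unfold_locales
    show "lorentz_metric A' M' g'" by (rule oM'(2))
    fix q w assume q: "q \<in> S'" and w: "w \<noteq> (0 :: real^2)"
    obtain p where p: "p \<in> S" "q = \<phi> p" using q S' by auto
    note s = pm.src.sub.chart_at_mem[OF p(1)]
    let ?s = "push_chart \<phi> (chart_at P p)"
    have s': "?s \<in> P'" "q \<in> fst ?s" using s p by (simp_all add: pm.push_mem pm.fst_push)
    define u where "u = components P' ?s q w"
    have wu: "from_components P' ?s q u = w" using sur.dst.sub.components_from_components(2)[OF s'] by (simp add: u_def)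
    then have "u \<noteq> 0" using w linear_0[OF sur.dst.sub.linear_from_components[OF s']] by auto
    have "incl_deriv P' A' q w = surf_vec P' A' ?s q u" by (simp add: surf_vec_def wu)
    also have "\<dots> = ?T p (surf_vec P A (chart_at P p) p u)" using pm.tangent_map_surf_vec[OF s] p by simp
    finally show "0 < g' q (incl_deriv P' A' q w) (incl_deriv P' A' q w)"
      using sp.surf_vec_nonzero[OF s \<open>u \<noteq> 0\<close>] by (simp add: p grS)
  qed
  have md: "(\<lambda>x. chart_metric A g c x v w) differentiable (at (snd c p))" if "c \<in> A" "p \<in> fst c" for c p v w
    by (rule smooth_on_differentiable[OF sp.smooth_chart_metric[OF that(1)]]) (use that in simp)
  have md': "(\<lambda>x. chart_metric A' g' c x v w) differentiable (at (snd c p))" if "c \<in> A'" "p \<in> fst c" for c p v w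
    by (rule smooth_on_differentiable[OF sp'.smooth_chart_metric[OF that(1)]]) (use that in simp)
  \<comment> \<open>The pulled-back metric agrees with \<open>g\<close> on \<open>S\<close> only, so
    its regularity on \<open>U\<close> is obtained from that of \<open>g'\<close> and
    \<open>\<phi>\<close>.\<close>
  have mdr: "(\<lambda>x. chart_metric A gr c x v w) differentiable (at (snd c p))" if "c \<in> A" "p \<in> fst c" "p \<in> U" for c p v w
    by (rule pm.chart_metric_map_differentiable[OF that gr bil' md'])
  have grb: "bilinear (gr p)" "gr p u v = gr p v u" if p: "p \<in> U" for p u v
  proof -
    note pM' = pm.map_into[OF p] and L = pm.linear_tangent_map[OF p]
    show "gr p u v = gr p v u" unfolding gr by (rule sym'[OF pM'])
    have "linear (\<lambda>x. g' (\<phi> p) (?T p x) y)" "linear (\<lambda>x. g' (\<phi> p) y (?T p x))" for y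
      using linear_compose[OF L, of "\<lambda>x. g' (\<phi> p) x y"] linear_compose[OF L, of "g' (\<phi> p) y"] bil'[OF pM']
      by (simp_all add: bilinear_def o_def)
    then show "bilinear (gr p)" by (simp add: bilinear_def gr)
  qed
  interpret mc: metric_connection M A M nab g
    by (rule metric_connectionI[OF pm.src.oriented_manifold_axioms _ nab sp.bil sp.sym md]) simp_all
  interpret mc': metric_connection M' A' M' nab' g'
    by (rule metric_connectionI[OF pm.dst.oriented_manifold_axioms _ nab' bil' sym' md']) simp_all
  interpret mr: metric_connection M A U nab_ref gr
    by (rule metric_connectionI[OF pm.src.oriented_manifold_axioms U(1) _ grb mdr]) (simp_all add: nab_ref gr_def)
  interpret ms: metric_surface M A M nab g S P
    by unfold_locales (use pm.src.sub_subset sp.inj_incl in simp_all)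
  interpret msr: metric_surface M A U nab_ref gr S P
    by unfold_locales (use U(2) sp.inj_incl in simp_all)
  interpret ms': metric_surface M' A' M' nab' g' S' P'
    by unfold_locales (use sur.dst.sub_subset sp'.inj_incl in simp_all)
  \<comment> \<open>The source metric here is the pullback, for which \<open>\<phi>\<close> is
    isometric on all of \<open>U\<close>, as derivatives of the metric require.\<close>
  interpret im: isometric_surfaces M A U nab_ref gr M' A' M' nab' g' \<phi> S P S' P'
  proof unfold_locales
    show "\<And>q. q \<in> U \<Longrightarrow> \<phi> q \<in> M'" by (rule pm.map_into)
    show "\<And>q u v. q \<in> U \<Longrightarrow> gr q u v = g' (\<phi> q) (?T q u) (?T q v)" by (rule gr)
    show "\<And>q. q \<in> U \<Longrightarrow> inj (?T q)" using inj\<phi> by simp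
    show "\<And>p v. p \<in> M' \<Longrightarrow> (\<And>w. g' p v w = 0) \<Longrightarrow> v = 0" by (rule lorentz_nondegenerate[OF oM'(2)])
  qed
  interpret ss': spacelike_metric_surface S' P' M' A' g' M' nab' by unfold_locales
  have Nt: "g p (N p) (N p) < 0" if "p \<in> S" for p using N(2) that by (simp add: future_timelike_def)
  interpret cs: cnt_setting S P M A g nab U nab_ref gr N X
  proof unfold_locales
    show "\<And>p u v. p \<in> S \<Longrightarrow> gr p u v = g p u v" using grS by (simp add: gr)
    show "smooth_field P A S N" "smooth_field P A S X" by fact+
    show "\<And>p. p \<in> S \<Longrightarrow> g p (N p) (N p) < 0" by (rule Nt)
  qed (use X(2) N_perp in simp_all)
  interpret surf: compact_surface S P by unfold_locales (rule oS(1))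
  have perp: "N_perp p = normal_part P A g p (N p)" for p by (simp add: N_perp)
  have X'at: "X' (\<phi> p) = ?T p (X p)" "N_perp' (\<phi> p) = ?T p (N_perp p)" "N_top' (\<phi> p) = ?T p (N_top p)" if "p \<in> S" for p
    using that by (simp_all add: X' N_perp' N_top' pm.push_field_at)
  have smX': "smooth_field P' A' S' X'" unfolding X' by (rule pm.smooth_push_field[OF X(1)])
  have X'n: "X' q \<in> surface_normal_space P' A' g' q" if q: "q \<in> S'" for q
  proof -
    obtain p where p: "p \<in> S" "q = \<phi> p" using q S' by auto
    show ?thesis using X(2) p unfolding p(2) surface_normal_space_def pm.tangent_space_push[OF p(1)]
      by (auto simp: X'at grS)
  qed
  have cov: "cov_along P' A' nab' (?T p v) X' (\<phi> p) = ?T p (cov_along P A nab_ref v X p)"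
    if p: "p \<in> S" and v: "v \<in> surface_tangent_space P A p" for p v
  proof -
    note s = pm.src.sub.chart_at_mem[OF p]
    obtain w where w: "v = surf_vec P A (chart_at P p) p w"
      using v unfolding range_surf_vec[OF pm.src.sub.oriented_manifold_axioms s, of A, symmetric] by blast
    show ?thesis unfolding w
      by (rule im.cov_along_map[OF s pm.push_mem[OF s(1)] pm.push_chart_diff(1)[OF s] openin_subtopology_self p X(1) _ smX' X'at(1)])
        (use p S' in simp)
  qed
  have H_eq: "- timelike_norm g p (N_perp p) * g p (H p) (X p)
      + 1 / timelike_norm g p (N_perp p) * g p (cov_along P A nab (N_top p) X p) (N_perp p)
      = energy_density P A g nab N X p" if p: "p \<in> S" for p
    using cs.mean_curvature_pairing[OF X(1) _ p] X(2)
    by (simp add: H N_top perp energy_density_def Let_def)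
  \<comment> \<open>The trace over the image plane is taken in the image of an orthonormal pair of
    \<open>S\<close>. The reference integrand thereby becomes a function on \<open>S\<close>,
    expressed through \<open>g\<close> and \<open>nab_ref\<close>.\<close>
  have H'_eq: "- timelike_norm g' (\<phi> p) (N_perp' (\<phi> p)) * g' (\<phi> p) (H' (\<phi> p)) (X' (\<phi> p))
      + 1 / timelike_norm g' (\<phi> p) (N_perp' (\<phi> p)) * g' (\<phi> p) (cov_along P' A' nab' (N_top' (\<phi> p)) X' (\<phi> p)) (N_perp' (\<phi> p))
      = energy_density P A g nab_ref N X p" if p: "p \<in> S" for p
  proof -
    have q: "\<phi> p \<in> S'" using p S' by simp
    obtain e2 e3 where o: "orthonormal_tangent P A g p e2 e3"
      using sp.orthonormal_basis_exists[OF p] unfolding orthonormal_tangent_def by blast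
    then have et: "e2 \<in> surface_tangent_space P A p" "e3 \<in> surface_tangent_space P A p" by (simp_all add: orthonormal_tangent_def)
    have o': "orthonormal_tangent P' A' g' (\<phi> p) (?T p e2) (?T p e3)"
      using o p by (simp add: orthonormal_tangent_def pm.tangent_space_push grS)
    have "normal_trace P' A' g' nab' X' (\<phi> p) = normal_trace P A g nab_ref X p"
      unfolding ss'.normal_trace_eq[OF smX' q q o'] cs.ref_conn.normal_trace_eq[OF X(1) p p o]
      by (simp add: cov p et grS)
    then have "g' (\<phi> p) (H' (\<phi> p)) (X' (\<phi> p)) = - normal_trace P A g nab_ref X p"
      using ss'.mean_curvature_pairing[OF smX' X'n q] by (simp add: H')
    moreover have "N_top p \<in> surface_tangent_space P A p"
      unfolding N_top perp by (rule sp.normal_part_tangent[OF p])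
    moreover have "timelike_norm g' (\<phi> p) (N_perp' (\<phi> p)) = timelike_norm g p (N_perp p)"
      using p by (simp add: timelike_norm_def X'at grS)
    ultimately show ?thesis
      using p by (simp add: X'at cov grS energy_density_def Let_def N_top perp)
  qed
  let ?form = "\<lambda>D p u v. energy_density P A g D N X p * area_form P A g p u v"
  have c: "continuous_two_form S P (?form nab)" by (rule cs.continuous_energy_form[OF N(1) Nt X(1)])
  have cr: "continuous_two_form S P (?form nab_ref)" by (rule cs.ref_conn.continuous_energy_form[OF N(1) Nt X(1)])
  define I where "I = form_integral S P (?form nab)"
  define J where "J = form_integral S P (?form nab_ref)"
  \<comment> \<open>Linearity of the integral needs continuous integrands, which \<open>c\<close>
    and \<open>cr\<close> provide for the two energy densities.\<close>
  have "form_integral S P (cnt_form P A U g nab nab_ref N)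
      = form_integral S P (\<lambda>p u v. 2 * (?form nab_ref p u v - ?form nab p u v))"
    by (rule surf.form_integral_cong) (simp add: cs.cnt_form_eq left_diff_distrib mult.assoc)
  also have "\<dots> = 2 * (J - I)" unfolding I_def J_def by (rule surf.form_integral_linear[OF cr c])
  finally have EIJ: "E = 1 / (8 * pi) * J - 1 / (8 * pi) * I" unfolding E cnt_energy_def by (simp add: field_simps)
  have SI: "surface_integral S P A g (\<lambda>p. - timelike_norm g p (N_perp p) * g p (H p) (X p)
      + 1 / timelike_norm g p (N_perp p) * g p (cov_along P A nab (N_top p) X p) (N_perp p)) = I"
    unfolding surface_integral_def I_def by (rule surf.form_integral_cong) (simp only: H_eq)
  have SJ: "surface_integral S' P' A' g' (\<lambda>q. - timelike_norm g' q (N_perp' q) * g' q (H' q) (X' q)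
      + 1 / timelike_norm g' q (N_perp' q) * g' q (cov_along P' A' nab' (N_top' q) X' q) (N_perp' q)) = J"
    unfolding surface_integral_def J_def
  proof (rule form_integral_push[OF pm.pushed_surface_axioms oS(1) cr])
    fix s p assume s: "s \<in> P" "p \<in> fst s"
    have p: "p \<in> S" using s pm.src.sub.chart_subset by blast
    have s': "push_chart \<phi> s \<in> P'" "\<phi> p \<in> fst (push_chart \<phi> s)" using s by (simp_all add: pm.push_mem pm.fst_push)
    have "induced_gram P' A' g' (push_chart \<phi> s) (\<phi> p) = induced_gram P A g s p"
      unfolding induced_gram_def pm.tangent_map_surf_vec[OF s, symmetric] grS[OF p] ..
    then have "form_density P' (area_form P' A' g') (push_chart \<phi> s) (\<phi> p) = form_density P (area_form P A g) s p"
      unfolding sp.area_form_density[OF s] sp'.area_form_density[OF s'] by simp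
    then show "form_density P' (\<lambda>q u v. (- timelike_norm g' q (N_perp' q) * g' q (H' q) (X' q)
      + 1 / timelike_norm g' q (N_perp' q) * g' q (cov_along P' A' nab' (N_top' q) X' q) (N_perp' q)) * area_form P' A' g' q u v)
        (push_chart \<phi> s) (\<phi> p) = form_density P (?form nab_ref) s p"
      unfolding form_density_def H'_eq[OF p] by simp
  qed
  have "E = 1 / (8 * pi) * surface_integral S P A g (\<lambda>p.
          timelike_norm g p (N p) * (- g' (\<phi> p) (H' (\<phi> p)) (X' (\<phi> p)) + g p (H p) (X p)))"
    if normal: "\<forall>p\<in>S. N p \<in> surface_normal_space P A g p"
  proof -
    have "timelike_norm g p (N p) * (- g' (\<phi> p) (H' (\<phi> p)) (X' (\<phi> p)) + g p (H p) (X p))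
        = energy_density P A g nab_ref N X p - energy_density P A g nab N X p" if p: "p \<in> S" for p
    proof -
      have n: "N_perp p = N p"
        unfolding perp using normal p subspace_0[OF sp.subspace_tangent[OF p]] by (intro sp.normal_part_unique) auto
      obtain e2 e3 where e: "e2 \<in> surface_tangent_space P A p" "e3 \<in> surface_tangent_space P A p"
        using sp.orthonormal_basis_exists[OF p] by blast
      \<comment> \<open>The direction 0 is written as a combination of tangent vectors with zero
        coefficients, because linearity of \<open>cov_along\<close> is available in tangent
        directions.\<close>
      have z: "cov_along P A nab 0 X p = 0"
        using cs.cov_along_combination[OF X(1) p p e, of 0 0] by simp
      have zr: "cov_along P A nab_ref 0 X p = 0"
        using cs.ref_conn.cov_along_combination[OF X(1) p p e, of 0 0] by simp
      have t: "N_top p = 0" by (simp add: N_top n)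
      have T0: "?T p 0 = 0" using linear_0[OF pm.linear_tangent_map] p U(2) by auto
      have z': "cov_along P' A' nab' 0 X' (\<phi> p) = 0"
        using cov[OF p subspace_0[OF sp.subspace_tangent[OF p]]] by (simp add: T0 zr)
      have "timelike_norm g' (\<phi> p) (?T p (N p)) = timelike_norm g p (N p)" using p by (simp add: timelike_norm_def grS)
      moreover have "g p 0 v = 0" "g' (\<phi> p) 0 v = 0" for v
        using bilinear_lzero[OF sp.bilS[OF p]] bilinear_lzero[OF sp'.bilS, of "\<phi> p"] p S' by auto
      ultimately show ?thesis
        using H_eq[OF p] H'_eq[OF p] p by (simp add: n t z z' T0 X'at algebra_simps)
    qed
    then have "surface_integral S P A g (\<lambda>p. timelike_norm g p (N p) * (- g' (\<phi> p) (H' (\<phi> p)) (X' (\<phi> p)) + g p (H p) (X p)))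
        = form_integral S P (\<lambda>p u v. 1 * (?form nab_ref p u v - ?form nab p u v))"
      unfolding surface_integral_def by (intro surf.form_integral_cong) (simp add: left_diff_distrib)
    also have "\<dots> = 1 * (J - I)" unfolding I_def J_def by (rule surf.form_integral_linear[OF cr c])
    finally show ?thesis unfolding EIJ by (simp add: right_diff_distrib)
  qed
  then show ?thesis unfolding SI SJ using EIJ by blast
qed

end
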